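(* Let $(G,g,f)$ be a third-type datum, $H=\mathfrak A^3_G(g,f)$, and let $G_B,\Gamma\le G$ be subgroups with $G=G_B\Gamma$, $G_B\cap\Gamma=\{1\}$, $g\in G_B$, $\Gamma\ne\{1\}$. Set $A=k[\Gamma]$ and $B=\mathfrak A^3_{G_B}(g,f|_{G_B})$. Let $\triangleright,\triangleleft$ be the canonical group actions, defined for $t\in G_B$, $h\in\Gamma$ by the unique decomposition $$th=(t\triangleright h)(t\triangleleft h),\qquad t\triangleright h\in\Gamma,\ t\triangleleft h\in G_B.$$ Then the matched pair of Hopf algebras $(A,B,\triangleright,\triangleleft)$ associated with the exact factorization $H=k[\Gamma]\,\mathfrak A^3_{G_B}(g,f|_{G_B})$ (group algebra factor first) is the one determined by these group actions and by $$\gamma_h=-f(h)\qquad(h\in\Gamma);$$ equivalently, $x\triangleright h=0$ and $x\triangleleft h=x-f(h)(1-g)$ for all $h\in\Gamma$. For this matched pair, the group bicrossed product $L=\Gamma\bowtie G_B$ is isomorphic to $G$ via $\Theta:L\to G$, $\Theta(h,t)=ht$, and the map $F:L\to k$, $F(h,t)=f(t)-\gamma_h$, satisfies $$F(h,t)=f(ht)=f(\Theta(h,t)).$$ Consequently $A\bowtie B\cong\mathfrak A^3_L(g,F)\cong\mathfrak A^3_G(g,f)=H$ as Hopf algebras.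
   Context: $k$ is an algebraically closed field of characteristic $p>0$; all algebras, tensor products etc. are over $k$; all groups are finite. A third-type datum is a triple $(G,g,f)$ where $G$ is a finite group, $g\in Z(G)$, $f:G\to(k,+)$ is a group homomorphism with $f(g)=1$, and $(f(t)^p-f(t))(1-g^p)=0$ in $k[G]$ for all $t\in G$. The Hopf algebra $\mathfrak A^3_G(g,f)$ is generated as an algebra by the group algebra $k[G]$ and an element $x$ subject to $tx-xt=f(t)\,t(1-g)$ for $t\in G$ and $x^p=x$, with $\Delta(t)=t\otimes t$, $\varepsilon(t)=1$, $S(t)=t^{-1}$ for $t\in G$, and $\Delta(x)=x\otimes 1+g\otimes x$, $\varepsilon(x)=0$, $S(x)=-g^{-1}x$. It has basis $\{tx^i\mid t\in G,\ 0\le i<p\}$. For a subgroup $G_B$ containing $g$, $\mathfrak A^3_{G_B}(g,f|_{G_B})$ is identified with the Hopf subalgebra of $\mathfrak A^3_G(g,f)$ generated by $G_B$ and $x$. A matched pair of Hopf algebras $(A,B,\triangleright,\triangleleft)$ consists of a left action $\triangleright:B\otimes A\to A$ making $A$ a left $B$-module coalgebra and a right action $\triangleleft:B\otimes A\to B$ making $B$ a right $A$-module coalgebra such that: $u\triangleright 1=\varepsilon(u)1$, $1\triangleleft a=\varepsilon(a)1$; $u\triangleright(ab)=(u_{(1)}\triangleright a_{(1)})((u_{(2)}\triangleleft a_{(2)})\triangleright b)$; $(uv)\triangleleft a=(u\triangleleft(v_{(1)}\triangleright a_{(1)}))(v_{(2)}\triangleleft a_{(2)})$; $u_{(1)}\triangleleft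 a_{(1)}\otimes u_{(2)}\triangleright a_{(2)}=u_{(2)}\triangleleft a_{(2)}\otimes u_{(1)}\triangleright a_{(1)}$. The bicrossed product $A\bowtie B$ is the tensor coalgebra $A\otimes B$ with multiplication $(a\bowtie u)(b\bowtie v)=a(u_{(1)}\triangleright b_{(1)})\bowtie(u_{(2)}\triangleleft b_{(2)})v$. If $A,B$ are Hopf subalgebras of $H$ and multiplication $A\otimes B\to H$ is bijective (an exact factorization $H=AB$), the associated matched pair (Majid) is the unique one for which multiplication $A\bowtie B\to H$, $a\bowtie u\mapsto au$, is a Hopf algebra isomorphism; i.e. $ua=(u_{(1)}\triangleright a_{(1)})(u_{(2)}\triangleleft a_{(2)})$ in $H$ for $u\in B$, $a\in A$. Under the hypotheses of the claim, $H=k[\Gamma]\,\mathfrak A^3_{G_B}(g,f|_{G_B})$ is an exact factorization. A matched pair of groups $(\Gamma,G_B,\triangleright,\triangleleft)$ consists of a left action of $G_B$ on the set $\Gamma$ and a right action of $\Gamma$ on the set $G_B$ with $t\triangleright(hk)=(t\triangleright h)((t\triangleleft h)\triangleright k)$ and $(ts)\triangleleft h=(t\triangleleft(s\triangleright h))(s\triangleleft h)$; the group bicrossed product $\Gamma\bowtie G_B$ is $\Gamma\times G_B$ with multiplication $(h,t)(k,s)=(h(t\triangleright k),(t\triangleleft k)s)$, and $g$ denotes $(1,g)$ in it. A Hopf matched pair of $k[\Gamma]$ and $\mathfrak A^3_{G_B}(g,f|_{G_B})$ is said to be determined by a matched pair of groups and a map $\gamma:\Gamma\to k$ if its actions restrict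 to the group actions on $G_B\times\Gamma$ and $x\triangleright h=0$, $x\triangleleft h=x+\gamma_h(1-g)$ for all $h\in\Gamma$. *)

theory Defs
  imports "HOL-Algebra.Algebra"
begin

section \<open>Vector spaces and algebras over a field given as a ring record\<close>

definition ring_characteristic :: "('k, 'm) ring_scheme \<Rightarrow> nat \<Rightarrow> bool" where
  "ring_characteristic K p \<longleftrightarrow> (\<forall>n::nat. [n] \<cdot>\<^bsub>K\<^esub> \<one>\<^bsub>K\<^esub> = \<zero>\<^bsub>K\<^esub> \<longleftrightarrow> p dvd n)"

text \<open>The library locale \<^locale>\<open>algebra\<close> only covers commutative algebras.\<close>

locale assoc_algebra = module K V + V: ring V for K (structure) and V (structure) +
  assumes smult_mult_left:
      "\<lbrakk>c \<in> carrier K; a \<in> carrier V; b \<in> carrier V\<rbrakk>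
        \<Longrightarrow> (c \<odot>\<^bsub>V\<^esub> a) \<otimes>\<^bsub>V\<^esub> b = c \<odot>\<^bsub>V\<^esub> (a \<otimes>\<^bsub>V\<^esub> b)"
    and smult_mult_right:
      "\<lbrakk>c \<in> carrier K; a \<in> carrier V; b \<in> carrier V\<rbrakk>
        \<Longrightarrow> a \<otimes>\<^bsub>V\<^esub> (c \<odot>\<^bsub>V\<^esub> b) = c \<odot>\<^bsub>V\<^esub> (a \<otimes>\<^bsub>V\<^esub> b)"

definition linear_maps ::
  "('k, 'm) ring_scheme \<Rightarrow> ('k, 'v, 'x) module_scheme \<Rightarrow> ('k, 'w, 'y) module_scheme \<Rightarrow> ('v \<Rightarrow> 'w) set"
where
  "linear_maps K V W = {\<phi>. \<phi> \<in> carrier V \<rightarrow> carrier W \<and>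
     (\<forall>a\<in>carrier V. \<forall>b\<in>carrier V. \<phi> (a \<oplus>\<^bsub>V\<^esub> b) = \<phi> a \<oplus>\<^bsub>W\<^esub> \<phi> b) \<and>
     (\<forall>c\<in>carrier K. \<forall>a\<in>carrier V. \<phi> (c \<odot>\<^bsub>V\<^esub> a) = c \<odot>\<^bsub>W\<^esub> \<phi> a)}"

definition bilinear_maps ::
  "('k, 'm) ring_scheme \<Rightarrow> ('k, 'v, 'x) module_scheme \<Rightarrow> ('k, 'w, 'y) module_scheme
    \<Rightarrow> ('k, 'z, 'u) module_scheme \<Rightarrow> ('v \<Rightarrow> 'w \<Rightarrow> 'z) set"
where
  "bilinear_maps K V W Z = {\<phi>. (\<forall>a\<in>carrier V. \<phi> a \<in> linear_maps K W Z) \<and>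
     (\<forall>b\<in>carrier W. (\<lambda>a. \<phi> a b) \<in> linear_maps K V Z)}"

definition algebra_homs ::
  "('k, 'm) ring_scheme \<Rightarrow> ('k, 'v, 'x) module_scheme \<Rightarrow> ('k, 'w, 'y) module_scheme \<Rightarrow> ('v \<Rightarrow> 'w) set"
where
  "algebra_homs K V W = ring_hom V W \<inter> linear_maps K V W"

definition base_algebra :: "('k, 'm) ring_scheme \<Rightarrow> ('k, 'k) module" where
  "base_algebra K = \<lparr>carrier = carrier K, monoid.mult = monoid.mult K, one = one K,
     ring.zero = ring.zero K, add = add K, smult = monoid.mult K\<rparr>"

definition opposite_algebra :: "('k, 'v, 'x) module_scheme \<Rightarrow> ('k, 'v, 'x) module_scheme" where
  "opposite_algebra V = V\<lparr>monoid.mult := \<lambda>a b. b \<otimes>\<^bsub>V\<^esub> a\<rparr>"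

definition quotient_algebra :: "('k, 'v, 'x) module_scheme \<Rightarrow> 'v set \<Rightarrow> ('k, 'v set) module" where
  "quotient_algebra V N =
     ring.extend (V Quot N) (module.fields (\<lambda>c C. \<Union>a\<in>C. N +>\<^bsub>V\<^esub> (c \<odot>\<^bsub>V\<^esub> a)))"


section \<open>Free modules and monoid algebras\<close>

definition supp :: "('k, 'm) ring_scheme \<Rightarrow> ('i \<Rightarrow> 'k) \<Rightarrow> 'i set" where
  "supp K a = {i. a i \<noteq> \<zero>\<^bsub>K\<^esub>}"

text \<open>Only the module part of \<open>free_module\<close> is meaningful; it has no multiplication.\<close>

definition free_module :: "('k, 'm) ring_scheme \<Rightarrow> 'i set \<Rightarrow> ('k, 'i \<Rightarrow> 'k) module" where
  "free_module K S =
    \<lparr>carrier = {a. a \<in> UNIV \<rightarrow> carrier K \<and> supp K a \<subseteq> S \<and> finite (supp K a)},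
     monoid.mult = undefined, one = undefined,
     ring.zero = (\<lambda>i. \<zero>\<^bsub>K\<^esub>), add = (\<lambda>a b i. a i \<oplus>\<^bsub>K\<^esub> b i),
     smult = (\<lambda>c a i. c \<otimes>\<^bsub>K\<^esub> a i)\<rparr>"

definition single :: "('k, 'm) ring_scheme \<Rightarrow> 'i \<Rightarrow> 'i \<Rightarrow> 'k" where
  "single K i = (\<lambda>j. if j = i then \<one>\<^bsub>K\<^esub> else \<zero>\<^bsub>K\<^esub>)"

text \<open>The linear map from a free module into \<open>Z\<close> sending the basis vector \<open>i\<close> to \<open>\<phi> i\<close>.\<close>

definition lin_ext ::
  "('k, 'm) ring_scheme \<Rightarrow> ('k, 'z, 'u) module_scheme \<Rightarrow> ('i \<Rightarrow> 'z) \<Rightarrow> ('i \<Rightarrow> 'k) \<Rightarrow> 'z" where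
  "lin_ext K Z \<phi> a = (\<Oplus>\<^bsub>Z\<^esub>i\<in>supp K a. a i \<odot>\<^bsub>Z\<^esub> \<phi> i)"

definition monoid_algebra :: "('k, 'm) ring_scheme \<Rightarrow> ('g, 'n) monoid_scheme \<Rightarrow> ('k, 'g \<Rightarrow> 'k) module" where
  "monoid_algebra K M = (let V = free_module K (carrier M) in
     V\<lparr>monoid.mult := (\<lambda>a b. lin_ext K V (\<lambda>s. lin_ext K V (\<lambda>t. single K (s \<otimes>\<^bsub>M\<^esub> t)) b) a),
       one := single K \<one>\<^bsub>M\<^esub>\<rparr>)"

definition free_monoid :: "'a set \<Rightarrow> 'a list monoid" where
  "free_monoid S = \<lparr>carrier = lists S, monoid.mult = (@), one = []\<rparr>"

abbreviation free_algebra :: "('k, 'm) ring_scheme \<Rightarrow> 'a set \<Rightarrow> ('k, 'a list \<Rightarrow> 'k) module" where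
  "free_algebra K S \<equiv> monoid_algebra K (free_monoid S)"

text \<open>The value of a noncommutative polynomial when the letters are replaced by \<open>v\<close>.\<close>

definition free_eval ::
  "('k, 'm) ring_scheme \<Rightarrow> ('k, 'z, 'u) module_scheme \<Rightarrow> ('a \<Rightarrow> 'z) \<Rightarrow> ('a list \<Rightarrow> 'k) \<Rightarrow> 'z" where
  "free_eval K Z v = lin_ext K Z (\<lambda>w. foldr (\<lambda>l y. v l \<otimes>\<^bsub>Z\<^esub> y) w \<one>\<^bsub>Z\<^esub>)"

text \<open>The algebra map, out of any quotient of a free algebra, with value \<open>v l\<close> at the class of the
  letter \<open>l\<close>; \<^const>\<open>the_elem\<close> extracts the value common to all representatives.\<close>

definition presented_hom ::
  "('k, 'm) ring_scheme \<Rightarrow> ('k, 'z, 'u) module_scheme \<Rightarrow> ('a \<Rightarrow> 'z) \<Rightarrow> ('a list \<Rightarrow> 'k) set \<Rightarrow> 'z" where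
  "presented_hom K Z v C = the_elem (free_eval K Z v ` C)"


section \<open>Tensor products\<close>

definition tensor_relations ::
  "('k, 'm) ring_scheme \<Rightarrow> ('k, 'v, 'x) module_scheme \<Rightarrow> ('k, 'w, 'y) module_scheme
    \<Rightarrow> ('v \<times> 'w \<Rightarrow> 'k) set"
where
  "tensor_relations K V W = (let P = free_module K (carrier V \<times> carrier W) in
     {single K (a \<oplus>\<^bsub>V\<^esub> a', b) \<ominus>\<^bsub>P\<^esub> (single K (a, b) \<oplus>\<^bsub>P\<^esub> single K (a', b)) | a a' b.
        a \<in> carrier V \<and> a' \<in> carrier V \<and> b \<in> carrier W} \<union>
     {single K (a, b \<oplus>\<^bsub>W\<^esub> b') \<ominus>\<^bsub>P\<^esub> (single K (a, b) \<oplus>\<^bsub>P\<^esub> single K (a, b')) | a b b'.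
        a \<in> carrier V \<and> b \<in> carrier W \<and> b' \<in> carrier W} \<union>
     {single K (c \<odot>\<^bsub>V\<^esub> a, b) \<ominus>\<^bsub>P\<^esub> (c \<odot>\<^bsub>P\<^esub> single K (a, b)) | c a b.
        c \<in> carrier K \<and> a \<in> carrier V \<and> b \<in> carrier W} \<union>
     {single K (a, c \<odot>\<^bsub>W\<^esub> b) \<ominus>\<^bsub>P\<^esub> (c \<odot>\<^bsub>P\<^esub> single K (a, b)) | c a b.
        c \<in> carrier K \<and> a \<in> carrier V \<and> b \<in> carrier W})"

definition tensor_kernel ::
  "('k, 'm) ring_scheme \<Rightarrow> ('k, 'v, 'x) module_scheme \<Rightarrow> ('k, 'w, 'y) module_scheme
    \<Rightarrow> ('v \<times> 'w \<Rightarrow> 'k) set"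
where
  "tensor_kernel K V W = \<Inter>{N. submodule N K (free_module K (carrier V \<times> carrier W)) \<and>
     tensor_relations K V W \<subseteq> N}"

definition tensor_module ::
  "('k, 'm) ring_scheme \<Rightarrow> ('k, 'v, 'x) module_scheme \<Rightarrow> ('k, 'w, 'y) module_scheme
    \<Rightarrow> ('k, ('v \<times> 'w \<Rightarrow> 'k) set) module"
where
  "tensor_module K V W =
     quotient_algebra (free_module K (carrier V \<times> carrier W)) (tensor_kernel K V W)"

definition pure_tensor ::
  "('k, 'm) ring_scheme \<Rightarrow> ('k, 'v, 'x) module_scheme \<Rightarrow> ('k, 'w, 'y) module_scheme
    \<Rightarrow> 'v \<Rightarrow> 'w \<Rightarrow> ('v \<times> 'w \<Rightarrow> 'k) set"
where
  "pure_tensor K V W a b =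
     tensor_kernel K V W +>\<^bsub>free_module K (carrier V \<times> carrier W)\<^esub> single K (a, b)"

text \<open>The linear map out of the tensor product induced by a bilinear map \<open>\<phi>\<close>; applied to a
  comultiplication \<open>\<Delta>(u)\<close> it is the Sweedler sum of the \<open>\<phi> u\<^sub>(\<^sub>1\<^sub>) u\<^sub>(\<^sub>2\<^sub>)\<close>. The arguments \<open>V\<close>, \<open>W\<close>
  are not needed to compute it.\<close>

definition tensor_lift ::
  "('k, 'm) ring_scheme \<Rightarrow> ('k, 'z, 'u) module_scheme \<Rightarrow> ('v \<Rightarrow> 'w \<Rightarrow> 'z) \<Rightarrow> ('v \<times> 'w \<Rightarrow> 'k) set \<Rightarrow> 'z"
where
  "tensor_lift K Z \<phi> C = the_elem (lin_ext K Z (\<lambda>(a, b). \<phi> a b) ` C)"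

definition tensor_algebra ::
  "('k, 'm) ring_scheme \<Rightarrow> ('k, 'v, 'x) module_scheme \<Rightarrow> ('k, 'w, 'y) module_scheme
    \<Rightarrow> ('k, ('v \<times> 'w \<Rightarrow> 'k) set) module"
where
  "tensor_algebra K V W = (let T = tensor_module K V W in
     T\<lparr>monoid.mult := (\<lambda>C D. tensor_lift K T (\<lambda>a b. tensor_lift K T (\<lambda>a' b'.
          pure_tensor K V W (a \<otimes>\<^bsub>V\<^esub> a') (b \<otimes>\<^bsub>W\<^esub> b')) D) C),
       one := pure_tensor K V W \<one>\<^bsub>V\<^esub> \<one>\<^bsub>W\<^esub>\<rparr>)"


section \<open>Hopf algebras\<close>

record ('k, 'h) hopf = "('k, 'h) module" +
  comul :: "'h \<Rightarrow> ('h \<times> 'h \<Rightarrow> 'k) set"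
  counit :: "'h \<Rightarrow> 'k"
  antipode :: "'h \<Rightarrow> 'h"

locale hopf_algebra = K: field K + H: assoc_algebra K H
  for K :: "('k, 'm) ring_scheme" (structure) and H :: "('k, 'h, 'x) hopf_scheme" (structure) +
  assumes comul_hom: "comul H \<in> algebra_homs K H (tensor_algebra K H H)"
    and counit_hom: "counit H \<in> algebra_homs K H (base_algebra K)"
    and antipode_linear: "antipode H \<in> linear_maps K H H"
    and coassoc: "h \<in> carrier H \<Longrightarrow>
      (let T = tensor_module K H (tensor_module K H H);
           pure = (\<lambda>a b c. pure_tensor K H (tensor_module K H H) a (pure_tensor K H H b c))
       in tensor_lift K T (\<lambda>a b. tensor_lift K T (\<lambda>a\<^sub>1 a\<^sub>2. pure a\<^sub>1 a\<^sub>2 b) (comul H a)) (comul H h)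
        = tensor_lift K T (\<lambda>a b. tensor_lift K T (\<lambda>b\<^sub>1 b\<^sub>2. pure a b\<^sub>1 b\<^sub>2) (comul H b)) (comul H h))"
    and counit_left: "h \<in> carrier H \<Longrightarrow> tensor_lift K H (\<lambda>a b. counit H a \<odot>\<^bsub>H\<^esub> b) (comul H h) = h"
    and counit_right: "h \<in> carrier H \<Longrightarrow> tensor_lift K H (\<lambda>a b. counit H b \<odot>\<^bsub>H\<^esub> a) (comul H h) = h"
    and antipode_left: "h \<in> carrier H \<Longrightarrow>
      tensor_lift K H (\<lambda>a b. antipode H a \<otimes>\<^bsub>H\<^esub> b) (comul H h) = counit H h \<odot>\<^bsub>H\<^esub> \<one>\<^bsub>H\<^esub>"
    and antipode_right: "h \<in> carrier H \<Longrightarrow>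
      tensor_lift K H (\<lambda>a b. a \<otimes>\<^bsub>H\<^esub> antipode H b) (comul H h) = counit H h \<odot>\<^bsub>H\<^esub> \<one>\<^bsub>H\<^esub>"

definition hopf_homs ::
  "('k, 'm) ring_scheme \<Rightarrow> ('k, 'h, 'x) hopf_scheme \<Rightarrow> ('k, 'j, 'y) hopf_scheme \<Rightarrow> ('h \<Rightarrow> 'j) set"
where
  "hopf_homs K H J = {\<phi>. hopf_algebra K H \<and> hopf_algebra K J \<and> \<phi> \<in> algebra_homs K H J \<and>
     (\<forall>h\<in>carrier H. comul J (\<phi> h) =
        tensor_lift K (tensor_module K J J) (\<lambda>a b. pure_tensor K J J (\<phi> a) (\<phi> b)) (comul H h)) \<and>
     (\<forall>h\<in>carrier H. counit J (\<phi> h) = counit H h) \<and>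
     (\<forall>h\<in>carrier H. antipode J (\<phi> h) = \<phi> (antipode H h))}"

definition hopf_isos ::
  "('k, 'm) ring_scheme \<Rightarrow> ('k, 'h, 'x) hopf_scheme \<Rightarrow> ('k, 'j, 'y) hopf_scheme \<Rightarrow> ('h \<Rightarrow> 'j) set"
where
  "hopf_isos K H J = {\<phi> \<in> hopf_homs K H J. bij_betw \<phi> (carrier H) (carrier J)}"

definition hopf_isomorphic ::
  "('k, 'm) ring_scheme \<Rightarrow> ('k, 'h, 'x) hopf_scheme \<Rightarrow> ('k, 'j, 'y) hopf_scheme \<Rightarrow> bool"
where
  "hopf_isomorphic K H J \<longleftrightarrow> hopf_isos K H J \<noteq> {}"


section \<open>Matched pairs of Hopf algebras\<close>

text \<open>The sum of all \<open>\<phi> u\<^sub>(\<^sub>1\<^sub>) u\<^sub>(\<^sub>2\<^sub>) a\<^sub>(\<^sub>1\<^sub>) a\<^sub>(\<^sub>2\<^sub>)\<close>.\<close>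

definition sweedler2 ::
  "('k, 'm) ring_scheme \<Rightarrow> ('k, 'a, 'x) hopf_scheme \<Rightarrow> ('k, 'b, 'y) hopf_scheme
    \<Rightarrow> ('k, 'z, 'u) module_scheme \<Rightarrow> ('b \<Rightarrow> 'b \<Rightarrow> 'a \<Rightarrow> 'a \<Rightarrow> 'z) \<Rightarrow> 'b \<Rightarrow> 'a \<Rightarrow> 'z"
where
  "sweedler2 K A B Z \<phi> u a =
     tensor_lift K Z (\<lambda>u\<^sub>1 u\<^sub>2. tensor_lift K Z (\<lambda>a\<^sub>1 a\<^sub>2. \<phi> u\<^sub>1 u\<^sub>2 a\<^sub>1 a\<^sub>2) (comul A a)) (comul B u)"

text \<open>An action \<open>B \<otimes> A \<rightarrow> A\<close> (or \<open>B \<otimes> A \<rightarrow> B\<close>) is given by the corresponding bilinear map.\<close>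

locale hopf_matched_pair = A: hopf_algebra K A + B: hopf_algebra K B
  for K :: "('k, 'm) ring_scheme" (structure) and A :: "('k, 'a, 'x) hopf_scheme" and B :: "('k, 'b, 'y) hopf_scheme"
    and lact :: "'b \<Rightarrow> 'a \<Rightarrow> 'a" (infixr \<open>\<rhd>\<close> 75) and ract :: "'b \<Rightarrow> 'a \<Rightarrow> 'b" (infixl \<open>\<lhd>\<lhd>\<close> 75) +
  assumes lact_bilinear: "lact \<in> bilinear_maps K B A A"
    and lact_one: "a \<in> carrier A \<Longrightarrow> \<one>\<^bsub>B\<^esub> \<rhd> a = a"
    and lact_mult: "\<lbrakk>u \<in> carrier B; v \<in> carrier B; a \<in> carrier A\<rbrakk>
      \<Longrightarrow> (u \<otimes>\<^bsub>B\<^esub> v) \<rhd> a = u \<rhd> (v \<rhd> a)"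
    and lact_comul: "\<lbrakk>u \<in> carrier B; a \<in> carrier A\<rbrakk> \<Longrightarrow> comul A (u \<rhd> a) =
      sweedler2 K A B (tensor_module K A A)
        (\<lambda>u\<^sub>1 u\<^sub>2 a\<^sub>1 a\<^sub>2. pure_tensor K A A (u\<^sub>1 \<rhd> a\<^sub>1) (u\<^sub>2 \<rhd> a\<^sub>2)) u a"
    and lact_counit: "\<lbrakk>u \<in> carrier B; a \<in> carrier A\<rbrakk>
      \<Longrightarrow> counit A (u \<rhd> a) = counit B u \<otimes> counit A a"
    and ract_bilinear: "ract \<in> bilinear_maps K B A B"
    and ract_one: "u \<in> carrier B \<Longrightarrow> u \<lhd>\<lhd> \<one>\<^bsub>A\<^esub> = u"
    and ract_mult: "\<lbrakk>u \<in> carrier B; a \<in> carrier A; b \<in> carrier A\<rbrakk>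
      \<Longrightarrow> u \<lhd>\<lhd> (a \<otimes>\<^bsub>A\<^esub> b) = (u \<lhd>\<lhd> a) \<lhd>\<lhd> b"
    and ract_comul: "\<lbrakk>u \<in> carrier B; a \<in> carrier A\<rbrakk> \<Longrightarrow> comul B (u \<lhd>\<lhd> a) =
      sweedler2 K A B (tensor_module K B B)
        (\<lambda>u\<^sub>1 u\<^sub>2 a\<^sub>1 a\<^sub>2. pure_tensor K B B (u\<^sub>1 \<lhd>\<lhd> a\<^sub>1) (u\<^sub>2 \<lhd>\<lhd> a\<^sub>2)) u a"
    and ract_counit: "\<lbrakk>u \<in> carrier B; a \<in> carrier A\<rbrakk>
      \<Longrightarrow> counit B (u \<lhd>\<lhd> a) = counit B u \<otimes> counit A a"
    and lact_unit: "u \<in> carrier B \<Longrightarrow> u \<rhd> \<one>\<^bsub>A\<^esub> = counit B u \<odot>\<^bsub>A\<^esub> \<one>\<^bsub>A\<^esub>"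
    and ract_unit: "a \<in> carrier A \<Longrightarrow> \<one>\<^bsub>B\<^esub> \<lhd>\<lhd> a = counit A a \<odot>\<^bsub>B\<^esub> \<one>\<^bsub>B\<^esub>"
    and lact_prod: "\<lbrakk>u \<in> carrier B; a \<in> carrier A; b \<in> carrier A\<rbrakk> \<Longrightarrow> u \<rhd> (a \<otimes>\<^bsub>A\<^esub> b) =
      sweedler2 K A B A (\<lambda>u\<^sub>1 u\<^sub>2 a\<^sub>1 a\<^sub>2. (u\<^sub>1 \<rhd> a\<^sub>1) \<otimes>\<^bsub>A\<^esub> ((u\<^sub>2 \<lhd>\<lhd> a\<^sub>2) \<rhd> b)) u a"
    and ract_prod: "\<lbrakk>u \<in> carrier B; v \<in> carrier B; a \<in> carrier A\<rbrakk> \<Longrightarrow> (u \<otimes>\<^bsub>B\<^esub> v) \<lhd>\<lhd> a =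
      sweedler2 K A B B (\<lambda>v\<^sub>1 v\<^sub>2 a\<^sub>1 a\<^sub>2. (u \<lhd>\<lhd> (v\<^sub>1 \<rhd> a\<^sub>1)) \<otimes>\<^bsub>B\<^esub> (v\<^sub>2 \<lhd>\<lhd> a\<^sub>2)) v a"
    and act_symmetric: "\<lbrakk>u \<in> carrier B; a \<in> carrier A\<rbrakk> \<Longrightarrow>
      sweedler2 K A B (tensor_module K B A)
        (\<lambda>u\<^sub>1 u\<^sub>2 a\<^sub>1 a\<^sub>2. pure_tensor K B A (u\<^sub>1 \<lhd>\<lhd> a\<^sub>1) (u\<^sub>2 \<rhd> a\<^sub>2)) u a =
      sweedler2 K A B (tensor_module K B A)
        (\<lambda>u\<^sub>1 u\<^sub>2 a\<^sub>1 a\<^sub>2. pure_tensor K B A (u\<^sub>2 \<lhd>\<lhd> a\<^sub>2) (u\<^sub>1 \<rhd> a\<^sub>1)) u a"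

definition bicrossed_mult ::
  "('k, 'm) ring_scheme \<Rightarrow> ('k, 'a, 'x) hopf_scheme \<Rightarrow> ('k, 'b, 'y) hopf_scheme
    \<Rightarrow> ('b \<Rightarrow> 'a \<Rightarrow> 'a) \<Rightarrow> ('b \<Rightarrow> 'a \<Rightarrow> 'b)
    \<Rightarrow> ('a \<times> 'b \<Rightarrow> 'k) set \<Rightarrow> ('a \<times> 'b \<Rightarrow> 'k) set \<Rightarrow> ('a \<times> 'b \<Rightarrow> 'k) set"
where
  "bicrossed_mult K A B lact ract C D = (let T = tensor_module K A B in
     tensor_lift K T (\<lambda>a u. tensor_lift K T (\<lambda>b v.
       sweedler2 K A B T (\<lambda>u\<^sub>1 u\<^sub>2 b\<^sub>1 b\<^sub>2.
         pure_tensor K A B (a \<otimes>\<^bsub>A\<^esub> lact u\<^sub>1 b\<^sub>1) (ract u\<^sub>2 b\<^sub>2 \<otimes>\<^bsub>B\<^esub> v)) u b) D) C)"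

text \<open>The antipode is forced by \<open>a \<bowtie> u = (a \<bowtie> 1)(1 \<bowtie> u)\<close>: it is
  \<open>S(a \<bowtie> u) = (1 \<bowtie> S(u))(S(a) \<bowtie> 1)\<close>.\<close>

definition bicrossed_product ::
  "('k, 'm) ring_scheme \<Rightarrow> ('k, 'a, 'x) hopf_scheme \<Rightarrow> ('k, 'b, 'y) hopf_scheme
    \<Rightarrow> ('b \<Rightarrow> 'a \<Rightarrow> 'a) \<Rightarrow> ('b \<Rightarrow> 'a \<Rightarrow> 'b) \<Rightarrow> ('k, ('a \<times> 'b \<Rightarrow> 'k) set) hopf"
where
  "bicrossed_product K A B lact ract =
    (let T = tensor_module K A B; TT = tensor_module K T T;
         pure = pure_tensor K A B; mul = bicrossed_mult K A B lact ract
     in \<lparr>carrier = carrier T, monoid.mult = mul, one = pure \<one>\<^bsub>A\<^esub> \<one>\<^bsub>B\<^esub>, 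
         ring.zero = ring.zero T, add = add T, smult = smult T,
         comul = tensor_lift K TT (\<lambda>a u. tensor_lift K TT (\<lambda>a\<^sub>1 a\<^sub>2. tensor_lift K TT (\<lambda>u\<^sub>1 u\<^sub>2.
           pure_tensor K T T (pure a\<^sub>1 u\<^sub>1) (pure a\<^sub>2 u\<^sub>2)) (comul B u)) (comul A a)),
         counit = tensor_lift K (base_algebra K) (\<lambda>a u. counit A a \<otimes>\<^bsub>K\<^esub> counit B u),
         antipode = tensor_lift K T (\<lambda>a u.
           mul (pure \<one>\<^bsub>A\<^esub> (antipode B u)) (pure (antipode A a) \<one>\<^bsub>B\<^esub>))\<rparr>)"

text \<open>\<open>A\<close> and \<open>B\<close> are regarded as Hopf subalgebras of \<open>H\<close> along injective Hopf maps \<open>i\<close> and \<open>j\<close>.\<close>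

definition factorization_map ::
  "('k, 'm) ring_scheme \<Rightarrow> ('k, 'h, 'z) hopf_scheme \<Rightarrow> ('a \<Rightarrow> 'h) \<Rightarrow> ('b \<Rightarrow> 'h)
    \<Rightarrow> ('a \<times> 'b \<Rightarrow> 'k) set \<Rightarrow> 'h"
where
  "factorization_map K H i j = tensor_lift K H (\<lambda>a u. i a \<otimes>\<^bsub>H\<^esub> j u)"

definition exact_factorization ::
  "('k, 'm) ring_scheme \<Rightarrow> ('k, 'h, 'z) hopf_scheme \<Rightarrow> ('k, 'a, 'x) hopf_scheme
    \<Rightarrow> ('k, 'b, 'y) hopf_scheme \<Rightarrow> ('a \<Rightarrow> 'h) \<Rightarrow> ('b \<Rightarrow> 'h) \<Rightarrow> bool"
where
  "exact_factorization K H A B i j \<longleftrightarrow>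
     i \<in> hopf_homs K A H \<and> inj_on i (carrier A) \<and>
     j \<in> hopf_homs K B H \<and> inj_on j (carrier B) \<and>
     bij_betw (factorization_map K H i j) (carrier (tensor_module K A B)) (carrier H)"

definition associated_matched_pair ::
  "('k, 'm) ring_scheme \<Rightarrow> ('k, 'h, 'z) hopf_scheme \<Rightarrow> ('k, 'a, 'x) hopf_scheme
    \<Rightarrow> ('k, 'b, 'y) hopf_scheme \<Rightarrow> ('a \<Rightarrow> 'h) \<Rightarrow> ('b \<Rightarrow> 'h)
    \<Rightarrow> ('b \<Rightarrow> 'a \<Rightarrow> 'a) \<Rightarrow> ('b \<Rightarrow> 'a \<Rightarrow> 'b) \<Rightarrow> bool"
where
  "associated_matched_pair K H A B i j lact ract \<longleftrightarrow>
     hopf_matched_pair K A B lact ract \<and>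
     factorization_map K H i j \<in> hopf_isos K (bicrossed_product K A B lact ract) H"


section \<open>Matched pairs of groups\<close>

locale group_matched_pair = P: group P + Q: group Q
  for P :: "('a, 'x) monoid_scheme" and Q :: "('b, 'y) monoid_scheme"
    and lact :: "'b \<Rightarrow> 'a \<Rightarrow> 'a" (infixr \<open>\<rhd>\<close> 75) and ract :: "'b \<Rightarrow> 'a \<Rightarrow> 'b" (infixl \<open>\<lhd>\<lhd>\<close> 75) +
  assumes lact_closed: "\<lbrakk>t \<in> carrier Q; h \<in> carrier P\<rbrakk> \<Longrightarrow> t \<rhd> h \<in> carrier P"
    and lact_one: "h \<in> carrier P \<Longrightarrow> \<one>\<^bsub>Q\<^esub> \<rhd> h = h"
    and lact_mult: "\<lbrakk>t \<in> carrier Q; s \<in> carrier Q; h \<in> carrier P\<rbrakk>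
      \<Longrightarrow> (t \<otimes>\<^bsub>Q\<^esub> s) \<rhd> h = t \<rhd> (s \<rhd> h)"
    and ract_closed: "\<lbrakk>t \<in> carrier Q; h \<in> carrier P\<rbrakk> \<Longrightarrow> t \<lhd>\<lhd> h \<in> carrier Q"
    and ract_one: "t \<in> carrier Q \<Longrightarrow> t \<lhd>\<lhd> \<one>\<^bsub>P\<^esub> = t"
    and ract_mult: "\<lbrakk>t \<in> carrier Q; h \<in> carrier P; k \<in> carrier P\<rbrakk>
      \<Longrightarrow> t \<lhd>\<lhd> (h \<otimes>\<^bsub>P\<^esub> k) = (t \<lhd>\<lhd> h) \<lhd>\<lhd> k"
    and lact_prod: "\<lbrakk>t \<in> carrier Q; h \<in> carrier P; k \<in> carrier P\<rbrakk>
      \<Longrightarrow> t \<rhd> (h \<otimes>\<^bsub>P\<^esub> k) = (t \<rhd> h) \<otimes>\<^bsub>P\<^esub> ((t \<lhd>\<lhd> h) \<rhd> k)"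
    and ract_prod: "\<lbrakk>t \<in> carrier Q; s \<in> carrier Q; h \<in> carrier P\<rbrakk>
      \<Longrightarrow> (t \<otimes>\<^bsub>Q\<^esub> s) \<lhd>\<lhd> h = (t \<lhd>\<lhd> (s \<rhd> h)) \<otimes>\<^bsub>Q\<^esub> (s \<lhd>\<lhd> h)"

definition group_bicrossed_product ::
  "('a, 'x) monoid_scheme \<Rightarrow> ('b, 'y) monoid_scheme \<Rightarrow> ('b \<Rightarrow> 'a \<Rightarrow> 'a) \<Rightarrow> ('b \<Rightarrow> 'a \<Rightarrow> 'b)
    \<Rightarrow> ('a \<times> 'b) monoid"
where
  "group_bicrossed_product P Q lact ract =
    \<lparr>carrier = carrier P \<times> carrier Q,
     monoid.mult = (\<lambda>(h, t) (k, s). (h \<otimes>\<^bsub>P\<^esub> lact t k, ract t k \<otimes>\<^bsub>Q\<^esub> s)),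
     one = (\<one>\<^bsub>P\<^esub>, \<one>\<^bsub>Q\<^esub>)\<rparr>"

text \<open>The two components of \<open>th = (t \<rhd> h)(t \<lhd> h)\<close> for a factorized group.\<close>

definition canonical_lact :: "('g, 'n) monoid_scheme \<Rightarrow> 'g set \<Rightarrow> 'g set \<Rightarrow> 'g \<Rightarrow> 'g \<Rightarrow> 'g" where
  "canonical_lact G \<Gamma> G\<^sub>B t h = (THE h'. h' \<in> \<Gamma> \<and> (\<exists>t'\<in>G\<^sub>B. t \<otimes>\<^bsub>G\<^esub> h = h' \<otimes>\<^bsub>G\<^esub> t'))"

definition canonical_ract :: "('g, 'n) monoid_scheme \<Rightarrow> 'g set \<Rightarrow> 'g set \<Rightarrow> 'g \<Rightarrow> 'g \<Rightarrow> 'g" where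
  "canonical_ract G \<Gamma> G\<^sub>B t h = (THE t'. t' \<in> G\<^sub>B \<and> (\<exists>h'\<in>\<Gamma>. t \<otimes>\<^bsub>G\<^esub> h = h' \<otimes>\<^bsub>G\<^esub> t'))"


section \<open>Group algebras and the Hopf algebras of the third type\<close>

definition group_hopf_algebra ::
  "('k, 'm) ring_scheme \<Rightarrow> ('g, 'n) monoid_scheme \<Rightarrow> ('k, 'g \<Rightarrow> 'k) hopf"
where
  "group_hopf_algebra K G = (let V = monoid_algebra K G in
     module.extend V (hopf.fields
       (lin_ext K (tensor_module K V V) (\<lambda>t. pure_tensor K V V (single K t) (single K t)))
       (lin_ext K (base_algebra K) (\<lambda>t. \<one>\<^bsub>K\<^esub>))
       (lin_ext K V (\<lambda>t. single K (inv\<^bsub>G\<^esub> t)))))"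

definition third_type_datum ::
  "('k, 'm) ring_scheme \<Rightarrow> nat \<Rightarrow> ('g, 'n) monoid_scheme \<Rightarrow> 'g \<Rightarrow> ('g \<Rightarrow> 'k) \<Rightarrow> bool"
where
  "third_type_datum K p G g f \<longleftrightarrow>
     group G \<and> finite (carrier G) \<and>
     g \<in> carrier G \<and> (\<forall>t\<in>carrier G. g \<otimes>\<^bsub>G\<^esub> t = t \<otimes>\<^bsub>G\<^esub> g) \<and>
     f \<in> hom G (add_monoid K) \<and> f g = \<one>\<^bsub>K\<^esub> \<and>
     (\<forall>t\<in>carrier G.
        (f t [^]\<^bsub>K\<^esub> p \<ominus>\<^bsub>K\<^esub> f t) \<odot>\<^bsub>monoid_algebra K G\<^esub>
          (\<one>\<^bsub>monoid_algebra K G\<^esub> \<ominus>\<^bsub>monoid_algebra K G\<^esub> single K (g [^]\<^bsub>G\<^esub> p))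
        = \<zero>\<^bsub>monoid_algebra K G\<^esub>)"

datatype 'g letter = Grp 'g | Xgen

abbreviation third_free :: "('k, 'm) ring_scheme \<Rightarrow> ('g, 'n) monoid_scheme \<Rightarrow> ('k, 'g letter list \<Rightarrow> 'k) module"
where
  "third_free K G \<equiv> free_algebra K (Grp ` carrier G \<union> {Xgen})"

text \<open>The first two families of relations present the group algebra by its multiplication table.\<close>

definition third_relations ::
  "('k, 'm) ring_scheme \<Rightarrow> nat \<Rightarrow> ('g, 'n) monoid_scheme \<Rightarrow> 'g \<Rightarrow> ('g \<Rightarrow> 'k)
    \<Rightarrow> ('g letter list \<Rightarrow> 'k) set"
where
  "third_relations K p G g f =
    (let R = third_free K G; e = (\<lambda>t. single K [Grp t]); x = single K [Xgen] in
     {(e s \<otimes>\<^bsub>R\<^esub> e t) \<ominus>\<^bsub>R\<^esub> e (s \<otimes>\<^bsub>G\<^esub> t) | s t. s \<in> carrier G \<and> t \<in> carrier G} \<union>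
     {e \<one>\<^bsub>G\<^esub> \<ominus>\<^bsub>R\<^esub> \<one>\<^bsub>R\<^esub>} \<union>
     {((e t \<otimes>\<^bsub>R\<^esub> x) \<ominus>\<^bsub>R\<^esub> (x \<otimes>\<^bsub>R\<^esub> e t)) \<ominus>\<^bsub>R\<^esub> (f t \<odot>\<^bsub>R\<^esub> (e t \<otimes>\<^bsub>R\<^esub> (\<one>\<^bsub>R\<^esub> \<ominus>\<^bsub>R\<^esub> e g))) | t. t \<in> carrier G} \<union>
     {(x [^]\<^bsub>R\<^esub> p) \<ominus>\<^bsub>R\<^esub> x})"

definition third_ideal ::
  "('k, 'm) ring_scheme \<Rightarrow> nat \<Rightarrow> ('g, 'n) monoid_scheme \<Rightarrow> 'g \<Rightarrow> ('g \<Rightarrow> 'k)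
    \<Rightarrow> ('g letter list \<Rightarrow> 'k) set"
where
  "third_ideal K p G g f = Idl\<^bsub>third_free K G\<^esub> (third_relations K p G g f)"

definition third_grp ::
  "('k, 'm) ring_scheme \<Rightarrow> nat \<Rightarrow> ('g, 'n) monoid_scheme \<Rightarrow> 'g \<Rightarrow> ('g \<Rightarrow> 'k)
    \<Rightarrow> 'g \<Rightarrow> ('g letter list \<Rightarrow> 'k) set"
where
  "third_grp K p G g f t = third_ideal K p G g f +>\<^bsub>third_free K G\<^esub> single K [Grp t]"

definition third_x ::
  "('k, 'm) ring_scheme \<Rightarrow> nat \<Rightarrow> ('g, 'n) monoid_scheme \<Rightarrow> 'g \<Rightarrow> ('g \<Rightarrow> 'k)
    \<Rightarrow> ('g letter list \<Rightarrow> 'k) set"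
where
  "third_x K p G g f = third_ideal K p G g f +>\<^bsub>third_free K G\<^esub> single K [Xgen]"

definition third_hopf_algebra ::
  "('k, 'm) ring_scheme \<Rightarrow> nat \<Rightarrow> ('g, 'n) monoid_scheme \<Rightarrow> 'g \<Rightarrow> ('g \<Rightarrow> 'k)
    \<Rightarrow> ('k, ('g letter list \<Rightarrow> 'k) set) hopf"
where
  "third_hopf_algebra K p G g f =
    (let V = quotient_algebra (third_free K G) (third_ideal K p G g f);
         T = tensor_algebra K V V; pure = pure_tensor K V V;
         e = third_grp K p G g f; x = third_x K p G g f
     in module.extend V (hopf.fields
       (presented_hom K T
         (\<lambda>l. case l of Grp t \<Rightarrow> pure (e t) (e t) | Xgen \<Rightarrow> pure x \<one>\<^bsub>V\<^esub> \<oplus>\<^bsub>T\<^esub> pure (e g) x))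
       (presented_hom K (base_algebra K)
         (\<lambda>l. case l of Grp t \<Rightarrow> \<one>\<^bsub>K\<^esub> | Xgen \<Rightarrow> \<zero>\<^bsub>K\<^esub>))
       (presented_hom K (opposite_algebra V)
         (\<lambda>l. case l of Grp t \<Rightarrow> e (inv\<^bsub>G\<^esub> t) | Xgen \<Rightarrow> \<ominus>\<^bsub>V\<^esub> (e (inv\<^bsub>G\<^esub> g) \<otimes>\<^bsub>V\<^esub> x)))))"

text \<open>The canonical maps from \<open>k[\<Gamma>]\<close> and from the third-type algebra of a subgroup (which is the
  quotient of a smaller free algebra) into the third-type algebra of \<open>G\<close>.\<close>

definition group_incl ::
  "('k, 'm) ring_scheme \<Rightarrow> nat \<Rightarrow> ('g, 'n) monoid_scheme \<Rightarrow> 'g \<Rightarrow> ('g \<Rightarrow> 'k)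
    \<Rightarrow> ('g \<Rightarrow> 'k) \<Rightarrow> ('g letter list \<Rightarrow> 'k) set"
where
  "group_incl K p G g f = lin_ext K (third_hopf_algebra K p G g f) (third_grp K p G g f)"

definition third_incl ::
  "('k, 'm) ring_scheme \<Rightarrow> nat \<Rightarrow> ('g, 'n) monoid_scheme \<Rightarrow> 'g \<Rightarrow> ('g \<Rightarrow> 'k)
    \<Rightarrow> ('g letter list \<Rightarrow> 'k) set \<Rightarrow> ('g letter list \<Rightarrow> 'k) set"
where
  "third_incl K p G g f = presented_hom K (third_hopf_algebra K p G g f)
     (\<lambda>l. case l of Grp t \<Rightarrow> third_grp K p G g f t | Xgen \<Rightarrow> third_x K p G g f)"

text \<open>The actions of a Hopf matched pair of \<open>k[P]\<close> and the third-type algebra of \<open>(Q, g, f)\<close> are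
  determined by a matched pair of groups and \<open>\<gamma>\<close>.\<close>

definition determined_by ::
  "('k, 'm) ring_scheme \<Rightarrow> nat \<Rightarrow> ('h, 'x) monoid_scheme \<Rightarrow> ('g, 'n) monoid_scheme \<Rightarrow> 'g \<Rightarrow> ('g \<Rightarrow> 'k)
    \<Rightarrow> ('g \<Rightarrow> 'h \<Rightarrow> 'h) \<Rightarrow> ('g \<Rightarrow> 'h \<Rightarrow> 'g) \<Rightarrow> ('h \<Rightarrow> 'k)
    \<Rightarrow> (('g letter list \<Rightarrow> 'k) set \<Rightarrow> ('h \<Rightarrow> 'k) \<Rightarrow> ('h \<Rightarrow> 'k))
    \<Rightarrow> (('g letter list \<Rightarrow> 'k) set \<Rightarrow> ('h \<Rightarrow> 'k) \<Rightarrow> ('g letter list \<Rightarrow> 'k) set) \<Rightarrow> bool"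
where
  "determined_by K p P Q g f l r \<gamma> lact ract \<longleftrightarrow>
    (let A = group_hopf_algebra K P; B = third_hopf_algebra K p Q g f;
         e = third_grp K p Q g f; x = third_x K p Q g f
     in (\<forall>t\<in>carrier Q. \<forall>h\<in>carrier P.
           lact (e t) (single K h) = single K (l t h) \<and> ract (e t) (single K h) = e (r t h)) \<and>
        (\<forall>h\<in>carrier P. lact x (single K h) = \<zero>\<^bsub>A\<^esub> \<and>
           ract x (single K h) = x \<oplus>\<^bsub>B\<^esub> (\<gamma> h \<odot>\<^bsub>B\<^esub> (\<one>\<^bsub>B\<^esub> \<ominus>\<^bsub>B\<^esub> e g))))"

end

theory Submission
  imports Defs "HOL-Combinatorics.Stirling" "HOL-Number_Theory.Residues"
begin

text \<open>
  Why the theorem holds. In \<open>H\<close> the commutation relation reads \<open>xh = h y\<^sub>h\<close> with \<open>y\<^sub>h = x - f(h)(1 - g)\<close>,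
  and \<open>sh = (s \<rhd> h)(s \<lhd> h)\<close> for \<open>s \<in> G\<^sub>B\<close>, \<open>h \<in> \<Gamma>\<close>. So a generator of \<open>B\<close> standing to the left of
  a grouplike element of \<open>A\<close> can be moved to its right, and the matched pair can be read off: moving \<open>s\<close>
  changes \<open>h\<close> into \<open>s \<rhd> h\<close> and leaves \<open>s \<lhd> h\<close> behind; moving \<open>x\<close> keeps \<open>h\<close> and leaves \<open>y\<^sub>h\<close> behind.
  This is \<open>x \<rhd> h = 0\<close> and \<open>x \<lhd> h = y\<^sub>h\<close>, that is \<open>\<gamma>\<^sub>h = -f(h)\<close>.

  To make this a proof, the locale \<open>factorized_actions\<close> records how two bilinear maps behave when
  their first argument is multiplied on the right by a generator. An element of \<open>B\<close> is a combination of
  products of generators, so these rules determine the actions. Apart from those that concern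
  the unit of \<open>B\<close>, the axioms of a matched pair are, like the identity \<open>uh = \<Sum> (u\<^sub>1 \<rhd> h)(u\<^sub>2 \<lhd> h)\<close> in \<open>H\<close>,
  equations between linear functions on \<open>B\<close> that obey the same recursion along right multiplication by generators
  (\<open>right_recursion_unique\<close>, \<open>sweedler_recursion\<close>); hence the rules give a matched pair whose
  bicrossed product is \<open>H\<close>. The rules hold for the actions obtained by projecting \<open>ua\<close> onto the two
  factors of \<open>H = AB\<close> (\<open>canonical_actions\<close>), and for any matched pair determined by the given data
  (\<open>determined_actions\<close>). Conversely, an associated matched pair must be given by these projections
  (\<open>unique_actions\<close>), so it is determined by the data.

  All of this needs concrete knowledge of the algebras. The exact factorization, and the injectivity of the
  inclusions, rest on the basis \<open>tx\<^sup>i\<close>, which is obtained from an explicit representation on the free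
  module with that basis. The relation \<open>x\<^sup>p = x\<close> has to be checked there, for the comultiplication
  and for the antipode. In characteristic \<open>p\<close> it says that the falling factorial \<open>x(x - 1)\<cdots>(x - p + 1)\<close>
  vanishes, and falling factorials behave well under the noncommutative substitutions that occur
  (\<open>falling_twist\<close>, \<open>falling_vandermonde_char\<close>).

  Finally \<open>\<Theta>\<close> is bijective because the factorization of the group is exact, and it carries \<open>F\<close> to \<open>f\<close>
  because \<open>f\<close> is additive; functoriality of the construction in the datum then gives the isomorphisms.
\<close>

section \<open>Linear and bilinear maps\<close>

lemma linear_mapsI:
  assumes "\<And>a. a \<in> carrier V \<Longrightarrow> \<phi> a \<in> carrier W"
    and "\<And>a b. a \<in> carrier V \<Longrightarrow> b \<in> carrier V \<Longrightarrow> \<phi> (a \<oplus>\<^bsub>V\<^esub> b) = \<phi> a \<oplus>\<^bsub>W\<^esub> \<phi> b"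
    and "\<And>c a. c \<in> carrier K \<Longrightarrow> a \<in> carrier V \<Longrightarrow> \<phi> (c \<odot>\<^bsub>V\<^esub> a) = c \<odot>\<^bsub>W\<^esub> \<phi> a"
  shows "\<phi> \<in> linear_maps K V W"
  using assms unfolding linear_maps_def by auto

lemma
  assumes "\<phi> \<in> linear_maps K V W"
  shows linear_closed: "a \<in> carrier V \<Longrightarrow> \<phi> a \<in> carrier W"
    and linear_add: "a \<in> carrier V \<Longrightarrow> b \<in> carrier V \<Longrightarrow> \<phi> (a \<oplus>\<^bsub>V\<^esub> b) = \<phi> a \<oplus>\<^bsub>W\<^esub> \<phi> b"
    and linear_smult: "c \<in> carrier K \<Longrightarrow> a \<in> carrier V \<Longrightarrow> \<phi> (c \<odot>\<^bsub>V\<^esub> a) = c \<odot>\<^bsub>W\<^esub> \<phi> a"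
  using assms unfolding linear_maps_def by auto

lemma linear_compose:
  assumes "\<phi> \<in> linear_maps K V W" "\<psi> \<in> linear_maps K W Z"
  shows "(\<lambda>a. \<psi> (\<phi> a)) \<in> linear_maps K V Z"
  using assms unfolding linear_maps_def by (auto simp: Pi_iff)

lemma linear_cong:
  assumes "\<And>a. a \<in> carrier V \<Longrightarrow> \<phi> a = \<psi> a" "\<phi> \<in> linear_maps K V W" "module K V"
  shows "\<psi> \<in> linear_maps K V W"
proof -
  interpret module K V by fact
  show ?thesis using assms(2) unfolding linear_maps_def by (auto simp: assms(1)[symmetric])
qed

lemma linear_zero:
  assumes "module K V" "module K W" "\<phi> \<in> linear_maps K V W"
  shows "\<phi> \<zero>\<^bsub>V\<^esub> = \<zero>\<^bsub>W\<^esub>"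
proof -
  interpret V: module K V by fact
  interpret W: module K W by fact
  have "\<phi> (\<zero>\<^bsub>K\<^esub> \<odot>\<^bsub>V\<^esub> \<zero>\<^bsub>V\<^esub>) = \<zero>\<^bsub>K\<^esub> \<odot>\<^bsub>W\<^esub> \<phi> \<zero>\<^bsub>V\<^esub>"
    using linear_smult[OF assms(3)] by blast
  then show ?thesis
    using linear_closed[OF assms(3)] by simp
qed

lemma linear_neg:
  assumes "module K V" "module K W" "\<phi> \<in> linear_maps K V W" "a \<in> carrier V"
  shows "\<phi> (\<ominus>\<^bsub>V\<^esub> a) = \<ominus>\<^bsub>W\<^esub> \<phi> a"
proof -
  interpret V: module K V by fact
  interpret W: module K W by fact
  have "\<phi> (\<ominus>\<^bsub>V\<^esub> a) \<oplus>\<^bsub>W\<^esub> \<phi> a = \<zero>\<^bsub>W\<^esub>"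
    using linear_add[OF assms(3), of "\<ominus>\<^bsub>V\<^esub> a" a] assms(4) linear_zero[OF assms(1-3)]
    by (simp add: V.M.l_neg)
  then show ?thesis
    using linear_closed[OF assms(3)] assms(4) by (simp add: W.M.minus_equality)
qed

lemma linear_minus:
  assumes "module K V" "module K W" "\<phi> \<in> linear_maps K V W" "a \<in> carrier V" "b \<in> carrier V"
  shows "\<phi> (a \<ominus>\<^bsub>V\<^esub> b) = \<phi> a \<ominus>\<^bsub>W\<^esub> \<phi> b"
proof -
  interpret V: module K V by fact
  show ?thesis
    using assms by (simp add: a_minus_def linear_add linear_neg)
qed

lemma zero_linear: "module K V \<Longrightarrow> module K W \<Longrightarrow> (\<lambda>a. \<zero>\<^bsub>W\<^esub>) \<in> linear_maps K V W"
proof -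
  assume "module K V" "module K W"
  then interpret V: module K V + W: module K W .
  show ?thesis by (rule linear_mapsI) auto
qed

lemma bilinear_mapsI:
  assumes "\<And>a b. a \<in> carrier V \<Longrightarrow> b \<in> carrier W \<Longrightarrow> \<phi> a b \<in> carrier Z"
    and "\<And>a a' b. a \<in> carrier V \<Longrightarrow> a' \<in> carrier V \<Longrightarrow> b \<in> carrier W \<Longrightarrow>
      \<phi> (a \<oplus>\<^bsub>V\<^esub> a') b = \<phi> a b \<oplus>\<^bsub>Z\<^esub> \<phi> a' b"
    and "\<And>a b b'. a \<in> carrier V \<Longrightarrow> b \<in> carrier W \<Longrightarrow> b' \<in> carrier W \<Longrightarrow>
      \<phi> a (b \<oplus>\<^bsub>W\<^esub> b') = \<phi> a b \<oplus>\<^bsub>Z\<^esub> \<phi> a b'"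
    and "\<And>c a b. c \<in> carrier K \<Longrightarrow> a \<in> carrier V \<Longrightarrow> b \<in> carrier W \<Longrightarrow>
      \<phi> (c \<odot>\<^bsub>V\<^esub> a) b = c \<odot>\<^bsub>Z\<^esub> \<phi> a b"
    and "\<And>c a b. c \<in> carrier K \<Longrightarrow> a \<in> carrier V \<Longrightarrow> b \<in> carrier W \<Longrightarrow>
      \<phi> a (c \<odot>\<^bsub>W\<^esub> b) = c \<odot>\<^bsub>Z\<^esub> \<phi> a b"
  shows "\<phi> \<in> bilinear_maps K V W Z"
  using assms unfolding bilinear_maps_def linear_maps_def by auto

lemma
  assumes "\<phi> \<in> bilinear_maps K V W Z"
  shows bilinear_left: "b \<in> carrier W \<Longrightarrow> (\<lambda>a. \<phi> a b) \<in> linear_maps K V Z"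
    and bilinear_right: "a \<in> carrier V \<Longrightarrow> \<phi> a \<in> linear_maps K W Z"
    and bilinear_closed: "a \<in> carrier V \<Longrightarrow> b \<in> carrier W \<Longrightarrow> \<phi> a b \<in> carrier Z"
    and bilinear_add_left: "a \<in> carrier V \<Longrightarrow> a' \<in> carrier V \<Longrightarrow> b \<in> carrier W \<Longrightarrow>
      \<phi> (a \<oplus>\<^bsub>V\<^esub> a') b = \<phi> a b \<oplus>\<^bsub>Z\<^esub> \<phi> a' b"
    and bilinear_add_right: "a \<in> carrier V \<Longrightarrow> b \<in> carrier W \<Longrightarrow> b' \<in> carrier W \<Longrightarrow>
      \<phi> a (b \<oplus>\<^bsub>W\<^esub> b') = \<phi> a b \<oplus>\<^bsub>Z\<^esub> \<phi> a b'"
    and bilinear_smult_left: "c \<in> carrier K \<Longrightarrow> a \<in> carrier V \<Longrightarrow> b \<in> carrier W \<Longrightarrow>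
      \<phi> (c \<odot>\<^bsub>V\<^esub> a) b = c \<odot>\<^bsub>Z\<^esub> \<phi> a b"
    and bilinear_smult_right: "c \<in> carrier K \<Longrightarrow> a \<in> carrier V \<Longrightarrow> b \<in> carrier W \<Longrightarrow>
      \<phi> a (c \<odot>\<^bsub>W\<^esub> b) = c \<odot>\<^bsub>Z\<^esub> \<phi> a b"
  using assms unfolding bilinear_maps_def linear_maps_def by auto

lemma bilinear_compose:
  assumes "\<phi> \<in> bilinear_maps K V W Z" "\<psi> \<in> linear_maps K Z U"
  shows "(\<lambda>a b. \<psi> (\<phi> a b)) \<in> bilinear_maps K V W U"
  using assms by (auto simp: bilinear_maps_def intro: linear_compose)

lemma bilinear_compose_args:
  assumes "\<phi> \<in> bilinear_maps K V W Z" "\<alpha> \<in> linear_maps K V' V" "\<beta> \<in> linear_maps K W' W"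
  shows "(\<lambda>a b. \<phi> (\<alpha> a) (\<beta> b)) \<in> bilinear_maps K V' W' Z"
  using assms
  by (intro bilinear_mapsI)
    (simp_all add: linear_closed[OF assms(2)] linear_closed[OF assms(3)] linear_add[OF assms(2)]
      linear_add[OF assms(3)] linear_smult[OF assms(2)] linear_smult[OF assms(3)]
      bilinear_closed[OF assms(1)] bilinear_add_left[OF assms(1)] bilinear_add_right[OF assms(1)]
      bilinear_smult_left[OF assms(1)] bilinear_smult_right[OF assms(1)])


lemma bilinear_flip: "\<phi> \<in> bilinear_maps K V W Z \<Longrightarrow> (\<lambda>b a. \<phi> a b) \<in> bilinear_maps K W V Z"
  by (simp add: bilinear_maps_def)


section \<open>Images and quotients\<close>

text \<open>The axioms pass along any surjection that respects the operations. This gives quotients, and with the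
  identity map it forgets the difference between records with the same underlying module.\<close>

lemma module_image:
  assumes "module K V" "q \<in> carrier V \<rightarrow> carrier W" "carrier W \<subseteq> q ` carrier V"
    and add: "\<And>a b. a \<in> carrier V \<Longrightarrow> b \<in> carrier V \<Longrightarrow> q (a \<oplus>\<^bsub>V\<^esub> b) = q a \<oplus>\<^bsub>W\<^esub> q b"
    and smult: "\<And>c a. c \<in> carrier K \<Longrightarrow> a \<in> carrier V \<Longrightarrow> q (c \<odot>\<^bsub>V\<^esub> a) = c \<odot>\<^bsub>W\<^esub> q a"
    and zero: "q \<zero>\<^bsub>V\<^esub> = \<zero>\<^bsub>W\<^esub>"
  shows "module K W"
proof -
  interpret V: module K V by fact
  have im: "\<exists>a\<in>carrier V. w = q a" if "w \<in> carrier W" for w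
    using that assms(3) by auto
  have cl: "q a \<in> carrier W" if "a \<in> carrier V" for a
    using that assms(2) by auto
  note s = add[symmetric] smult[symmetric] zero[symmetric] cl
  show ?thesis
  proof (rule moduleI)
    show "cring K" by (rule V.is_cring)
    show "abelian_group W"
    proof (rule abelian_groupI)
      fix x assume "x \<in> carrier W"
      then obtain a where a: "a \<in> carrier V" "x = q a" using im by blast
      then show "\<exists>y\<in>carrier W. y \<oplus>\<^bsub>W\<^esub> x = \<zero>\<^bsub>W\<^esub>"
        by (intro bexI[of _ "q (\<ominus>\<^bsub>V\<^esub> a)"]) (simp_all add: s V.M.l_neg)
    next
      fix x y z assume "x \<in> carrier W" "y \<in> carrier W" "z \<in> carrier W"
      then obtain a b c where "a \<in> carrier V" "x = q a" "b \<in> carrier V" "y = q b"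
        "c \<in> carrier V" "z = q c" using im by meson
      then show "x \<oplus>\<^bsub>W\<^esub> y \<in> carrier W" "x \<oplus>\<^bsub>W\<^esub> y = y \<oplus>\<^bsub>W\<^esub> x"
        "(x \<oplus>\<^bsub>W\<^esub> y) \<oplus>\<^bsub>W\<^esub> z = x \<oplus>\<^bsub>W\<^esub> (y \<oplus>\<^bsub>W\<^esub> z)" "\<zero>\<^bsub>W\<^esub> \<oplus>\<^bsub>W\<^esub> x = x"
        by (simp_all add: s V.M.a_ac)
    qed (simp add: s)
    fix c x assume "c \<in> carrier K" "x \<in> carrier W"
    then show "c \<odot>\<^bsub>W\<^esub> x \<in> carrier W" using im[of x] by (auto simp: s)
  next
    fix c d x assume "c \<in> carrier K" "d \<in> carrier K" "x \<in> carrier W"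
    then show "(c \<oplus>\<^bsub>K\<^esub> d) \<odot>\<^bsub>W\<^esub> x = (c \<odot>\<^bsub>W\<^esub> x) \<oplus>\<^bsub>W\<^esub> (d \<odot>\<^bsub>W\<^esub> x)"
      using im[of x] by (auto simp: s V.smult_l_distr)
  next
    fix c x y assume "c \<in> carrier K" "x \<in> carrier W" "y \<in> carrier W"
    then show "c \<odot>\<^bsub>W\<^esub> (x \<oplus>\<^bsub>W\<^esub> y) = (c \<odot>\<^bsub>W\<^esub> x) \<oplus>\<^bsub>W\<^esub> (c \<odot>\<^bsub>W\<^esub> y)"
      using im[of x] im[of y] by (auto simp: s V.smult_r_distr)
  next
    fix c d x assume "c \<in> carrier K" "d \<in> carrier K" "x \<in> carrier W"
    then show "(c \<otimes>\<^bsub>K\<^esub> d) \<odot>\<^bsub>W\<^esub> x = c \<odot>\<^bsub>W\<^esub> (d \<odot>\<^bsub>W\<^esub> x)"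
      using im[of x] by (auto simp: s V.smult_assoc1)
  next
    fix x assume "x \<in> carrier W"
    then show "\<one>\<^bsub>K\<^esub> \<odot>\<^bsub>W\<^esub> x = x" using im[of x] by (auto simp: s)
  qed
qed

lemma assoc_algebraI:
  assumes "module K V" "monoid V"
    and "\<And>a b c. a \<in> carrier V \<Longrightarrow> b \<in> carrier V \<Longrightarrow> c \<in> carrier V \<Longrightarrow>
      (a \<oplus>\<^bsub>V\<^esub> b) \<otimes>\<^bsub>V\<^esub> c = a \<otimes>\<^bsub>V\<^esub> c \<oplus>\<^bsub>V\<^esub> b \<otimes>\<^bsub>V\<^esub> c"
    and "\<And>a b c. a \<in> carrier V \<Longrightarrow> b \<in> carrier V \<Longrightarrow> c \<in> carrier V \<Longrightarrow>
      c \<otimes>\<^bsub>V\<^esub> (a \<oplus>\<^bsub>V\<^esub> b) = c \<otimes>\<^bsub>V\<^esub> a \<oplus>\<^bsub>V\<^esub> c \<otimes>\<^bsub>V\<^esub> b"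
    and "\<And>c a b. c \<in> carrier K \<Longrightarrow> a \<in> carrier V \<Longrightarrow> b \<in> carrier V \<Longrightarrow>
      (c \<odot>\<^bsub>V\<^esub> a) \<otimes>\<^bsub>V\<^esub> b = c \<odot>\<^bsub>V\<^esub> (a \<otimes>\<^bsub>V\<^esub> b)"
    and "\<And>c a b. c \<in> carrier K \<Longrightarrow> a \<in> carrier V \<Longrightarrow> b \<in> carrier V \<Longrightarrow>
      a \<otimes>\<^bsub>V\<^esub> (c \<odot>\<^bsub>V\<^esub> b) = c \<odot>\<^bsub>V\<^esub> (a \<otimes>\<^bsub>V\<^esub> b)"
  shows "assoc_algebra K V"
proof -
  interpret V: module K V by fact
  have "ring V"
    by (rule ringI) (use assms V.M.abelian_group_axioms in auto)
  then interpret V': ring V .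
  show ?thesis
    by unfold_locales (use assms in auto)
qed

lemma assoc_algebra_image:
  assumes "assoc_algebra K V" "q \<in> carrier V \<rightarrow> carrier W" "carrier W \<subseteq> q ` carrier V"
    and add: "\<And>a b. a \<in> carrier V \<Longrightarrow> b \<in> carrier V \<Longrightarrow> q (a \<oplus>\<^bsub>V\<^esub> b) = q a \<oplus>\<^bsub>W\<^esub> q b"
    and smult: "\<And>c a. c \<in> carrier K \<Longrightarrow> a \<in> carrier V \<Longrightarrow> q (c \<odot>\<^bsub>V\<^esub> a) = c \<odot>\<^bsub>W\<^esub> q a"
    and zero: "q \<zero>\<^bsub>V\<^esub> = \<zero>\<^bsub>W\<^esub>"
    and mult: "\<And>a b. a \<in> carrier V \<Longrightarrow> b \<in> carrier V \<Longrightarrow> q (a \<otimes>\<^bsub>V\<^esub> b) = q a \<otimes>\<^bsub>W\<^esub> q b"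
    and one: "q \<one>\<^bsub>V\<^esub> = \<one>\<^bsub>W\<^esub>"
  shows "assoc_algebra K W"
proof -
  interpret V: assoc_algebra K V by fact
  have im: "\<exists>a\<in>carrier V. w = q a" if "w \<in> carrier W" for w
    using that assms(3) by auto
  have cl: "q a \<in> carrier W" if "a \<in> carrier V" for a
    using that assms(2) by auto
  note s = add[symmetric] smult[symmetric] zero[symmetric] mult[symmetric] one[symmetric] cl
  show ?thesis
  proof (rule assoc_algebraI)
    show "module K W"
      by (rule module_image[of K V q W]) (use assms V.module_axioms in auto)
    show "monoid W"
    proof (rule monoidI)
      fix x y z assume "x \<in> carrier W" "y \<in> carrier W" "z \<in> carrier W"
      then obtain a b c where "a \<in> carrier V" "x = q a" "b \<in> carrier V" "y = q b"
        "c \<in> carrier V" "z = q c" using im by meson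
      then show "x \<otimes>\<^bsub>W\<^esub> y \<in> carrier W"
        "(x \<otimes>\<^bsub>W\<^esub> y) \<otimes>\<^bsub>W\<^esub> z = x \<otimes>\<^bsub>W\<^esub> (y \<otimes>\<^bsub>W\<^esub> z)" "\<one>\<^bsub>W\<^esub> \<otimes>\<^bsub>W\<^esub> x = x" "x \<otimes>\<^bsub>W\<^esub> \<one>\<^bsub>W\<^esub> = x"
        by (simp_all add: s V.V.m_assoc)
    qed (simp add: s)
  next
    fix x y z assume "x \<in> carrier W" "y \<in> carrier W" "z \<in> carrier W"
    then show "(x \<oplus>\<^bsub>W\<^esub> y) \<otimes>\<^bsub>W\<^esub> z = x \<otimes>\<^bsub>W\<^esub> z \<oplus>\<^bsub>W\<^esub> y \<otimes>\<^bsub>W\<^esub> z"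
      and "z \<otimes>\<^bsub>W\<^esub> (x \<oplus>\<^bsub>W\<^esub> y) = z \<otimes>\<^bsub>W\<^esub> x \<oplus>\<^bsub>W\<^esub> z \<otimes>\<^bsub>W\<^esub> y"
      using im[of x] im[of y] im[of z] by (auto simp: s V.V.l_distr V.V.r_distr)
  next
    fix c x y assume "c \<in> carrier K" "x \<in> carrier W" "y \<in> carrier W"
    then show "(c \<odot>\<^bsub>W\<^esub> x) \<otimes>\<^bsub>W\<^esub> y = c \<odot>\<^bsub>W\<^esub> (x \<otimes>\<^bsub>W\<^esub> y)"
      and "x \<otimes>\<^bsub>W\<^esub> (c \<odot>\<^bsub>W\<^esub> y) = c \<odot>\<^bsub>W\<^esub> (x \<otimes>\<^bsub>W\<^esub> y)"
      using im[of x] im[of y] by (auto simp: s V.smult_mult_left V.smult_mult_right)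
  qed
qed

lemma quotient_algebra_sel [simp]:
  "carrier (quotient_algebra V N) = a_rcosets\<^bsub>V\<^esub> N"
  "ring.zero (quotient_algebra V N) = N"
  "add (quotient_algebra V N) = set_add V"
  "monoid.mult (quotient_algebra V N) = rcoset_mult V N"
  "one (quotient_algebra V N) = N +>\<^bsub>V\<^esub> \<one>\<^bsub>V\<^esub>"
  "smult (quotient_algebra V N) = (\<lambda>c C. \<Union>a\<in>C. N +>\<^bsub>V\<^esub> (c \<odot>\<^bsub>V\<^esub> a))"
  by (simp_all add: quotient_algebra_def FactRing_def ring.defs module.defs)

lemma submodule_abelian_subgroup:
  assumes "module K V" "submodule N K V"
  shows "abelian_subgroup N V"
proof -
  interpret V: module K V by fact
  show ?thesis
    using assms(2) submodule.axioms(1) V.M.abelian_group_axioms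
    by (intro abelian_subgroupI3 additive_subgroup.intro) auto
qed

text \<open>All that is ever used about a quotient: the class map is a surjection that respects every
  operation, and it identifies elements whose difference lies in the submodule.\<close>

lemma
  assumes V: "module K V" and N: "submodule N K V"
  shows quotient_carrier: "carrier (quotient_algebra V N) = (\<lambda>a. N +>\<^bsub>V\<^esub> a) ` carrier V"
    and quotient_zero: "N +>\<^bsub>V\<^esub> \<zero>\<^bsub>V\<^esub> = \<zero>\<^bsub>quotient_algebra V N\<^esub>"
    and quotient_add: "\<And>a b. a \<in> carrier V \<Longrightarrow> b \<in> carrier V \<Longrightarrow>
      N +>\<^bsub>V\<^esub> (a \<oplus>\<^bsub>V\<^esub> b) = (N +>\<^bsub>V\<^esub> a) \<oplus>\<^bsub>quotient_algebra V N\<^esub> (N +>\<^bsub>V\<^esub> b)"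
    and quotient_smult: "\<And>c a. c \<in> carrier K \<Longrightarrow> a \<in> carrier V \<Longrightarrow>
      N +>\<^bsub>V\<^esub> (c \<odot>\<^bsub>V\<^esub> a) = c \<odot>\<^bsub>quotient_algebra V N\<^esub> (N +>\<^bsub>V\<^esub> a)"
    and quotient_module: "module K (quotient_algebra V N)"
    and quotient_eqI: "\<And>a b. a \<in> carrier V \<Longrightarrow> b \<in> carrier V \<Longrightarrow> a \<ominus>\<^bsub>V\<^esub> b \<in> N \<Longrightarrow>
      N +>\<^bsub>V\<^esub> a = N +>\<^bsub>V\<^esub> b"
    and quotient_rep: "\<And>a. a \<in> carrier V \<Longrightarrow> a \<in> N +>\<^bsub>V\<^esub> a"
proof -
  interpret V: module K V by fact
  interpret N: abelian_subgroup N V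
    by (rule submodule_abelian_subgroup[OF V N])
  have NV: "N \<subseteq> carrier V" by (rule N.a_subset)
  show carr: "carrier (quotient_algebra V N) = (\<lambda>a. N +>\<^bsub>V\<^esub> a) ` carrier V"
    by (auto simp: A_RCOSETS_def')
  show zero: "N +>\<^bsub>V\<^esub> \<zero>\<^bsub>V\<^esub> = \<zero>\<^bsub>quotient_algebra V N\<^esub>"
    using NV by (simp add: V.M.a_coset_add_zero)
  show add: "N +>\<^bsub>V\<^esub> (a \<oplus>\<^bsub>V\<^esub> b) = (N +>\<^bsub>V\<^esub> a) \<oplus>\<^bsub>quotient_algebra V N\<^esub> (N +>\<^bsub>V\<^esub> b)"
    if "a \<in> carrier V" "b \<in> carrier V" for a b
    using that N.a_rcos_sum by simp
  show eqI: "N +>\<^bsub>V\<^esub> a = N +>\<^bsub>V\<^esub> b" if "a \<in> carrier V" "b \<in> carrier V" "a \<ominus>\<^bsub>V\<^esub> b \<in> N" for a b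
  proof -
    have "a = (a \<ominus>\<^bsub>V\<^esub> b) \<oplus>\<^bsub>V\<^esub> b"
      using that by (simp add: a_minus_def V.M.a_assoc V.M.l_neg)
    then have "a \<in> N +>\<^bsub>V\<^esub> b"
      using that(3) unfolding a_r_coset_def' by blast
    then show ?thesis
      using V.M.a_repr_independence[OF _ that(2) N.a_subgroup] by blast
  qed
  show rep: "a \<in> N +>\<^bsub>V\<^esub> a" if "a \<in> carrier V" for a
    using that by (rule N.a_rcos_self)
  show smult: "N +>\<^bsub>V\<^esub> (c \<odot>\<^bsub>V\<^esub> a) = c \<odot>\<^bsub>quotient_algebra V N\<^esub> (N +>\<^bsub>V\<^esub> a)"
    if c: "c \<in> carrier K" and a: "a \<in> carrier V" for c a
  proof -
    have "N +>\<^bsub>V\<^esub> (c \<odot>\<^bsub>V\<^esub> b) = N +>\<^bsub>V\<^esub> (c \<odot>\<^bsub>V\<^esub> a)" if b: "b \<in> N +>\<^bsub>V\<^esub> a" for b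
    proof -
      from b obtain n where n: "n \<in> N" "b = n \<oplus>\<^bsub>V\<^esub> a"
        unfolding a_r_coset_def' by blast
      have nV: "n \<in> carrier V" using n NV by blast
      have "c \<odot>\<^bsub>V\<^esub> b \<ominus>\<^bsub>V\<^esub> c \<odot>\<^bsub>V\<^esub> a = c \<odot>\<^bsub>V\<^esub> n"
        using n nV c a by (simp add: V.smult_r_distr a_minus_def V.M.a_assoc V.M.r_neg)
      also have "\<dots> \<in> N"
        using submodule.smult_closed[OF N c n(1)] .
      finally show ?thesis
        using c a nV n(2) by (intro eqI) auto
    qed
    then have "(\<Union>b\<in>N +>\<^bsub>V\<^esub> a. N +>\<^bsub>V\<^esub> (c \<odot>\<^bsub>V\<^esub> b)) = (\<Union>b\<in>N +>\<^bsub>V\<^esub> a. N +>\<^bsub>V\<^esub> (c \<odot>\<^bsub>V\<^esub> a))"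
      by (intro SUP_cong refl)
    also have "\<dots> = N +>\<^bsub>V\<^esub> (c \<odot>\<^bsub>V\<^esub> a)"
      using rep[OF a] by blast
    finally show ?thesis by simp
  qed
  show "module K (quotient_algebra V N)"
    by (rule module_image[OF V, of "\<lambda>a. N +>\<^bsub>V\<^esub> a"])
      (use carr add smult zero in auto)
qed

lemma submodule_kernel:
  assumes "module K V" "module K W" "\<phi> \<in> linear_maps K V W"
  shows "submodule {a \<in> carrier V. \<phi> a = \<zero>\<^bsub>W\<^esub>} K V"
proof -
  interpret V: module K V by fact
  interpret W: module K W by fact
  show ?thesis
    using linear_closed[OF assms(3)] linear_zero[OF assms] linear_neg[OF assms]
    by (intro V.submoduleI) (auto simp: linear_add[OF assms(3)] linear_smult[OF assms(3)])
qed

text \<open>A linear map that vanishes on the submodule takes a single value on each class; this is what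
  makes \<^const>\<open>the_elem\<close> in the two lifting operations harmless.\<close>

lemma the_elem_coset:
  assumes V: "module K V" and W: "module K W" and N: "submodule N K V"
    and \<phi>: "\<phi> \<in> linear_maps K V W" and vanish: "\<And>n. n \<in> N \<Longrightarrow> \<phi> n = \<zero>\<^bsub>W\<^esub>"
    and a: "a \<in> carrier V"
  shows "the_elem (\<phi> ` (N +>\<^bsub>V\<^esub> a)) = \<phi> a"
proof -
  interpret V: module K V by fact
  interpret W: module K W by fact
  have NV: "N \<subseteq> carrier V" using V.submoduleE(1)[OF N] .
  have "\<phi> b = \<phi> a" if "b \<in> N +>\<^bsub>V\<^esub> a" for b
  proof -
    from that obtain n where n: "n \<in> N" "b = n \<oplus>\<^bsub>V\<^esub> a"
      unfolding a_r_coset_def' by blast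
    then show ?thesis
      using NV a vanish linear_closed[OF \<phi> a] by (auto simp: linear_add[OF \<phi>])
  qed
  moreover have "a \<in> N +>\<^bsub>V\<^esub> a" by (rule quotient_rep[OF V N a])
  ultimately have "\<phi> ` (N +>\<^bsub>V\<^esub> a) = {\<phi> a}" by blast
  then show ?thesis by simp
qed


section \<open>Free modules\<close>

lemma free_module_sel [simp]:
  "ring.zero (free_module K S) = (\<lambda>i. \<zero>\<^bsub>K\<^esub>)"
  "add (free_module K S) = (\<lambda>a b i. a i \<oplus>\<^bsub>K\<^esub> b i)"
  "smult (free_module K S) = (\<lambda>c a i. c \<otimes>\<^bsub>K\<^esub> a i)"
  by (simp_all add: free_module_def)

lemma free_module_carrier:
  "a \<in> carrier (free_module K S) \<longleftrightarrow> (\<forall>i. a i \<in> carrier K) \<and> supp K a \<subseteq> S \<and> finite (supp K a)"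
  by (auto simp: free_module_def)

context cring
begin

lemma free_module_module: "module R (free_module R S)"
proof -
  have sub: "supp R (\<lambda>i. a i \<oplus> b i) \<subseteq> supp R a \<union> supp R b" for a b
    by (auto simp: supp_def)
  have subm: "c \<in> carrier R \<Longrightarrow> supp R (\<lambda>i. c \<otimes> a i) \<subseteq> supp R a" for a c
    by (auto simp: supp_def)
  show ?thesis
  proof (rule moduleI)
    show "abelian_group (free_module R S)"
    proof (rule abelian_groupI)
      fix a b assume "a \<in> carrier (free_module R S)" "b \<in> carrier (free_module R S)"
      then show "a \<oplus>\<^bsub>free_module R S\<^esub> b \<in> carrier (free_module R S)"
        using sub[of a b] by (auto simp: free_module_carrier intro: finite_subset[OF sub])
    next
      fix a assume a: "a \<in> carrier (free_module R S)"
      have "supp R (\<lambda>i. \<ominus> a i) \<subseteq> supp R a"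
        by (auto simp: supp_def)
      with a have "(\<lambda>i. \<ominus> a i) \<in> carrier (free_module R S)"
        by (auto simp: free_module_carrier intro: finite_subset)
      then show "\<exists>b\<in>carrier (free_module R S). b \<oplus>\<^bsub>free_module R S\<^esub> a = \<zero>\<^bsub>free_module R S\<^esub>"
        using a by (intro bexI[of _ "\<lambda>i. \<ominus> a i"]) (auto simp: free_module_carrier l_neg)
    qed (auto simp: free_module_carrier a_ac supp_def)
    fix c a assume "c \<in> carrier R" "a \<in> carrier (free_module R S)"
    then show "c \<odot>\<^bsub>free_module R S\<^esub> a \<in> carrier (free_module R S)"
      using subm[of c a] by (auto simp: free_module_carrier intro: finite_subset[OF subm])
  qed (auto simp: free_module_carrier l_distr r_distr m_assoc is_cring)
qed

lemma single_in [simp]: "i \<in> S \<Longrightarrow> single R i \<in> carrier (free_module R S)"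
  by (auto simp: free_module_carrier single_def supp_def)

lemma free_module_induct [consumes 1, case_names zero single add]:
  assumes "a \<in> carrier (free_module R S)"
    and "P \<zero>\<^bsub>free_module R S\<^esub>"
    and "\<And>c i. c \<in> carrier R \<Longrightarrow> i \<in> S \<Longrightarrow> P (c \<odot>\<^bsub>free_module R S\<^esub> single R i)"
    and "\<And>a b. a \<in> carrier (free_module R S) \<Longrightarrow> b \<in> carrier (free_module R S) \<Longrightarrow>
      P a \<Longrightarrow> P b \<Longrightarrow> P (a \<oplus>\<^bsub>free_module R S\<^esub> b)"
  shows "P a"
proof -
  interpret F: module R "free_module R S" by (rule free_module_module)
  have "finite T \<Longrightarrow> a \<in> carrier (free_module R S) \<Longrightarrow> supp R a = T \<Longrightarrow> P a" for T a
  proof (induction T arbitrary: a rule: finite_induct)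
    case empty
    then have "a = \<zero>\<^bsub>free_module R S\<^esub>" by (auto simp: supp_def)
    then show ?case using assms(2) by simp
  next
    case (insert j T)
    have jS: "j \<in> S" and aj: "a i \<in> carrier R" for i
      using insert.prems by (auto simp: free_module_carrier)
    define b where "b = (\<lambda>i. if i = j then \<zero> else a i)"
    have sb: "supp R b = T"
      using insert.prems insert.hyps by (auto simp: supp_def b_def)
    have b: "b \<in> carrier (free_module R S)"
      using insert.prems sb insert.hyps by (auto simp: free_module_carrier b_def)
    have "a = (a j \<odot>\<^bsub>free_module R S\<^esub> single R j) \<oplus>\<^bsub>free_module R S\<^esub> b"
      by (rule ext) (simp add: b_def single_def aj)
    moreover have "a j \<odot>\<^bsub>free_module R S\<^esub> single R j \<in> carrier (free_module R S)"
      by (rule F.smult_closed[OF aj single_in[OF jS]])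
    ultimately show ?case
      using assms(4)[OF _ b assms(3)[OF aj jS] insert.IH[OF b sb]] by metis
  qed
  then show ?thesis using assms(1) by (auto simp: free_module_carrier)
qed

lemma lin_ext_superset:
  assumes Z: "module R Z" and \<phi>: "\<And>i. i \<in> S \<Longrightarrow> \<phi> i \<in> carrier Z"
    and T: "finite T" "supp R a \<subseteq> T" "T \<subseteq> S" and a: "\<And>i. a i \<in> carrier R"
  shows "lin_ext R Z \<phi> a = (\<Oplus>\<^bsub>Z\<^esub>i\<in>T. a i \<odot>\<^bsub>Z\<^esub> \<phi> i)"
proof -
  interpret Z: module R Z by fact
  show ?thesis unfolding lin_ext_def
    by (rule Z.M.add.finprod_mono_neutral_cong_left) (use T a \<phi> in \<open>auto simp: supp_def\<close>)
qed

lemma lin_ext_linear: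
  assumes Z: "module R Z" and \<phi>: "\<And>i. i \<in> S \<Longrightarrow> \<phi> i \<in> carrier Z"
  shows "lin_ext R Z \<phi> \<in> linear_maps R (free_module R S) Z"
proof -
  interpret Z: module R Z by fact
  interpret F: module R "free_module R S" by (rule free_module_module)
  have le: "lin_ext R Z \<phi> a = (\<Oplus>\<^bsub>Z\<^esub>i\<in>T. a i \<odot>\<^bsub>Z\<^esub> \<phi> i)"
    if "finite T" "supp R a \<subseteq> T" "T \<subseteq> S" "\<And>i. a i \<in> carrier R" for T a
    using \<phi> that by (rule lin_ext_superset[OF Z])
  show ?thesis
  proof (rule linear_mapsI)
    fix a assume a: "a \<in> carrier (free_module R S)"
    then show "lin_ext R Z \<phi> a \<in> carrier Z"
      using \<phi> unfolding lin_ext_def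
      by (intro Z.M.finsum_closed) (auto simp: free_module_carrier)
  next
    fix a b assume a: "a \<in> carrier (free_module R S)" and b: "b \<in> carrier (free_module R S)"
    let ?T = "supp R a \<union> supp R b"
    have T: "finite ?T" "?T \<subseteq> S" using a b by (auto simp: free_module_carrier)
    have ab: "a i \<in> carrier R" "b i \<in> carrier R" for i
      using a b by (auto simp: free_module_carrier)
    have sub: "supp R (\<lambda>i. a i \<oplus> b i) \<subseteq> ?T"
      by (auto simp: supp_def)
    have "lin_ext R Z \<phi> (a \<oplus>\<^bsub>free_module R S\<^esub> b) = (\<Oplus>\<^bsub>Z\<^esub>i\<in>?T. (a i \<oplus> b i) \<odot>\<^bsub>Z\<^esub> \<phi> i)"
      using le[OF T(1) sub T(2)] ab by simp
    also have "\<dots> = (\<Oplus>\<^bsub>Z\<^esub>i\<in>?T. a i \<odot>\<^bsub>Z\<^esub> \<phi> i \<oplus>\<^bsub>Z\<^esub> b i \<odot>\<^bsub>Z\<^esub> \<phi> i)"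
      by (rule Z.M.finsum_cong') (use T ab \<phi> in \<open>auto simp: Z.smult_l_distr\<close>)
    also have "\<dots> = lin_ext R Z \<phi> a \<oplus>\<^bsub>Z\<^esub> lin_ext R Z \<phi> b"
      unfolding le[OF T(1) Un_upper1 T(2) ab(1)] le[OF T(1) Un_upper2 T(2) ab(2)]
      by (rule Z.M.finsum_addf) (use T ab \<phi> in auto)
    finally show "lin_ext R Z \<phi> (a \<oplus>\<^bsub>free_module R S\<^esub> b) = lin_ext R Z \<phi> a \<oplus>\<^bsub>Z\<^esub> lin_ext R Z \<phi> b" .
  next
    fix c a assume c: "c \<in> carrier R" and a: "a \<in> carrier (free_module R S)"
    let ?T = "supp R a"
    have T: "finite ?T" "?T \<subseteq> S" using a by (auto simp: free_module_carrier)
    have ab: "a i \<in> carrier R" for i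
      using a by (auto simp: free_module_carrier)
    have sub: "supp R (\<lambda>i. c \<otimes> a i) \<subseteq> ?T"
      using c by (auto simp: supp_def)
    have "lin_ext R Z \<phi> (c \<odot>\<^bsub>free_module R S\<^esub> a) = (\<Oplus>\<^bsub>Z\<^esub>i\<in>?T. (c \<otimes> a i) \<odot>\<^bsub>Z\<^esub> \<phi> i)"
      using le[OF T(1) sub T(2)] ab c by simp
    also have "\<dots> = (\<Oplus>\<^bsub>Z\<^esub>i\<in>?T. c \<odot>\<^bsub>Z\<^esub> (a i \<odot>\<^bsub>Z\<^esub> \<phi> i))"
      by (rule Z.M.finsum_cong') (use T ab c \<phi> in \<open>auto simp: Z.smult_assoc1\<close>)
    also have "\<dots> = c \<odot>\<^bsub>Z\<^esub> lin_ext R Z \<phi> a"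
      unfolding lin_ext_def
      by (rule Z.finsum_smult_ldistr[symmetric]) (use T ab c \<phi> in auto)
    finally show "lin_ext R Z \<phi> (c \<odot>\<^bsub>free_module R S\<^esub> a) = c \<odot>\<^bsub>Z\<^esub> lin_ext R Z \<phi> a" .
  qed
qed

lemma lin_ext_single:
  assumes Z: "module R Z" and "\<phi> i \<in> carrier Z"
  shows "lin_ext R Z \<phi> (single R i) = \<phi> i"
proof -
  interpret Z: module R Z by fact
  have "lin_ext R Z \<phi> (single R i) = (\<Oplus>\<^bsub>Z\<^esub>j\<in>{i}. single R i j \<odot>\<^bsub>Z\<^esub> \<phi> j)"
    by (rule lin_ext_superset[OF Z, where S = "{i}"]) (use assms in \<open>auto simp: single_def supp_def\<close>)
  also have "\<dots> = \<phi> i" using assms by (simp add: single_def)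
  finally show ?thesis .
qed

lemma linear_free_eqI:
  assumes Z: "module R Z" and "\<phi> \<in> linear_maps R (free_module R S) Z"
    "\<psi> \<in> linear_maps R (free_module R S) Z"
    and "\<And>i. i \<in> S \<Longrightarrow> \<phi> (single R i) = \<psi> (single R i)" and a: "a \<in> carrier (free_module R S)"
  shows "\<phi> a = \<psi> a"
  using a
proof (induction a rule: free_module_induct)
  case zero
  then show ?case using linear_zero[OF free_module_module Z] assms(2,3) by metis
next
  case (single c i)
  then show ?case using linear_smult[OF assms(2)] linear_smult[OF assms(3)] assms(4) by simp
next
  case (add a b)
  then show ?case using linear_add[OF assms(2)] linear_add[OF assms(3)] by simp
qed

end


declare free_module_sel [simp del]

section \<open>Tensor products\<close>

lemma linear_sum:
  assumes "module K W" "\<phi> \<in> linear_maps K V W" "\<psi> \<in> linear_maps K V W"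
  shows "(\<lambda>a. \<phi> a \<oplus>\<^bsub>W\<^esub> \<psi> a) \<in> linear_maps K V W"
proof -
  interpret W: module K W by fact
  note s = linear_closed[OF assms(2)] linear_closed[OF assms(3)]
  show ?thesis
    by (rule linear_mapsI)
      (simp_all add: linear_add[OF assms(2)] linear_add[OF assms(3)] linear_smult[OF assms(2)]
        linear_smult[OF assms(3)] s W.M.a_ac W.smult_r_distr)
qed

context cring
begin

context
  fixes V :: "('a, 'v, 'x) module_scheme" and W :: "('a, 'w, 'y) module_scheme"
  assumes V: "module R V" and W: "module R W"
begin

interpretation V: module R V by (rule V)
interpretation W: module R W by (rule W)
interpretation P: module R "free_module R (carrier V \<times> carrier W)"
  by (rule free_module_module)

lemma tensor_relations_closed:
  "tensor_relations R V W \<subseteq> carrier (free_module R (carrier V \<times> carrier W))"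
  unfolding tensor_relations_def Let_def
  by (intro Un_least subsetI; clarify; intro P.M.minus_closed P.M.a_closed P.smult_closed single_in)
    auto

lemma tensor_kernel_submodule:
  "submodule (tensor_kernel R V W) R (free_module R (carrier V \<times> carrier W))"
proof (rule P.submoduleI)
  have "submodule (carrier (free_module R (carrier V \<times> carrier W))) R
    (free_module R (carrier V \<times> carrier W))"
    by (rule P.submoduleI) (auto intro: P.M.a_closed P.smult_closed P.M.a_inv_closed P.M.zero_closed)
  then show "tensor_kernel R V W \<subseteq> carrier (free_module R (carrier V \<times> carrier W))"
    using tensor_relations_closed unfolding tensor_kernel_def by blast
  show "\<zero>\<^bsub>free_module R (carrier V \<times> carrier W)\<^esub> \<in> tensor_kernel R V W"
    unfolding tensor_kernel_def using submodule.axioms(1) subgroup.one_closed by fastforce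
next
  fix a assume "a \<in> tensor_kernel R V W"
  then show "\<ominus>\<^bsub>free_module R (carrier V \<times> carrier W)\<^esub> a \<in> tensor_kernel R V W"
    unfolding tensor_kernel_def using P.submoduleE(3) by blast
next
  fix a b assume "a \<in> tensor_kernel R V W" "b \<in> tensor_kernel R V W"
  then show "a \<oplus>\<^bsub>free_module R (carrier V \<times> carrier W)\<^esub> b \<in> tensor_kernel R V W"
    unfolding tensor_kernel_def using P.submoduleE(5) by blast
next
  fix c a assume "c \<in> carrier R" "a \<in> tensor_kernel R V W"
  then show "c \<odot>\<^bsub>free_module R (carrier V \<times> carrier W)\<^esub> a \<in> tensor_kernel R V W"
    unfolding tensor_kernel_def using P.submoduleE(4) by blast
qed

lemma tensor_relations_kernel: "tensor_relations R V W \<subseteq> tensor_kernel R V W"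
  unfolding tensor_kernel_def by blast

lemma tensor_module_module: "module R (tensor_module R V W)"
  unfolding tensor_module_def
  by (rule quotient_module[OF free_module_module tensor_kernel_submodule])

interpretation T: module R "tensor_module R V W"
  by (rule tensor_module_module)

lemmas tensor_quotient_add = quotient_add[OF free_module_module tensor_kernel_submodule, folded tensor_module_def]
lemmas tensor_quotient_smult = quotient_smult[OF free_module_module tensor_kernel_submodule, folded tensor_module_def]
lemmas tensor_quotient_eqI = quotient_eqI[OF free_module_module tensor_kernel_submodule]

lemma pure_bilinear: "pure_tensor R V W \<in> bilinear_maps R V W (tensor_module R V W)"
proof -
  let ?F = "free_module R (carrier V \<times> carrier W)"
  have rel: "x \<in> tensor_relations R V W \<Longrightarrow> x \<in> tensor_kernel R V W" for x
    using tensor_relations_kernel by blast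
  show ?thesis
  proof (rule bilinear_mapsI)
    fix a b assume "a \<in> carrier V" "b \<in> carrier W"
    then show "pure_tensor R V W a b \<in> carrier (tensor_module R V W)"
      unfolding pure_tensor_def tensor_module_def
        quotient_carrier[OF free_module_module tensor_kernel_submodule]
      by (intro imageI single_in) auto
  next
    fix a a' b assume *: "a \<in> carrier V" "a' \<in> carrier V" "b \<in> carrier W"
    then have "single R (a \<oplus>\<^bsub>V\<^esub> a', b) \<ominus>\<^bsub>?F\<^esub> (single R (a, b) \<oplus>\<^bsub>?F\<^esub> single R (a', b)) \<in> tensor_kernel R V W"
      by (intro rel) (unfold tensor_relations_def Let_def, blast)
    with * show "pure_tensor R V W (a \<oplus>\<^bsub>V\<^esub> a') b
      = pure_tensor R V W a b \<oplus>\<^bsub>tensor_module R V W\<^esub> pure_tensor R V W a' b"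
      unfolding pure_tensor_def
      by (subst tensor_quotient_add[symmetric]; (intro tensor_quotient_eqI P.M.a_closed single_in)?)
        simp_all
  next
    fix a b b' assume *: "a \<in> carrier V" "b \<in> carrier W" "b' \<in> carrier W"
    then have "single R (a, b \<oplus>\<^bsub>W\<^esub> b') \<ominus>\<^bsub>?F\<^esub> (single R (a, b) \<oplus>\<^bsub>?F\<^esub> single R (a, b')) \<in> tensor_kernel R V W"
      by (intro rel) (unfold tensor_relations_def Let_def, blast)
    with * show "pure_tensor R V W a (b \<oplus>\<^bsub>W\<^esub> b')
      = pure_tensor R V W a b \<oplus>\<^bsub>tensor_module R V W\<^esub> pure_tensor R V W a b'"
      unfolding pure_tensor_def
      by (subst tensor_quotient_add[symmetric]; (intro tensor_quotient_eqI P.M.a_closed single_in)?)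
        simp_all
  next
    fix c a b assume *: "c \<in> carrier R" "a \<in> carrier V" "b \<in> carrier W"
    then have "single R (c \<odot>\<^bsub>V\<^esub> a, b) \<ominus>\<^bsub>?F\<^esub> (c \<odot>\<^bsub>?F\<^esub> single R (a, b)) \<in> tensor_kernel R V W"
      by (intro rel) (unfold tensor_relations_def Let_def, blast)
    with * show "pure_tensor R V W (c \<odot>\<^bsub>V\<^esub> a) b = c \<odot>\<^bsub>tensor_module R V W\<^esub> pure_tensor R V W a b"
      unfolding pure_tensor_def
      by (subst tensor_quotient_smult[symmetric]; (intro tensor_quotient_eqI P.smult_closed single_in)?)
        simp_all
    from * have "single R (a, c \<odot>\<^bsub>W\<^esub> b) \<ominus>\<^bsub>?F\<^esub> (c \<odot>\<^bsub>?F\<^esub> single R (a, b)) \<in> tensor_kernel R V W"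
      by (intro rel) (unfold tensor_relations_def Let_def, blast)
    with * show "pure_tensor R V W a (c \<odot>\<^bsub>W\<^esub> b) = c \<odot>\<^bsub>tensor_module R V W\<^esub> pure_tensor R V W a b"
      unfolding pure_tensor_def
      by (subst tensor_quotient_smult[symmetric]; (intro tensor_quotient_eqI P.smult_closed single_in)?)
        simp_all
  qed
qed

lemmas pure_closed = bilinear_closed[OF pure_bilinear]
lemmas pure_add_left = bilinear_add_left[OF pure_bilinear]
lemmas pure_add_right = bilinear_add_right[OF pure_bilinear]
lemmas pure_smult_left = bilinear_smult_left[OF pure_bilinear]
lemmas pure_smult_right = bilinear_smult_right[OF pure_bilinear]

lemma pure_zero_left: "b \<in> carrier W \<Longrightarrow> pure_tensor R V W \<zero>\<^bsub>V\<^esub> b = \<zero>\<^bsub>tensor_module R V W\<^esub>"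
  using linear_zero[OF V tensor_module_module bilinear_left[OF pure_bilinear]] .

lemma pure_zero_right: "a \<in> carrier V \<Longrightarrow> pure_tensor R V W a \<zero>\<^bsub>W\<^esub> = \<zero>\<^bsub>tensor_module R V W\<^esub>"
  using linear_zero[OF W tensor_module_module bilinear_right[OF pure_bilinear]] .

text \<open>Zero and scalar multiples of pure tensors are themselves pure, so an induction over a tensor
  product has only two cases.\<close>

lemma tensor_induct [consumes 1, case_names pure add]:
  assumes "C \<in> carrier (tensor_module R V W)"
    and pure: "\<And>a b. a \<in> carrier V \<Longrightarrow> b \<in> carrier W \<Longrightarrow> P (pure_tensor R V W a b)"
    and add: "\<And>C D. C \<in> carrier (tensor_module R V W) \<Longrightarrow> D \<in> carrier (tensor_module R V W) \<Longrightarrow>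
      P C \<Longrightarrow> P D \<Longrightarrow> P (C \<oplus>\<^bsub>tensor_module R V W\<^esub> D)"
  shows "P C"
proof -
  let ?F = "free_module R (carrier V \<times> carrier W)" and ?N = "tensor_kernel R V W"
  have "P (?N +>\<^bsub>?F\<^esub> x)" if "x \<in> carrier ?F" for x
    using that
  proof (induction x rule: free_module_induct)
    case zero
    have "?N +>\<^bsub>?F\<^esub> \<zero>\<^bsub>?F\<^esub> = pure_tensor R V W \<zero>\<^bsub>V\<^esub> \<zero>\<^bsub>W\<^esub>"
      using pure_zero_left quotient_zero[OF free_module_module tensor_kernel_submodule]
      by (simp add: tensor_module_def)
    then show ?case using pure[of "\<zero>\<^bsub>V\<^esub>" "\<zero>\<^bsub>W\<^esub>"] by simp
  next
    case (single c i)
    obtain a b where i: "i = (a, b)" "a \<in> carrier V" "b \<in> carrier W" using single by auto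
    have "?N +>\<^bsub>?F\<^esub> (c \<odot>\<^bsub>?F\<^esub> single R i) = pure_tensor R V W (c \<odot>\<^bsub>V\<^esub> a) b"
      using single i tensor_quotient_smult[OF single(1) single_in[OF single(2)]]
        pure_smult_left by (simp add: pure_tensor_def)
    then show ?case using pure[of "c \<odot>\<^bsub>V\<^esub> a" b] i single by simp
  next
    case (add x y)
    then show ?case
      using assms(3)[of "?N +>\<^bsub>?F\<^esub> x" "?N +>\<^bsub>?F\<^esub> y"] tensor_quotient_add[of x y]
        quotient_carrier[OF free_module_module tensor_kernel_submodule]
      by (simp add: tensor_module_def)
  qed
  then show ?thesis
    using assms(1) quotient_carrier[OF free_module_module tensor_kernel_submodule]
    by (auto simp: tensor_module_def)
qed

lemma
  assumes Z: "module R Z" and \<phi>: "\<phi> \<in> bilinear_maps R V W Z"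
  shows tensor_lift_linear: "tensor_lift R Z \<phi> \<in> linear_maps R (tensor_module R V W) Z"
    and tensor_lift_pure: "\<And>a b. a \<in> carrier V \<Longrightarrow> b \<in> carrier W \<Longrightarrow>
      tensor_lift R Z \<phi> (pure_tensor R V W a b) = \<phi> a b"
proof -
  interpret Z: module R Z by fact
  let ?F = "free_module R (carrier V \<times> carrier W)" and ?N = "tensor_kernel R V W"
  let ?l = "lin_ext R Z (\<lambda>(a, b). \<phi> a b)"
  have l: "?l \<in> linear_maps R ?F Z"
    by (rule lin_ext_linear[OF Z]) (auto intro: bilinear_closed[OF \<phi>])
  have single: "?l (single R (a, b)) = \<phi> a b" if "a \<in> carrier V" "b \<in> carrier W" for a b
    using lin_ext_single[OF Z, of "\<lambda>(a, b). \<phi> a b" "(a, b)"] bilinear_closed[OF \<phi>] that by simp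
  have min: "?l (x \<ominus>\<^bsub>?F\<^esub> y) = \<zero>\<^bsub>Z\<^esub>" if "x \<in> carrier ?F" "y \<in> carrier ?F" "?l x = ?l y" for x y
    using linear_minus[OF free_module_module Z l that(1,2)] linear_closed[OF l that(2)] that(3)
    by (simp add: a_minus_def Z.M.r_neg)
  note s = single linear_add[OF l] linear_smult[OF l] bilinear_add_left[OF \<phi>] bilinear_add_right[OF \<phi>]
    bilinear_smult_left[OF \<phi>] bilinear_smult_right[OF \<phi>]
  have "tensor_relations R V W \<subseteq> {x \<in> carrier ?F. ?l x = \<zero>\<^bsub>Z\<^esub>}"
  proof
    fix x assume x: "x \<in> tensor_relations R V W"
    then have "?l x = \<zero>\<^bsub>Z\<^esub>"
      unfolding tensor_relations_def Let_def
      by (elim UnE; clarify; intro min P.M.a_closed P.smult_closed single_in)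
        (auto simp: s)
    then show "x \<in> {x \<in> carrier ?F. ?l x = \<zero>\<^bsub>Z\<^esub>}" using x tensor_relations_closed by blast
  qed
  then have vanish: "?l x = \<zero>\<^bsub>Z\<^esub>" if "x \<in> ?N" for x
    using that submodule_kernel[OF free_module_module Z l] unfolding tensor_kernel_def by blast
  have cos: "tensor_lift R Z \<phi> (?N +>\<^bsub>?F\<^esub> x) = ?l x" if "x \<in> carrier ?F" for x
    unfolding tensor_lift_def
    by (rule the_elem_coset[OF free_module_module Z tensor_kernel_submodule l vanish that])
  show "tensor_lift R Z \<phi> (pure_tensor R V W a b) = \<phi> a b"
    if "a \<in> carrier V" "b \<in> carrier W" for a b
    using that by (simp add: pure_tensor_def cos single)
  note qc = quotient_carrier[OF free_module_module tensor_kernel_submodule]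
  show "tensor_lift R Z \<phi> \<in> linear_maps R (tensor_module R V W) Z"
  proof (rule linear_mapsI)
    fix C assume C: "C \<in> carrier (tensor_module R V W)"
    then obtain x where x: "x \<in> carrier ?F" "C = ?N +>\<^bsub>?F\<^esub> x"
      unfolding tensor_module_def qc by blast
    then show "tensor_lift R Z \<phi> C \<in> carrier Z" by (simp add: cos linear_closed[OF l])
    fix c assume c: "c \<in> carrier R"
    then show "tensor_lift R Z \<phi> (c \<odot>\<^bsub>tensor_module R V W\<^esub> C) = c \<odot>\<^bsub>Z\<^esub> tensor_lift R Z \<phi> C"
      using x linear_smult[OF l c x(1)] P.smult_closed[OF c x(1)]
      by (simp add: cos tensor_quotient_smult[symmetric])
  next
    fix C D assume "C \<in> carrier (tensor_module R V W)" "D \<in> carrier (tensor_module R V W)"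
    then obtain x y where "x \<in> carrier ?F" "C = ?N +>\<^bsub>?F\<^esub> x" "y \<in> carrier ?F" "D = ?N +>\<^bsub>?F\<^esub> y"
      unfolding tensor_module_def qc by blast
    then show "tensor_lift R Z \<phi> (C \<oplus>\<^bsub>tensor_module R V W\<^esub> D)
      = tensor_lift R Z \<phi> C \<oplus>\<^bsub>Z\<^esub> tensor_lift R Z \<phi> D"
      using linear_add[OF l] P.M.a_closed
      by (simp add: cos tensor_quotient_add[symmetric])
  qed
qed

lemma tensor_eqI:
  assumes "\<phi> \<in> linear_maps R (tensor_module R V W) Z" "\<psi> \<in> linear_maps R (tensor_module R V W) Z"
    and "\<And>a b. a \<in> carrier V \<Longrightarrow> b \<in> carrier W \<Longrightarrow>
      \<phi> (pure_tensor R V W a b) = \<psi> (pure_tensor R V W a b)"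
    and "C \<in> carrier (tensor_module R V W)"
  shows "\<phi> C = \<psi> C"
  using assms(4)
  by (induction C rule: tensor_induct)
    (simp_all add: assms(3) linear_add[OF assms(1)] linear_add[OF assms(2)])

lemma tensor_lift_cong:
  assumes "module R Z" and "\<phi> \<in> bilinear_maps R V W Z"
    and eq: "\<And>a b. a \<in> carrier V \<Longrightarrow> b \<in> carrier W \<Longrightarrow> \<phi> a b = \<psi> a b"
    and "C \<in> carrier (tensor_module R V W)"
  shows "tensor_lift R Z \<phi> C = tensor_lift R Z \<psi> C"
proof -
  have \<psi>: "\<psi> \<in> bilinear_maps R V W Z"
    by (rule bilinear_mapsI)
      (simp_all add: eq[symmetric] bilinear_closed[OF assms(2)] bilinear_add_left[OF assms(2)]
        bilinear_add_right[OF assms(2)] bilinear_smult_left[OF assms(2)] bilinear_smult_right[OF assms(2)])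
  show ?thesis
    by (rule tensor_eqI[OF tensor_lift_linear[OF assms(1,2)] tensor_lift_linear[OF assms(1) \<psi>] _ assms(4)])
      (simp add: tensor_lift_pure[OF assms(1,2)] tensor_lift_pure[OF assms(1) \<psi>] eq)
qed

lemma tensor_lift_compose:
  assumes Z: "module R Z" and U: "module R U" and \<phi>: "\<phi> \<in> bilinear_maps R V W Z"
    and L: "L \<in> linear_maps R Z U" and C: "C \<in> carrier (tensor_module R V W)"
  shows "L (tensor_lift R Z \<phi> C) = tensor_lift R U (\<lambda>a b. L (\<phi> a b)) C"
  by (rule tensor_eqI[OF linear_compose[OF tensor_lift_linear[OF Z \<phi>] L]
        tensor_lift_linear[OF U bilinear_compose[OF \<phi> L]] _ C])
    (simp add: tensor_lift_pure[OF Z \<phi>] tensor_lift_pure[OF U bilinear_compose[OF \<phi> L]])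

lemma tensor_lift_sum:
  assumes Z: "module R Z" and \<phi>: "\<phi> \<in> bilinear_maps R V W Z" and \<psi>: "\<psi> \<in> bilinear_maps R V W Z"
    and C: "C \<in> carrier (tensor_module R V W)"
  shows "tensor_lift R Z (\<lambda>a b. \<phi> a b \<oplus>\<^bsub>Z\<^esub> \<psi> a b) C
    = tensor_lift R Z \<phi> C \<oplus>\<^bsub>Z\<^esub> tensor_lift R Z \<psi> C"
proof -
  have sum: "(\<lambda>a b. \<phi> a b \<oplus>\<^bsub>Z\<^esub> \<psi> a b) \<in> bilinear_maps R V W Z"
    using \<phi> \<psi> unfolding bilinear_maps_def by (auto intro!: linear_sum[OF Z])
  show ?thesis
    by (rule tensor_eqI[OF tensor_lift_linear[OF Z sum]
          linear_sum[OF Z tensor_lift_linear[OF Z \<phi>] tensor_lift_linear[OF Z \<psi>]] _ C])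
      (simp add: tensor_lift_pure[OF Z \<phi>] tensor_lift_pure[OF Z \<psi>] tensor_lift_pure[OF Z sum])
qed

lemma tensor_lift_zero:
  assumes Z: "module R Z" and C: "C \<in> carrier (tensor_module R V W)"
  shows "tensor_lift R Z (\<lambda>a b. \<zero>\<^bsub>Z\<^esub>) C = \<zero>\<^bsub>Z\<^esub>"
proof -
  interpret Z: module R Z by fact
  have zero: "(\<lambda>a b. \<zero>\<^bsub>Z\<^esub>) \<in> bilinear_maps R V W Z"
    by (rule bilinear_mapsI) auto
  show ?thesis
    by (rule tensor_eqI[OF tensor_lift_linear[OF Z zero] zero_linear[OF tensor_module_module Z] _ C])
      (simp add: tensor_lift_pure[OF Z zero])
qed

text \<open>Sweedler sums inherit linearity in a parameter of the summand; together with \<open>tensor_lift_linear\<close> this is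
  how nested Sweedler sums are seen to be multilinear.\<close>

lemma tensor_lift_param:
  assumes Z: "module R Z" and U: "module R U"
    and \<phi>: "\<And>x. x \<in> carrier U \<Longrightarrow> \<phi> x \<in> bilinear_maps R V W Z"
    and lin: "\<And>a b. a \<in> carrier V \<Longrightarrow> b \<in> carrier W \<Longrightarrow> (\<lambda>x. \<phi> x a b) \<in> linear_maps R U Z"
    and C: "C \<in> carrier (tensor_module R V W)"
  shows "(\<lambda>x. tensor_lift R Z (\<phi> x) C) \<in> linear_maps R U Z"
  using C
proof (induction C rule: tensor_induct)
  case (pure a b)
  show ?case
    by (rule linear_cong[OF _ lin[OF pure] U]) (simp add: tensor_lift_pure[OF Z \<phi>] pure)
next
  case (add C D)
  show ?case
    by (rule linear_cong[OF _ linear_sum[OF Z add(3,4)] U])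
      (simp add: linear_add[OF tensor_lift_linear[OF Z \<phi>]] add)
qed

lemma tensor_lift_param2:
  assumes Z: "module R Z" and U: "module R U" and Y: "module R Y"
    and \<phi>: "\<And>x y. x \<in> carrier U \<Longrightarrow> y \<in> carrier Y \<Longrightarrow> \<phi> x y \<in> bilinear_maps R V W Z"
    and bil: "\<And>a b. a \<in> carrier V \<Longrightarrow> b \<in> carrier W \<Longrightarrow> (\<lambda>x y. \<phi> x y a b) \<in> bilinear_maps R U Y Z"
    and C: "C \<in> carrier (tensor_module R V W)"
  shows "(\<lambda>x y. tensor_lift R Z (\<phi> x y) C) \<in> bilinear_maps R U Y Z"
  unfolding bilinear_maps_def
  by (auto intro!: tensor_lift_param[OF Z Y _ _ C] tensor_lift_param[OF Z U _ _ C] \<phi>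
      bilinear_left[OF bil] bilinear_right[OF bil])

end


end

text \<open>The two sides of coassociativity are liftings of bilinear maps, so they can be compared on pure tensors.\<close>

lemma (in cring) iterated_comul_bilinear:
  fixes V :: "('a, 'v, 'x) module_scheme"
  defines "T \<equiv> tensor_module R V V" and "T3 \<equiv> tensor_module R V (tensor_module R V V)"
    and "pure3 \<equiv> (\<lambda>a b c. pure_tensor R V (tensor_module R V V) a (pure_tensor R V V b c))"
  assumes V: "module R V" and \<Delta>: "\<Delta> \<in> linear_maps R V T"
  shows "(\<lambda>a b. tensor_lift R T3 (\<lambda>a\<^sub>1 a\<^sub>2. pure3 a\<^sub>1 a\<^sub>2 b) (\<Delta> a)) \<in> bilinear_maps R V V T3" (is ?L)
    and "(\<lambda>a b. tensor_lift R T3 (\<lambda>b\<^sub>1 b\<^sub>2. pure3 a b\<^sub>1 b\<^sub>2) (\<Delta> b)) \<in> bilinear_maps R V V T3" (is ?R)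
    and "\<And>b. b \<in> carrier V \<Longrightarrow> (\<lambda>a\<^sub>1 a\<^sub>2. pure3 a\<^sub>1 a\<^sub>2 b) \<in> bilinear_maps R V V T3"
    and "\<And>a. a \<in> carrier V \<Longrightarrow> (\<lambda>b\<^sub>1 b\<^sub>2. pure3 a b\<^sub>1 b\<^sub>2) \<in> bilinear_maps R V V T3"
proof -
  note T = tensor_module_module[OF V V]
  note T3 = tensor_module_module[OF V T]
  note s = pure_closed[OF V V] pure_add_left[OF V V] pure_add_right[OF V V]
    pure_smult_left[OF V V] pure_smult_right[OF V V] pure_closed[OF V T] pure_add_left[OF V T]
    pure_add_right[OF V T] pure_smult_left[OF V T] pure_smult_right[OF V T]
  show l: "(\<lambda>a\<^sub>1 a\<^sub>2. pure3 a\<^sub>1 a\<^sub>2 b) \<in> bilinear_maps R V V T3"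
    and r: "(\<lambda>b\<^sub>1 b\<^sub>2. pure3 b b\<^sub>1 b\<^sub>2) \<in> bilinear_maps R V V T3" if "b \<in> carrier V" for b
    unfolding pure3_def T3_def using that by (intro bilinear_mapsI; simp add: s)+
  have lin: "(\<lambda>b. pure3 u v b) \<in> linear_maps R V T3" "(\<lambda>b. pure3 b u v) \<in> linear_maps R V T3"
    if "u \<in> carrier V" "v \<in> carrier V" for u v
    unfolding pure3_def T3_def using that by (intro linear_mapsI; simp add: s)+
  note cl = linear_closed[OF \<Delta>, unfolded T_def]
  show ?L and ?R
    unfolding bilinear_maps_def
    by (auto intro!: linear_compose[OF \<Delta>[unfolded T_def] tensor_lift_linear[OF V V T3[folded T3_def] l]]
        tensor_lift_param[OF V V T3[folded T3_def] V l lin(1) cl]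
        linear_compose[OF \<Delta>[unfolded T_def] tensor_lift_linear[OF V V T3[folded T3_def] r]]
        tensor_lift_param[OF V V T3[folded T3_def] V r lin(2) cl])
qed

lemma (in assoc_algebra) mult_bilinear: "(\<lambda>a b. a \<otimes>\<^bsub>V\<^esub> b) \<in> bilinear_maps K V V V"
  by (rule bilinear_mapsI) (simp_all add: V.l_distr V.r_distr smult_mult_left smult_mult_right)

lemma (in assoc_algebra) mult_linear:
  "c \<in> carrier V \<Longrightarrow> (\<lambda>a. c \<otimes>\<^bsub>V\<^esub> a) \<in> linear_maps K V V"
  "c \<in> carrier V \<Longrightarrow> (\<lambda>a. a \<otimes>\<^bsub>V\<^esub> c) \<in> linear_maps K V V"
  by (auto intro!: linear_mapsI simp: V.l_distr V.r_distr smult_mult_left smult_mult_right)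

lemma (in module) id_linear: "(\<lambda>a. a) \<in> linear_maps R M M"
  by (rule linear_mapsI) auto

lemma bilinear_sum:
  assumes "module K Z" "\<phi> \<in> bilinear_maps K V W Z" "\<psi> \<in> bilinear_maps K V W Z"
  shows "(\<lambda>a b. \<phi> a b \<oplus>\<^bsub>Z\<^esub> \<psi> a b) \<in> bilinear_maps K V W Z"
  using assms unfolding bilinear_maps_def by (auto intro!: linear_sum)


section \<open>Tensor products of algebras\<close>

lemma tensor_algebra_sel [simp]:
  "carrier (tensor_algebra K V W) = carrier (tensor_module K V W)"
  "ring.zero (tensor_algebra K V W) = ring.zero (tensor_module K V W)"
  "add (tensor_algebra K V W) = add (tensor_module K V W)"
  "smult (tensor_algebra K V W) = smult (tensor_module K V W)"
  "one (tensor_algebra K V W) = pure_tensor K V W \<one>\<^bsub>V\<^esub> \<one>\<^bsub>W\<^esub>"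
  by (simp_all add: tensor_algebra_def Let_def)

text \<open>An algebra may be replaced by its underlying module wherever only linear maps matter.\<close>

lemma module_part_cong:
  assumes "carrier Z = carrier Z'" "ring.zero Z = ring.zero Z'" "add Z = add Z'" "smult Z = smult Z'"
  shows "linear_maps K V Z = linear_maps K V Z'" "linear_maps K Z V = linear_maps K Z' V"
    "bilinear_maps K V W Z = bilinear_maps K V W Z'"
    "lin_ext K Z = lin_ext K Z'" "tensor_lift K Z = tensor_lift K Z'"
proof -
  show *: "linear_maps K V Z = linear_maps K V Z'" "linear_maps K Z V = linear_maps K Z' V" for V
    by (simp_all add: assms linear_maps_def)
  show **: "lin_ext K Z = lin_ext K Z'"
    by (intro ext) (simp add: assms lin_ext_def finsum_def finprod_def)
  show "bilinear_maps K V W Z = bilinear_maps K V W Z'" for V W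
    by (simp add: bilinear_maps_def *)
  show "tensor_lift K Z = tensor_lift K Z'"
    by (intro ext) (simp add: tensor_lift_def **)
qed

lemmas tensor_algebra_maps [simp] =
  module_part_cong[of "tensor_algebra K V W" "tensor_module K V W" for K V W, OF tensor_algebra_sel(1-4)]

context cring
begin

context
  fixes V :: "('a, 'v, 'x) module_scheme" and W :: "('a, 'w, 'y) module_scheme"
  assumes V': "assoc_algebra R V" and W': "assoc_algebra R W"
begin

interpretation V: assoc_algebra R V by (rule V')
interpretation W: assoc_algebra R W by (rule W')

lemmas left_module = V.module_axioms
lemmas right_module = W.module_axioms
lemmas both_module = tensor_module_module[OF left_module right_module]

interpretation T: module R "tensor_module R V W" by (rule both_module)

lemmas pure_mult_simps = pure_closed[OF left_module right_module] pure_add_left[OF left_module right_module] pure_add_right[OF left_module right_module]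
  pure_smult_left[OF left_module right_module] pure_smult_right[OF left_module right_module]
  V.V.l_distr V.V.r_distr W.V.l_distr W.V.r_distr V.smult_mult_left V.smult_mult_right
  W.smult_mult_left W.smult_mult_right

lemma mult_pure_bilinear:
  "a \<in> carrier V \<Longrightarrow> b \<in> carrier W \<Longrightarrow>
    (\<lambda>a' b'. pure_tensor R V W (a \<otimes>\<^bsub>V\<^esub> a') (b \<otimes>\<^bsub>W\<^esub> b')) \<in> bilinear_maps R V W (tensor_module R V W)"
  by (rule bilinear_mapsI) (simp_all add: pure_mult_simps)

lemma mult_pure_bilinear':
  assumes "D \<in> carrier (tensor_module R V W)"
  shows "(\<lambda>a b. tensor_lift R (tensor_module R V W)
    (\<lambda>a' b'. pure_tensor R V W (a \<otimes>\<^bsub>V\<^esub> a') (b \<otimes>\<^bsub>W\<^esub> b')) D) \<in> bilinear_maps R V W (tensor_module R V W)"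
  by (rule tensor_lift_param2[OF left_module right_module both_module left_module right_module mult_pure_bilinear _ assms])
    (simp, simp, rule bilinear_mapsI, simp_all add: pure_mult_simps)

lemma tensor_mult_eq: "C \<otimes>\<^bsub>tensor_algebra R V W\<^esub> D =
    tensor_lift R (tensor_module R V W) (\<lambda>a b. tensor_lift R (tensor_module R V W)
      (\<lambda>a' b'. pure_tensor R V W (a \<otimes>\<^bsub>V\<^esub> a') (b \<otimes>\<^bsub>W\<^esub> b')) D) C"
  by (simp add: tensor_algebra_def Let_def)

lemma pure_mult:
  assumes "a \<in> carrier V" "b \<in> carrier W" "a' \<in> carrier V" "b' \<in> carrier W"
  shows "pure_tensor R V W a b \<otimes>\<^bsub>tensor_algebra R V W\<^esub> pure_tensor R V W a' b'
    = pure_tensor R V W (a \<otimes>\<^bsub>V\<^esub> a') (b \<otimes>\<^bsub>W\<^esub> b')"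
  unfolding tensor_mult_eq
  using assms by (simp add: tensor_lift_pure[OF left_module right_module both_module] mult_pure_bilinear mult_pure_bilinear' pure_mult_simps)

lemma tensor_mult_bilinear:
  "(\<otimes>\<^bsub>tensor_algebra R V W\<^esub>) \<in>
    bilinear_maps R (tensor_module R V W) (tensor_module R V W) (tensor_module R V W)"
  unfolding tensor_mult_eq[abs_def] bilinear_maps_def
proof (intro CollectI conjI ballI)
  show "(\<lambda>C. tensor_lift R (tensor_module R V W) (\<lambda>a b. tensor_lift R (tensor_module R V W)
      (\<lambda>a' b'. pure_tensor R V W (a \<otimes>\<^bsub>V\<^esub> a') (b \<otimes>\<^bsub>W\<^esub> b')) D) C)
      \<in> linear_maps R (tensor_module R V W) (tensor_module R V W)"
    if "D \<in> carrier (tensor_module R V W)" for D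
    by (rule tensor_lift_linear[OF left_module right_module both_module mult_pure_bilinear'[OF that]])
  show "(\<lambda>D. tensor_lift R (tensor_module R V W) (\<lambda>a b. tensor_lift R (tensor_module R V W)
      (\<lambda>a' b'. pure_tensor R V W (a \<otimes>\<^bsub>V\<^esub> a') (b \<otimes>\<^bsub>W\<^esub> b')) D) C)
      \<in> linear_maps R (tensor_module R V W) (tensor_module R V W)"
    if "C \<in> carrier (tensor_module R V W)" for C
    by (rule tensor_lift_param[OF left_module right_module both_module both_module mult_pure_bilinear' tensor_lift_linear[OF left_module right_module both_module mult_pure_bilinear] that])
qed

lemma tensor_assoc_algebra: "assoc_algebra R (tensor_algebra R V W)"
proof -
  let ?T = "tensor_module R V W" and ?A = "tensor_algebra R V W"
  note s = bilinear_closed[OF tensor_mult_bilinear] bilinear_add_left[OF tensor_mult_bilinear]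
    bilinear_add_right[OF tensor_mult_bilinear] bilinear_smult_left[OF tensor_mult_bilinear]
    bilinear_smult_right[OF tensor_mult_bilinear]
  have mod: "module R ?A"
    by (rule module_image[OF both_module, of "\<lambda>x. x"]) auto
  have assoc1: "(pure_tensor R V W a b \<otimes>\<^bsub>?A\<^esub> pure_tensor R V W a' b') \<otimes>\<^bsub>?A\<^esub> E
      = pure_tensor R V W a b \<otimes>\<^bsub>?A\<^esub> (pure_tensor R V W a' b' \<otimes>\<^bsub>?A\<^esub> E)"
    if "a \<in> carrier V" "b \<in> carrier W" "a' \<in> carrier V" "b' \<in> carrier W" "E \<in> carrier ?T" for a b a' b' E
    using that(5)
    by (induction E rule: tensor_induct[OF left_module right_module, consumes 1])
      (simp_all add: pure_mult that s pure_closed[OF left_module right_module] V.V.m_assoc W.V.m_assoc)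
  have assoc2: "(pure_tensor R V W a b \<otimes>\<^bsub>?A\<^esub> D) \<otimes>\<^bsub>?A\<^esub> E = pure_tensor R V W a b \<otimes>\<^bsub>?A\<^esub> (D \<otimes>\<^bsub>?A\<^esub> E)"
    if "a \<in> carrier V" "b \<in> carrier W" "D \<in> carrier ?T" "E \<in> carrier ?T" for a b D E
    using that(3)
    by (induction D rule: tensor_induct[OF left_module right_module, consumes 1]) (simp_all add: assoc1 that s pure_closed[OF left_module right_module])
  have assoc3: "(C \<otimes>\<^bsub>?A\<^esub> D) \<otimes>\<^bsub>?A\<^esub> E = C \<otimes>\<^bsub>?A\<^esub> (D \<otimes>\<^bsub>?A\<^esub> E)"
    if "C \<in> carrier ?T" "D \<in> carrier ?T" "E \<in> carrier ?T" for C D E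
    using that(1)
    by (induction C rule: tensor_induct[OF left_module right_module, consumes 1]) (simp_all add: assoc2 that s)
  have one: "\<one>\<^bsub>?A\<^esub> \<otimes>\<^bsub>?A\<^esub> C = C \<and> C \<otimes>\<^bsub>?A\<^esub> \<one>\<^bsub>?A\<^esub> = C" if "C \<in> carrier ?T" for C
    using that
    by (induction C rule: tensor_induct[OF left_module right_module, consumes 1]) (simp_all add: pure_mult s pure_closed[OF left_module right_module])
  show ?thesis
    by (rule assoc_algebraI[OF mod monoidI])
      (use assoc3 one in \<open>simp_all add: s pure_closed[OF left_module right_module]\<close>)
qed

text \<open>Multiplicativity of a lifted map needs to be known on pure tensors only. The three maps may differ,
  which covers liftings that depend on the factors.\<close>

lemma tensor_lift_mult:
  assumes Z: "assoc_algebra R Z"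
    and G: "G \<in> bilinear_maps R V W Z" "G' \<in> bilinear_maps R V W Z" "G'' \<in> bilinear_maps R V W Z"
    and eq: "\<And>a b a' b'. a \<in> carrier V \<Longrightarrow> b \<in> carrier W \<Longrightarrow> a' \<in> carrier V \<Longrightarrow> b' \<in> carrier W \<Longrightarrow>
      G'' (a \<otimes>\<^bsub>V\<^esub> a') (b \<otimes>\<^bsub>W\<^esub> b') = G a b \<otimes>\<^bsub>Z\<^esub> G' a' b'"
    and C: "C \<in> carrier (tensor_module R V W)" and D: "D \<in> carrier (tensor_module R V W)"
  shows "tensor_lift R Z G'' (C \<otimes>\<^bsub>tensor_algebra R V W\<^esub> D) = tensor_lift R Z G C \<otimes>\<^bsub>Z\<^esub> tensor_lift R Z G' D"
proof -
  interpret Z: assoc_algebra R Z by fact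
  note s = bilinear_closed[OF tensor_mult_bilinear] bilinear_add_left[OF tensor_mult_bilinear]
    bilinear_add_right[OF tensor_mult_bilinear] tensor_lift_pure[OF left_module right_module Z.module_axioms]
    linear_add[OF tensor_lift_linear[OF left_module right_module Z.module_axioms G(1)]]
    linear_add[OF tensor_lift_linear[OF left_module right_module Z.module_axioms G(2)]]
    linear_add[OF tensor_lift_linear[OF left_module right_module Z.module_axioms G(3)]]
    linear_closed[OF tensor_lift_linear[OF left_module right_module Z.module_axioms G(1)]]
    linear_closed[OF tensor_lift_linear[OF left_module right_module Z.module_axioms G(2)]]
  have *: "tensor_lift R Z G'' (pure_tensor R V W a b \<otimes>\<^bsub>tensor_algebra R V W\<^esub> D)
      = tensor_lift R Z G (pure_tensor R V W a b) \<otimes>\<^bsub>Z\<^esub> tensor_lift R Z G' D"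
    if "a \<in> carrier V" "b \<in> carrier W" for a b
    using D
    by (induction D rule: tensor_induct[OF left_module right_module, consumes 1])
      (simp_all add: s that pure_mult G eq pure_closed[OF left_module right_module] bilinear_closed[OF G(1)] Z.V.r_distr)
  show ?thesis using C
    by (induction C rule: tensor_induct[OF left_module right_module, consumes 1]) (simp_all add: s * D Z.V.l_distr)
qed

lemma tensor_lift_algebra_hom:
  assumes Z: "assoc_algebra R Z" and G: "G \<in> bilinear_maps R V W Z"
    and "\<And>a b a' b'. a \<in> carrier V \<Longrightarrow> b \<in> carrier W \<Longrightarrow> a' \<in> carrier V \<Longrightarrow> b' \<in> carrier W \<Longrightarrow>
      G (a \<otimes>\<^bsub>V\<^esub> a') (b \<otimes>\<^bsub>W\<^esub> b') = G a b \<otimes>\<^bsub>Z\<^esub> G a' b'"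
    and "G \<one>\<^bsub>V\<^esub> \<one>\<^bsub>W\<^esub> = \<one>\<^bsub>Z\<^esub>"
  shows "tensor_lift R Z G \<in> algebra_homs R (tensor_algebra R V W) Z"
proof -
  interpret Z: assoc_algebra R Z by fact
  note lin = tensor_lift_linear[OF left_module right_module Z.module_axioms G]
  show ?thesis
    unfolding algebra_homs_def
    using lin assms(4) linear_closed[OF lin] linear_add[OF lin]
    by (auto intro!: ring_hom_memI tensor_lift_mult[OF Z G G G assms(3)]
        simp: tensor_lift_pure[OF left_module right_module Z.module_axioms G])
qed

lemma
  assumes Z: "module R Z" and G: "G \<in> bilinear_maps R V W Z"
    and cd: "c \<in> carrier V" "d \<in> carrier W" and C: "C \<in> carrier (tensor_module R V W)"
  shows tensor_lift_pure_left: "tensor_lift R Z G (pure_tensor R V W c d \<otimes>\<^bsub>tensor_algebra R V W\<^esub> C)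
      = tensor_lift R Z (\<lambda>a b. G (c \<otimes>\<^bsub>V\<^esub> a) (d \<otimes>\<^bsub>W\<^esub> b)) C" (is ?L)
    and tensor_lift_pure_right: "tensor_lift R Z G (C \<otimes>\<^bsub>tensor_algebra R V W\<^esub> pure_tensor R V W c d)
      = tensor_lift R Z (\<lambda>a b. G (a \<otimes>\<^bsub>V\<^esub> c) (b \<otimes>\<^bsub>W\<^esub> d)) C" (is ?R)
proof -
  have lin: "(\<lambda>a. c \<otimes>\<^bsub>V\<^esub> a) \<in> linear_maps R V V" "(\<lambda>a. a \<otimes>\<^bsub>V\<^esub> c) \<in> linear_maps R V V"
    "(\<lambda>b. d \<otimes>\<^bsub>W\<^esub> b) \<in> linear_maps R W W" "(\<lambda>b. b \<otimes>\<^bsub>W\<^esub> d) \<in> linear_maps R W W"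
    using cd by (auto intro!: linear_mapsI simp: pure_mult_simps)
  note bil = bilinear_compose_args[OF G lin(1,3)] bilinear_compose_args[OF G lin(2,4)]
  note s = bilinear_closed[OF tensor_mult_bilinear] bilinear_add_left[OF tensor_mult_bilinear]
    bilinear_add_right[OF tensor_mult_bilinear] tensor_lift_pure[OF left_module right_module Z]
    linear_add[OF tensor_lift_linear[OF left_module right_module Z]]
  show ?L using C
    by (induction C rule: tensor_induct[OF left_module right_module, consumes 1]) (simp_all add: s G bil cd pure_mult pure_closed[OF left_module right_module])
  show ?R using C
    by (induction C rule: tensor_induct[OF left_module right_module, consumes 1]) (simp_all add: s G bil cd pure_mult pure_closed[OF left_module right_module])
qed

end

end


section \<open>Monoid algebras, base field and opposite algebra\<close>

lemma
  assumes "\<phi> \<in> algebra_homs K V W"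
  shows algebra_hom_linear: "\<phi> \<in> linear_maps K V W"
    and algebra_hom_mult: "a \<in> carrier V \<Longrightarrow> b \<in> carrier V \<Longrightarrow> \<phi> (a \<otimes>\<^bsub>V\<^esub> b) = \<phi> a \<otimes>\<^bsub>W\<^esub> \<phi> b"
    and algebra_hom_one: "\<phi> \<one>\<^bsub>V\<^esub> = \<one>\<^bsub>W\<^esub>"
  using assms by (auto simp: algebra_homs_def ring_hom_mult ring_hom_one)

lemma algebra_homsI:
  assumes "\<phi> \<in> linear_maps K V W"
    and "\<And>a b. a \<in> carrier V \<Longrightarrow> b \<in> carrier V \<Longrightarrow> \<phi> (a \<otimes>\<^bsub>V\<^esub> b) = \<phi> a \<otimes>\<^bsub>W\<^esub> \<phi> b"
    and "\<phi> \<one>\<^bsub>V\<^esub> = \<one>\<^bsub>W\<^esub>"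
  shows "\<phi> \<in> algebra_homs K V W"
  using assms unfolding algebra_homs_def
  by (auto intro!: ring_hom_memI linear_closed[OF assms(1)] simp: linear_add[OF assms(1)])

lemma algebra_hom_compose:
  assumes "\<phi> \<in> algebra_homs K V W" "\<psi> \<in> algebra_homs K W Z"
  shows "(\<lambda>a. \<psi> (\<phi> a)) \<in> algebra_homs K V Z"
  using linear_closed[OF algebra_hom_linear[OF assms(1)]]
  by (intro algebra_homsI linear_compose[OF algebra_hom_linear[OF assms(1)] algebra_hom_linear[OF assms(2)]])
    (simp_all add: algebra_hom_mult[OF assms(1)] algebra_hom_mult[OF assms(2)]
      algebra_hom_one[OF assms(1)] algebra_hom_one[OF assms(2)])

lemma algebra_hom_pow:
  assumes "\<phi> \<in> algebra_homs K V W" "monoid V" "a \<in> carrier V"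
  shows "\<phi> (a [^]\<^bsub>V\<^esub> (n::nat)) = \<phi> a [^]\<^bsub>W\<^esub> n"
proof (induction n)
  case (Suc n)
  then show ?case
    using monoid.nat_pow_closed[OF assms(2,3)] assms(3)
    by (simp add: nat_pow_def algebra_hom_mult[OF assms(1)])
qed (simp add: nat_pow_def algebra_hom_one[OF assms(1)])

lemma base_algebra_sel [simp]:
  "carrier (base_algebra K) = carrier K" "ring.zero (base_algebra K) = ring.zero K"
  "add (base_algebra K) = add K" "smult (base_algebra K) = monoid.mult K"
  "monoid.mult (base_algebra K) = monoid.mult K" "one (base_algebra K) = one K"
  by (simp_all add: base_algebra_def)

lemma opposite_algebra_sel [simp]:
  "carrier (opposite_algebra V) = carrier V" "ring.zero (opposite_algebra V) = ring.zero V"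
  "add (opposite_algebra V) = add V" "smult (opposite_algebra V) = smult V"
  "monoid.mult (opposite_algebra V) = (\<lambda>a b. b \<otimes>\<^bsub>V\<^esub> a)" "one (opposite_algebra V) = one V"
  by (simp_all add: opposite_algebra_def)

lemma opposite_algebra_assoc:
  assumes "assoc_algebra K V"
  shows "assoc_algebra K (opposite_algebra V)"
proof -
  interpret V: assoc_algebra K V by fact
  show ?thesis
  proof (rule assoc_algebraI)
    show "module K (opposite_algebra V)"
      by (rule module_image[OF V.module_axioms, of "\<lambda>x. x"]) auto
    show "monoid (opposite_algebra V)"
      by (rule monoidI) (auto simp: V.V.m_assoc)
  qed (auto simp: V.V.l_distr V.V.r_distr V.smult_mult_left V.smult_mult_right)
qed

lemma monoid_algebra_sel [simp]:
  "carrier (monoid_algebra K M) = carrier (free_module K (carrier M))"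
  "ring.zero (monoid_algebra K M) = ring.zero (free_module K (carrier M))"
  "add (monoid_algebra K M) = add (free_module K (carrier M))"
  "smult (monoid_algebra K M) = smult (free_module K (carrier M))"
  "one (monoid_algebra K M) = single K \<one>\<^bsub>M\<^esub>"
  by (simp_all add: monoid_algebra_def Let_def)

lemmas monoid_algebra_maps [simp] =
  module_part_cong[of "monoid_algebra K M" "free_module K (carrier M)" for K M, OF monoid_algebra_sel(1-4)]

context cring
begin

lemma base_algebra_assoc: "assoc_algebra R (base_algebra R)"
proof -
  have ab: "abelian_group (base_algebra R)"
    by (rule abelian_groupI) (auto simp: a_ac intro: l_neg)
  show ?thesis
  proof (rule assoc_algebraI)
    show "module R (base_algebra R)"
      by (rule moduleI) (auto simp: is_cring ab l_distr r_distr m_assoc)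
    show "monoid (base_algebra R)"
      by (rule monoidI) (auto simp: m_assoc)
  qed (auto simp: l_distr r_distr m_ac)
qed

lemma lin_ext_param:
  assumes Z: "module R Z" and U: "module R U"
    and closed: "\<And>s u. s \<in> S \<Longrightarrow> u \<in> carrier U \<Longrightarrow> L s u \<in> carrier Z"
    and lin: "\<And>s. s \<in> S \<Longrightarrow> L s \<in> linear_maps R U Z" and a: "a \<in> carrier (free_module R S)"
  shows "(\<lambda>u. lin_ext R Z (\<lambda>s. L s u) a) \<in> linear_maps R U Z"
proof -
  interpret Z: module R Z by fact
  note l = lin_ext_linear[OF Z closed]
  show ?thesis
    using a
  proof (induction a rule: free_module_induct)
    case zero
    show ?case
      by (rule linear_cong[OF _ zero_linear[OF U Z] U])
        (simp add: linear_zero[OF free_module_module Z l])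
  next
    case (single c i)
    have "(\<lambda>u. c \<odot>\<^bsub>Z\<^esub> L i u) \<in> linear_maps R U Z"
      by (rule linear_mapsI)
        (simp_all add: single closed linear_add[OF lin] linear_smult[OF lin] Z.smult_r_distr
          Z.smult_assoc1[symmetric] m_comm)
    then show ?case
      by (rule linear_cong[OF _ _ U, rotated])
        (simp add: linear_smult[OF l] single lin_ext_single[OF Z] closed)
  next
    case (add a b)
    show ?case
      by (rule linear_cong[OF _ linear_sum[OF Z add(3,4)] U]) (simp add: linear_add[OF l] add)
  qed
qed

context
  fixes M :: "('g, 'n) monoid_scheme"
  assumes M: "monoid M"
begin

interpretation M: monoid M by (rule M)

lemma monoid_algebra_mult_inner:
  assumes "s \<in> carrier M"
  shows "lin_ext R (free_module R (carrier M)) (\<lambda>t. single R (s \<otimes>\<^bsub>M\<^esub> t))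
    \<in> linear_maps R (free_module R (carrier M)) (free_module R (carrier M))"
  by (rule lin_ext_linear[OF free_module_module]) (simp add: assms)

lemma monoid_algebra_mult_bilinear:
  "(\<otimes>\<^bsub>monoid_algebra R M\<^esub>) \<in> bilinear_maps R (free_module R (carrier M))
    (free_module R (carrier M)) (free_module R (carrier M))"
proof -
  let ?F = "free_module R (carrier M)"
  note l = linear_closed[OF monoid_algebra_mult_inner]
  have "(\<lambda>a b. lin_ext R ?F (\<lambda>s. lin_ext R ?F (\<lambda>t. single R (s \<otimes>\<^bsub>M\<^esub> t)) b) a) \<in> bilinear_maps R ?F ?F ?F"
    unfolding bilinear_maps_def
  proof (intro CollectI conjI ballI)
    fix a assume a: "a \<in> carrier ?F"
    show "(\<lambda>b. lin_ext R ?F (\<lambda>s. lin_ext R ?F (\<lambda>t. single R (s \<otimes>\<^bsub>M\<^esub> t)) b) a) \<in> linear_maps R ?F ?F"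
      by (rule lin_ext_param[OF free_module_module free_module_module l monoid_algebra_mult_inner a])
  next
    fix b assume b: "b \<in> carrier ?F"
    show "(\<lambda>a. lin_ext R ?F (\<lambda>s. lin_ext R ?F (\<lambda>t. single R (s \<otimes>\<^bsub>M\<^esub> t)) b) a) \<in> linear_maps R ?F ?F"
      by (rule lin_ext_linear[OF free_module_module l[OF _ b]])
  qed
  then show ?thesis by (simp add: monoid_algebra_def Let_def)
qed

lemma single_mult:
  assumes "s \<in> carrier M" "t \<in> carrier M"
  shows "single R s \<otimes>\<^bsub>monoid_algebra R M\<^esub> single R t = single R (s \<otimes>\<^bsub>M\<^esub> t)"
proof -
  let ?F = "free_module R (carrier M)"
  have "lin_ext R ?F (\<lambda>t. single R (s \<otimes>\<^bsub>M\<^esub> t)) (single R t) = single R (s \<otimes>\<^bsub>M\<^esub> t)"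
    by (rule lin_ext_single[OF free_module_module]) (simp add: assms)
  moreover have "lin_ext R ?F (\<lambda>s. lin_ext R ?F (\<lambda>t. single R (s \<otimes>\<^bsub>M\<^esub> t)) (single R t)) (single R s)
      = lin_ext R ?F (\<lambda>t. single R (s \<otimes>\<^bsub>M\<^esub> t)) (single R t)"
    by (rule lin_ext_single[OF free_module_module])
      (rule linear_closed[OF monoid_algebra_mult_inner single_in], simp_all add: assms)
  ultimately show ?thesis by (simp add: monoid_algebra_def Let_def)
qed

lemma monoid_algebra_assoc: "assoc_algebra R (monoid_algebra R M)"
proof -
  let ?F = "free_module R (carrier M)" and ?A = "monoid_algebra R M"
  note s = bilinear_closed[OF monoid_algebra_mult_bilinear]
    bilinear_add_left[OF monoid_algebra_mult_bilinear] bilinear_add_right[OF monoid_algebra_mult_bilinear]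
    bilinear_smult_left[OF monoid_algebra_mult_bilinear] bilinear_smult_right[OF monoid_algebra_mult_bilinear]
    linear_zero[OF free_module_module free_module_module bilinear_left[OF monoid_algebra_mult_bilinear]]
    linear_zero[OF free_module_module free_module_module bilinear_right[OF monoid_algebra_mult_bilinear]]
  interpret F: module R ?F by (rule free_module_module)
  have mod: "module R ?A"
    by (rule module_image[OF free_module_module, of "\<lambda>x. x"]) auto
  have assoc1: "(single R i \<otimes>\<^bsub>?A\<^esub> single R j) \<otimes>\<^bsub>?A\<^esub> c = single R i \<otimes>\<^bsub>?A\<^esub> (single R j \<otimes>\<^bsub>?A\<^esub> c)"
    if "i \<in> carrier M" "j \<in> carrier M" "c \<in> carrier ?F" for i j c
    using that(3) by (induction c rule: free_module_induct) (simp_all add: single_mult that s M.m_assoc)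
  have assoc2: "(single R i \<otimes>\<^bsub>?A\<^esub> b) \<otimes>\<^bsub>?A\<^esub> c = single R i \<otimes>\<^bsub>?A\<^esub> (b \<otimes>\<^bsub>?A\<^esub> c)"
    if "i \<in> carrier M" "b \<in> carrier ?F" "c \<in> carrier ?F" for i b c
    using that(2) by (induction b rule: free_module_induct) (simp_all add: assoc1 that s)
  have assoc3: "(a \<otimes>\<^bsub>?A\<^esub> b) \<otimes>\<^bsub>?A\<^esub> c = a \<otimes>\<^bsub>?A\<^esub> (b \<otimes>\<^bsub>?A\<^esub> c)"
    if "a \<in> carrier ?F" "b \<in> carrier ?F" "c \<in> carrier ?F" for a b c
    using that(1) by (induction a rule: free_module_induct) (simp_all add: assoc2 that s)
  have one: "\<one>\<^bsub>?A\<^esub> \<otimes>\<^bsub>?A\<^esub> a = a \<and> a \<otimes>\<^bsub>?A\<^esub> \<one>\<^bsub>?A\<^esub> = a" if "a \<in> carrier ?F" for a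
    using that by (induction a rule: free_module_induct) (simp_all add: single_mult s)
  show ?thesis
    by (rule assoc_algebraI[OF mod monoidI]) (use assoc3 one in \<open>simp_all add: s\<close>)
qed

lemma lin_ext_algebra_hom:
  assumes Z: "assoc_algebra R Z" and closed: "\<And>s. s \<in> carrier M \<Longrightarrow> \<phi> s \<in> carrier Z"
    and mult: "\<And>s t. s \<in> carrier M \<Longrightarrow> t \<in> carrier M \<Longrightarrow> \<phi> (s \<otimes>\<^bsub>M\<^esub> t) = \<phi> s \<otimes>\<^bsub>Z\<^esub> \<phi> t"
    and one: "\<phi> \<one>\<^bsub>M\<^esub> = \<one>\<^bsub>Z\<^esub>"
  shows "lin_ext R Z \<phi> \<in> algebra_homs R (monoid_algebra R M) Z"
proof -
  interpret Z: assoc_algebra R Z by fact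
  let ?F = "free_module R (carrier M)" and ?A = "monoid_algebra R M"
  have lin: "lin_ext R Z \<phi> \<in> linear_maps R ?F Z"
    by (rule lin_ext_linear[OF Z.module_axioms closed])
  interpret F: module R ?F by (rule free_module_module)
  note s = bilinear_closed[OF monoid_algebra_mult_bilinear]
    bilinear_add_left[OF monoid_algebra_mult_bilinear] bilinear_add_right[OF monoid_algebra_mult_bilinear]
    bilinear_smult_left[OF monoid_algebra_mult_bilinear] bilinear_smult_right[OF monoid_algebra_mult_bilinear]
    linear_zero[OF free_module_module free_module_module bilinear_left[OF monoid_algebra_mult_bilinear]]
    linear_zero[OF free_module_module free_module_module bilinear_right[OF monoid_algebra_mult_bilinear]]
    linear_add[OF lin] linear_smult[OF lin] linear_zero[OF free_module_module Z.module_axioms lin]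
    linear_closed[OF lin] lin_ext_single[OF Z.module_axioms, of \<phi>, OF closed]
    Z.V.l_distr Z.V.r_distr Z.smult_mult_left Z.smult_mult_right
  have *: "lin_ext R Z \<phi> (single R i \<otimes>\<^bsub>?A\<^esub> b) = lin_ext R Z \<phi> (single R i) \<otimes>\<^bsub>Z\<^esub> lin_ext R Z \<phi> b"
    if "i \<in> carrier M" "b \<in> carrier ?F" for i b
    using that(2) by (induction b rule: free_module_induct) (simp_all add: that s mult closed single_mult)
  have "lin_ext R Z \<phi> (a \<otimes>\<^bsub>?A\<^esub> b) = lin_ext R Z \<phi> a \<otimes>\<^bsub>Z\<^esub> lin_ext R Z \<phi> b"
    if "a \<in> carrier ?F" "b \<in> carrier ?F" for a b
    using that(1) by (induction a rule: free_module_induct) (simp_all add: that s closed *)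
  then show ?thesis
    using lin one by (intro algebra_homsI) (simp_all add: s)
qed

end


end

section \<open>Algebras given by generators and relations\<close>

lemma free_monoid_monoid: "monoid (free_monoid S)"
  by (rule monoidI) (auto simp: free_monoid_def)

lemma free_monoid_sel [simp]:
  "carrier (free_monoid S) = lists S" "one (free_monoid S) = []" "monoid.mult (free_monoid S) = (@)"
  by (simp_all add: free_monoid_def)

context cring
begin

lemma free_algebra_assoc: "assoc_algebra R (free_algebra R S)"
  by (rule monoid_algebra_assoc[OF free_monoid_monoid])

lemma
  assumes Z: "assoc_algebra R Z" and v: "\<And>l. l \<in> S \<Longrightarrow> v l \<in> carrier Z"
  shows free_eval_hom: "free_eval R Z v \<in> algebra_homs R (free_algebra R S) Z"
    and free_eval_letter: "l \<in> S \<Longrightarrow> free_eval R Z v (single R [l]) = v l"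
proof -
  interpret Z: assoc_algebra R Z by fact
  have cl: "foldr (\<lambda>l y. v l \<otimes>\<^bsub>Z\<^esub> y) w \<one>\<^bsub>Z\<^esub> \<in> carrier Z" if "w \<in> lists S" for w
    using that by induction (auto simp: v)
  have mult: "foldr (\<lambda>l y. v l \<otimes>\<^bsub>Z\<^esub> y) w z = foldr (\<lambda>l y. v l \<otimes>\<^bsub>Z\<^esub> y) w \<one>\<^bsub>Z\<^esub> \<otimes>\<^bsub>Z\<^esub> z"
    if "w \<in> lists S" "z \<in> carrier Z" for w z
    using that by induction (auto simp: v cl Z.V.m_assoc)
  show "free_eval R Z v \<in> algebra_homs R (free_algebra R S) Z"
    unfolding free_eval_def
    by (rule lin_ext_algebra_hom[OF free_monoid_monoid Z])
      (simp_all add: cl mult[symmetric] in_lists_conv_set)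
  show "free_eval R Z v (single R [l]) = v l" if "l \<in> S"
    unfolding free_eval_def
    using that v lin_ext_single[OF Z.module_axioms, of "\<lambda>w. foldr (\<lambda>l y. v l \<otimes>\<^bsub>Z\<^esub> y) w \<one>\<^bsub>Z\<^esub>" "[l]"]
    by simp
qed

end

abbreviation presented_algebra ::
  "('k, 'm) ring_scheme \<Rightarrow> 'a set \<Rightarrow> ('a list \<Rightarrow> 'k) set \<Rightarrow> ('k, ('a list \<Rightarrow> 'k) set) module"
where
  "presented_algebra K S Rel \<equiv> quotient_algebra (free_algebra K S) (Idl\<^bsub>free_algebra K S\<^esub> Rel)"

lemma ideal_submodule:
  assumes "assoc_algebra K V" "ideal N V"
  shows "submodule N K V"
proof -
  interpret V: assoc_algebra K V by fact
  interpret N: ideal N V by fact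
  show ?thesis
  proof (rule V.submoduleI)
    fix c n assume cn: "c \<in> carrier K" "n \<in> N"
    then have "(c \<odot>\<^bsub>V\<^esub> \<one>\<^bsub>V\<^esub>) \<otimes>\<^bsub>V\<^esub> n \<in> N"
      by (intro N.I_l_closed) auto
    then show "c \<odot>\<^bsub>V\<^esub> n \<in> N"
      using cn N.a_subset by (simp add: V.smult_mult_left subset_iff)
  qed (use N.a_subset in auto)
qed

lemma quotient_assoc_algebra:
  assumes V: "assoc_algebra K V" and N: "ideal N V"
  shows "assoc_algebra K (quotient_algebra V N)"
    and "(\<lambda>a. N +>\<^bsub>V\<^esub> a) \<in> algebra_homs K V (quotient_algebra V N)"
proof -
  interpret V: assoc_algebra K V by fact
  interpret N: ideal N V by fact
  note sub = ideal_submodule[OF V N]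
  have mult: "N +>\<^bsub>V\<^esub> (a \<otimes>\<^bsub>V\<^esub> b) = (N +>\<^bsub>V\<^esub> a) \<otimes>\<^bsub>quotient_algebra V N\<^esub> (N +>\<^bsub>V\<^esub> b)"
    if "a \<in> carrier V" "b \<in> carrier V" for a b
    using that N.rcoset_mult_add by simp
  note q = quotient_carrier[OF V.module_axioms sub] quotient_add[OF V.module_axioms sub]
    quotient_smult[OF V.module_axioms sub] quotient_zero[OF V.module_axioms sub]
  show "assoc_algebra K (quotient_algebra V N)"
    by (rule assoc_algebra_image[OF V, of "\<lambda>a. N +>\<^bsub>V\<^esub> a"])
      (use q mult in \<open>auto simp del: quotient_algebra_sel(1,2,3,4,6)\<close>)
  show "(\<lambda>a. N +>\<^bsub>V\<^esub> a) \<in> algebra_homs K V (quotient_algebra V N)"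
    by (intro algebra_homsI linear_mapsI)
      (use q mult in \<open>auto simp del: quotient_algebra_sel(1,2,3,4,6)\<close>)
qed

declare quotient_algebra_sel [simp del]

context cring
begin

context
  fixes S :: "'s set" and Rel :: "('s list \<Rightarrow> 'a) set"
  assumes Rel: "Rel \<subseteq> carrier (free_algebra R S)"
begin

interpretation F: assoc_algebra R "free_algebra R S" by (rule free_algebra_assoc)

abbreviation (input) "rel_ideal \<equiv> Idl\<^bsub>free_algebra R S\<^esub> Rel"
abbreviation (input) "rel_class a \<equiv> rel_ideal +>\<^bsub>free_algebra R S\<^esub> a"

lemma rel_ideal: "ideal rel_ideal (free_algebra R S)"
  using Rel by (rule F.V.genideal_ideal)

lemmas rel_submodule = ideal_submodule[OF free_algebra_assoc rel_ideal]
lemmas presented_assoc = quotient_assoc_algebra(1)[OF free_algebra_assoc rel_ideal]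
lemmas rel_class_hom = quotient_assoc_algebra(2)[OF free_algebra_assoc rel_ideal]
lemmas presented_carrier = quotient_carrier[OF F.module_axioms rel_submodule]

lemma presented_relation: "r \<in> Rel \<Longrightarrow> rel_class r = \<zero>\<^bsub>presented_algebra R S Rel\<^esub>"
proof -
  assume r: "r \<in> Rel"
  then have *: "r \<in> rel_ideal" using F.V.genideal_self[OF Rel] by blast
  have "rel_class r = rel_class \<zero>\<^bsub>free_algebra R S\<^esub>"
    using r Rel *
    by (intro quotient_eqI[OF F.module_axioms rel_submodule])
      (auto simp: a_minus_def simp del: monoid_algebra_sel)
  then show ?thesis using quotient_zero[OF F.module_axioms rel_submodule] by simp
qed

text \<open>The universal property of a presentation: the kernel of the evaluation is an ideal, so it contains the
  ideal generated by the relations as soon as it contains the relations.\<close>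

lemma
  assumes Z: "assoc_algebra R Z" and v: "\<And>l. l \<in> S \<Longrightarrow> v l \<in> carrier Z"
    and vanish: "\<And>r. r \<in> Rel \<Longrightarrow> free_eval R Z v r = \<zero>\<^bsub>Z\<^esub>"
  shows presented_hom_class:
      "a \<in> carrier (free_algebra R S) \<Longrightarrow> presented_hom R Z v (rel_class a) = free_eval R Z v a"
    and presented_hom_letter: "l \<in> S \<Longrightarrow> presented_hom R Z v (rel_class (single R [l])) = v l"
    and presented_hom_hom: "presented_hom R Z v \<in> algebra_homs R (presented_algebra R S Rel) Z"
proof -
  interpret Z: assoc_algebra R Z by fact
  have ev: "free_eval R Z v \<in> algebra_homs R (free_algebra R S) Z"
    using v by (rule free_eval_hom[OF Z])
  have "ring_hom_ring (free_algebra R S) Z (free_eval R Z v)"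
    using ev unfolding algebra_homs_def by (intro ring_hom_ringI2 F.V.ring_axioms Z.V.ring_axioms) blast
  then interpret ev: ring_hom_ring "free_algebra R S" Z "free_eval R Z v" .
  have "Rel \<subseteq> a_kernel (free_algebra R S) Z (free_eval R Z v)"
    using vanish Rel unfolding a_kernel_def' by blast
  then have "rel_ideal \<subseteq> a_kernel (free_algebra R S) Z (free_eval R Z v)"
    by (intro F.V.genideal_minimal ev.kernel_is_ideal)
  then have van: "\<And>n. n \<in> rel_ideal \<Longrightarrow> free_eval R Z v n = \<zero>\<^bsub>Z\<^esub>"
    unfolding a_kernel_def' by blast
  show cls: "presented_hom R Z v (rel_class a) = free_eval R Z v a"
    if "a \<in> carrier (free_algebra R S)" for a
    unfolding presented_hom_def
    by (rule the_elem_coset[OF F.module_axioms Z.module_axioms rel_submodule algebra_hom_linear[OF ev] van that])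
  show "presented_hom R Z v (rel_class (single R [l])) = v l" if "l \<in> S" for l
    using that by (simp add: cls free_eval_letter[OF Z, of S v, OF v])
  have ex: "\<exists>a \<in> carrier (free_algebra R S). x = rel_class a"
    if "x \<in> carrier (presented_algebra R S Rel)" for x
    using that presented_carrier by blast
  note q = algebra_hom_mult[OF rel_class_hom] linear_add[OF algebra_hom_linear[OF rel_class_hom]]
    linear_smult[OF algebra_hom_linear[OF rel_class_hom]] algebra_hom_one[OF rel_class_hom]
  note e = algebra_hom_mult[OF ev] linear_add[OF algebra_hom_linear[OF ev]]
    linear_smult[OF algebra_hom_linear[OF ev]] algebra_hom_one[OF ev] linear_closed[OF algebra_hom_linear[OF ev]]
  show "presented_hom R Z v \<in> algebra_homs R (presented_algebra R S Rel) Z"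
  proof (intro algebra_homsI linear_mapsI)
    show "presented_hom R Z v \<one>\<^bsub>presented_algebra R S Rel\<^esub> = \<one>\<^bsub>Z\<^esub>"
      using e(4) cls[OF F.V.one_closed] q(4) by simp
  next
    fix x y assume "x \<in> carrier (presented_algebra R S Rel)" "y \<in> carrier (presented_algebra R S Rel)"
    then obtain a b where ab: "a \<in> carrier (free_algebra R S)" "x = rel_class a"
      "b \<in> carrier (free_algebra R S)" "y = rel_class b" using ex by metis
    then show "presented_hom R Z v x \<in> carrier Z" by (simp add: cls e(5) del: monoid_algebra_sel)
    show "presented_hom R Z v (x \<oplus>\<^bsub>presented_algebra R S Rel\<^esub> y)
        = presented_hom R Z v x \<oplus>\<^bsub>Z\<^esub> presented_hom R Z v y"
      using ab q(2)[of a b] cls[of "a \<oplus>\<^bsub>free_algebra R S\<^esub> b"] e(2)[of a b] cls[of a] cls[of b]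
        F.M.a_closed by metis
    show "presented_hom R Z v (x \<otimes>\<^bsub>presented_algebra R S Rel\<^esub> y)
        = presented_hom R Z v x \<otimes>\<^bsub>Z\<^esub> presented_hom R Z v y"
      using ab q(1)[of a b] cls[of "a \<otimes>\<^bsub>free_algebra R S\<^esub> b"] e(1)[of a b] cls[of a] cls[of b]
        F.V.m_closed by metis
    fix c assume "c \<in> carrier R"
    then show "presented_hom R Z v (c \<odot>\<^bsub>presented_algebra R S Rel\<^esub> x) = c \<odot>\<^bsub>Z\<^esub> presented_hom R Z v x"
      using ab q(3)[of c a] cls[of "c \<odot>\<^bsub>free_algebra R S\<^esub> a"] e(3)[of c a] cls[of a]
        F.smult_closed by metis
  qed
qed

text \<open>Words span a presented algebra, so a property stable under linear combinations holds
  everywhere once it survives multiplication by a generator, on whichever side is convenient.\<close>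

lemma presented_induct:
  assumes x: "x \<in> carrier (presented_algebra R S Rel)"
    and one: "P \<one>\<^bsub>presented_algebra R S Rel\<^esub>"
    and add: "\<And>a b. a \<in> carrier (presented_algebra R S Rel) \<Longrightarrow> b \<in> carrier (presented_algebra R S Rel) \<Longrightarrow>
      P a \<Longrightarrow> P b \<Longrightarrow> P (a \<oplus>\<^bsub>presented_algebra R S Rel\<^esub> b)"
    and smult: "\<And>c a. c \<in> carrier R \<Longrightarrow> a \<in> carrier (presented_algebra R S Rel) \<Longrightarrow> P a \<Longrightarrow>
      P (c \<odot>\<^bsub>presented_algebra R S Rel\<^esub> a)"
    and mult: "(\<forall>a l. a \<in> carrier (presented_algebra R S Rel) \<longrightarrow> l \<in> S \<longrightarrow> P a \<longrightarrow>
          P (rel_class (single R [l]) \<otimes>\<^bsub>presented_algebra R S Rel\<^esub> a))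
      \<or> (\<forall>a l. a \<in> carrier (presented_algebra R S Rel) \<longrightarrow> l \<in> S \<longrightarrow> P a \<longrightarrow>
          P (a \<otimes>\<^bsub>presented_algebra R S Rel\<^esub> rel_class (single R [l])))"
  shows "P x"
proof -
  let ?V = "presented_algebra R S Rel"
  interpret V: assoc_algebra R ?V by (rule presented_assoc)
  note q = algebra_hom_mult[OF rel_class_hom] linear_add[OF algebra_hom_linear[OF rel_class_hom]]
    linear_smult[OF algebra_hom_linear[OF rel_class_hom]] algebra_hom_one[OF rel_class_hom]
    linear_closed[OF algebra_hom_linear[OF rel_class_hom]]
  have in_F: "single R w \<in> carrier (free_algebra R S)" if "w \<in> lists S" for w
    using that by simp
  have app: "rel_class (single R (w @ w')) = rel_class (single R w) \<otimes>\<^bsub>?V\<^esub> rel_class (single R w')"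
    if "w \<in> lists S" "w' \<in> lists S" for w w'
    using q(1)[OF in_F[OF that(1)] in_F[OF that(2)]] that single_mult[OF free_monoid_monoid, of w S w'] by simp
  have nil: "rel_class (single R []) = \<one>\<^bsub>?V\<^esub>" using q(4) by simp
  have word: "P (rel_class (single R w))" if "w \<in> lists S" for w
    using mult
  proof
    assume m: "\<forall>a l. a \<in> carrier ?V \<longrightarrow> l \<in> S \<longrightarrow> P a \<longrightarrow> P (rel_class (single R [l]) \<otimes>\<^bsub>?V\<^esub> a)"
    show ?thesis using that
    proof induction
      case (Cons l w)
      then show ?case using m app[of "[l]" w] q(5)[OF in_F, of w] by simp
    qed (simp add: nil one)
  next
    assume m: "\<forall>a l. a \<in> carrier ?V \<longrightarrow> l \<in> S \<longrightarrow> P a \<longrightarrow> P (a \<otimes>\<^bsub>?V\<^esub> rel_class (single R [l]))"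
    show ?thesis using that
    proof (induction w rule: rev_induct)
      case (snoc l w)
      then show ?case using m app[of w "[l]"] q(5)[OF in_F, of w] by simp
    qed (simp add: nil one)
  qed
  have "P (rel_class a)" if "a \<in> carrier (free_algebra R S)" for a
  proof -
    have "a \<in> carrier (free_module R (lists S))" using that by simp
    then show ?thesis
    proof (induction a rule: free_module_induct)
      case zero
      have "\<zero>\<^bsub>R\<^esub> \<odot>\<^bsub>?V\<^esub> \<one>\<^bsub>?V\<^esub> = rel_class \<zero>\<^bsub>free_algebra R S\<^esub>"
        using quotient_zero[OF F.module_axioms rel_submodule] V.smult_l_null[OF V.V.one_closed] by simp
      then show ?case using smult[OF zero_closed V.V.one_closed one] by simp
    next
      case (single c w)
      then show ?case using smult[OF single(1) q(5)[OF in_F] word] q(3)[OF single(1) in_F, of w] by simp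
    next
      case (add a b)
      then show ?case using assms(3)[of "rel_class a" "rel_class b"] q(2)[of a b] q(5)[of a] q(5)[of b] by simp
    qed
  qed
  then show ?thesis using x presented_carrier by auto
qed

end

end


section \<open>Falling factorials in characteristic p\<close>

text \<open>Expand \<open>m\<^sup>p\<close> in falling factorials of \<open>m\<close>: the terms beyond \<open>m\<close> vanish, those strictly between
  \<open>1\<close> and \<open>m\<close> are divisible by \<open>p\<close> by induction, and \<open>m\<^sup>p \<equiv> m\<close> leaves \<open>p\<close> dividing the coefficient times \<open>m!\<close>.\<close>

lemma prime_dvd_Stirling:
  assumes p: "Factorial_Ring.prime (p::nat)" and j: "1 < j" "j < p"
  shows "p dvd Stirling p j"
proof -
  have step: "m * (fact j * (m choose j)) = fact (Suc j) * (m choose Suc j) + j * (fact j * (m choose j))"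
    for m j :: nat
  proof (cases "j \<le> m")
    case True
    have "fact (Suc j) * (m choose Suc j) = fact j * (Suc j * (m choose Suc j))"
      by (simp add: algebra_simps)
    also have "\<dots> = fact j * ((m - j) * (m choose j))"
      by (simp only: binomial_absorb_comp binomial_absorption)
    finally show ?thesis using True by (simp add: algebra_simps flip: distrib_left)
  qed (simp add: binomial_eq_0)
  have expand: "m ^ n = (\<Sum>j\<le>n. Stirling n j * (fact j * (m choose j)))" for m n :: nat
  proof (induction n)
    case (Suc n)
    have "m ^ Suc n = (\<Sum>j\<le>n. Stirling n j * (m * (fact j * (m choose j))))"
      by (simp add: Suc sum_distrib_left algebra_simps)
    also have "\<dots> = (\<Sum>j\<le>n. Stirling n j * (fact (Suc j) * (m choose Suc j)))
        + (\<Sum>j\<le>n. j * Stirling n j * (fact j * (m choose j)))"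
      by (simp only: step) (simp add: algebra_simps sum.distrib)
    also have "(\<Sum>j\<le>n. j * Stirling n j * (fact j * (m choose j)))
        = (\<Sum>j\<le>Suc n. j * Stirling n j * (fact j * (m choose j)))"
      by simp
    also have "\<dots> = (\<Sum>j\<le>n. Suc j * Stirling n (Suc j) * (fact (Suc j) * (m choose Suc j)))"
      by (subst sum.atMost_Suc_shift) simp
    finally show ?case
      by (subst sum.atMost_Suc_shift) (simp add: sum.distrib algebra_simps)
  qed simp
  show ?thesis
    using j
  proof (induction j rule: less_induct)
    case (less m)
    have "Stirling p j * (fact j * (m choose j)) = 0" if "j > m" for j
      using that by simp
    then have "m ^ p = (\<Sum>j\<le>m. Stirling p j * (fact j * (m choose j)))"
      unfolding expand using less.prems by (intro sum.mono_neutral_right) auto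
    moreover have "Stirling p (Suc 0) = 1" "Stirling p 0 = 0"
      using less.prems Stirling_1 by (cases p; auto simp del: Stirling.simps(4))+
    moreover have "{..m} = insert m (insert 1 (insert 0 {2..<m}))" using less.prems by auto
    ultimately have eq: "m ^ p = Stirling p m * fact m
        + (m + (\<Sum>j\<in>{2..<m}. Stirling p j * (fact j * (m choose j))))"
      using less.prems by simp
    have "p dvd (\<Sum>j\<in>{2..<m}. Stirling p j * (fact j * (m choose j)))"
      using less by (intro dvd_sum) auto
    moreover have "\<not> p dvd m" using less.prems by (auto dest: dvd_imp_le)
    then have "[m ^ (p - 1) * m = 1 * m] (mod p)"
      using p by (intro cong_mult fermat_theorem cong_refl)
    then have "[m ^ p = m] (mod p)"
      using less.prems by (cases p) (simp_all add: mult.commute)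
    ultimately have "p dvd Stirling p m * fact m"
      unfolding eq
      by (metis (no_types, lifting) cong_add_lcancel_0_nat cong_dvd_iff dvd_0_right dvd_add_left_iff
          add.assoc add.commute cong_0_iff)
    moreover have "\<not> p dvd fact m"
      using p less.prems by (simp add: prime_dvd_fact_iff)
    ultimately show ?case using p by (simp add: prime_dvd_mult_nat)
  qed
qed

\<comment> \<open>Frees the dot for natural multiples in a ring.\<close>
no_notation ideal_prod (infixl \<open>\<cdot>\<index>\<close> 80)

fun falling :: "('a, 'm) ring_scheme \<Rightarrow> 'a \<Rightarrow> nat \<Rightarrow> 'a" where
  "falling R y 0 = \<one>\<^bsub>R\<^esub>"
| "falling R y (Suc m) = falling R y m \<otimes>\<^bsub>R\<^esub> (y \<ominus>\<^bsub>R\<^esub> [m] \<cdot>\<^bsub>R\<^esub> \<one>\<^bsub>R\<^esub>)"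

context ring
begin

lemma add_pow_closed [simp]: "a \<in> carrier R \<Longrightarrow> [(n::nat)] \<cdot> a \<in> carrier R"
  by (rule add.nat_pow_closed)

lemma add_pow_Suc: "a \<in> carrier R \<Longrightarrow> [(Suc n)] \<cdot> a = [n] \<cdot> a \<oplus> a"
  by (rule add.nat_pow_Suc)

lemma add_pow_add: "a \<in> carrier R \<Longrightarrow> [((m::nat) + n)] \<cdot> a = [m] \<cdot> a \<oplus> [n] \<cdot> a"
  by (simp add: add.nat_pow_mult)

lemma add_pow_mult: "a \<in> carrier R \<Longrightarrow> [(m::nat)] \<cdot> ([(n::nat)] \<cdot> a) = [(m * n)] \<cdot> a"
  by (simp add: add.nat_pow_pow mult.commute)

lemma nat_scalar_right: "a \<in> carrier R \<Longrightarrow> a \<otimes> [(n::nat)] \<cdot> \<one> = [n] \<cdot> a"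
  by (simp add: add_pow_rdistr)

lemma nat_scalar_left: "a \<in> carrier R \<Longrightarrow> [(n::nat)] \<cdot> \<one> \<otimes> a = [n] \<cdot> a"
  by (simp add: add_pow_ldistr)

lemma add_pow_distrib: "a \<in> carrier R \<Longrightarrow> b \<in> carrier R \<Longrightarrow> [(n::nat)] \<cdot> (a \<oplus> b) = [n] \<cdot> a \<oplus> [n] \<cdot> b"
  by (simp add: add.nat_pow_distrib)

lemma falling_closed [simp]: "y \<in> carrier R \<Longrightarrow> falling R y m \<in> carrier R"
  by (induction m) auto

text \<open>The common pattern of the Stirling and the binomial expansions: if multiplying the entry
  \<open>F m j\<close> by the next factor produces \<open>u j\<close> times the entry below it and once the entry
  to the lower right, then the product of the factors is the sum along a row, weighted by the
  numbers \<open>c m j\<close> that obey the corresponding recursion.\<close>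

lemma triangle_expansion:
  fixes c :: "nat \<Rightarrow> nat \<Rightarrow> nat" and u :: "nat \<Rightarrow> nat"
  assumes F [simp]: "\<And>m j. F m j \<in> carrier R" and Z [simp]: "\<And>m. Z m \<in> carrier R"
    and step: "\<And>m j. j \<le> m \<Longrightarrow> F m j \<otimes> Z m = [(u j)] \<cdot> F (Suc m) j \<oplus> F (Suc m) (Suc j)"
    and c: "c 0 0 = 1" "\<And>m. c (Suc m) 0 = u 0 * c m 0"
      "\<And>m j. c (Suc m) (Suc j) = u (Suc j) * c m (Suc j) + c m j" "\<And>m. c m (Suc m) = 0"
    and P: "P 0 = \<one>" "\<And>m. P (Suc m) = P m \<otimes> Z m" and F0: "F 0 0 = \<one>"
  shows "P m = (\<Oplus>j\<in>{..m}. [(c m j)] \<cdot> F m j)"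
proof (induction m)
  case 0
  show ?case by (simp add: P F0 c)
next
  case (Suc m)
  let ?a = "\<lambda>j. [(u j * c m j)] \<cdot> F (Suc m) j" and ?b = "\<lambda>j. [(c m j)] \<cdot> F (Suc m) (Suc j)"
  have "P (Suc m) = (\<Oplus>j\<in>{..m}. [(c m j)] \<cdot> F m j \<otimes> Z m)"
    by (simp add: P Suc finsum_ldistr Pi_def)
  also have "\<dots> = (\<Oplus>j\<in>{..m}. ?a j \<oplus> ?b j)"
    by (rule finsum_cong')
      (auto simp: add_pow_ldistr step add_pow_distrib add_pow_mult mult.commute)
  also have "\<dots> = (\<Oplus>j\<in>{..m}. ?a j) \<oplus> (\<Oplus>j\<in>{..m}. ?b j)"
    by (rule finsum_addf) auto
  also have "(\<Oplus>j\<in>{..m}. ?a j) = (\<Oplus>j\<in>{..Suc m}. ?a j)"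
    by (subst finsum_Suc) (auto simp: c)
  also have "\<dots> = (\<Oplus>j\<in>{..m}. ?a (Suc j)) \<oplus> ?a 0"
    by (rule finsum_Suc2) auto
  also have "(\<Oplus>j\<in>{..m}. ?a (Suc j)) \<oplus> ?a 0 \<oplus> (\<Oplus>j\<in>{..m}. ?b j)
      = ((\<Oplus>j\<in>{..m}. ?a (Suc j)) \<oplus> (\<Oplus>j\<in>{..m}. ?b j)) \<oplus> ?a 0"
    by (simp add: a_ac Pi_def)
  also have "(\<Oplus>j\<in>{..m}. ?a (Suc j)) \<oplus> (\<Oplus>j\<in>{..m}. ?b j) = (\<Oplus>j\<in>{..m}. ?a (Suc j) \<oplus> ?b j)"
    by (rule finsum_addf[symmetric]) auto
  also have "\<dots> = (\<Oplus>j\<in>{..m}. [(c (Suc m) (Suc j))] \<cdot> F (Suc m) (Suc j))"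
    by (rule finsum_cong') (auto simp: c add_pow_add)
  also have "\<dots> \<oplus> ?a 0 = (\<Oplus>j\<in>{..Suc m}. [(c (Suc m) j)] \<cdot> F (Suc m) j)"
    by (subst finsum_Suc2) (auto simp: c)
  finally show ?case .
qed

lemma commute_minus_scalar:
  assumes "a \<in> carrier R" "y \<in> carrier R" "a \<otimes> y = y \<otimes> a"
  shows "a \<otimes> (y \<ominus> [m] \<cdot> \<one>) = (y \<ominus> [(m::nat)] \<cdot> \<one>) \<otimes> a"
  using assms by (simp add: a_minus_def r_distr l_distr r_minus l_minus nat_scalar_left nat_scalar_right)

lemma falling_commute:
  assumes [simp]: "a \<in> carrier R" "y \<in> carrier R" and comm: "a \<otimes> y = y \<otimes> a"
  shows "a \<otimes> falling R y m = falling R y m \<otimes> a"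
proof (induction m)
  case (Suc m)
  have "a \<otimes> falling R y (Suc m) = (a \<otimes> falling R y m) \<otimes> (y \<ominus> [m] \<cdot> \<one>)"
    by (simp add: m_assoc)
  also have "\<dots> = falling R y m \<otimes> (a \<otimes> (y \<ominus> [m] \<cdot> \<one>))"
    by (simp add: Suc m_assoc)
  also have "\<dots> = falling R y (Suc m) \<otimes> a"
    by (simp add: commute_minus_scalar[OF _ _ comm] m_assoc)
  finally show ?case .
qed simp

lemma falling_Suc_left:
  assumes [simp]: "y \<in> carrier R"
  shows "falling R y (Suc m) = (y \<ominus> [m] \<cdot> \<one>) \<otimes> falling R y m"
proof -
  have "(y \<ominus> [m] \<cdot> \<one>) \<otimes> y = y \<otimes> (y \<ominus> [m] \<cdot> \<one>)"
    by (simp add: a_minus_def r_distr l_distr r_minus l_minus nat_scalar_left nat_scalar_right)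
  then show ?thesis
    by (simp add: falling_commute)
qed

text \<open>If conjugating \<open>c\<close> by \<open>u\<close> shifts it by \<open>u\<^sup>-\<^sup>1 - 1\<close>, then \<open>uc - m\<close> moves past \<open>u\<^sup>m\<close> as
  \<open>u(c - m)\<close>, so the factors of the falling factorial of \<open>uc\<close> separate.\<close>

lemma falling_twist:
  assumes [simp]: "u \<in> carrier R" "c \<in> carrier R" and tw: "c \<otimes> u \<oplus> u = u \<otimes> c \<oplus> \<one>"
  shows "falling R (u \<otimes> c) m = u [^] m \<otimes> falling R c m"
proof -
  have comm: "(u \<otimes> c) \<otimes> u [^] m \<oplus> [m] \<cdot> (u [^] Suc m) = u [^] Suc m \<otimes> c \<oplus> [m] \<cdot> (u [^] m)" for m
  proof (induction m)
    case (Suc m)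
    have "(u \<otimes> c) \<otimes> u [^] Suc m \<oplus> [(Suc m)] \<cdot> (u [^] Suc (Suc m))
        = ((u \<otimes> c) \<otimes> u [^] m \<oplus> [m] \<cdot> (u [^] Suc m)) \<otimes> u \<oplus> u [^] Suc m \<otimes> u"
      by (simp add: l_distr add_pow_ldistr add_pow_Suc m_assoc a_ac)
    also have "\<dots> = u [^] Suc m \<otimes> (c \<otimes> u \<oplus> u) \<oplus> [m] \<cdot> (u [^] Suc m)"
      unfolding Suc by (simp add: l_distr r_distr add_pow_ldistr m_assoc a_ac)
    also have "\<dots> = u [^] Suc (Suc m) \<otimes> c \<oplus> [(Suc m)] \<cdot> (u [^] Suc m)"
      unfolding tw by (simp add: r_distr add_pow_Suc m_assoc a_ac)
    finally show ?case .
  qed simp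
  have shift: "(u \<otimes> c \<ominus> [m] \<cdot> \<one>) \<otimes> u [^] m = u [^] Suc m \<otimes> (c \<ominus> [m] \<cdot> \<one>)" for m :: nat
  proof -
    have "(u \<otimes> c \<ominus> [m] \<cdot> \<one>) \<otimes> u [^] m
        = ((u \<otimes> c) \<otimes> u [^] m \<oplus> [m] \<cdot> (u [^] Suc m)) \<oplus> \<ominus> ([m] \<cdot> (u [^] m)) \<oplus> \<ominus> ([m] \<cdot> (u [^] Suc m))"
      by (simp add: a_minus_def l_distr l_minus nat_scalar_left a_ac r_neg r_neg1 r_neg2)
    also have "\<dots> = u [^] Suc m \<otimes> (c \<ominus> [m] \<cdot> \<one>)"
      unfolding comm
      by (simp add: a_minus_def r_distr r_minus nat_scalar_right a_ac r_neg r_neg1 r_neg2)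
    finally show ?thesis .
  qed
  show ?thesis
  proof (induction m)
    case (Suc m)
    have "falling R (u \<otimes> c) (Suc m) = (u \<otimes> c \<ominus> [m] \<cdot> \<one>) \<otimes> u [^] m \<otimes> falling R c m"
      by (simp only: falling_Suc_left[of "u \<otimes> c"] m_closed assms Suc) (simp add: m_assoc)
    then show ?case
      unfolding shift by (simp add: m_assoc falling_Suc_left del: falling.simps)
  qed simp
qed

end

locale char_ring = ring +
  fixes p :: nat
  assumes prime: "Factorial_Ring.prime p" and char: "[p] \<cdot> \<one> = \<zero>"
begin

lemma multiple_zero: "p dvd n \<Longrightarrow> a \<in> carrier R \<Longrightarrow> [n] \<cdot> a = \<zero>"
proof (elim dvdE)
  fix k assume "a \<in> carrier R" "n = p * k"
  moreover have "[p] \<cdot> a = a \<otimes> [p] \<cdot> \<one>" if "a \<in> carrier R" for a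
    using that by (simp add: nat_scalar_right)
  ultimately show "[n] \<cdot> a = \<zero>" using add_pow_mult[of a p k] by (simp add: char)
qed

lemma two_term_sum:
  assumes F: "\<And>j. F j \<in> carrier R" and a: "a < p" "c a = 1" "c p = (1::nat)"
    and dvd: "\<And>j. j \<noteq> a \<Longrightarrow> j < p \<Longrightarrow> p dvd c j"
  shows "(\<Oplus>j\<in>{..p}. [(c j)] \<cdot> F j) = F a \<oplus> F p"
proof -
  have "(\<Oplus>j\<in>{..p}. [(c j)] \<cdot> F j) = (\<Oplus>j\<in>{a, p}. [(c j)] \<cdot> F j)"
    by (rule add.finprod_mono_neutral_cong_right)
      (use a F in \<open>auto intro!: multiple_zero dvd\<close>)
  then show ?thesis using a F by simp
qed

text \<open>The Stirling expansion of \<open>y\<^sup>p\<close> has only its first and last terms left in characteristic \<open>p\<close>. So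
  \<open>y\<^sup>p = y\<close> becomes the vanishing of a product of linear factors, which can be treated one at a time.\<close>

lemma power_char:
  assumes [simp]: "y \<in> carrier R"
  shows "y [^] p = y \<oplus> falling R y p"
proof -
  have "y [^] m = (\<Oplus>j\<in>{..m}. [(Stirling m j)] \<cdot> falling R y j)" for m
  proof (rule triangle_expansion[where Z = "\<lambda>_. y" and u = "\<lambda>j. j" and F = "\<lambda>m. falling R y"])
    fix m j :: nat
    have "falling R y j \<otimes> y = falling R y j \<otimes> [j] \<cdot> \<one> \<oplus> falling R y j \<otimes> (y \<ominus> [j] \<cdot> \<one>)"
      by (simp add: r_distr[symmetric] a_minus_def a_ac r_neg)
    then show "falling R y j \<otimes> y = [j] \<cdot> falling R y j \<oplus> falling R y (Suc j)"
      by (simp add: nat_scalar_right)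
  qed auto
  then have "y [^] p = (\<Oplus>j\<in>{..p}. [(Stirling p j)] \<cdot> falling R y j)" .
  also have "\<dots> = falling R y 1 \<oplus> falling R y p"
  proof (rule two_term_sum)
    show "1 < p" using prime by (rule prime_gt_1_nat)
    then show "Stirling p 1 = 1"
      using Stirling_1 by (cases p) (auto simp del: Stirling.simps(4))
    fix j assume "j \<noteq> 1" "j < p"
    then show "p dvd Stirling p j"
      using prime_dvd_Stirling[OF prime, of j] by (cases p; cases j) auto
  qed auto
  finally show ?thesis by (simp add: a_minus_def)
qed

lemma power_char_iff:
  assumes "y \<in> carrier R"
  shows "y [^] p = y \<longleftrightarrow> falling R y p = \<zero>"
  using assms by (simp add: power_char add.r_cancel_one)

text \<open>A common form of the binomial theorem and of the Vandermonde identity; the middle binomial coefficients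
  vanish.\<close>

lemma binomial_char:
  assumes F: "\<And>m j. F m j \<in> carrier R" and Z: "\<And>m. Z m \<in> carrier R"
    and step: "\<And>m j. j \<le> m \<Longrightarrow> F m j \<otimes> Z m = F (Suc m) j \<oplus> F (Suc m) (Suc j)"
    and P: "P 0 = \<one>" "\<And>m. P (Suc m) = P m \<otimes> Z m" and F0: "F 0 0 = \<one>"
  shows "P p = F p 0 \<oplus> F p p"
proof -
  have "P p = (\<Oplus>j\<in>{..p}. [(p choose j)] \<cdot> F p j)"
    by (rule triangle_expansion[where u = "\<lambda>_. 1" and Z = Z]) (use assms in auto)
  also have "\<dots> = F p 0 \<oplus> F p p"
  proof (rule two_term_sum)
    fix j assume "j \<noteq> 0" "j < p"
    then show "p dvd (p choose j)" using prime by (intro dvd_choose_prime) auto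
  qed (use F prime_gt_0_nat[OF prime] in auto)
  finally show ?thesis .
qed

lemma neg_one_power: "(\<ominus> \<one>) [^] p = \<ominus> \<one>"
proof -
  obtain n where n: "p = Suc n" using prime_gt_0_nat[OF prime] by (cases p) auto
  have "\<ominus> \<one> \<ominus> [n] \<cdot> \<one> = \<ominus> ([p] \<cdot> \<one>)"
    by (simp add: n add_pow_Suc a_minus_def minus_add a_comm)
  then have "falling R (\<ominus> \<one>) (Suc n) = falling R (\<ominus> \<one>) n \<otimes> \<ominus> ([p] \<cdot> \<one>)"
    by simp
  then have "falling R (\<ominus> \<one>) p = \<zero>"
    by (simp only: n[symmetric] char) simp
  then show ?thesis by (simp add: power_char_iff)
qed

lemma neg_power:
  assumes "a \<in> carrier R"
  shows "(\<ominus> a) [^] p = \<ominus> (a [^] p)"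
  using pow_mult_distrib[of "\<ominus> \<one>" a p] assms by (simp add: l_minus r_minus neg_one_power)

lemma one_minus_power:
  assumes [simp]: "r \<in> carrier R"
  shows "(\<one> \<ominus> r) [^] p = \<one> \<ominus> r [^] p"
proof -
  have "(\<one> \<ominus> r) [^] p = (\<ominus> r) [^] (0::nat) \<oplus> (\<ominus> r) [^] p"
    by (rule binomial_char[where F = "\<lambda>m j. (\<ominus> r) [^] j" and Z = "\<lambda>_. \<one> \<ominus> r"])
      (auto simp: a_minus_def r_distr)
  then show ?thesis by (simp add: neg_power a_minus_def)
qed

text \<open>Vandermonde's identity for \<open>y\<close> and \<open>gz\<close>. The relation between \<open>y\<close> and \<open>g\<close> is designed so that moving
  \<open>g\<^sup>j\<close> past \<open>y\<close> costs \<open>j(1 - g)\<close>: the factor \<open>y + gz - m\<close> then splits into \<open>y - (m - j)\<close> acting on the left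
  part and \<open>g(z - j)\<close> acting on the right part.\<close>

lemma falling_vandermonde_char:
  assumes [simp]: "y \<in> carrier R" "g \<in> carrier R" "z \<in> carrier R"
    and yg: "y \<otimes> g \<oplus> g = g \<otimes> y \<oplus> g \<otimes> g" and zy: "z \<otimes> y = y \<otimes> z" and zg: "z \<otimes> g = g \<otimes> z"
  shows "falling R (y \<oplus> g \<otimes> z) p = falling R y p \<oplus> g [^] p \<otimes> falling R z p"
proof -
  let ?F = "\<lambda>m j. falling R y (m - j) \<otimes> (g [^] j \<otimes> falling R z j)"
  have comm: "g [^] j \<otimes> y \<oplus> [j] \<cdot> (g [^] j \<otimes> g) = y \<otimes> g [^] j \<oplus> [j] \<cdot> (g [^] j)" for j :: nat
  proof (induction j)
    case (Suc j)
    have cg: "g [^] j \<otimes> g = g \<otimes> g [^] j"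
      using nat_pow_Suc2[OF assms(2), of j] by simp
    have "g [^] Suc j \<otimes> y \<oplus> [(Suc j)] \<cdot> (g [^] Suc j \<otimes> g)
        = g \<otimes> (g [^] j \<otimes> y \<oplus> [j] \<cdot> (g [^] j \<otimes> g)) \<oplus> (g \<otimes> g) \<otimes> g [^] j"
      unfolding nat_pow_Suc cg
      by (simp add: r_distr add_pow_rdistr add_pow_Suc m_assoc a_ac cg)
    also have "\<dots> = (g \<otimes> y \<oplus> g \<otimes> g) \<otimes> g [^] j \<oplus> [j] \<cdot> (g \<otimes> g [^] j)"
      unfolding Suc by (simp add: l_distr r_distr add_pow_rdistr m_assoc a_ac)
    also have "\<dots> = y \<otimes> g [^] Suc j \<oplus> [(Suc j)] \<cdot> (g [^] Suc j)"
      unfolding yg[symmetric] nat_pow_Suc cg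
      by (simp add: l_distr add_pow_Suc m_assoc a_ac)
    finally show ?case .
  qed simp
  have "falling R (y \<oplus> g \<otimes> z) p = ?F p 0 \<oplus> ?F p p"
  proof (rule binomial_char[where Z = "\<lambda>m. y \<oplus> g \<otimes> z \<ominus> [m] \<cdot> \<one>"])
    fix m j :: nat assume j: "j \<le> m"
    let ?A = "falling R y (m - j)" and ?B = "g [^] j" and ?C = "falling R z j"
    have Cy: "?C \<otimes> y = y \<otimes> ?C" and Cg: "?C \<otimes> g = g \<otimes> ?C"
      using falling_commute[of y z j] falling_commute[of g z j] zy zg by simp_all
    have By: "?B \<otimes> y = y \<otimes> ?B \<oplus> [j] \<cdot> ?B \<oplus> \<ominus> ([j] \<cdot> (?B \<otimes> g))"
      unfolding comm[symmetric] by (simp add: a_assoc r_neg)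
    have "?C \<otimes> (y \<oplus> g \<otimes> z \<ominus> [m] \<cdot> \<one>) = y \<otimes> ?C \<oplus> g \<otimes> (?C \<otimes> z) \<oplus> \<ominus> ([m] \<cdot> ?C)"
      by (simp add: a_minus_def r_distr r_minus nat_scalar_right Cy Cg flip: m_assoc)
    then have "?B \<otimes> (?C \<otimes> (y \<oplus> g \<otimes> z \<ominus> [m] \<cdot> \<one>))
        = (?B \<otimes> y) \<otimes> ?C \<oplus> (?B \<otimes> g) \<otimes> (?C \<otimes> z) \<oplus> \<ominus> ([(m - j)] \<cdot> (?B \<otimes> ?C) \<oplus> [j] \<cdot> (?B \<otimes> ?C))"
      using j by (simp add: r_distr r_minus add_pow_rdistr m_assoc flip: add_pow_add)
    also have "\<dots> = (y \<ominus> [(m - j)] \<cdot> \<one>) \<otimes> (?B \<otimes> ?C) \<oplus> (?B \<otimes> g) \<otimes> (?C \<otimes> (z \<ominus> [j] \<cdot> \<one>))"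
      unfolding By
      by (simp add: a_minus_def l_distr r_distr l_minus r_minus nat_scalar_left nat_scalar_right
          add_pow_ldistr add_pow_rdistr m_assoc minus_add a_ac r_neg r_neg1 r_neg2)
    finally have "?A \<otimes> (?B \<otimes> (?C \<otimes> (y \<oplus> g \<otimes> z \<ominus> [m] \<cdot> \<one>)))
        = ?A \<otimes> (y \<ominus> [(m - j)] \<cdot> \<one>) \<otimes> (?B \<otimes> ?C) \<oplus> ?A \<otimes> ((?B \<otimes> g) \<otimes> (?C \<otimes> (z \<ominus> [j] \<cdot> \<one>)))"
      by (simp add: r_distr m_assoc)
    then show "?F m j \<otimes> (y \<oplus> g \<otimes> z \<ominus> [m] \<cdot> \<one>) = ?F (Suc m) j \<oplus> ?F (Suc m) (Suc j)"
      using j by (simp add: m_assoc Suc_diff_le)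
  qed simp_all
  then show ?thesis by simp
qed

end


section \<open>Endomorphism algebras\<close>

text \<open>Endomorphisms are undefined off the carrier, so that two of them are equal when they agree on it.\<close>

definition end_algebra :: "('k, 'm) ring_scheme \<Rightarrow> ('k, 'v, 'x) module_scheme \<Rightarrow> ('k, 'v \<Rightarrow> 'v) module" where
  "end_algebra K V = \<lparr>carrier = linear_maps K V V \<inter> extensional (carrier V),
     monoid.mult = (\<lambda>\<phi> \<psi>. \<lambda>a\<in>carrier V. \<phi> (\<psi> a)), one = (\<lambda>a\<in>carrier V. a),
     ring.zero = (\<lambda>a\<in>carrier V. \<zero>\<^bsub>V\<^esub>), add = (\<lambda>\<phi> \<psi>. \<lambda>a\<in>carrier V. \<phi> a \<oplus>\<^bsub>V\<^esub> \<psi> a),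
     smult = (\<lambda>c \<phi>. \<lambda>a\<in>carrier V. c \<odot>\<^bsub>V\<^esub> \<phi> a)\<rparr>"

lemma end_algebra_apply [simp]:
  assumes "a \<in> carrier V"
  shows "(\<phi> \<otimes>\<^bsub>end_algebra K V\<^esub> \<psi>) a = \<phi> (\<psi> a)" "\<one>\<^bsub>end_algebra K V\<^esub> a = a"
    "\<zero>\<^bsub>end_algebra K V\<^esub> a = \<zero>\<^bsub>V\<^esub>" "(\<phi> \<oplus>\<^bsub>end_algebra K V\<^esub> \<psi>) a = \<phi> a \<oplus>\<^bsub>V\<^esub> \<psi> a"
    "(c \<odot>\<^bsub>end_algebra K V\<^esub> \<phi>) a = c \<odot>\<^bsub>V\<^esub> \<phi> a"
  using assms by (simp_all add: end_algebra_def)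

lemma end_algebra_linear: "\<phi> \<in> carrier (end_algebra K V) \<Longrightarrow> \<phi> \<in> linear_maps K V V"
  by (simp add: end_algebra_def)

lemma end_algebra_eqI:
  assumes "\<phi> \<in> carrier (end_algebra K V)" "\<psi> \<in> carrier (end_algebra K V)"
    and "\<And>a. a \<in> carrier V \<Longrightarrow> \<phi> a = \<psi> a"
  shows "\<phi> = \<psi>"
  using assms by (auto simp: end_algebra_def intro: extensionalityI)

lemma end_algebra_assoc:
  assumes V: "module K V"
  shows "assoc_algebra K (end_algebra K V)"
proof -
  interpret V: module K V by fact
  let ?E = "end_algebra K V"
  note lin = end_algebra_linear[THEN linear_closed] end_algebra_linear[THEN linear_add]
    end_algebra_linear[THEN linear_smult]
  have mem: "restrict \<phi> (carrier V) \<in> carrier ?E" if "\<phi> \<in> linear_maps K V V" for \<phi>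
    using that linear_cong[OF _ that V, of "restrict \<phi> (carrier V)"] by (simp add: end_algebra_def)
  have cl: "\<one>\<^bsub>?E\<^esub> \<in> carrier ?E" "\<zero>\<^bsub>?E\<^esub> \<in> carrier ?E"
    "\<phi> \<in> carrier ?E \<Longrightarrow> \<psi> \<in> carrier ?E \<Longrightarrow> \<phi> \<otimes>\<^bsub>?E\<^esub> \<psi> \<in> carrier ?E"
    "\<phi> \<in> carrier ?E \<Longrightarrow> \<psi> \<in> carrier ?E \<Longrightarrow> \<phi> \<oplus>\<^bsub>?E\<^esub> \<psi> \<in> carrier ?E"
    "c \<in> carrier K \<Longrightarrow> \<phi> \<in> carrier ?E \<Longrightarrow> c \<odot>\<^bsub>?E\<^esub> \<phi> \<in> carrier ?E" for c \<phi> \<psi>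
  proof -
    have "(\<lambda>a. a) \<in> linear_maps K V V" by (rule linear_mapsI) auto
    then show "\<one>\<^bsub>?E\<^esub> \<in> carrier ?E" using mem by (simp add: end_algebra_def)
    show "\<zero>\<^bsub>?E\<^esub> \<in> carrier ?E" using mem[OF zero_linear[OF V V]] by (simp add: end_algebra_def)
    show "\<phi> \<otimes>\<^bsub>?E\<^esub> \<psi> \<in> carrier ?E" if "\<phi> \<in> carrier ?E" "\<psi> \<in> carrier ?E"
      using mem[OF linear_compose[of \<psi> K V V \<phi> V]] that by (simp add: end_algebra_def)
    show "\<phi> \<oplus>\<^bsub>?E\<^esub> \<psi> \<in> carrier ?E" if "\<phi> \<in> carrier ?E" "\<psi> \<in> carrier ?E"
      using mem[OF linear_sum[OF V, of \<phi> V \<psi>]] that by (simp add: end_algebra_def)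
    assume c: "c \<in> carrier K" "\<phi> \<in> carrier ?E"
    then have "(\<lambda>a. c \<odot>\<^bsub>V\<^esub> \<phi> a) \<in> linear_maps K V V"
      by (intro linear_mapsI) (simp_all add: lin V.smult_r_distr V.smult_assoc1[symmetric] V.R.m_comm)
    then show "c \<odot>\<^bsub>?E\<^esub> \<phi> \<in> carrier ?E" using mem by (simp add: end_algebra_def)
  qed
  have mod: "module K ?E"
  proof (rule moduleI)
    show "abelian_group ?E"
    proof (rule abelian_groupI)
      fix \<phi> assume \<phi>: "\<phi> \<in> carrier ?E"
      have m: "\<ominus>\<^bsub>K\<^esub> \<one>\<^bsub>K\<^esub> \<in> carrier K" by simp
      show "\<exists>\<psi>\<in>carrier ?E. \<psi> \<oplus>\<^bsub>?E\<^esub> \<phi> = \<zero>\<^bsub>?E\<^esub>"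
        by (intro bexI[of _ "(\<ominus>\<^bsub>K\<^esub> \<one>\<^bsub>K\<^esub>) \<odot>\<^bsub>?E\<^esub> \<phi>"] end_algebra_eqI[of _ K V] cl \<phi> m)
          (simp add: V.smult_l_minus lin[OF \<phi>] V.M.l_neg)
    qed (auto intro!: end_algebra_eqI[of _ K V] cl simp: lin V.M.a_ac)
  qed (auto intro!: end_algebra_eqI[of _ K V] cl V.is_cring simp: lin V.smult_l_distr V.smult_r_distr V.smult_assoc1)
  show ?thesis
  proof (rule assoc_algebraI[OF mod])
    show "monoid ?E"
      by (rule monoidI) (auto intro!: end_algebra_eqI[of _ K V] cl simp: lin)
  qed (auto intro!: end_algebra_eqI[of _ K V] cl simp: lin)
qed

lemma end_algebra_minus:
  assumes "module K V" "\<phi> \<in> carrier (end_algebra K V)" "\<psi> \<in> carrier (end_algebra K V)" "a \<in> carrier V"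
  shows "(\<phi> \<ominus>\<^bsub>end_algebra K V\<^esub> \<psi>) a = \<phi> a \<ominus>\<^bsub>V\<^esub> \<psi> a"
proof -
  interpret V: module K V by fact
  interpret E: assoc_algebra K "end_algebra K V" by (rule end_algebra_assoc) fact
  note cl = end_algebra_linear[THEN linear_closed]
  have "(\<phi> \<ominus>\<^bsub>end_algebra K V\<^esub> \<psi>) a \<oplus>\<^bsub>V\<^esub> \<psi> a = \<phi> a"
  proof -
    have "((\<phi> \<ominus>\<^bsub>end_algebra K V\<^esub> \<psi>) \<oplus>\<^bsub>end_algebra K V\<^esub> \<psi>) = \<phi>"
      using assms by (simp add: a_minus_def E.M.a_assoc E.M.l_neg)
    then show ?thesis using assms(4) by (metis end_algebra_apply(4))
  qed
  then show ?thesis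
    using assms cl[of "\<phi> \<ominus>\<^bsub>end_algebra K V\<^esub> \<psi>" K V a] cl[of \<psi> K V a]
    by (metis E.M.minus_closed V.M.a_assoc V.M.a_inv_closed V.M.r_neg V.M.r_zero a_minus_def)
qed

lemma (in cring)
  fixes S :: "'i set" and \<phi> :: "'i \<Rightarrow> 'i \<Rightarrow> 'a"
  defines "E \<equiv> end_algebra R (free_module R S)"
  assumes \<phi>: "\<And>i. i \<in> S \<Longrightarrow> \<phi> i \<in> carrier (free_module R S)"
  shows end_free_closed: "restrict (lin_ext R (free_module R S) \<phi>) (carrier (free_module R S)) \<in> carrier E"
    and end_free_single: "\<And>i. i \<in> S \<Longrightarrow>
      restrict (lin_ext R (free_module R S) \<phi>) (carrier (free_module R S)) (single R i) = \<phi> i"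
proof -
  have l: "lin_ext R (free_module R S) \<phi> \<in> linear_maps R (free_module R S) (free_module R S)"
    by (rule lin_ext_linear[OF free_module_module \<phi>])
  show "restrict (lin_ext R (free_module R S) \<phi>) (carrier (free_module R S)) \<in> carrier E"
    using linear_cong[OF _ l free_module_module, of "restrict (lin_ext R (free_module R S) \<phi>) (carrier (free_module R S))"]
    by (simp add: E_def end_algebra_def)
  show "restrict (lin_ext R (free_module R S) \<phi>) (carrier (free_module R S)) (single R i) = \<phi> i"
    if "i \<in> S" for i
    using that \<phi> by (simp add: lin_ext_single[OF free_module_module])
qed

lemma (in cring) end_free_eqI:
  assumes "\<phi> \<in> carrier (end_algebra R (free_module R S))" "\<psi> \<in> carrier (end_algebra R (free_module R S))"
    and "\<And>i. i \<in> S \<Longrightarrow> \<phi> (single R i) = \<psi> (single R i)"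
  shows "\<phi> = \<psi>"
  by (rule end_algebra_eqI[OF assms(1,2)])
    (rule linear_free_eqI[OF free_module_module end_algebra_linear[OF assms(1)] end_algebra_linear[OF assms(2)] assms(3)])


section \<open>The algebra of the third type\<close>

lemma (in assoc_algebra) char_ring:
  assumes "Factorial_Ring.prime p" "[p] \<cdot>\<^bsub>K\<^esub> \<one>\<^bsub>K\<^esub> = \<zero>\<^bsub>K\<^esub>"
  shows "char_ring V p"
proof -
  have "[n] \<cdot>\<^bsub>V\<^esub> \<one>\<^bsub>V\<^esub> = ([n] \<cdot>\<^bsub>K\<^esub> \<one>\<^bsub>K\<^esub>) \<odot>\<^bsub>V\<^esub> \<one>\<^bsub>V\<^esub>" for n :: nat
    by (induction n) (simp_all add: V.add_pow_Suc R.add_pow_Suc smult_l_distr)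
  then show ?thesis
    using assms by unfold_locales simp_all
qed

lemma third_hopf_sel:
  "carrier (third_hopf_algebra K p G g f)
     = carrier (quotient_algebra (third_free K G) (third_ideal K p G g f))"
  "monoid.mult (third_hopf_algebra K p G g f)
     = monoid.mult (quotient_algebra (third_free K G) (third_ideal K p G g f))"
  "one (third_hopf_algebra K p G g f) = one (quotient_algebra (third_free K G) (third_ideal K p G g f))"
  "ring.zero (third_hopf_algebra K p G g f)
     = ring.zero (quotient_algebra (third_free K G) (third_ideal K p G g f))"
  "add (third_hopf_algebra K p G g f) = add (quotient_algebra (third_free K G) (third_ideal K p G g f))"
  "smult (third_hopf_algebra K p G g f) = smult (quotient_algebra (third_free K G) (third_ideal K p G g f))"
  by (simp_all add: third_hopf_algebra_def Let_def module.defs)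

abbreviation letters :: "('g, 'n) monoid_scheme \<Rightarrow> 'g letter set" where
  "letters G \<equiv> Grp ` carrier G \<union> {Xgen}"

locale third_type = field K + G: group G
  for K :: "('k, 'm) ring_scheme" and p :: nat and G :: "('g, 'n) monoid_scheme" and g :: 'g and f :: "'g \<Rightarrow> 'k" +
  assumes prime: "Factorial_Ring.prime p" and char: "[p] \<cdot>\<^bsub>K\<^esub> \<one>\<^bsub>K\<^esub> = \<zero>\<^bsub>K\<^esub>"
    and datum: "third_type_datum K p G g f"
begin

abbreviation "H \<equiv> third_hopf_algebra K p G g f"
abbreviation "e \<equiv> third_grp K p G g f"
abbreviation "x \<equiv> third_x K p G g f"

lemma g_closed [simp]: "g \<in> carrier G"
  using datum by (simp add: third_type_datum_def)

lemma g_central: "t \<in> carrier G \<Longrightarrow> g \<otimes>\<^bsub>G\<^esub> t = t \<otimes>\<^bsub>G\<^esub> g"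
  using datum by (simp add: third_type_datum_def)

lemma f_closed [simp]: "t \<in> carrier G \<Longrightarrow> f t \<in> carrier K"
  using datum by (auto simp: third_type_datum_def hom_def)

lemma f_mult [simp]: "s \<in> carrier G \<Longrightarrow> t \<in> carrier G \<Longrightarrow> f (s \<otimes>\<^bsub>G\<^esub> t) = f s \<oplus>\<^bsub>K\<^esub> f t"
  using datum by (auto simp: third_type_datum_def hom_def)

lemma f_g [simp]: "f g = \<one>\<^bsub>K\<^esub>"
  using datum by (simp add: third_type_datum_def)

lemma f_one [simp]: "f \<one>\<^bsub>G\<^esub> = \<zero>\<^bsub>K\<^esub>"
  using f_mult[of "\<one>\<^bsub>G\<^esub>" "\<one>\<^bsub>G\<^esub>"] by (simp del: f_mult)

lemma f_inv [simp]: "t \<in> carrier G \<Longrightarrow> f (inv\<^bsub>G\<^esub> t) = \<ominus>\<^bsub>K\<^esub> f t"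
  using f_mult[of "inv\<^bsub>G\<^esub> t" t] by (simp add: minus_equality del: f_mult)

lemma p_gt_1: "1 < p"
  using prime by (rule prime_gt_1_nat)

text \<open>In the group algebra the coefficient of \<open>1\<close> in \<open>c(1 - g\<^sup>p)\<close> is \<open>c\<close> unless \<open>g\<^sup>p = 1\<close>.\<close>

lemma datum_cases: "g [^]\<^bsub>G\<^esub> p = \<one>\<^bsub>G\<^esub> \<or> (\<forall>t\<in>carrier G. f t [^]\<^bsub>K\<^esub> p = f t)"
proof (rule disjCI)
  assume ne: "\<not> (\<forall>t\<in>carrier G. f t [^]\<^bsub>K\<^esub> p = f t)"
  then obtain t where t: "t \<in> carrier G" "f t [^]\<^bsub>K\<^esub> p \<noteq> f t" by blast
  let ?c = "f t [^]\<^bsub>K\<^esub> p \<ominus>\<^bsub>K\<^esub> f t" and ?A = "monoid_algebra K G"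
  interpret A: assoc_algebra K ?A by (rule monoid_algebra_assoc) (rule G.is_monoid)
  have c: "?c \<in> carrier K" "?c \<noteq> \<zero>\<^bsub>K\<^esub>" using t by simp_all
  have gp: "single K (g [^]\<^bsub>G\<^esub> p) \<in> carrier ?A" by simp
  have "?c \<odot>\<^bsub>?A\<^esub> (\<one>\<^bsub>?A\<^esub> \<ominus>\<^bsub>?A\<^esub> single K (g [^]\<^bsub>G\<^esub> p)) = \<zero>\<^bsub>?A\<^esub>"
    using datum t by (simp add: third_type_datum_def)
  then have "?c \<odot>\<^bsub>?A\<^esub> \<one>\<^bsub>?A\<^esub> = ?c \<odot>\<^bsub>?A\<^esub> single K (g [^]\<^bsub>G\<^esub> p)"
    using c gp by (simp add: a_minus_def A.smult_r_distr A.smult_r_minus A.M.minus_equality A.M.l_neg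
        del: monoid_algebra_sel) (metis A.M.minus_equality A.M.minus_minus A.V.one_closed A.smult_closed A.M.a_inv_closed)
  then have "(?c \<odot>\<^bsub>?A\<^esub> \<one>\<^bsub>?A\<^esub>) \<one>\<^bsub>G\<^esub> = (?c \<odot>\<^bsub>?A\<^esub> single K (g [^]\<^bsub>G\<^esub> p)) \<one>\<^bsub>G\<^esub>" by simp
  then show "g [^]\<^bsub>G\<^esub> p = \<one>\<^bsub>G\<^esub>"
    using c by (auto simp: single_def free_module_sel split: if_splits)
qed

lemma relations_closed: "third_relations K p G g f \<subseteq> carrier (third_free K G)"
proof -
  interpret F: assoc_algebra K "third_free K G" by (rule free_algebra_assoc)
  have in_F: "single K [Grp t] \<in> carrier (third_free K G)" if "t \<in> carrier G" for t
    using that by simp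
  have x_F: "single K [Xgen] \<in> carrier (third_free K G)" by simp
  show ?thesis
    unfolding third_relations_def Let_def
    by (intro Un_least subsetI; clarify)
      (intro F.M.minus_closed F.V.m_closed F.smult_closed F.V.one_closed F.V.nat_pow_closed in_F x_F
        G.m_closed G.one_closed g_closed f_closed; assumption)+
qed

lemma H_image: "assoc_algebra K H"
  by (rule assoc_algebra_image[OF presented_assoc[OF relations_closed, folded third_ideal_def], of "\<lambda>a. a"])
    (auto simp: third_hopf_sel)

end

sublocale third_type \<subseteq> H: assoc_algebra K "third_hopf_algebra K p G g f"
  by (rule H_image)

sublocale third_type \<subseteq> HC: char_ring "third_hopf_algebra K p G g f" p
  by (rule H.char_ring[OF prime char])


\<comment> \<open>The letter set \<open>Grp ` carrier G \<union> {Xgen}\<close> must keep its form for rewriting.\<close>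
declare Un_insert_right [simp del]

lemma
  assumes "carrier V = carrier V'" "add V = add V'" "smult V = smult V'"
    and "carrier W = carrier W'" "add W = add W'" "smult W = smult W'"
  shows tensor_module_cong: "tensor_module K V W = tensor_module K V' W'"
    and pure_tensor_cong: "pure_tensor K V W = pure_tensor K V' W'"
    and tensor_algebra_cong: "monoid.mult V = monoid.mult V' \<Longrightarrow> one V = one V' \<Longrightarrow>
      monoid.mult W = monoid.mult W' \<Longrightarrow> one W = one W' \<Longrightarrow> tensor_algebra K V W = tensor_algebra K V' W'"
proof -
  have k: "tensor_kernel K V W = tensor_kernel K V' W'"
    by (simp add: assms tensor_kernel_def tensor_relations_def)
  show t: "tensor_module K V W = tensor_module K V' W'"
    by (simp add: assms tensor_module_def k)
  show p: "pure_tensor K V W = pure_tensor K V' W'"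
    by (intro ext) (simp add: assms pure_tensor_def k)
  assume "monoid.mult V = monoid.mult V'" "one V = one V'"
      "monoid.mult W = monoid.mult W'" "one W = one W'"
  then show "tensor_algebra K V W = tensor_algebra K V' W'"
    by (simp add: tensor_algebra_def t p)
qed

text \<open>The Hopf algebra adds fields to the presented algebra; all notions that ignore these fields agree.\<close>

lemma third_quotient [simp]:
  fixes K p G g f
  defines "V \<equiv> quotient_algebra (third_free K G) (third_ideal K p G g f)"
    and "H \<equiv> third_hopf_algebra K p G g f"
  shows "carrier V = carrier H" "monoid.mult V = monoid.mult H" "one V = one H"
    "ring.zero V = ring.zero H" "add V = add H" "smult V = smult H"
    and "linear_maps K V Z = linear_maps K H Z" "linear_maps K Z V = linear_maps K Z H"
    "algebra_homs K V Z = algebra_homs K H Z" "algebra_homs K Z V = algebra_homs K Z H"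
    and "tensor_module K V V = tensor_module K H H" "pure_tensor K V V = pure_tensor K H H"
    "tensor_algebra K V V = tensor_algebra K H H" "lin_ext K V = lin_ext K H"
proof -
  show s: "carrier V = carrier H" "monoid.mult V = monoid.mult H" "one V = one H"
    "ring.zero V = ring.zero H" "add V = add H" "smult V = smult H"
    by (simp_all add: V_def H_def third_hopf_sel)
  show m: "linear_maps K V Z = linear_maps K H Z" "linear_maps K Z V = linear_maps K Z H" for Z
    by (simp_all add: linear_maps_def s)
  show "algebra_homs K V Z = algebra_homs K H Z" "algebra_homs K Z V = algebra_homs K Z H" for Z
    by (simp_all add: algebra_homs_def ring_hom_def m s)
  show "tensor_module K V V = tensor_module K H H"
    by (rule tensor_module_cong) (simp_all add: s)
  show "pure_tensor K V V = pure_tensor K H H"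
    by (rule pure_tensor_cong) (simp_all add: s)
  show "tensor_algebra K V V = tensor_algebra K H H"
    by (rule tensor_algebra_cong) (simp_all add: s)
  show "lin_ext K V = lin_ext K H"
    by (rule module_part_cong) (simp_all add: s)
qed

context third_type
begin

abbreviation "cls a \<equiv> third_ideal K p G g f +>\<^bsub>third_free K G\<^esub> a"

interpretation F: assoc_algebra K "third_free K G" by (rule free_algebra_assoc)

lemma cls_hom: "(\<lambda>a. cls a) \<in> algebra_homs K (third_free K G) H"
  using rel_class_hom[OF relations_closed] by (simp flip: third_ideal_def)

lemma cls_letters: "cls (single K [Grp t]) = e t" "cls (single K [Xgen]) = x"
  by (simp_all add: third_grp_def third_x_def)

lemma letter_closed: "l \<in> letters G \<Longrightarrow> single K [l] \<in> carrier (third_free K G)"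
  by simp

lemmas grp_letter = letter_closed[of "Grp t" for t]
lemmas x_letter = letter_closed[of Xgen]

lemmas cls_simps = algebra_hom_mult[OF cls_hom] algebra_hom_one[OF cls_hom]
  linear_smult[OF algebra_hom_linear[OF cls_hom]] linear_closed[OF algebra_hom_linear[OF cls_hom]]
  linear_minus[OF F.module_axioms H.module_axioms algebra_hom_linear[OF cls_hom]]
  algebra_hom_pow[OF cls_hom F.V.is_monoid]

lemma cls_relation: "r \<in> third_relations K p G g f \<Longrightarrow> cls r = \<zero>\<^bsub>H\<^esub>"
  using presented_relation[OF relations_closed] by (simp flip: third_ideal_def)

lemma e_closed [simp]: "t \<in> carrier G \<Longrightarrow> e t \<in> carrier H"
  using cls_simps(4)[OF grp_letter] by (simp add: cls_letters del: monoid_algebra_sel)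

lemma x_closed [simp]: "x \<in> carrier H"
  using cls_simps(4)[OF x_letter] by (simp add: cls_letters del: monoid_algebra_sel)

lemma e_mult: "s \<in> carrier G \<Longrightarrow> t \<in> carrier G \<Longrightarrow> e s \<otimes>\<^bsub>H\<^esub> e t = e (s \<otimes>\<^bsub>G\<^esub> t)"
proof -
  assume st: "s \<in> carrier G" "t \<in> carrier G"
  have "(single K [Grp s] \<otimes>\<^bsub>third_free K G\<^esub> single K [Grp t]) \<ominus>\<^bsub>third_free K G\<^esub> single K [Grp (s \<otimes>\<^bsub>G\<^esub> t)]
      \<in> third_relations K p G g f"
    using st unfolding third_relations_def Let_def by blast
  from cls_relation[OF this] show ?thesis
    using st by (simp add: cls_simps grp_letter cls_letters F.V.m_closed del: monoid_algebra_sel)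
qed

lemma e_one: "e \<one>\<^bsub>G\<^esub> = \<one>\<^bsub>H\<^esub>"
proof -
  have "single K [Grp \<one>\<^bsub>G\<^esub>] \<ominus>\<^bsub>third_free K G\<^esub> \<one>\<^bsub>third_free K G\<^esub> \<in> third_relations K p G g f"
    unfolding third_relations_def Let_def by blast
  from cls_relation[OF this] show ?thesis
    by (simp add: cls_simps grp_letter cls_letters del: monoid_algebra_sel)
qed

lemma e_x_commutator:
  assumes t: "t \<in> carrier G"
  shows "e t \<otimes>\<^bsub>H\<^esub> x \<ominus>\<^bsub>H\<^esub> x \<otimes>\<^bsub>H\<^esub> e t = f t \<odot>\<^bsub>H\<^esub> (e t \<otimes>\<^bsub>H\<^esub> (\<one>\<^bsub>H\<^esub> \<ominus>\<^bsub>H\<^esub> e g))"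
proof -
  let ?F = "third_free K G"
  have "((single K [Grp t] \<otimes>\<^bsub>?F\<^esub> single K [Xgen]) \<ominus>\<^bsub>?F\<^esub> (single K [Xgen] \<otimes>\<^bsub>?F\<^esub> single K [Grp t]))
      \<ominus>\<^bsub>?F\<^esub> (f t \<odot>\<^bsub>?F\<^esub> (single K [Grp t] \<otimes>\<^bsub>?F\<^esub> (\<one>\<^bsub>?F\<^esub> \<ominus>\<^bsub>?F\<^esub> single K [Grp g]))) \<in> third_relations K p G g f"
    using t unfolding third_relations_def Let_def by blast
  from cls_relation[OF this] show ?thesis
    using t by (simp add: cls_simps grp_letter x_letter cls_letters F.V.m_closed F.M.minus_closed F.smult_closed
        del: monoid_algebra_sel)
qed

lemma x_power: "x [^]\<^bsub>H\<^esub> p = x"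
proof -
  have "(single K [Xgen] [^]\<^bsub>third_free K G\<^esub> p) \<ominus>\<^bsub>third_free K G\<^esub> single K [Xgen] \<in> third_relations K p G g f"
    unfolding third_relations_def Let_def by blast
  from cls_relation[OF this] show ?thesis
    by (simp add: cls_simps x_letter cls_letters F.V.nat_pow_closed del: monoid_algebra_sel)
qed

text \<open>The defining relation says that \<open>t\<^sup>-\<^sup>1xt = x - f(t)(1 - g)\<close>.\<close>

definition twist :: "'k \<Rightarrow> ('g letter list \<Rightarrow> 'k) set" where
  "twist c = x \<ominus>\<^bsub>H\<^esub> c \<odot>\<^bsub>H\<^esub> (\<one>\<^bsub>H\<^esub> \<ominus>\<^bsub>H\<^esub> e g)"

lemma twist_closed [simp]: "c \<in> carrier K \<Longrightarrow> twist c \<in> carrier H"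
  by (simp add: twist_def)

lemma x_e:
  assumes t: "t \<in> carrier G"
  shows "x \<otimes>\<^bsub>H\<^esub> e t = e t \<otimes>\<^bsub>H\<^esub> twist (f t)"
proof -
  have "e t \<otimes>\<^bsub>H\<^esub> twist (f t) = e t \<otimes>\<^bsub>H\<^esub> x \<ominus>\<^bsub>H\<^esub> f t \<odot>\<^bsub>H\<^esub> (e t \<otimes>\<^bsub>H\<^esub> (\<one>\<^bsub>H\<^esub> \<ominus>\<^bsub>H\<^esub> e g))"
    using t by (simp add: twist_def a_minus_def H.V.r_distr H.V.r_minus H.smult_mult_right)
  also have "\<dots> = x \<otimes>\<^bsub>H\<^esub> e t"
    unfolding e_x_commutator[OF t, symmetric]
    using t by (simp add: a_minus_def H.M.minus_add H.M.a_ac H.M.r_neg H.M.r_neg1 H.M.r_neg2)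
  finally show ?thesis by simp
qed

text \<open>The universal property: an algebra map out of \<open>H\<close> is a choice of images of the group elements and of
  \<open>x\<close> that satisfies the relations.\<close>

lemma third_hom:
  fixes Z :: "('k, 'z, 'u) module_scheme"
  assumes Z: "assoc_algebra K Z" and E: "\<And>t. t \<in> carrier G \<Longrightarrow> E t \<in> carrier Z" and \<xi>: "\<xi> \<in> carrier Z"
    and mult: "\<And>s t. s \<in> carrier G \<Longrightarrow> t \<in> carrier G \<Longrightarrow> E s \<otimes>\<^bsub>Z\<^esub> E t = E (s \<otimes>\<^bsub>G\<^esub> t)"
    and one: "E \<one>\<^bsub>G\<^esub> = \<one>\<^bsub>Z\<^esub>"
    and comm: "\<And>t. t \<in> carrier G \<Longrightarrow>
      E t \<otimes>\<^bsub>Z\<^esub> \<xi> \<ominus>\<^bsub>Z\<^esub> \<xi> \<otimes>\<^bsub>Z\<^esub> E t = f t \<odot>\<^bsub>Z\<^esub> (E t \<otimes>\<^bsub>Z\<^esub> (\<one>\<^bsub>Z\<^esub> \<ominus>\<^bsub>Z\<^esub> E g))"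
    and pow: "\<xi> [^]\<^bsub>Z\<^esub> p = \<xi>"
  defines "v \<equiv> \<lambda>l. case l of Grp t \<Rightarrow> E t | Xgen \<Rightarrow> \<xi>"
  shows third_hom_hom: "presented_hom K Z v \<in> algebra_homs K H Z"
    and third_hom_e: "\<And>t. t \<in> carrier G \<Longrightarrow> presented_hom K Z v (e t) = E t"
    and third_hom_x: "presented_hom K Z v x = \<xi>"
proof -
  interpret Z: assoc_algebra K Z by fact
  have v: "v l \<in> carrier Z" if "l \<in> letters G" for l
    using that E \<xi> by (auto simp: v_def)
  have ev: "free_eval K Z v \<in> algebra_homs K (third_free K G) Z"
    using v by (rule free_eval_hom[OF Z])
  have let_ev: "free_eval K Z v (single K [l]) = v l" if "l \<in> letters G" for l
    using v that by (rule free_eval_letter[OF Z])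
  have lets: "free_eval K Z v (single K [Grp t]) = E t" if "t \<in> carrier G" for t
    using let_ev[of "Grp t"] that by (simp add: v_def)
  have letx: "free_eval K Z v (single K [Xgen]) = \<xi>"
    using let_ev[of Xgen] by (simp add: v_def)
  note s = algebra_hom_mult[OF ev] algebra_hom_one[OF ev] linear_smult[OF algebra_hom_linear[OF ev]]
    linear_minus[OF F.module_axioms Z.module_axioms algebra_hom_linear[OF ev]]
    algebra_hom_pow[OF ev F.V.is_monoid]
  have van: "free_eval K Z v r = \<zero>\<^bsub>Z\<^esub>" if "r \<in> third_relations K p G g f" for r
    using that unfolding third_relations_def Let_def
    by (elim UnE; clarify)
      (simp_all add: s grp_letter x_letter F.V.m_closed F.M.minus_closed F.smult_closed F.V.nat_pow_closed lets letx
        mult one comm pow E \<xi> del: monoid_algebra_sel)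
  show "presented_hom K Z v \<in> algebra_homs K H Z"
    using presented_hom_hom[OF relations_closed Z v van] by (simp flip: third_ideal_def)
  show "presented_hom K Z v (e t) = E t" if "t \<in> carrier G" for t
    using presented_hom_letter[OF relations_closed Z v van, of "Grp t"] that
    by (simp add: third_grp_def v_def flip: third_ideal_def)
  show "presented_hom K Z v x = \<xi>"
    using presented_hom_letter[OF relations_closed Z v van, of Xgen]
    by (simp add: third_x_def v_def flip: third_ideal_def)
qed

lemma H_induct_left [consumes 1, case_names one add smult grp x]:
  assumes "h \<in> carrier H" and "P \<one>\<^bsub>H\<^esub>"
    and "\<And>a b. a \<in> carrier H \<Longrightarrow> b \<in> carrier H \<Longrightarrow> P a \<Longrightarrow> P b \<Longrightarrow> P (a \<oplus>\<^bsub>H\<^esub> b)"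
    and "\<And>c a. c \<in> carrier K \<Longrightarrow> a \<in> carrier H \<Longrightarrow> P a \<Longrightarrow> P (c \<odot>\<^bsub>H\<^esub> a)"
    and grp: "\<And>t a. t \<in> carrier G \<Longrightarrow> a \<in> carrier H \<Longrightarrow> P a \<Longrightarrow> P (e t \<otimes>\<^bsub>H\<^esub> a)"
    and x: "\<And>a. a \<in> carrier H \<Longrightarrow> P a \<Longrightarrow> P (x \<otimes>\<^bsub>H\<^esub> a)"
  shows "P h"
proof (rule presented_induct[OF relations_closed, of h P, folded third_ideal_def, unfolded third_quotient,
      OF assms(1-4)], assumption+, rule disjI1, intro allI impI)
  fix a l assume "a \<in> carrier H" "l \<in> letters G" "P a"
  then show "P (cls (single K [l]) \<otimes>\<^bsub>H\<^esub> a)"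
    using grp[of _ a] x[of a] by (auto simp: third_grp_def third_x_def)
qed

lemma H_induct_right [consumes 1, case_names one add smult grp x]:
  assumes "h \<in> carrier H" and "P \<one>\<^bsub>H\<^esub>"
    and "\<And>a b. a \<in> carrier H \<Longrightarrow> b \<in> carrier H \<Longrightarrow> P a \<Longrightarrow> P b \<Longrightarrow> P (a \<oplus>\<^bsub>H\<^esub> b)"
    and "\<And>c a. c \<in> carrier K \<Longrightarrow> a \<in> carrier H \<Longrightarrow> P a \<Longrightarrow> P (c \<odot>\<^bsub>H\<^esub> a)"
    and grp: "\<And>t a. t \<in> carrier G \<Longrightarrow> a \<in> carrier H \<Longrightarrow> P a \<Longrightarrow> P (a \<otimes>\<^bsub>H\<^esub> e t)"
    and x: "\<And>a. a \<in> carrier H \<Longrightarrow> P a \<Longrightarrow> P (a \<otimes>\<^bsub>H\<^esub> x)"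
  shows "P h"
proof (rule presented_induct[OF relations_closed, of h P, folded third_ideal_def, unfolded third_quotient,
      OF assms(1-4)], assumption+, rule disjI2, intro allI impI)
  fix a l assume "a \<in> carrier H" "l \<in> letters G" "P a"
  then show "P (a \<otimes>\<^bsub>H\<^esub> cls (single K [l]))"
    using grp[of _ a] x[of a] by (auto simp: third_grp_def third_x_def)
qed

end


section \<open>The basis of the algebra of the third type\<close>

text \<open>Ordered rewriting with \<open>a_ac\<close> leaves opposite summands a few places apart; these rules cancel them.\<close>

lemma (in abelian_group) neg_cancel:
  shows "\<lbrakk>y \<in> carrier G; a \<in> carrier G; z \<in> carrier G\<rbrakk> \<Longrightarrow>
      y \<oplus> (a \<oplus> (\<ominus> y \<oplus> z)) = a \<oplus> z"
    "\<lbrakk>y \<in> carrier G; a \<in> carrier G\<rbrakk> \<Longrightarrow>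
      y \<oplus> (a \<oplus> \<ominus> y) = a"
    "\<lbrakk>y \<in> carrier G; a \<in> carrier G; z \<in> carrier G\<rbrakk> \<Longrightarrow>
      \<ominus> y \<oplus> (a \<oplus> (y \<oplus> z)) = a \<oplus> z"
    "\<lbrakk>y \<in> carrier G; a \<in> carrier G\<rbrakk> \<Longrightarrow>
      \<ominus> y \<oplus> (a \<oplus> y) = a"
    "\<lbrakk>y \<in> carrier G; a \<in> carrier G; b \<in> carrier G; z \<in> carrier G\<rbrakk> \<Longrightarrow>
      y \<oplus> (a \<oplus> (b \<oplus> (\<ominus> y \<oplus> z))) = a \<oplus> (b \<oplus> z)"
    "\<lbrakk>y \<in> carrier G; a \<in> carrier G; b \<in> carrier G\<rbrakk> \<Longrightarrow>
      y \<oplus> (a \<oplus> (b \<oplus> \<ominus> y)) = a \<oplus> b"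
    "\<lbrakk>y \<in> carrier G; a \<in> carrier G; b \<in> carrier G; z \<in> carrier G\<rbrakk> \<Longrightarrow>
      \<ominus> y \<oplus> (a \<oplus> (b \<oplus> (y \<oplus> z))) = a \<oplus> (b \<oplus> z)"
    "\<lbrakk>y \<in> carrier G; a \<in> carrier G; b \<in> carrier G\<rbrakk> \<Longrightarrow>
      \<ominus> y \<oplus> (a \<oplus> (b \<oplus> y)) = a \<oplus> b"
    "\<lbrakk>y \<in> carrier G; a \<in> carrier G; b \<in> carrier G; c \<in> carrier G; z \<in> carrier G\<rbrakk> \<Longrightarrow>
      y \<oplus> (a \<oplus> (b \<oplus> (c \<oplus> (\<ominus> y \<oplus> z)))) = a \<oplus> (b \<oplus> (c \<oplus> z))"
    "\<lbrakk>y \<in> carrier G; a \<in> carrier G; b \<in> carrier G; c \<in> carrier G\<rbrakk> \<Longrightarrow>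
      y \<oplus> (a \<oplus> (b \<oplus> (c \<oplus> \<ominus> y))) = a \<oplus> (b \<oplus> c)"
    "\<lbrakk>y \<in> carrier G; a \<in> carrier G; b \<in> carrier G; c \<in> carrier G; z \<in> carrier G\<rbrakk> \<Longrightarrow>
      \<ominus> y \<oplus> (a \<oplus> (b \<oplus> (c \<oplus> (y \<oplus> z)))) = a \<oplus> (b \<oplus> (c \<oplus> z))"
    "\<lbrakk>y \<in> carrier G; a \<in> carrier G; b \<in> carrier G; c \<in> carrier G\<rbrakk> \<Longrightarrow>
      \<ominus> y \<oplus> (a \<oplus> (b \<oplus> (c \<oplus> y))) = a \<oplus> (b \<oplus> c)"
    "\<lbrakk>y \<in> carrier G; a \<in> carrier G; b \<in> carrier G; c \<in> carrier G; d \<in> carrier G; z \<in> carrier G\<rbrakk> \<Longrightarrow>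
      y \<oplus> (a \<oplus> (b \<oplus> (c \<oplus> (d \<oplus> (\<ominus> y \<oplus> z))))) = a \<oplus> (b \<oplus> (c \<oplus> (d \<oplus> z)))"
    "\<lbrakk>y \<in> carrier G; a \<in> carrier G; b \<in> carrier G; c \<in> carrier G; d \<in> carrier G\<rbrakk> \<Longrightarrow>
      y \<oplus> (a \<oplus> (b \<oplus> (c \<oplus> (d \<oplus> \<ominus> y)))) = a \<oplus> (b \<oplus> (c \<oplus> d))"
    "\<lbrakk>y \<in> carrier G; a \<in> carrier G; b \<in> carrier G; c \<in> carrier G; d \<in> carrier G; z \<in> carrier G\<rbrakk> \<Longrightarrow>
      \<ominus> y \<oplus> (a \<oplus> (b \<oplus> (c \<oplus> (d \<oplus> (y \<oplus> z))))) = a \<oplus> (b \<oplus> (c \<oplus> (d \<oplus> z)))"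
    "\<lbrakk>y \<in> carrier G; a \<in> carrier G; b \<in> carrier G; c \<in> carrier G; d \<in> carrier G\<rbrakk> \<Longrightarrow>
      \<ominus> y \<oplus> (a \<oplus> (b \<oplus> (c \<oplus> (d \<oplus> y)))) = a \<oplus> (b \<oplus> (c \<oplus> d))"
    "\<lbrakk>y \<in> carrier G; a \<in> carrier G; b \<in> carrier G; c \<in> carrier G; d \<in> carrier G; e \<in> carrier G; z \<in> carrier G\<rbrakk> \<Longrightarrow>
      y \<oplus> (a \<oplus> (b \<oplus> (c \<oplus> (d \<oplus> (e \<oplus> (\<ominus> y \<oplus> z)))))) = a \<oplus> (b \<oplus> (c \<oplus> (d \<oplus> (e \<oplus> z))))"
    "\<lbrakk>y \<in> carrier G; a \<in> carrier G; b \<in> carrier G; c \<in> carrier G; d \<in> carrier G; e \<in> carrier G\<rbrakk> \<Longrightarrow>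
      y \<oplus> (a \<oplus> (b \<oplus> (c \<oplus> (d \<oplus> (e \<oplus> \<ominus> y))))) = a \<oplus> (b \<oplus> (c \<oplus> (d \<oplus> e)))"
    "\<lbrakk>y \<in> carrier G; a \<in> carrier G; b \<in> carrier G; c \<in> carrier G; d \<in> carrier G; e \<in> carrier G; z \<in> carrier G\<rbrakk> \<Longrightarrow>
      \<ominus> y \<oplus> (a \<oplus> (b \<oplus> (c \<oplus> (d \<oplus> (e \<oplus> (y \<oplus> z)))))) = a \<oplus> (b \<oplus> (c \<oplus> (d \<oplus> (e \<oplus> z))))"
    "\<lbrakk>y \<in> carrier G; a \<in> carrier G; b \<in> carrier G; c \<in> carrier G; d \<in> carrier G; e \<in> carrier G\<rbrakk> \<Longrightarrow>
      \<ominus> y \<oplus> (a \<oplus> (b \<oplus> (c \<oplus> (d \<oplus> (e \<oplus> y))))) = a \<oplus> (b \<oplus> (c \<oplus> (d \<oplus> e)))"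
  by (simp_all add: a_lcomm[of y a] a_lcomm[of y b] a_lcomm[of y c] a_lcomm[of y d] a_lcomm[of y e]
      a_lcomm[of "\<ominus> y" a] a_lcomm[of "\<ominus> y" b] a_lcomm[of "\<ominus> y" c] a_lcomm[of "\<ominus> y" d]
      a_lcomm[of "\<ominus> y" e] r_neg l_neg r_neg1 r_neg2)

context third_type
begin

abbreviation "basis_index \<equiv> carrier G \<times> {..<p}"
abbreviation "M \<equiv> free_module K basis_index"
abbreviation "E \<equiv> end_algebra K M"

interpretation M: module K M by (rule free_module_module)
interpretation E: assoc_algebra K E by (rule end_algebra_assoc) (rule free_module_module)
interpretation EC: char_ring E p by (rule E.char_ring[OF prime char])

text \<open>The left regular representation in the expected basis, where \<open>(t, i)\<close> stands for \<open>tx\<^sup>i\<close>. As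
  \<open>x \<cdot> tx\<^sup>i = tx\<^sup>i\<^sup>+\<^sup>1 - f(t)(tx\<^sup>i - tgx\<^sup>i)\<close>, the generator \<open>x\<close> acts by \<open>op_x\<close>: the first term is \<open>op_y\<close>,
  which returns from exponent \<open>p\<close> to exponent \<open>1\<close>, and the second is \<open>op_d\<close>.\<close>

definition operator :: "('g \<times> nat \<Rightarrow> 'g \<times> nat \<Rightarrow> 'k) \<Rightarrow> ('g \<times> nat \<Rightarrow> 'k) \<Rightarrow> ('g \<times> nat \<Rightarrow> 'k)" where
  "operator \<phi> = restrict (lin_ext K M \<phi>) (carrier M)"

definition "op_grp s = operator (\<lambda>(t, i). single K (s \<otimes>\<^bsub>G\<^esub> t, i))"
definition "op_g = operator (\<lambda>(t, i). single K (t \<otimes>\<^bsub>G\<^esub> g, i))"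
definition "op_f = operator (\<lambda>(t, i). (\<ominus>\<^bsub>K\<^esub> f t) \<odot>\<^bsub>M\<^esub> single K (t, i))"
definition "op_y = operator (\<lambda>(t, i). single K (t, if Suc i < p then Suc i else 1))"
definition "op_d = (\<one>\<^bsub>E\<^esub> \<ominus>\<^bsub>E\<^esub> op_g) \<otimes>\<^bsub>E\<^esub> op_f"
definition "op_x = op_d \<oplus>\<^bsub>E\<^esub> op_y"

lemma op_closed [simp]:
  "s \<in> carrier G \<Longrightarrow> op_grp s \<in> carrier E" "op_g \<in> carrier E" "op_f \<in> carrier E" "op_y \<in> carrier E"
  "op_d \<in> carrier E" "op_x \<in> carrier E"
proof -
  show *: "s \<in> carrier G \<Longrightarrow> op_grp s \<in> carrier E" "op_g \<in> carrier E" "op_f \<in> carrier E" "op_y \<in> carrier E"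
    unfolding op_grp_def op_g_def op_f_def op_y_def operator_def
    using p_gt_1 by (auto intro!: end_free_closed M.smult_closed)
  then show "op_d \<in> carrier E" "op_x \<in> carrier E"
    by (simp_all add: op_x_def op_d_def)
qed

lemma op_single [simp]:
  assumes "t \<in> carrier G" "i < p"
  shows "s \<in> carrier G \<Longrightarrow> op_grp s (single K (t, i)) = single K (s \<otimes>\<^bsub>G\<^esub> t, i)"
    and "op_g (single K (t, i)) = single K (t \<otimes>\<^bsub>G\<^esub> g, i)"
    and "op_f (single K (t, i)) = (\<ominus>\<^bsub>K\<^esub> f t) \<odot>\<^bsub>M\<^esub> single K (t, i)"
    and "op_y (single K (t, i)) = single K (t, if Suc i < p then Suc i else 1)"
proof -
  have 1: "(\<lambda>(t, i). single K (s \<otimes>\<^bsub>G\<^esub> t, i)) j \<in> carrier M" if "s \<in> carrier G" "j \<in> basis_index" for s j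
    using that by auto
  have 2: "(\<lambda>(t, i). single K (t \<otimes>\<^bsub>G\<^esub> g, i)) j \<in> carrier M" if "j \<in> basis_index" for j
    using that by auto
  have 3: "(\<lambda>(t, i). (\<ominus>\<^bsub>K\<^esub> f t) \<odot>\<^bsub>M\<^esub> single K (t, i)) j \<in> carrier M" if "j \<in> basis_index" for j
    using that by (auto intro!: M.smult_closed)
  have 4: "(\<lambda>(t, i). single K (t, if Suc i < p then Suc i else 1)) j \<in> carrier M" if "j \<in> basis_index" for j
    using that p_gt_1 by auto
  have j: "(t, i) \<in> basis_index" using assms by simp
  show "s \<in> carrier G \<Longrightarrow> op_grp s (single K (t, i)) = single K (s \<otimes>\<^bsub>G\<^esub> t, i)"
    unfolding op_grp_def operator_def by (subst end_free_single[OF 1 j]) auto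
  show "op_g (single K (t, i)) = single K (t \<otimes>\<^bsub>G\<^esub> g, i)"
    unfolding op_g_def operator_def by (subst end_free_single[OF 2 j]) auto
  show "op_f (single K (t, i)) = (\<ominus>\<^bsub>K\<^esub> f t) \<odot>\<^bsub>M\<^esub> single K (t, i)"
    unfolding op_f_def operator_def by (subst end_free_single[OF 3 j]) auto
  show "op_y (single K (t, i)) = single K (t, if Suc i < p then Suc i else 1)"
    unfolding op_y_def operator_def by (subst end_free_single[OF 4 j]) auto
qed

lemmas op_linear = linear_add[OF end_algebra_linear[of _ K M]] linear_smult[OF end_algebra_linear[of _ K M]]
  linear_closed[OF end_algebra_linear[of _ K M]]
  linear_minus[OF free_module_module free_module_module end_algebra_linear[of _ K M]]
  end_algebra_minus[OF free_module_module, of _ basis_index]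

lemma op_d_single [simp]:
  assumes "t \<in> carrier G" "i < p"
  shows "op_d (single K (t, i)) = (\<ominus>\<^bsub>K\<^esub> f t) \<odot>\<^bsub>M\<^esub> single K (t, i) \<ominus>\<^bsub>M\<^esub> (\<ominus>\<^bsub>K\<^esub> f t) \<odot>\<^bsub>M\<^esub> single K (t \<otimes>\<^bsub>G\<^esub> g, i)"
  using assms by (simp add: op_d_def op_linear) (simp add: a_minus_def M.smult_r_distr M.smult_r_minus)

lemma op_x_single [simp]:
  assumes "t \<in> carrier G" "i < p"
  shows "op_x (single K (t, i)) = op_d (single K (t, i)) \<oplus>\<^bsub>M\<^esub> op_y (single K (t, i))"
  using assms by (simp add: op_x_def)

lemma op_grp_mult: "s \<in> carrier G \<Longrightarrow> t \<in> carrier G \<Longrightarrow> op_grp s \<otimes>\<^bsub>E\<^esub> op_grp t = op_grp (s \<otimes>\<^bsub>G\<^esub> t)"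
  by (rule end_free_eqI[where S = basis_index]) (auto simp: G.m_assoc)

lemma op_grp_one: "op_grp \<one>\<^bsub>G\<^esub> = \<one>\<^bsub>E\<^esub>"
  by (rule end_free_eqI[where S = basis_index]) auto

lemma op_commutator:
  assumes t: "t \<in> carrier G"
  shows "op_grp t \<otimes>\<^bsub>E\<^esub> op_x \<ominus>\<^bsub>E\<^esub> op_x \<otimes>\<^bsub>E\<^esub> op_grp t = f t \<odot>\<^bsub>E\<^esub> (op_grp t \<otimes>\<^bsub>E\<^esub> (\<one>\<^bsub>E\<^esub> \<ominus>\<^bsub>E\<^esub> op_grp g))"
proof (rule end_free_eqI[where S = basis_index])
  fix j assume "j \<in> basis_index"
  then obtain u i where j: "j = (u, i)" and u: "u \<in> carrier G" and i: "i < p" by auto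
  let ?i = "if Suc i < p then Suc i else 1"
  have ip: "?i < p" using p_gt_1 by simp
  let ?a = "single K (t \<otimes>\<^bsub>G\<^esub> u, i)" and ?b = "single K (t \<otimes>\<^bsub>G\<^esub> (u \<otimes>\<^bsub>G\<^esub> g), i)" and ?c = "single K (t \<otimes>\<^bsub>G\<^esub> u, ?i)"
  have cl: "?a \<in> carrier M" "?b \<in> carrier M" "?c \<in> carrier M" using t u i ip by simp_all
  have 1: "op_grp t (op_x (single K j)) = ((\<ominus>\<^bsub>K\<^esub> f u) \<odot>\<^bsub>M\<^esub> ?a \<ominus>\<^bsub>M\<^esub> (\<ominus>\<^bsub>K\<^esub> f u) \<odot>\<^bsub>M\<^esub> ?b) \<oplus>\<^bsub>M\<^esub> ?c"
    using t u i ip by (simp add: j op_linear G.m_assoc del: if_cong split del: if_split)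
  have 2: "op_x (op_grp t (single K j))
      = ((\<ominus>\<^bsub>K\<^esub> (f t \<oplus>\<^bsub>K\<^esub> f u)) \<odot>\<^bsub>M\<^esub> ?a \<ominus>\<^bsub>M\<^esub> (\<ominus>\<^bsub>K\<^esub> (f t \<oplus>\<^bsub>K\<^esub> f u)) \<odot>\<^bsub>M\<^esub> ?b) \<oplus>\<^bsub>M\<^esub> ?c"
    using t u i ip by (simp add: j op_linear G.m_assoc split del: if_split)
  have "(op_grp t \<otimes>\<^bsub>E\<^esub> op_x \<ominus>\<^bsub>E\<^esub> op_x \<otimes>\<^bsub>E\<^esub> op_grp t) (single K j)
      = op_grp t (op_x (single K j)) \<ominus>\<^bsub>M\<^esub> op_x (op_grp t (single K j))"
    using t u i by (simp add: j op_linear del: op_x_single op_d_single op_single)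
  also have "\<dots> = f t \<odot>\<^bsub>M\<^esub> ?a \<ominus>\<^bsub>M\<^esub> f t \<odot>\<^bsub>M\<^esub> ?b"
    unfolding 1 2 using cl t u
    by (simp split del: if_split add: a_minus_def M.smult_l_minus M.smult_l_distr M.M.minus_add M.M.a_ac M.M.r_neg M.M.r_neg1
        M.M.r_neg2 M.M.neg_cancel)
  also have "\<dots> = (f t \<odot>\<^bsub>E\<^esub> (op_grp t \<otimes>\<^bsub>E\<^esub> (\<one>\<^bsub>E\<^esub> \<ominus>\<^bsub>E\<^esub> op_grp g))) (single K j)"
    using t u i cl by (simp add: j op_linear g_central) (simp add: M.smult_r_minus M.smult_r_distr a_minus_def)
  finally show "(op_grp t \<otimes>\<^bsub>E\<^esub> op_x \<ominus>\<^bsub>E\<^esub> op_x \<otimes>\<^bsub>E\<^esub> op_grp t) (single K j)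
      = (f t \<odot>\<^bsub>E\<^esub> (op_grp t \<otimes>\<^bsub>E\<^esub> (\<one>\<^bsub>E\<^esub> \<ominus>\<^bsub>E\<^esub> op_grp g))) (single K j)" .
qed (use t in simp_all)

lemma pow_iterate:
  assumes "\<phi> \<in> carrier E" "a \<in> carrier M"
  shows "(\<phi> [^]\<^bsub>E\<^esub> (n::nat)) a = (\<phi> ^^ n) a"
proof (induction n)
  case (Suc n)
  have "(\<phi> [^]\<^bsub>E\<^esub> Suc n) a = (\<phi> \<otimes>\<^bsub>E\<^esub> \<phi> [^]\<^bsub>E\<^esub> n) a"
    by (simp only: E.V.nat_pow_Suc2[OF assms(1)])
  then show ?case using assms Suc by simp
qed (use assms in simp)

lemma op_y_power: "op_y [^]\<^bsub>E\<^esub> p = op_y"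
proof (rule end_free_eqI[where S = basis_index])
  fix j assume "j \<in> basis_index"
  then obtain t i where j: "j = (t, i)" and t: "t \<in> carrier G" and i: "i < p" by auto
  obtain q where q: "p = Suc q" "0 < q" using p_gt_1 by (cases p) auto
  have pow: "(op_y ^^ n) (single K (t, 0)) = single K (t, n)" if "n < p" for n
    using that by (induction n) (use t p_gt_1 in simp_all)
  have 0: "(op_y ^^ p) (single K (t, 0)) = op_y (single K (t, 0))"
  proof -
    have "op_y ^^ p = op_y \<circ> op_y ^^ q" using q(1) by (metis funpow.simps(2))
    moreover have "q < p" "\<not> Suc q < p" using q by linarith+
    ultimately show ?thesis using t p_gt_1 pow[of q] by simp
  qed
  have "(op_y [^]\<^bsub>E\<^esub> p) (single K j) = (op_y ^^ p) ((op_y ^^ i) (single K (t, 0)))"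
    using t i by (simp add: j pow[OF i] pow_iterate)
  also have "\<dots> = (op_y ^^ i) ((op_y ^^ p) (single K (t, 0)))"
    by (metis add.commute comp_apply funpow_add)
  also have "\<dots> = op_y ((op_y ^^ i) (single K (t, 0)))"
    unfolding 0 by (metis comp_apply funpow_Suc_right funpow.simps(2))
  finally show "(op_y [^]\<^bsub>E\<^esub> p) (single K j) = op_y (single K j)"
    by (simp only: pow[OF i] j)
qed simp_all

lemma op_twist: "op_f \<otimes>\<^bsub>E\<^esub> (\<one>\<^bsub>E\<^esub> \<ominus>\<^bsub>E\<^esub> op_g) \<oplus>\<^bsub>E\<^esub> (\<one>\<^bsub>E\<^esub> \<ominus>\<^bsub>E\<^esub> op_g) = (\<one>\<^bsub>E\<^esub> \<ominus>\<^bsub>E\<^esub> op_g) \<otimes>\<^bsub>E\<^esub> op_f \<oplus>\<^bsub>E\<^esub> \<one>\<^bsub>E\<^esub>"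
proof (rule end_free_eqI[where S = basis_index])
  fix j assume "j \<in> basis_index"
  then obtain t i where j: "j = (t, i)" and t: "t \<in> carrier G" and i: "i < p" by auto
  have cl: "single K (t, i) \<in> carrier M" "single K (t \<otimes>\<^bsub>G\<^esub> g, i) \<in> carrier M" using t i by simp_all
  show "(op_f \<otimes>\<^bsub>E\<^esub> (\<one>\<^bsub>E\<^esub> \<ominus>\<^bsub>E\<^esub> op_g) \<oplus>\<^bsub>E\<^esub> (\<one>\<^bsub>E\<^esub> \<ominus>\<^bsub>E\<^esub> op_g)) (single K j)
      = ((\<one>\<^bsub>E\<^esub> \<ominus>\<^bsub>E\<^esub> op_g) \<otimes>\<^bsub>E\<^esub> op_f \<oplus>\<^bsub>E\<^esub> \<one>\<^bsub>E\<^esub>) (single K j)"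
    using t i cl
    by (simp add: j op_linear)
      (simp add: a_minus_def minus_add M.smult_l_minus M.smult_l_distr M.smult_r_distr M.smult_r_minus
        M.M.minus_add M.M.a_ac M.M.r_neg M.M.r_neg1 M.M.r_neg2 M.M.neg_cancel)
qed simp_all

text \<open>By \<open>falling_twist\<close> the falling factorial of \<open>op_d\<close> is \<open>(1 - g)\<^sup>p\<close> times that of the diagonal operator
  \<open>op_f\<close>, that is \<open>(1 - g\<^sup>p)(f\<^sup>p - f)\<close> up to sign: exactly what the last condition on a datum annihilates.\<close>

lemma op_d_falling: "falling E op_d p = \<zero>\<^bsub>E\<^esub>"
proof -
  have "falling E op_f p = op_f [^]\<^bsub>E\<^esub> p \<ominus>\<^bsub>E\<^esub> op_f"
    using EC.power_char[of op_f] by (simp add: a_minus_def E.M.a_ac E.M.r_neg2 E.M.r_neg1)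
  then have d: "falling E op_d p = (\<one>\<^bsub>E\<^esub> \<ominus>\<^bsub>E\<^esub> op_g [^]\<^bsub>E\<^esub> p) \<otimes>\<^bsub>E\<^esub> (op_f [^]\<^bsub>E\<^esub> p \<ominus>\<^bsub>E\<^esub> op_f)"
    using E.V.falling_twist[OF _ _ op_twist, of p] EC.one_minus_power[of op_g] by (simp add: op_d_def)
  interpret KC: char_ring K p by unfold_locales (rule prime, rule char)
  show ?thesis
    unfolding d
  proof (rule end_free_eqI[where S = basis_index])
    fix j assume "j \<in> basis_index"
    then obtain t i where j: "j = (t, i)" and t: "t \<in> carrier G" and i: "i < p" by auto
    have cl: "single K (t, i) \<in> carrier M" using t i by simp
    have "(op_f ^^ n) (single K j) = ((\<ominus>\<^bsub>K\<^esub> f t) [^]\<^bsub>K\<^esub> n) \<odot>\<^bsub>M\<^esub> single K j" for n :: nat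
      by (induction n) (use t i cl in \<open>simp_all add: j op_linear M.smult_assoc1[symmetric] m_comm\<close>)
    then have f_pow: "(op_f [^]\<^bsub>E\<^esub> n) (single K j) = ((\<ominus>\<^bsub>K\<^esub> f t) [^]\<^bsub>K\<^esub> n) \<odot>\<^bsub>M\<^esub> single K j" for n :: nat
      using cl by (simp add: j pow_iterate)
    have "(op_g ^^ n) (single K j) = single K (t \<otimes>\<^bsub>G\<^esub> g [^]\<^bsub>G\<^esub> n, i)" for n :: nat
      by (induction n) (use t i in \<open>simp_all add: j G.m_assoc\<close>)
    then have g_pow: "(op_g [^]\<^bsub>E\<^esub> n) (single K j) = single K (t \<otimes>\<^bsub>G\<^esub> g [^]\<^bsub>G\<^esub> n, i)" for n :: nat
      using cl by (simp add: j pow_iterate)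
    let ?c = "\<ominus>\<^bsub>K\<^esub> (f t [^]\<^bsub>K\<^esub> p) \<ominus>\<^bsub>K\<^esub> \<ominus>\<^bsub>K\<^esub> f t"
    have c: "?c \<in> carrier K" using t by simp
    have "(op_f [^]\<^bsub>E\<^esub> p \<ominus>\<^bsub>E\<^esub> op_f) (single K j) = ?c \<odot>\<^bsub>M\<^esub> single K j"
      using t i cl f_pow[of p] op_single(3)[OF t i] KC.neg_power[of "f t"]
      by (simp add: j op_linear) (simp add: M.smult_l_distr M.smult_l_minus a_minus_def)
    then have "((\<one>\<^bsub>E\<^esub> \<ominus>\<^bsub>E\<^esub> op_g [^]\<^bsub>E\<^esub> p) \<otimes>\<^bsub>E\<^esub> (op_f [^]\<^bsub>E\<^esub> p \<ominus>\<^bsub>E\<^esub> op_f)) (single K j)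
        = (\<one>\<^bsub>E\<^esub> \<ominus>\<^bsub>E\<^esub> op_g [^]\<^bsub>E\<^esub> p) (?c \<odot>\<^bsub>M\<^esub> single K j)"
      using cl by (simp add: j)
    also have "\<dots> = ?c \<odot>\<^bsub>M\<^esub> ((\<one>\<^bsub>E\<^esub> \<ominus>\<^bsub>E\<^esub> op_g [^]\<^bsub>E\<^esub> p) (single K j))"
      by (rule linear_smult[OF end_algebra_linear c]) (use cl in \<open>simp_all add: j\<close>)
    also have "(\<one>\<^bsub>E\<^esub> \<ominus>\<^bsub>E\<^esub> op_g [^]\<^bsub>E\<^esub> p) (single K j) = single K (t, i) \<ominus>\<^bsub>M\<^esub> single K (t \<otimes>\<^bsub>G\<^esub> g [^]\<^bsub>G\<^esub> p, i)"
      using cl g_pow[of p] by (simp add: j op_linear)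
    also have "?c \<odot>\<^bsub>M\<^esub> \<dots> = \<zero>\<^bsub>M\<^esub>"
      using datum_cases
    proof
      assume "g [^]\<^bsub>G\<^esub> p = \<one>\<^bsub>G\<^esub>"
      then show ?thesis using t cl c by (simp add: M.M.r_neg a_minus_def)
    next
      assume "\<forall>t\<in>carrier G. f t [^]\<^bsub>K\<^esub> p = f t"
      then have c0: "?c = \<zero>\<^bsub>K\<^esub>" using t by (simp add: a_minus_def l_neg)
      show ?thesis unfolding c0 using t i cl by simp
    qed
    also have "\<zero>\<^bsub>M\<^esub> = \<zero>\<^bsub>E\<^esub> (single K j)" using cl by (simp add: j)
    finally show "((\<one>\<^bsub>E\<^esub> \<ominus>\<^bsub>E\<^esub> op_g [^]\<^bsub>E\<^esub> p) \<otimes>\<^bsub>E\<^esub> (op_f [^]\<^bsub>E\<^esub> p \<ominus>\<^bsub>E\<^esub> op_f)) (single K j) = \<zero>\<^bsub>E\<^esub> (single K j)" .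
  qed simp_all
qed

text \<open>The summands commute, so the case \<open>g = 1\<close> of the Vandermonde identity applies.\<close>

lemma op_x_power: "op_x [^]\<^bsub>E\<^esub> p = op_x"
proof -
  have comm: "op_y \<otimes>\<^bsub>E\<^esub> op_d = op_d \<otimes>\<^bsub>E\<^esub> op_y"
  proof (rule end_free_eqI[where S = basis_index])
    fix j assume "j \<in> basis_index"
    then obtain t i where j: "j = (t, i)" and t: "t \<in> carrier G" and i: "i < p" by auto
    let ?i = "if Suc i < p then Suc i else 1"
    have ip: "?i < p" using p_gt_1 by simp
    then show "(op_y \<otimes>\<^bsub>E\<^esub> op_d) (single K j) = (op_d \<otimes>\<^bsub>E\<^esub> op_y) (single K j)"
      using t i by (simp add: j op_linear split del: if_split)
  qed simp_all
  have "falling E (op_d \<oplus>\<^bsub>E\<^esub> \<one>\<^bsub>E\<^esub> \<otimes>\<^bsub>E\<^esub> op_y) p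
      = falling E op_d p \<oplus>\<^bsub>E\<^esub> \<one>\<^bsub>E\<^esub> [^]\<^bsub>E\<^esub> p \<otimes>\<^bsub>E\<^esub> falling E op_y p"
    by (rule EC.falling_vandermonde_char) (simp_all add: comm)
  moreover have "falling E op_y p = \<zero>\<^bsub>E\<^esub>"
    using op_y_power by (simp add: EC.power_char_iff)
  ultimately show ?thesis
    by (simp add: op_d_falling EC.power_char_iff op_x_def)
qed

definition rep :: "('g letter list \<Rightarrow> 'k) set \<Rightarrow> ('g \<times> nat \<Rightarrow> 'k) \<Rightarrow> ('g \<times> nat \<Rightarrow> 'k)" where
  "rep = presented_hom K E (\<lambda>l. case l of Grp t \<Rightarrow> op_grp t | Xgen \<Rightarrow> op_x)"

lemma rep: "rep \<in> algebra_homs K H E" "t \<in> carrier G \<Longrightarrow> rep (e t) = op_grp t" "rep x = op_x"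
  unfolding rep_def
  by (auto intro!: third_hom[OF E.assoc_algebra_axioms] op_grp_mult op_grp_one op_commutator op_x_power)

lemma rep_linear: "rep h \<in> linear_maps K M M" if "h \<in> carrier H"
  using linear_closed[OF algebra_hom_linear[OF rep(1)] that] by (rule end_algebra_linear)

definition normal_form :: "('g letter list \<Rightarrow> 'k) set \<Rightarrow> ('g \<times> nat \<Rightarrow> 'k)" where
  "normal_form h = rep h (single K (\<one>\<^bsub>G\<^esub>, 0))"

definition monomial :: "'g \<times> nat \<Rightarrow> ('g letter list \<Rightarrow> 'k) set" where
  "monomial = (\<lambda>(t, i). e t \<otimes>\<^bsub>H\<^esub> x [^]\<^bsub>H\<^esub> i)"

lemma base_in: "single K (\<one>\<^bsub>G\<^esub>, 0) \<in> carrier M"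
  using p_gt_1 by simp

lemma normal_form_linear: "normal_form \<in> linear_maps K H M"
  unfolding normal_form_def
  by (rule linear_mapsI)
    (simp_all add: linear_closed[OF rep_linear] base_in linear_add[OF algebra_hom_linear[OF rep(1)]]
      linear_smult[OF algebra_hom_linear[OF rep(1)]])

lemma normal_form_mult: "a \<in> carrier H \<Longrightarrow> b \<in> carrier H \<Longrightarrow> normal_form (a \<otimes>\<^bsub>H\<^esub> b) = rep a (normal_form b)"
  unfolding normal_form_def using base_in by (simp add: algebra_hom_mult[OF rep(1)])

lemma monomial_closed [simp]: "j \<in> basis_index \<Longrightarrow> monomial j \<in> carrier H"
  by (auto simp: monomial_def)

lemma normal_form_monomial: "j \<in> basis_index \<Longrightarrow> normal_form (monomial j) = single K j"
proof -
  assume "j \<in> basis_index"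
  then obtain t i where j: "j = (t, i)" and t: "t \<in> carrier G" and i: "i < p" by auto
  have d: "op_d (single K (\<one>\<^bsub>G\<^esub>, n)) = \<zero>\<^bsub>M\<^esub>" if "n < p" for n
    using that by (simp add: a_minus_def M.M.r_neg)
  have "normal_form (x [^]\<^bsub>H\<^esub> n) = single K (\<one>\<^bsub>G\<^esub>, n)" if "n < p" for n
    using that
  proof (induction n)
    case 0
    show ?case using base_in by (simp add: normal_form_def algebra_hom_one[OF rep(1)])
  next
    case (Suc n)
    have "normal_form (x [^]\<^bsub>H\<^esub> Suc n) = op_x (single K (\<one>\<^bsub>G\<^esub>, n))"
      unfolding H.V.nat_pow_Suc2[OF x_closed]
      using Suc normal_form_mult[OF x_closed, of "x [^]\<^bsub>H\<^esub> n"] by (simp only: rep(3) H.V.nat_pow_closed x_closed Suc_lessD)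
    also have "\<dots> = single K (\<one>\<^bsub>G\<^esub>, Suc n)"
      using Suc.prems d[of n] by (simp del: op_d_single)
    finally show ?case .
  qed
  then show ?thesis
    using t i by (simp add: j monomial_def normal_form_mult rep(2))
qed

text \<open>Left multiplication on \<open>H\<close> and the operators on \<open>M\<close> correspond under \<^const>\<open>monomial\<close>, so
  starting from \<open>1\<close> every element is recovered from its normal form.\<close>

lemma monomials_span:
  assumes h: "h \<in> carrier H"
  shows "lin_ext K H monomial (normal_form h) = h"
proof -
  have lin: "lin_ext K H monomial \<in> linear_maps K M H"
    by (rule lin_ext_linear[OF H.module_axioms]) (rule monomial_closed)
  have single: "lin_ext K H monomial (single K j) = monomial j" if "j \<in> basis_index" for j
    by (rule lin_ext_single[OF H.module_axioms]) (rule monomial_closed[OF that])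
  have mon: "monomial (t, i) = e t \<otimes>\<^bsub>H\<^esub> x [^]\<^bsub>H\<^esub> i" for t i
    by (simp add: monomial_def)
  note nl = linear_closed[OF normal_form_linear]
  have eq: "lin_ext K H monomial (\<phi> a) = c \<otimes>\<^bsub>H\<^esub> lin_ext K H monomial a"
    if "\<phi> \<in> carrier E" "c \<in> carrier H" "a \<in> carrier M"
      and "\<And>t i. t \<in> carrier G \<Longrightarrow> i < p \<Longrightarrow>
        lin_ext K H monomial (\<phi> (single K (t, i))) = c \<otimes>\<^bsub>H\<^esub> monomial (t, i)" for \<phi> c a
  proof (rule linear_free_eqI[OF H.module_axioms _ _ _ that(3)])
    show "(\<lambda>a. lin_ext K H monomial (\<phi> a)) \<in> linear_maps K M H"
      by (rule linear_compose[OF end_algebra_linear[OF that(1)] lin])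
    show "(\<lambda>a. c \<otimes>\<^bsub>H\<^esub> lin_ext K H monomial a) \<in> linear_maps K M H"
      using that(2) by (intro linear_mapsI)
        (simp_all add: linear_closed[OF lin] linear_add[OF lin] linear_smult[OF lin] H.V.r_distr H.smult_mult_right)
  qed (use that(4) single in auto)
  show ?thesis
    using h
  proof (induction h rule: H_induct_left)
    case one
    have "lin_ext K H monomial (single K (\<one>\<^bsub>G\<^esub>, 0)) = monomial (\<one>\<^bsub>G\<^esub>, 0)"
      using p_gt_1 by (intro single) simp
    moreover have "normal_form \<one>\<^bsub>H\<^esub> = single K (\<one>\<^bsub>G\<^esub>, 0)"
      using base_in by (simp add: normal_form_def algebra_hom_one[OF rep(1)])
    ultimately show ?case
      by (simp add: monomial_def e_one)
  next
    case (add a b)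
    then show ?case by (simp add: linear_add[OF normal_form_linear] linear_add[OF lin] nl)
  next
    case (smult c a)
    then show ?case by (simp add: linear_smult[OF normal_form_linear] linear_smult[OF lin] nl)
  next
    case (grp t a)
    have "lin_ext K H monomial (op_grp t (normal_form a)) = e t \<otimes>\<^bsub>H\<^esub> lin_ext K H monomial (normal_form a)"
      by (rule eq) (use grp in \<open>simp_all add: nl single mon H.V.m_assoc[symmetric] e_mult\<close>)
    then show ?case using grp by (simp add: normal_form_mult rep(2))
  next
    case (x a)
    have "lin_ext K H monomial (op_x (normal_form a)) = x \<otimes>\<^bsub>H\<^esub> lin_ext K H monomial (normal_form a)"
    proof (rule eq)
      fix t i assume ti: "t \<in> carrier G" "i < p"
      let ?i = "if Suc i < p then Suc i else 1"
      have ip: "?i < p" using p_gt_1 by simp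
      have xi: "x \<otimes>\<^bsub>H\<^esub> x [^]\<^bsub>H\<^esub> i = x [^]\<^bsub>H\<^esub> ?i"
      proof (cases "Suc i < p")
        case True
        then show ?thesis using H.V.nat_pow_Suc2[OF x_closed, of i] by simp
      next
        case False
        then have pi: "Suc i = p" using ti by simp
        have "x \<otimes>\<^bsub>H\<^esub> x [^]\<^bsub>H\<^esub> i = x [^]\<^bsub>H\<^esub> Suc i"
          by (rule H.V.nat_pow_Suc2[symmetric]) simp
        also have "\<dots> = x" by (simp only: pi x_power)
        finally show ?thesis using False by simp
      qed
      have cl: "single K (t, i) \<in> carrier M" "single K (t \<otimes>\<^bsub>G\<^esub> g, i) \<in> carrier M" "single K (t, ?i) \<in> carrier M"
        using ti ip by simp_all
      have "lin_ext K H monomial (op_x (single K (t, i)))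
          = ((\<ominus>\<^bsub>K\<^esub> f t) \<odot>\<^bsub>H\<^esub> monomial (t, i) \<ominus>\<^bsub>H\<^esub> (\<ominus>\<^bsub>K\<^esub> f t) \<odot>\<^bsub>H\<^esub> monomial (t \<otimes>\<^bsub>G\<^esub> g, i)) \<oplus>\<^bsub>H\<^esub> monomial (t, ?i)"
        using ti ip cl
        by (simp add: linear_add[OF lin] linear_smult[OF lin] single
            linear_minus[OF free_module_module H.module_axioms lin] split del: if_split)
      also have "\<dots> = e t \<otimes>\<^bsub>H\<^esub> ((x \<ominus>\<^bsub>H\<^esub> f t \<odot>\<^bsub>H\<^esub> (\<one>\<^bsub>H\<^esub> \<ominus>\<^bsub>H\<^esub> e g)) \<otimes>\<^bsub>H\<^esub> x [^]\<^bsub>H\<^esub> i)"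
        unfolding monomial_def prod.case xi[symmetric]
        using ti
        by (simp add: a_minus_def H.smult_l_minus H.smult_r_minus H.smult_r_distr H.V.l_distr H.V.r_distr
            H.V.l_minus H.V.r_minus H.smult_mult_left H.smult_mult_right H.V.m_assoc[symmetric] e_mult
            H.M.minus_add H.M.a_ac)
      also have "\<dots> = x \<otimes>\<^bsub>H\<^esub> monomial (t, i)"
        using ti x_e[OF ti(1)] by (simp add: monomial_def twist_def H.V.m_assoc[symmetric])
      finally show "lin_ext K H monomial (op_x (single K (t, i))) = x \<otimes>\<^bsub>H\<^esub> monomial (t, i)" .
    qed (use x in \<open>simp_all add: nl\<close>)
    then show ?case using x by (simp add: normal_form_mult rep(3))
  qed
qed

lemma third_eqI:
  assumes Z: "module K Z" and \<phi>: "\<phi> \<in> linear_maps K H Z" and \<psi>: "\<psi> \<in> linear_maps K H Z"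
    and eq: "\<And>t i. t \<in> carrier G \<Longrightarrow> i < p \<Longrightarrow> \<phi> (e t \<otimes>\<^bsub>H\<^esub> x [^]\<^bsub>H\<^esub> i) = \<psi> (e t \<otimes>\<^bsub>H\<^esub> x [^]\<^bsub>H\<^esub> i)"
    and h: "h \<in> carrier H"
  shows "\<phi> h = \<psi> h"
proof -
  have lin: "lin_ext K H monomial \<in> linear_maps K M H"
    by (rule lin_ext_linear[OF H.module_axioms]) (rule monomial_closed)
  have single: "lin_ext K H monomial (single K j) = monomial j" if "j \<in> basis_index" for j
    by (rule lin_ext_single[OF H.module_axioms]) (rule monomial_closed[OF that])
  have "\<phi> (lin_ext K H monomial (normal_form h)) = \<psi> (lin_ext K H monomial (normal_form h))"
    by (rule linear_free_eqI[OF Z linear_compose[OF lin \<phi>] linear_compose[OF lin \<psi>] _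
          linear_closed[OF normal_form_linear h]])
      (use eq in \<open>auto simp: single\<close>, simp add: monomial_def)
  then show ?thesis by (simp add: monomials_span h)
qed

lemma third_basis:
  assumes Z: "module K Z" and \<phi>: "\<And>t i. t \<in> carrier G \<Longrightarrow> i < p \<Longrightarrow> \<phi> t i \<in> carrier Z"
  obtains L where "L \<in> linear_maps K H Z"
    and "\<And>t i. t \<in> carrier G \<Longrightarrow> i < p \<Longrightarrow> L (e t \<otimes>\<^bsub>H\<^esub> x [^]\<^bsub>H\<^esub> i) = \<phi> t i"
proof
  let ?L = "\<lambda>h. lin_ext K Z (\<lambda>(t, i). \<phi> t i) (normal_form h)"
  show "?L \<in> linear_maps K H Z"
    by (rule linear_compose[OF normal_form_linear lin_ext_linear[OF Z]]) (use \<phi> in auto)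
  show "?L (e t \<otimes>\<^bsub>H\<^esub> x [^]\<^bsub>H\<^esub> i) = \<phi> t i" if "t \<in> carrier G" "i < p" for t i
    using normal_form_monomial[of "(t, i)"] lin_ext_single[OF Z, of "\<lambda>(t, i). \<phi> t i" "(t, i)"] that \<phi>
    by (simp add: monomial_def)
qed

end


section \<open>The Hopf algebra structure\<close>

lemma presented_hom_cong:
  assumes "carrier Z = carrier Z'" "ring.zero Z = ring.zero Z'" "add Z = add Z'" "smult Z = smult Z'"
    and "monoid.mult Z = monoid.mult Z'" "one Z = one Z'"
  shows "presented_hom K Z = presented_hom K Z'"
  by (intro ext) (simp add: presented_hom_def free_eval_def module_part_cong(4)[OF assms(1-4)] assms(5,6))

lemma third_hopf_maps:
  fixes K p G g f
  defines "V \<equiv> quotient_algebra (third_free K G) (third_ideal K p G g f)"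
    and "H \<equiv> third_hopf_algebra K p G g f"
    and "e \<equiv> third_grp K p G g f" and "x \<equiv> third_x K p G g f"
  shows "comul H = presented_hom K (tensor_algebra K V V) (\<lambda>l. case l of Grp t \<Rightarrow> pure_tensor K V V (e t) (e t)
      | Xgen \<Rightarrow> pure_tensor K V V x \<one>\<^bsub>V\<^esub> \<oplus>\<^bsub>tensor_algebra K V V\<^esub> pure_tensor K V V (e g) x)"
    and "counit H = presented_hom K (base_algebra K) (\<lambda>l. case l of Grp t \<Rightarrow> \<one>\<^bsub>K\<^esub> | Xgen \<Rightarrow> \<zero>\<^bsub>K\<^esub>)"
    and "antipode H = presented_hom K (opposite_algebra V)
      (\<lambda>l. case l of Grp t \<Rightarrow> e (inv\<^bsub>G\<^esub> t) | Xgen \<Rightarrow> \<ominus>\<^bsub>V\<^esub> (e (inv\<^bsub>G\<^esub> g) \<otimes>\<^bsub>V\<^esub> x))"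
  unfolding assms third_hopf_algebra_def Let_def by (simp_all add: hopf.defs module.defs del: third_quotient tensor_algebra_sel tensor_algebra_maps)

lemma opposite_pow:
  assumes "monoid V" "a \<in> carrier V"
  shows "a [^]\<^bsub>opposite_algebra V\<^esub> (n::nat) = a [^]\<^bsub>V\<^esub> n"
proof (induction n)
  case (Suc n)
  have "a [^]\<^bsub>opposite_algebra V\<^esub> Suc n = a \<otimes>\<^bsub>V\<^esub> a [^]\<^bsub>opposite_algebra V\<^esub> n"
    by (simp add: nat_pow_def)
  then show ?case
    by (simp only: Suc monoid.nat_pow_Suc2[OF assms])
qed (simp add: nat_pow_def)

lemma bilinear_neg:
  assumes "module K V" "module K W" "module K Z" "\<phi> \<in> bilinear_maps K V W Z" "a \<in> carrier V" "b \<in> carrier W"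
  shows "\<phi> (\<ominus>\<^bsub>V\<^esub> a) b = \<ominus>\<^bsub>Z\<^esub> \<phi> a b" "\<phi> a (\<ominus>\<^bsub>W\<^esub> b) = \<ominus>\<^bsub>Z\<^esub> \<phi> a b"
  using linear_neg[OF assms(1,3) bilinear_left[OF assms(4,6)] assms(5)]
    linear_neg[OF assms(2,3) bilinear_right[OF assms(4,5)] assms(6)] by simp_all

context third_type
begin

abbreviation "T \<equiv> tensor_module K H H"
abbreviation "TA \<equiv> tensor_algebra K H H"
abbreviation "pure \<equiv> pure_tensor K H H"

lemmas H_module = H.module_axioms
lemmas T_module = tensor_module_module[OF H_module H_module]
lemmas TA_assoc = tensor_assoc_algebra[OF H.assoc_algebra_axioms H.assoc_algebra_axioms]
lemmas pure_H_simps = pure_closed[OF H_module H_module] pure_add_left[OF H_module H_module]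
  pure_add_right[OF H_module H_module] pure_smult_left[OF H_module H_module] pure_smult_right[OF H_module H_module]
  bilinear_neg[OF H_module H_module T_module pure_bilinear[OF H_module H_module]]
lemmas pure_H_mult = pure_mult[OF H.assoc_algebra_axioms H.assoc_algebra_axioms]

interpretation TA: assoc_algebra K TA by (rule TA_assoc)
interpretation TC: char_ring TA p by (rule TA.char_ring[OF prime char])
interpretation T: module K T by (rule T_module)

lemma comul_eq: "comul H = presented_hom K TA
    (\<lambda>l. case l of Grp t \<Rightarrow> pure (e t) (e t) | Xgen \<Rightarrow> pure x \<one>\<^bsub>H\<^esub> \<oplus>\<^bsub>TA\<^esub> pure (e g) x)"
  by (simp only: third_hopf_maps third_quotient)

lemmas counit_eq = third_hopf_maps(2)[of K p G g f]

lemma antipode_eq: "antipode H = presented_hom K (opposite_algebra H)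
    (\<lambda>l. case l of Grp t \<Rightarrow> e (inv\<^bsub>G\<^esub> t) | Xgen \<Rightarrow> \<ominus>\<^bsub>H\<^esub> (e (inv\<^bsub>G\<^esub> g) \<otimes>\<^bsub>H\<^esub> x))"
proof -
  let ?V = "quotient_algebra (third_free K G) (third_ideal K p G g f)"
  have inv: "a_inv ?V = a_inv H"
    by (simp add: fun_eq_iff a_inv_def m_inv_def)
  have "antipode H = presented_hom K (opposite_algebra ?V)
    (\<lambda>l. case l of Grp t \<Rightarrow> e (inv\<^bsub>G\<^esub> t) | Xgen \<Rightarrow> \<ominus>\<^bsub>?V\<^esub> (e (inv\<^bsub>G\<^esub> g) \<otimes>\<^bsub>?V\<^esub> x))"
    by (rule third_hopf_maps)
  moreover have "presented_hom K (opposite_algebra ?V) = presented_hom K (opposite_algebra H)"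
    by (rule presented_hom_cong) simp_all
  ultimately show ?thesis unfolding inv third_quotient by (rule trans[OF _ fun_cong])
qed

lemma x_e_expand: "t \<in> carrier G \<Longrightarrow> x \<otimes>\<^bsub>H\<^esub> e t = e t \<otimes>\<^bsub>H\<^esub> x \<ominus>\<^bsub>H\<^esub> f t \<odot>\<^bsub>H\<^esub> (e t \<ominus>\<^bsub>H\<^esub> e (t \<otimes>\<^bsub>G\<^esub> g))"
  by (simp add: x_e twist_def a_minus_def H.V.r_distr H.V.r_minus H.smult_mult_right e_mult)

text \<open>The relation that needs an idea is \<open>\<xi>\<^sup>p = \<xi>\<close> for \<open>\<xi> = x \<otimes> 1 + g \<otimes> x\<close>. It is the Vandermonde
  identity for \<open>y = x \<otimes> 1\<close> and \<open>z = 1 \<otimes> x\<close>, both of which have vanishing falling factorial.\<close>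

lemma
  shows comul_hom: "comul H \<in> algebra_homs K H TA"
    and comul_e: "t \<in> carrier G \<Longrightarrow> comul H (e t) = pure (e t) (e t)"
    and comul_x: "comul H x = pure x \<one>\<^bsub>H\<^esub> \<oplus>\<^bsub>T\<^esub> pure (e g) x"
proof -
  let ?E = "\<lambda>t. pure (e t) (e t)" and ?\<xi> = "pure x \<one>\<^bsub>H\<^esub> \<oplus>\<^bsub>TA\<^esub> pure (e g) x"
  have 1: "?E t \<in> carrier TA" if "t \<in> carrier G" for t
    using that by (simp add: pure_H_simps)
  have 2: "?\<xi> \<in> carrier TA" by (simp add: pure_H_simps)
  have 3: "?E s \<otimes>\<^bsub>TA\<^esub> ?E t = ?E (s \<otimes>\<^bsub>G\<^esub> t)" if "s \<in> carrier G" "t \<in> carrier G" for s t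
    using that by (simp add: pure_H_mult e_mult)
  have 4: "?E \<one>\<^bsub>G\<^esub> = \<one>\<^bsub>TA\<^esub>" by (simp add: e_one)
  have 5: "?E t \<otimes>\<^bsub>TA\<^esub> ?\<xi> \<ominus>\<^bsub>TA\<^esub> ?\<xi> \<otimes>\<^bsub>TA\<^esub> ?E t = f t \<odot>\<^bsub>TA\<^esub> (?E t \<otimes>\<^bsub>TA\<^esub> (\<one>\<^bsub>TA\<^esub> \<ominus>\<^bsub>TA\<^esub> ?E g))"
    if t: "t \<in> carrier G" for t
  proof -
    have cl: "pure a b \<in> carrier TA" if "a \<in> carrier H" "b \<in> carrier H" for a b
      using that by (simp add: pure_H_simps)
    have neg: "\<ominus>\<^bsub>T\<^esub> a = \<ominus>\<^bsub>TA\<^esub> a" for a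
      by (simp add: a_inv_def m_inv_def)
    have "?E t \<otimes>\<^bsub>TA\<^esub> ?\<xi> = pure (e t \<otimes>\<^bsub>H\<^esub> x) (e t) \<oplus>\<^bsub>TA\<^esub> pure (e (t \<otimes>\<^bsub>G\<^esub> g)) (e t \<otimes>\<^bsub>H\<^esub> x)"
      using t by (subst TA.V.r_distr) (simp_all add: pure_H_mult e_mult pure_H_simps)
    moreover have "?\<xi> \<otimes>\<^bsub>TA\<^esub> ?E t = pure (x \<otimes>\<^bsub>H\<^esub> e t) (e t) \<oplus>\<^bsub>TA\<^esub> pure (e (t \<otimes>\<^bsub>G\<^esub> g)) (x \<otimes>\<^bsub>H\<^esub> e t)"
      using t by (subst TA.V.l_distr) (simp_all add: pure_H_mult e_mult pure_H_simps g_central)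
    moreover have "pure (x \<otimes>\<^bsub>H\<^esub> e t) (e t) = pure (e t \<otimes>\<^bsub>H\<^esub> x) (e t)
        \<ominus>\<^bsub>TA\<^esub> f t \<odot>\<^bsub>TA\<^esub> (pure (e t) (e t) \<ominus>\<^bsub>TA\<^esub> pure (e (t \<otimes>\<^bsub>G\<^esub> g)) (e t))"
      using t by (simp add: x_e_expand a_minus_def pure_H_simps neg)
    moreover have "pure (e (t \<otimes>\<^bsub>G\<^esub> g)) (x \<otimes>\<^bsub>H\<^esub> e t) = pure (e (t \<otimes>\<^bsub>G\<^esub> g)) (e t \<otimes>\<^bsub>H\<^esub> x)
        \<ominus>\<^bsub>TA\<^esub> f t \<odot>\<^bsub>TA\<^esub> (pure (e (t \<otimes>\<^bsub>G\<^esub> g)) (e t) \<ominus>\<^bsub>TA\<^esub> pure (e (t \<otimes>\<^bsub>G\<^esub> g)) (e (t \<otimes>\<^bsub>G\<^esub> g)))"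
      using t by (simp add: x_e_expand a_minus_def pure_H_simps neg)
    moreover have "?E t \<otimes>\<^bsub>TA\<^esub> (\<one>\<^bsub>TA\<^esub> \<ominus>\<^bsub>TA\<^esub> ?E g) = ?E t \<ominus>\<^bsub>TA\<^esub> ?E (t \<otimes>\<^bsub>G\<^esub> g)"
      unfolding a_minus_def using t 1 3[OF t g_closed]
      by (subst TA.V.r_distr) (simp_all add: TA.V.r_minus del: tensor_algebra_sel)
    ultimately show ?thesis
      using cl[of "e t \<otimes>\<^bsub>H\<^esub> x" "e t"] cl[of "e (t \<otimes>\<^bsub>G\<^esub> g)" "e t \<otimes>\<^bsub>H\<^esub> x"] cl[of "e t" "e t"]
        cl[of "e (t \<otimes>\<^bsub>G\<^esub> g)" "e t"] cl[of "e (t \<otimes>\<^bsub>G\<^esub> g)" "e (t \<otimes>\<^bsub>G\<^esub> g)"] t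
      by (simp add: a_minus_def TA.smult_r_distr TA.smult_r_minus TA.M.minus_add TA.M.a_ac
          TA.M.r_neg TA.M.r_neg1 TA.M.r_neg2 TA.M.neg_cancel del: tensor_algebra_sel)
  qed
  have 6: "?\<xi> [^]\<^bsub>TA\<^esub> p = ?\<xi>"
  proof -
    let ?y = "pure x \<one>\<^bsub>H\<^esub>" and ?g = "pure (e g) \<one>\<^bsub>H\<^esub>" and ?z = "pure \<one>\<^bsub>H\<^esub> x"
    have left: "(\<lambda>a. pure a \<one>\<^bsub>H\<^esub>) \<in> algebra_homs K H TA" and right: "(\<lambda>a. pure \<one>\<^bsub>H\<^esub> a) \<in> algebra_homs K H TA"
      by (intro algebra_homsI linear_mapsI; simp add: pure_H_simps pure_H_mult)+
    have cl: "?y \<in> carrier TA" "?g \<in> carrier TA" "?z \<in> carrier TA" by (simp_all add: pure_H_simps)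
    have y: "falling TA ?y p = \<zero>\<^bsub>TA\<^esub>" and z: "falling TA ?z p = \<zero>\<^bsub>TA\<^esub>"
      using algebra_hom_pow[OF left H.V.is_monoid x_closed, of p] algebra_hom_pow[OF right H.V.is_monoid x_closed, of p]
        TC.power_char_iff[OF cl(1)] TC.power_char_iff[OF cl(3)] by (simp_all add: x_power)
    have gz: "?\<xi> = ?y \<oplus>\<^bsub>TA\<^esub> ?g \<otimes>\<^bsub>TA\<^esub> ?z" by (simp add: pure_H_mult)
    have xg: "x \<otimes>\<^bsub>H\<^esub> e g \<oplus>\<^bsub>H\<^esub> e g = e g \<otimes>\<^bsub>H\<^esub> x \<oplus>\<^bsub>H\<^esub> e g \<otimes>\<^bsub>H\<^esub> e g"
      by (simp add: x_e_expand a_minus_def e_mult H.M.minus_add H.M.a_ac H.M.r_neg H.M.r_neg1 H.M.r_neg2 H.M.neg_cancel)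
    have "?y \<otimes>\<^bsub>TA\<^esub> ?g \<oplus>\<^bsub>TA\<^esub> ?g = pure (x \<otimes>\<^bsub>H\<^esub> e g \<oplus>\<^bsub>H\<^esub> e g) \<one>\<^bsub>H\<^esub>"
      by (simp add: pure_H_mult pure_H_simps)
    also have "\<dots> = ?g \<otimes>\<^bsub>TA\<^esub> ?y \<oplus>\<^bsub>TA\<^esub> ?g \<otimes>\<^bsub>TA\<^esub> ?g"
      unfolding xg by (simp add: pure_H_mult pure_H_simps)
    finally have yg: "?y \<otimes>\<^bsub>TA\<^esub> ?g \<oplus>\<^bsub>TA\<^esub> ?g = ?g \<otimes>\<^bsub>TA\<^esub> ?y \<oplus>\<^bsub>TA\<^esub> ?g \<otimes>\<^bsub>TA\<^esub> ?g" .
    have comm: "?z \<otimes>\<^bsub>TA\<^esub> ?y = ?y \<otimes>\<^bsub>TA\<^esub> ?z" "?z \<otimes>\<^bsub>TA\<^esub> ?g = ?g \<otimes>\<^bsub>TA\<^esub> ?z"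
      by (simp_all add: pure_H_mult)
    have "falling TA ?\<xi> p = \<zero>\<^bsub>TA\<^esub>"
      unfolding gz TC.falling_vandermonde_char[OF cl yg comm] y z
      using cl by (simp del: tensor_algebra_sel)
    then show ?thesis using TC.power_char_iff[OF 2] by blast
  qed
  note hom = third_hom[OF TA_assoc, where E = ?E and \<xi> = ?\<xi>, OF 1 2 3 4 5 6]
  show "comul H \<in> algebra_homs K H TA" unfolding comul_eq by (rule hom(1))
  show "t \<in> carrier G \<Longrightarrow> comul H (e t) = pure (e t) (e t)" unfolding comul_eq by (rule hom(2))
  show "comul H x = pure x \<one>\<^bsub>H\<^esub> \<oplus>\<^bsub>T\<^esub> pure (e g) x" unfolding comul_eq using hom(3) by simp
qed

lemma
  shows counit_hom: "counit H \<in> algebra_homs K H (base_algebra K)"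
    and counit_e: "t \<in> carrier G \<Longrightarrow> counit H (e t) = \<one>\<^bsub>K\<^esub>"
    and counit_x: "counit H x = \<zero>\<^bsub>K\<^esub>"
proof -
  interpret B: assoc_algebra K "base_algebra K" by (rule base_algebra_assoc)
  have neg: "\<one>\<^bsub>K\<^esub> \<ominus>\<^bsub>base_algebra K\<^esub> \<one>\<^bsub>K\<^esub> = \<zero>\<^bsub>K\<^esub>"
    using B.M.r_neg[of "\<one>\<^bsub>K\<^esub>"] by (simp add: a_minus_def)
  have "\<zero>\<^bsub>K\<^esub> \<ominus>\<^bsub>base_algebra K\<^esub> \<zero>\<^bsub>K\<^esub> = \<zero>\<^bsub>K\<^esub>"
    using B.M.r_neg[of "\<zero>\<^bsub>K\<^esub>"] by (simp add: a_minus_def)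
  moreover have "\<zero>\<^bsub>K\<^esub> [^]\<^bsub>base_algebra K\<^esub> p = \<zero>\<^bsub>K\<^esub>"
    using B.V.nat_pow_zero[of p] p_gt_1 by simp
  ultimately have *: "\<zero>\<^bsub>K\<^esub> \<ominus>\<^bsub>base_algebra K\<^esub> \<zero>\<^bsub>K\<^esub> = \<zero>\<^bsub>K\<^esub>" "\<zero>\<^bsub>K\<^esub> [^]\<^bsub>base_algebra K\<^esub> p = \<zero>\<^bsub>K\<^esub>" by blast+
  note hom = third_hom[OF base_algebra_assoc, where E = "\<lambda>t. \<one>\<^bsub>K\<^esub>" and \<xi> = "\<zero>\<^bsub>K\<^esub>"]
  show "counit H \<in> algebra_homs K H (base_algebra K)"
    unfolding counit_eq by (rule hom(1)) (simp_all add: neg *)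
  show "t \<in> carrier G \<Longrightarrow> counit H (e t) = \<one>\<^bsub>K\<^esub>"
    unfolding counit_eq by (rule hom(2)) (simp_all add: neg *)
  show "counit H x = \<zero>\<^bsub>K\<^esub>"
    unfolding counit_eq by (rule hom(3)) (simp_all add: neg *)
qed

lemma g_inv_central: "t \<in> carrier G \<Longrightarrow> inv\<^bsub>G\<^esub> g \<otimes>\<^bsub>G\<^esub> t = t \<otimes>\<^bsub>G\<^esub> inv\<^bsub>G\<^esub> g"
  using g_central[of t] by (metis G.inv_closed G.inv_solve_left G.inv_solve_right G.m_assoc G.m_closed g_closed)

text \<open>For the power relation, the falling factorial of \<open>g\<^sup>-\<^sup>1(-x)\<close> separates by \<open>falling_twist\<close>, and that of \<open>-x\<close>
  vanishes together with that of \<open>x\<close>.\<close>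

lemma
  shows antipode_hom: "antipode H \<in> algebra_homs K H (opposite_algebra H)"
    and antipode_e: "t \<in> carrier G \<Longrightarrow> antipode H (e t) = e (inv\<^bsub>G\<^esub> t)"
    and antipode_x: "antipode H x = \<ominus>\<^bsub>H\<^esub> (e (inv\<^bsub>G\<^esub> g) \<otimes>\<^bsub>H\<^esub> x)"
proof -
  let ?O = "opposite_algebra H" and ?E = "\<lambda>t. e (inv\<^bsub>G\<^esub> t)" and ?\<xi> = "\<ominus>\<^bsub>H\<^esub> (e (inv\<^bsub>G\<^esub> g) \<otimes>\<^bsub>H\<^esub> x)"
  have minus: "a \<ominus>\<^bsub>?O\<^esub> b = a \<ominus>\<^bsub>H\<^esub> b" for a b
    by (simp add: a_minus_def a_inv_def m_inv_def)
  have 1: "?E t \<in> carrier ?O" if "t \<in> carrier G" for t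
    using that by simp
  have 2: "?\<xi> \<in> carrier ?O" by simp
  have 3: "?E s \<otimes>\<^bsub>?O\<^esub> ?E t = ?E (s \<otimes>\<^bsub>G\<^esub> t)" if "s \<in> carrier G" "t \<in> carrier G" for s t
    using that by (simp add: e_mult G.inv_mult_group)
  have 4: "?E \<one>\<^bsub>G\<^esub> = \<one>\<^bsub>?O\<^esub>" by (simp add: e_one)
  have 5: "?E t \<otimes>\<^bsub>?O\<^esub> ?\<xi> \<ominus>\<^bsub>?O\<^esub> ?\<xi> \<otimes>\<^bsub>?O\<^esub> ?E t = f t \<odot>\<^bsub>?O\<^esub> (?E t \<otimes>\<^bsub>?O\<^esub> (\<one>\<^bsub>?O\<^esub> \<ominus>\<^bsub>?O\<^esub> ?E g))"
    if t: "t \<in> carrier G" for t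
  proof -
    let ?s = "inv\<^bsub>G\<^esub> t" and ?h = "inv\<^bsub>G\<^esub> g"
    have s: "?s \<in> carrier G" using t by simp
    have hg: "?h \<otimes>\<^bsub>G\<^esub> (?s \<otimes>\<^bsub>G\<^esub> g) = ?s"
      using s g_central[OF s] by (metis G.inv_closed G.inv_solve_left g_closed G.m_closed)
    have 1: "(e ?h \<otimes>\<^bsub>H\<^esub> x) \<otimes>\<^bsub>H\<^esub> e ?s = e (?h \<otimes>\<^bsub>G\<^esub> ?s) \<otimes>\<^bsub>H\<^esub> x \<ominus>\<^bsub>H\<^esub> (\<ominus>\<^bsub>K\<^esub> f t) \<odot>\<^bsub>H\<^esub> (e (?h \<otimes>\<^bsub>G\<^esub> ?s) \<ominus>\<^bsub>H\<^esub> e ?s)"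
      using t s hg
      by (simp add: H.V.m_assoc x_e_expand)
        (simp add: a_minus_def H.V.r_distr H.V.r_minus H.smult_mult_right H.V.m_assoc[symmetric] e_mult)
    have 2: "e ?s \<otimes>\<^bsub>H\<^esub> (e ?h \<otimes>\<^bsub>H\<^esub> x) = e (?h \<otimes>\<^bsub>G\<^esub> ?s) \<otimes>\<^bsub>H\<^esub> x"
      using s by (simp add: H.V.m_assoc[symmetric] e_mult g_inv_central)
    have "?\<xi> \<otimes>\<^bsub>H\<^esub> e ?s \<ominus>\<^bsub>H\<^esub> e ?s \<otimes>\<^bsub>H\<^esub> ?\<xi> = f t \<odot>\<^bsub>H\<^esub> ((\<one>\<^bsub>H\<^esub> \<ominus>\<^bsub>H\<^esub> e ?h) \<otimes>\<^bsub>H\<^esub> e ?s)"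
      using t s
      by (simp add: H.V.l_minus H.V.r_minus 1 2)
        (simp add: a_minus_def H.V.l_distr H.V.l_minus e_mult H.smult_r_distr H.smult_r_minus H.smult_l_minus
          H.M.minus_add H.M.a_ac H.M.r_neg H.M.r_neg1 H.M.r_neg2 H.M.neg_cancel)
    then show ?thesis by (simp add: minus)
  qed
  have 6: "?\<xi> [^]\<^bsub>?O\<^esub> p = ?\<xi>"
  proof -
    let ?h = "inv\<^bsub>G\<^esub> g"
    have tw: "(\<ominus>\<^bsub>H\<^esub> x) \<otimes>\<^bsub>H\<^esub> e ?h \<oplus>\<^bsub>H\<^esub> e ?h = e ?h \<otimes>\<^bsub>H\<^esub> (\<ominus>\<^bsub>H\<^esub> x) \<oplus>\<^bsub>H\<^esub> \<one>\<^bsub>H\<^esub>"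
      by (simp add: H.V.l_minus H.V.r_minus x_e_expand)
        (simp add: a_minus_def e_one H.smult_l_minus H.smult_r_distr H.smult_r_minus
          H.M.minus_add H.M.a_ac H.M.r_neg H.M.r_neg1 H.M.r_neg2 H.M.neg_cancel)
    have "falling H (\<ominus>\<^bsub>H\<^esub> x) p = \<zero>\<^bsub>H\<^esub>"
      using HC.power_char_iff[of "\<ominus>\<^bsub>H\<^esub> x"] HC.neg_power[of x] by (simp add: x_power)
    then have "falling H (e ?h \<otimes>\<^bsub>H\<^esub> (\<ominus>\<^bsub>H\<^esub> x)) p = \<zero>\<^bsub>H\<^esub>"
      using H.V.falling_twist[OF _ _ tw, of p] by simp
    then have "?\<xi> [^]\<^bsub>H\<^esub> p = ?\<xi>"
      using HC.power_char_iff[of "e ?h \<otimes>\<^bsub>H\<^esub> (\<ominus>\<^bsub>H\<^esub> x)"] by (simp add: H.V.r_minus)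
    then show ?thesis by (simp add: opposite_pow[OF H.V.is_monoid])
  qed
  note hom = third_hom[OF opposite_algebra_assoc[OF H.assoc_algebra_axioms], where E = ?E and \<xi> = ?\<xi>, OF 1 2 3 4 5 6]
  show "antipode H \<in> algebra_homs K H ?O" unfolding antipode_eq by (rule hom(1))
  show "t \<in> carrier G \<Longrightarrow> antipode H (e t) = e (inv\<^bsub>G\<^esub> t)" unfolding antipode_eq by (rule hom(2))
  show "antipode H x = ?\<xi>" unfolding antipode_eq by (rule hom(3))
qed

end


context third_type
begin

interpretation TA: assoc_algebra K TA by (rule TA_assoc)
interpretation T: module K T by (rule T_module)

lemma third_hom_eqI:
  assumes \<phi>: "\<phi> \<in> algebra_homs K H Z" and \<psi>: "\<psi> \<in> algebra_homs K H Z"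
    and e: "\<And>t. t \<in> carrier G \<Longrightarrow> \<phi> (e t) = \<psi> (e t)" and x: "\<phi> x = \<psi> x" and h: "h \<in> carrier H"
  shows "\<phi> h = \<psi> h"
  using h
proof (induction h rule: H_induct_left)
  case one
  show ?case by (simp add: algebra_hom_one[OF \<phi>] algebra_hom_one[OF \<psi>])
next
  case (add a b)
  then show ?case
    by (simp add: linear_add[OF algebra_hom_linear[OF \<phi>]] linear_add[OF algebra_hom_linear[OF \<psi>]])
next
  case (smult c a)
  then show ?case
    by (simp add: linear_smult[OF algebra_hom_linear[OF \<phi>]] linear_smult[OF algebra_hom_linear[OF \<psi>]])
next
  case (grp t a)
  then show ?case by (simp add: algebra_hom_mult[OF \<phi>] algebra_hom_mult[OF \<psi>] e)
next
  case (x a)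
  then show ?case by (simp add: algebra_hom_mult[OF \<phi>] algebra_hom_mult[OF \<psi>] assms(4))
qed

lemma comul_linear: "comul H \<in> linear_maps K H T"
  using algebra_hom_linear[OF comul_hom] by simp

lemma comul_closed [simp]: "h \<in> carrier H \<Longrightarrow> comul H h \<in> carrier T"
  by (rule linear_closed[OF comul_linear])

text \<open>How Sweedler sums react to multiplication by a generator.\<close>

lemma
  assumes Z: "module K Z" and F: "F \<in> bilinear_maps K H H Z" and h: "h \<in> carrier H"
  shows sweedler_e_left: "t \<in> carrier G \<Longrightarrow> tensor_lift K Z F (comul H (e t \<otimes>\<^bsub>H\<^esub> h))
      = tensor_lift K Z (\<lambda>a b. F (e t \<otimes>\<^bsub>H\<^esub> a) (e t \<otimes>\<^bsub>H\<^esub> b)) (comul H h)"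
    and sweedler_e_right: "t \<in> carrier G \<Longrightarrow> tensor_lift K Z F (comul H (h \<otimes>\<^bsub>H\<^esub> e t))
      = tensor_lift K Z (\<lambda>a b. F (a \<otimes>\<^bsub>H\<^esub> e t) (b \<otimes>\<^bsub>H\<^esub> e t)) (comul H h)"
    and sweedler_x_left: "tensor_lift K Z F (comul H (x \<otimes>\<^bsub>H\<^esub> h))
      = tensor_lift K Z (\<lambda>a b. F (x \<otimes>\<^bsub>H\<^esub> a) b \<oplus>\<^bsub>Z\<^esub> F (e g \<otimes>\<^bsub>H\<^esub> a) (x \<otimes>\<^bsub>H\<^esub> b)) (comul H h)"
    and sweedler_x_right: "tensor_lift K Z F (comul H (h \<otimes>\<^bsub>H\<^esub> x))
      = tensor_lift K Z (\<lambda>a b. F (a \<otimes>\<^bsub>H\<^esub> x) b \<oplus>\<^bsub>Z\<^esub> F (a \<otimes>\<^bsub>H\<^esub> e g) (b \<otimes>\<^bsub>H\<^esub> x)) (comul H h)"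
proof -
  note lin = tensor_lift_linear[OF H_module H_module Z F]
  note L = tensor_lift_pure_left[OF H.assoc_algebra_axioms H.assoc_algebra_axioms Z F _ _ comul_closed[OF h]]
  note R = tensor_lift_pure_right[OF H.assoc_algebra_axioms H.assoc_algebra_axioms Z F _ _ comul_closed[OF h]]
  have bl: "(\<lambda>a b. F (c \<otimes>\<^bsub>H\<^esub> a) (d \<otimes>\<^bsub>H\<^esub> b)) \<in> bilinear_maps K H H Z"
    if "c \<in> carrier H" "d \<in> carrier H" for c d
    by (rule bilinear_compose_args[OF F H.mult_linear(1)[OF that(1)] H.mult_linear(1)[OF that(2)]])
  have br: "(\<lambda>a b. F (a \<otimes>\<^bsub>H\<^esub> c) (b \<otimes>\<^bsub>H\<^esub> d)) \<in> bilinear_maps K H H Z"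
    if "c \<in> carrier H" "d \<in> carrier H" for c d
    by (rule bilinear_compose_args[OF F H.mult_linear(2)[OF that(1)] H.mult_linear(2)[OF that(2)]])
  note cong = tensor_lift_cong[OF H_module H_module Z _ _ comul_closed[OF h]]
  show "tensor_lift K Z F (comul H (e t \<otimes>\<^bsub>H\<^esub> h))
      = tensor_lift K Z (\<lambda>a b. F (e t \<otimes>\<^bsub>H\<^esub> a) (e t \<otimes>\<^bsub>H\<^esub> b)) (comul H h)" if "t \<in> carrier G"
    using that h by (simp add: algebra_hom_mult[OF comul_hom] comul_e L)
  show "tensor_lift K Z F (comul H (h \<otimes>\<^bsub>H\<^esub> e t))
      = tensor_lift K Z (\<lambda>a b. F (a \<otimes>\<^bsub>H\<^esub> e t) (b \<otimes>\<^bsub>H\<^esub> e t)) (comul H h)" if "t \<in> carrier G"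
    using that h by (simp add: algebra_hom_mult[OF comul_hom] comul_e R)
  have cl: "pure x \<one>\<^bsub>H\<^esub> \<in> carrier TA" "pure (e g) x \<in> carrier TA" "comul H h \<in> carrier TA"
    using h by (simp_all add: pure_H_simps)
  have "tensor_lift K Z F (comul H (x \<otimes>\<^bsub>H\<^esub> h))
      = tensor_lift K Z F (pure x \<one>\<^bsub>H\<^esub> \<otimes>\<^bsub>TA\<^esub> comul H h) \<oplus>\<^bsub>Z\<^esub> tensor_lift K Z F (pure (e g) x \<otimes>\<^bsub>TA\<^esub> comul H h)"
    using h TA.V.l_distr[OF cl] TA.V.m_closed[OF cl(1,3)] TA.V.m_closed[OF cl(2,3)]
    by (simp add: algebra_hom_mult[OF comul_hom] comul_x linear_add[OF lin])
  also have "\<dots> = tensor_lift K Z (\<lambda>a b. F (x \<otimes>\<^bsub>H\<^esub> a) (\<one>\<^bsub>H\<^esub> \<otimes>\<^bsub>H\<^esub> b) \<oplus>\<^bsub>Z\<^esub> F (e g \<otimes>\<^bsub>H\<^esub> a) (x \<otimes>\<^bsub>H\<^esub> b)) (comul H h)"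
    by (simp only: L x_closed e_closed g_closed H.V.one_closed
        tensor_lift_sum[OF H_module H_module Z bl bl comul_closed[OF h]])
  also have "\<dots> = tensor_lift K Z (\<lambda>a b. F (x \<otimes>\<^bsub>H\<^esub> a) b \<oplus>\<^bsub>Z\<^esub> F (e g \<otimes>\<^bsub>H\<^esub> a) (x \<otimes>\<^bsub>H\<^esub> b)) (comul H h)"
    by (rule cong) (use bilinear_sum[OF Z bl[of x "\<one>\<^bsub>H\<^esub>"] bl[of "e g" x]] in simp_all)
  finally show "tensor_lift K Z F (comul H (x \<otimes>\<^bsub>H\<^esub> h))
      = tensor_lift K Z (\<lambda>a b. F (x \<otimes>\<^bsub>H\<^esub> a) b \<oplus>\<^bsub>Z\<^esub> F (e g \<otimes>\<^bsub>H\<^esub> a) (x \<otimes>\<^bsub>H\<^esub> b)) (comul H h)" .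
  have "tensor_lift K Z F (comul H (h \<otimes>\<^bsub>H\<^esub> x))
      = tensor_lift K Z F (comul H h \<otimes>\<^bsub>TA\<^esub> pure x \<one>\<^bsub>H\<^esub>) \<oplus>\<^bsub>Z\<^esub> tensor_lift K Z F (comul H h \<otimes>\<^bsub>TA\<^esub> pure (e g) x)"
    using h TA.V.r_distr[OF cl] TA.V.m_closed[OF cl(3,1)] TA.V.m_closed[OF cl(3,2)]
    by (simp add: algebra_hom_mult[OF comul_hom] comul_x linear_add[OF lin])
  also have "\<dots> = tensor_lift K Z (\<lambda>a b. F (a \<otimes>\<^bsub>H\<^esub> x) (b \<otimes>\<^bsub>H\<^esub> \<one>\<^bsub>H\<^esub>) \<oplus>\<^bsub>Z\<^esub> F (a \<otimes>\<^bsub>H\<^esub> e g) (b \<otimes>\<^bsub>H\<^esub> x)) (comul H h)"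
    by (simp only: R x_closed e_closed g_closed H.V.one_closed
        tensor_lift_sum[OF H_module H_module Z br br comul_closed[OF h]])
  also have "\<dots> = tensor_lift K Z (\<lambda>a b. F (a \<otimes>\<^bsub>H\<^esub> x) b \<oplus>\<^bsub>Z\<^esub> F (a \<otimes>\<^bsub>H\<^esub> e g) (b \<otimes>\<^bsub>H\<^esub> x)) (comul H h)"
    by (rule cong) (use bilinear_sum[OF Z br[of x "\<one>\<^bsub>H\<^esub>"] br[of "e g" x]] in simp_all)
  finally show "tensor_lift K Z F (comul H (h \<otimes>\<^bsub>H\<^esub> x))
      = tensor_lift K Z (\<lambda>a b. F (a \<otimes>\<^bsub>H\<^esub> x) b \<oplus>\<^bsub>Z\<^esub> F (a \<otimes>\<^bsub>H\<^esub> e g) (b \<otimes>\<^bsub>H\<^esub> x)) (comul H h)" .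
qed

abbreviation "T3 \<equiv> tensor_module K H T"
abbreviation "TA3 \<equiv> tensor_algebra K H TA"
abbreviation "pure3 \<equiv> pure_tensor K H T"

lemma T3_eq: "tensor_module K H TA = T3" "pure_tensor K H TA = pure3"
  by (rule tensor_module_cong pure_tensor_cong; simp)+

lemmas T3_module = tensor_module_module[OF H_module T_module]
lemmas TA3_assoc = tensor_assoc_algebra[OF H.assoc_algebra_axioms TA_assoc]
lemmas pure3_simps = pure_closed[OF H_module T_module] pure_add_left[OF H_module T_module]
  pure_add_right[OF H_module T_module] pure_smult_left[OF H_module T_module] pure_smult_right[OF H_module T_module]
lemmas pure3_mult = pure_mult[OF H.assoc_algebra_axioms TA_assoc, unfolded T3_eq tensor_algebra_sel]

lemma TA3_lift: "tensor_lift K TA3 = tensor_lift K T3"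
  "linear_maps K V TA3 = linear_maps K V T3" "bilinear_maps K V W TA3 = bilinear_maps K V W T3"
  by (simp_all add: T3_eq)

text \<open>Both sides are algebra maps, so the generators decide.\<close>

lemma H_coassoc:
  assumes h: "h \<in> carrier H"
  shows "tensor_lift K T3 (\<lambda>a b. tensor_lift K T3 (\<lambda>a\<^sub>1 a\<^sub>2. pure3 a\<^sub>1 (pure a\<^sub>2 b)) (comul H a)) (comul H h)
    = tensor_lift K T3 (\<lambda>a b. tensor_lift K T3 (\<lambda>b\<^sub>1 b\<^sub>2. pure3 a (pure b\<^sub>1 b\<^sub>2)) (comul H b)) (comul H h)"
proof -
  interpret T3: module K T3 by (rule T3_module)
  let ?l = "\<lambda>b a\<^sub>1 a\<^sub>2. pure3 a\<^sub>1 (pure a\<^sub>2 b)" and ?r = "\<lambda>a b\<^sub>1 b\<^sub>2. pure3 a (pure b\<^sub>1 b\<^sub>2)"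
  let ?L = "\<lambda>a b. tensor_lift K T3 (?l b) (comul H a)" and ?R = "\<lambda>a b. tensor_lift K T3 (?r a) (comul H b)"
  note bil = iterated_comul_bilinear[OF H_module comul_linear]
  have l: "?l b \<in> bilinear_maps K H H T3" and r: "?r b \<in> bilinear_maps K H H T3" if "b \<in> carrier H" for b
    by (rule bil(3)[OF that], rule bil(4)[OF that])
  have L: "?L \<in> bilinear_maps K H H T3" and R: "?R \<in> bilinear_maps K H H T3"
    by (rule bil(1), rule bil(2))
  note lift = tensor_lift_pure[OF H_module H_module T3_module]
  note tm = tensor_lift_mult[OF H.assoc_algebra_axioms H.assoc_algebra_axioms TA3_assoc, unfolded TA3_lift]
  have Lm: "?L (a \<otimes>\<^bsub>H\<^esub> a') (b \<otimes>\<^bsub>H\<^esub> b') = ?L a b \<otimes>\<^bsub>TA3\<^esub> ?L a' b'"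
    if "a \<in> carrier H" "b \<in> carrier H" "a' \<in> carrier H" "b' \<in> carrier H" for a b a' b'
    unfolding algebra_hom_mult[OF comul_hom that(1,3)]
    by (rule tm) (use that l in \<open>simp_all add: pure3_mult pure_H_mult pure_H_simps\<close>)
  have Rm: "?R (a \<otimes>\<^bsub>H\<^esub> a') (b \<otimes>\<^bsub>H\<^esub> b') = ?R a b \<otimes>\<^bsub>TA3\<^esub> ?R a' b'"
    if "a \<in> carrier H" "b \<in> carrier H" "a' \<in> carrier H" "b' \<in> carrier H" for a b a' b'
    unfolding algebra_hom_mult[OF comul_hom that(2,4)]
    by (rule tm) (use that r in \<open>simp_all add: pure3_mult pure_H_mult pure_H_simps\<close>)
  have comul_one: "comul H \<one>\<^bsub>H\<^esub> = pure \<one>\<^bsub>H\<^esub> \<one>\<^bsub>H\<^esub>"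
    using algebra_hom_one[OF comul_hom] by simp
  note th = tensor_lift_algebra_hom[OF H.assoc_algebra_axioms H.assoc_algebra_axioms TA3_assoc, unfolded TA3_lift]
  have Lh: "tensor_lift K T3 ?L \<in> algebra_homs K TA TA3"
    by (rule th[OF L Lm]) (simp_all add: comul_one lift l T3_eq)
  have Rh: "tensor_lift K T3 ?R \<in> algebra_homs K TA TA3"
    by (rule th[OF R Rm]) (simp_all add: comul_one lift r T3_eq)
  note s = lift[OF L] lift[OF R] lift[OF l] lift[OF r] comul_one comul_e comul_x pure_H_simps pure3_simps
    linear_add[OF tensor_lift_linear[OF H_module H_module T3_module L]]
    linear_add[OF tensor_lift_linear[OF H_module H_module T3_module R]]
    linear_add[OF tensor_lift_linear[OF H_module H_module T3_module l]]
    linear_add[OF tensor_lift_linear[OF H_module H_module T3_module r]]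
  show ?thesis
    by (rule third_hom_eqI[OF algebra_hom_compose[OF comul_hom Lh] algebra_hom_compose[OF comul_hom Rh] _ _ h])
      (simp_all add: s T3.M.a_ac)
qed

lemma counit_linear: "counit H \<in> linear_maps K H (base_algebra K)"
  by (rule algebra_hom_linear[OF counit_hom])

lemma counit_simps [simp]:
  "a \<in> carrier H \<Longrightarrow> counit H a \<in> carrier K"
  "a \<in> carrier H \<Longrightarrow> b \<in> carrier H \<Longrightarrow> counit H (a \<oplus>\<^bsub>H\<^esub> b) = counit H a \<oplus>\<^bsub>K\<^esub> counit H b"
  "a \<in> carrier H \<Longrightarrow> b \<in> carrier H \<Longrightarrow> counit H (a \<otimes>\<^bsub>H\<^esub> b) = counit H a \<otimes>\<^bsub>K\<^esub> counit H b"
  "c \<in> carrier K \<Longrightarrow> a \<in> carrier H \<Longrightarrow> counit H (c \<odot>\<^bsub>H\<^esub> a) = c \<otimes>\<^bsub>K\<^esub> counit H a"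
  "counit H \<one>\<^bsub>H\<^esub> = \<one>\<^bsub>K\<^esub>" "t \<in> carrier G \<Longrightarrow> counit H (e t) = \<one>\<^bsub>K\<^esub>" "counit H x = \<zero>\<^bsub>K\<^esub>"
  using linear_closed[OF counit_linear, of a] linear_add[OF counit_linear] algebra_hom_mult[OF counit_hom]
    linear_smult[OF counit_linear] algebra_hom_one[OF counit_hom]
  by (simp_all add: counit_e counit_x)

lemma antipode_linear: "antipode H \<in> linear_maps K H H"
  using algebra_hom_linear[OF antipode_hom]
  by (simp add: module_part_cong(1)[of "opposite_algebra H" H])

lemma antipode_simps [simp]:
  "a \<in> carrier H \<Longrightarrow> antipode H a \<in> carrier H"
  "a \<in> carrier H \<Longrightarrow> b \<in> carrier H \<Longrightarrow> antipode H (a \<oplus>\<^bsub>H\<^esub> b) = antipode H a \<oplus>\<^bsub>H\<^esub> antipode H b"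
  "c \<in> carrier K \<Longrightarrow> a \<in> carrier H \<Longrightarrow> antipode H (c \<odot>\<^bsub>H\<^esub> a) = c \<odot>\<^bsub>H\<^esub> antipode H a"
  "a \<in> carrier H \<Longrightarrow> b \<in> carrier H \<Longrightarrow> antipode H (a \<otimes>\<^bsub>H\<^esub> b) = antipode H b \<otimes>\<^bsub>H\<^esub> antipode H a"
  "antipode H \<one>\<^bsub>H\<^esub> = \<one>\<^bsub>H\<^esub>"
  using linear_closed[OF antipode_linear] linear_add[OF antipode_linear] linear_smult[OF antipode_linear]
    algebra_hom_mult[OF antipode_hom] algebra_hom_one[OF antipode_hom] by simp_all

lemma H_counit_left: "h \<in> carrier H \<Longrightarrow> tensor_lift K H (\<lambda>a b. counit H a \<odot>\<^bsub>H\<^esub> b) (comul H h) = h"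
  and H_counit_right: "h \<in> carrier H \<Longrightarrow> tensor_lift K H (\<lambda>a b. counit H b \<odot>\<^bsub>H\<^esub> a) (comul H h) = h"
proof -
  let ?l = "\<lambda>a b. counit H a \<odot>\<^bsub>H\<^esub> b" and ?r = "\<lambda>a b. counit H b \<odot>\<^bsub>H\<^esub> a"
  have l: "?l \<in> bilinear_maps K H H H" and r: "?r \<in> bilinear_maps K H H H"
    by (intro bilinear_mapsI; simp add: H.smult_l_distr H.smult_r_distr H.smult_assoc1[symmetric] m_comm)+
  note th = tensor_lift_algebra_hom[OF H.assoc_algebra_axioms H.assoc_algebra_axioms H.assoc_algebra_axioms]
  have lh: "tensor_lift K H ?l \<in> algebra_homs K TA H"
    by (rule th[OF l]) (simp_all add: H.smult_mult_left H.smult_mult_right H.smult_assoc1[symmetric] m_comm)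
  have rh: "tensor_lift K H ?r \<in> algebra_homs K TA H"
    by (rule th[OF r]) (simp_all add: H.smult_mult_left H.smult_mult_right H.smult_assoc1[symmetric] m_comm)
  have id: "(\<lambda>a. a) \<in> algebra_homs K H H"
    by (rule algebra_homsI[OF H.id_linear]) auto
  note s = tensor_lift_pure[OF H_module H_module H_module l] tensor_lift_pure[OF H_module H_module H_module r]
    comul_e comul_x pure_H_simps
    linear_add[OF tensor_lift_linear[OF H_module H_module H_module l]]
    linear_add[OF tensor_lift_linear[OF H_module H_module H_module r]]
  show "tensor_lift K H ?l (comul H h) = h" if "h \<in> carrier H"
    by (rule third_hom_eqI[OF algebra_hom_compose[OF comul_hom lh] id _ _ that]) (simp_all add: s)
  show "tensor_lift K H ?r (comul H h) = h" if "h \<in> carrier H"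
    by (rule third_hom_eqI[OF algebra_hom_compose[OF comul_hom rh] id _ _ that]) (simp_all add: s)
qed

lemma e_inv: "t \<in> carrier G \<Longrightarrow> e (inv\<^bsub>G\<^esub> t) \<otimes>\<^bsub>H\<^esub> e t = \<one>\<^bsub>H\<^esub>" "t \<in> carrier G \<Longrightarrow> e t \<otimes>\<^bsub>H\<^esub> e (inv\<^bsub>G\<^esub> t) = \<one>\<^bsub>H\<^esub>"
  by (simp_all add: e_mult e_one)

lemma cancel_middle:
  assumes "a \<in> carrier H" "b \<in> carrier H" "c \<in> carrier H" "d \<in> carrier H" "b \<otimes>\<^bsub>H\<^esub> c = \<one>\<^bsub>H\<^esub>"
  shows "(a \<otimes>\<^bsub>H\<^esub> b) \<otimes>\<^bsub>H\<^esub> (c \<otimes>\<^bsub>H\<^esub> d) = a \<otimes>\<^bsub>H\<^esub> d"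
proof -
  have "(a \<otimes>\<^bsub>H\<^esub> b) \<otimes>\<^bsub>H\<^esub> (c \<otimes>\<^bsub>H\<^esub> d) = a \<otimes>\<^bsub>H\<^esub> ((b \<otimes>\<^bsub>H\<^esub> c) \<otimes>\<^bsub>H\<^esub> d)"
    using assms(1-4) by (simp add: H.V.m_assoc)
  then show ?thesis using assms by simp
qed

text \<open>Neither side is multiplicative, so the argument is an induction instead: left multiplication by a generator
  works for the left identity, right multiplication for the right one, since the antipode reverses products
  and the new factors then meet in the middle.\<close>

lemma
  assumes h: "h \<in> carrier H"
  shows H_antipode_left: "tensor_lift K H (\<lambda>a b. antipode H a \<otimes>\<^bsub>H\<^esub> b) (comul H h) = counit H h \<odot>\<^bsub>H\<^esub> \<one>\<^bsub>H\<^esub>"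
    and H_antipode_right: "tensor_lift K H (\<lambda>a b. a \<otimes>\<^bsub>H\<^esub> antipode H b) (comul H h) = counit H h \<odot>\<^bsub>H\<^esub> \<one>\<^bsub>H\<^esub>"
proof -
  let ?l = "\<lambda>a b. antipode H a \<otimes>\<^bsub>H\<^esub> b" and ?r = "\<lambda>a b. a \<otimes>\<^bsub>H\<^esub> antipode H b"
  have l: "?l \<in> bilinear_maps K H H H" and r: "?r \<in> bilinear_maps K H H H"
    by (intro bilinear_mapsI; simp add: H.V.l_distr H.V.r_distr H.smult_mult_left H.smult_mult_right)+
  note lin = tensor_lift_linear[OF H_module H_module H_module l] tensor_lift_linear[OF H_module H_module H_module r]
  have one: "comul H \<one>\<^bsub>H\<^esub> = pure \<one>\<^bsub>H\<^esub> \<one>\<^bsub>H\<^esub>"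
    using algebra_hom_one[OF comul_hom] by simp
  note s = tensor_lift_pure[OF H_module H_module H_module l] tensor_lift_pure[OF H_module H_module H_module r]
    linear_add[OF lin(1)] linear_add[OF lin(2)] linear_smult[OF lin(1)] linear_smult[OF lin(2)]
    linear_add[OF comul_linear] linear_smult[OF comul_linear] one H.smult_l_distr H.smult_assoc1
  note cong = tensor_lift_cong[OF H_module H_module H_module _ _ comul_closed]
  have zero: "tensor_lift K H (\<lambda>a b. \<zero>\<^bsub>H\<^esub>) (comul H a) = \<zero>\<^bsub>H\<^esub>" if "a \<in> carrier H" for a
    by (rule tensor_lift_zero[OF H_module H_module H_module comul_closed[OF that]])
  have zb: "(\<lambda>a b. \<zero>\<^bsub>H\<^esub>) \<in> bilinear_maps K H H H"
    by (rule bilinear_mapsI) auto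
  show "tensor_lift K H ?l (comul H h) = counit H h \<odot>\<^bsub>H\<^esub> \<one>\<^bsub>H\<^esub>"
    using h
  proof (induction h rule: H_induct_left)
    case (grp t a)
    have "tensor_lift K H ?l (comul H (e t \<otimes>\<^bsub>H\<^esub> a))
        = tensor_lift K H (\<lambda>b c. ?l (e t \<otimes>\<^bsub>H\<^esub> b) (e t \<otimes>\<^bsub>H\<^esub> c)) (comul H a)"
      by (rule sweedler_e_left[OF H_module l grp(2,1)])
    also have "\<dots> = tensor_lift K H ?l (comul H a)"
      by (rule cong[OF l _ grp(2), symmetric]) (use grp in \<open>simp add: antipode_e cancel_middle e_inv\<close>)
    finally show ?case using grp by simp
  next
    case (x a)
    have "tensor_lift K H ?l (comul H (x \<otimes>\<^bsub>H\<^esub> a))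
        = tensor_lift K H (\<lambda>b c. ?l (x \<otimes>\<^bsub>H\<^esub> b) c \<oplus>\<^bsub>H\<^esub> ?l (e g \<otimes>\<^bsub>H\<^esub> b) (x \<otimes>\<^bsub>H\<^esub> c)) (comul H a)"
      by (rule sweedler_x_left[OF H_module l x(1)])
    also have "\<dots> = tensor_lift K H (\<lambda>b c. \<zero>\<^bsub>H\<^esub>) (comul H a)"
      by (rule cong[OF zb _ x(1), symmetric])
        (simp add: antipode_x antipode_e H.V.m_assoc H.V.l_minus H.V.r_minus H.M.l_neg)
    finally show ?case using x by (simp add: zero)
  qed (simp_all add: s)
  show "tensor_lift K H ?r (comul H h) = counit H h \<odot>\<^bsub>H\<^esub> \<one>\<^bsub>H\<^esub>"
    using h
  proof (induction h rule: H_induct_right)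
    case (grp t a)
    have "tensor_lift K H ?r (comul H (a \<otimes>\<^bsub>H\<^esub> e t))
        = tensor_lift K H (\<lambda>b c. ?r (b \<otimes>\<^bsub>H\<^esub> e t) (c \<otimes>\<^bsub>H\<^esub> e t)) (comul H a)"
      by (rule sweedler_e_right[OF H_module r grp(2,1)])
    also have "\<dots> = tensor_lift K H ?r (comul H a)"
      by (rule cong[OF r _ grp(2), symmetric]) (use grp in \<open>simp add: antipode_e cancel_middle e_inv\<close>)
    finally show ?case using grp by simp
  next
    case (x a)
    have "tensor_lift K H ?r (comul H (a \<otimes>\<^bsub>H\<^esub> x))
        = tensor_lift K H (\<lambda>b c. ?r (b \<otimes>\<^bsub>H\<^esub> x) c \<oplus>\<^bsub>H\<^esub> ?r (b \<otimes>\<^bsub>H\<^esub> e g) (c \<otimes>\<^bsub>H\<^esub> x)) (comul H a)"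
      by (rule sweedler_x_right[OF H_module r x(1)])
    also have "\<dots> = tensor_lift K H (\<lambda>b c. \<zero>\<^bsub>H\<^esub>) (comul H a)"
    proof (rule cong[OF zb _ x(1), symmetric])
      fix b c assume bc: "b \<in> carrier H" "c \<in> carrier H"
      have "e g \<otimes>\<^bsub>H\<^esub> ((e (inv\<^bsub>G\<^esub> g) \<otimes>\<^bsub>H\<^esub> x) \<otimes>\<^bsub>H\<^esub> antipode H c) = x \<otimes>\<^bsub>H\<^esub> antipode H c"
        using bc by (simp add: H.V.m_assoc[symmetric] e_inv)
      then show "\<zero>\<^bsub>H\<^esub> = ?r (b \<otimes>\<^bsub>H\<^esub> x) c \<oplus>\<^bsub>H\<^esub> ?r (b \<otimes>\<^bsub>H\<^esub> e g) (c \<otimes>\<^bsub>H\<^esub> x)"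
        using bc by (simp add: antipode_x H.V.l_minus H.V.r_minus H.V.m_assoc[of b] H.M.r_neg)
    qed
    finally show ?case using x by (simp add: zero)
  qed (simp_all add: s)
qed

lemma H_hopf: "hopf_algebra K H"
proof (intro hopf_algebra.intro hopf_algebra_axioms.intro field_axioms H.assoc_algebra_axioms)
qed (use H_coassoc in \<open>simp_all add: comul_hom counit_hom antipode_linear H_counit_left H_counit_right
    H_antipode_left H_antipode_right Let_def\<close>)

end


section \<open>Maps of Hopf algebras\<close>

lemma algebra_hom_cong:
  assumes "assoc_algebra K V" "\<phi> \<in> algebra_homs K V W" "\<And>a. a \<in> carrier V \<Longrightarrow> \<phi> a = \<psi> a"
  shows "\<psi> \<in> algebra_homs K V W"
proof -
  interpret V: assoc_algebra K V by fact
  show ?thesis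
    using linear_cong[OF assms(3) algebra_hom_linear[OF assms(2)] V.module_axioms]
      algebra_hom_mult[OF assms(2)] algebra_hom_one[OF assms(2)]
    by (intro algebra_homsI) (simp_all add: assms(3)[symmetric])
qed

definition tensor_map ::
  "('k, 'm) ring_scheme \<Rightarrow> ('k, 'v, 'x) module_scheme \<Rightarrow> ('k, 'w, 'y) module_scheme
    \<Rightarrow> ('a \<Rightarrow> 'v) \<Rightarrow> ('b \<Rightarrow> 'w) \<Rightarrow> ('a \<times> 'b \<Rightarrow> 'k) set \<Rightarrow> ('v \<times> 'w \<Rightarrow> 'k) set" where
  "tensor_map K V W \<phi> \<psi> = tensor_lift K (tensor_module K V W) (\<lambda>a b. pure_tensor K V W (\<phi> a) (\<psi> b))"

context cring
begin

context
  fixes V :: "('a, 'v, 'x) module_scheme" and W :: "('a, 'w, 'y) module_scheme"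
    and V' :: "('a, 'v1, 'x1) module_scheme" and W' :: "('a, 'w1, 'y1) module_scheme"
    and \<phi> \<psi>
  assumes V: "module R V" and W: "module R W" and V': "module R V'" and W': "module R W'"
    and \<phi>: "\<phi> \<in> linear_maps R V' V" and \<psi>: "\<psi> \<in> linear_maps R W' W"
begin

lemma tensor_map_bilinear: "(\<lambda>a b. pure_tensor R V W (\<phi> a) (\<psi> b)) \<in> bilinear_maps R V' W' (tensor_module R V W)"
  by (rule bilinear_compose_args[OF pure_bilinear[OF V W] \<phi> \<psi>])

lemma tensor_map_linear: "tensor_map R V W \<phi> \<psi> \<in> linear_maps R (tensor_module R V' W') (tensor_module R V W)"
  unfolding tensor_map_def
  by (rule tensor_lift_linear[OF V' W' tensor_module_module[OF V W] tensor_map_bilinear])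

lemma tensor_map_pure: "a \<in> carrier V' \<Longrightarrow> b \<in> carrier W' \<Longrightarrow>
    tensor_map R V W \<phi> \<psi> (pure_tensor R V' W' a b) = pure_tensor R V W (\<phi> a) (\<psi> b)"
  unfolding tensor_map_def
  by (rule tensor_lift_pure[OF V' W' tensor_module_module[OF V W] tensor_map_bilinear])

lemma tensor_lift_map:
  assumes Z: "module R Z" and F: "F \<in> bilinear_maps R V W Z" and C: "C \<in> carrier (tensor_module R V' W')"
  shows "tensor_lift R Z F (tensor_map R V W \<phi> \<psi> C) = tensor_lift R Z (\<lambda>a b. F (\<phi> a) (\<psi> b)) C"
  by (rule tensor_eqI[OF V' W' linear_compose[OF tensor_map_linear tensor_lift_linear[OF V W Z F]]
        tensor_lift_linear[OF V' W' Z bilinear_compose_args[OF F \<phi> \<psi>]] _ C])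
    (simp add: tensor_map_pure tensor_lift_pure[OF V W Z F] linear_closed[OF \<phi>] linear_closed[OF \<psi>]
      tensor_lift_pure[OF V' W' Z bilinear_compose_args[OF F \<phi> \<psi>]])

lemma tensor_map_inverse:
  assumes \<phi>': "\<phi>' \<in> linear_maps R V V'" and \<psi>': "\<psi>' \<in> linear_maps R W W'"
    and inv: "\<And>a. a \<in> carrier V' \<Longrightarrow> \<phi>' (\<phi> a) = a" "\<And>b. b \<in> carrier W' \<Longrightarrow> \<psi>' (\<psi> b) = b"
    and C: "C \<in> carrier (tensor_module R V' W')"
  shows "tensor_map R V' W' \<phi>' \<psi>' (tensor_map R V W \<phi> \<psi> C) = C"
proof -
  interpret T: module R "tensor_module R V' W'" by (rule tensor_module_module[OF V' W'])
  have bil: "(\<lambda>a b. pure_tensor R V' W' (\<phi>' a) (\<psi>' b)) \<in> bilinear_maps R V W (tensor_module R V' W')"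
    by (rule bilinear_compose_args[OF pure_bilinear[OF V' W'] \<phi>' \<psi>'])
  have lin: "tensor_map R V' W' \<phi>' \<psi>' \<in> linear_maps R (tensor_module R V W) (tensor_module R V' W')"
    unfolding tensor_map_def by (rule tensor_lift_linear[OF V W T.module_axioms bil])
  show ?thesis
  proof (rule tensor_eqI[OF V' W' linear_compose[OF tensor_map_linear lin] T.id_linear _ C])
    fix a b assume ab: "a \<in> carrier V'" "b \<in> carrier W'"
    show "tensor_map R V' W' \<phi>' \<psi>' (tensor_map R V W \<phi> \<psi> (pure_tensor R V' W' a b)) = pure_tensor R V' W' a b"
      unfolding tensor_map_pure[OF ab] unfolding tensor_map_def
      using ab by (simp add: tensor_lift_pure[OF V W T.module_axioms bil] inv linear_closed[OF \<phi>] linear_closed[OF \<psi>])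
  qed
qed

end

lemma tensor_map_algebra_hom:
  assumes "assoc_algebra R V" "assoc_algebra R W" "assoc_algebra R V'" "assoc_algebra R W'"
    and \<phi>: "\<phi> \<in> algebra_homs R V' V" and \<psi>: "\<psi> \<in> algebra_homs R W' W"
  shows "tensor_map R V W \<phi> \<psi> \<in> algebra_homs R (tensor_algebra R V' W') (tensor_algebra R V W)"
proof -
  interpret V: assoc_algebra R V by fact
  interpret W: assoc_algebra R W by fact
  interpret V': assoc_algebra R V' by fact
  interpret W': assoc_algebra R W' by fact
  note lin = algebra_hom_linear[OF \<phi>] algebra_hom_linear[OF \<psi>]
  have "tensor_lift R (tensor_algebra R V W) (\<lambda>a b. pure_tensor R V W (\<phi> a) (\<psi> b))
      \<in> algebra_homs R (tensor_algebra R V' W') (tensor_algebra R V W)"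
    by (rule tensor_lift_algebra_hom[OF assms(3,4) tensor_assoc_algebra[OF assms(1,2)]])
      (simp_all add: tensor_map_bilinear[OF V.module_axioms W.module_axioms V'.module_axioms W'.module_axioms lin] algebra_hom_mult[OF \<phi>]
        algebra_hom_mult[OF \<psi>] algebra_hom_one[OF \<phi>] algebra_hom_one[OF \<psi>] pure_mult[OF assms(1,2)]
        linear_closed[OF lin(1)] linear_closed[OF lin(2)])
  then show ?thesis by (simp add: tensor_map_def)
qed

end

lemma hopf_homs_compose:
  assumes \<phi>: "\<phi> \<in> hopf_homs K H J" and \<psi>: "\<psi> \<in> hopf_homs K J L"
  shows "(\<lambda>h. \<psi> (\<phi> h)) \<in> hopf_homs K H L"
proof -
  interpret H: hopf_algebra K H using \<phi> by (simp add: hopf_homs_def)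
  interpret J: hopf_algebra K J using \<phi> by (simp add: hopf_homs_def)
  interpret L: hopf_algebra K L using \<psi> by (simp add: hopf_homs_def)
  have ah: "\<phi> \<in> algebra_homs K H J" "\<psi> \<in> algebra_homs K J L"
    using \<phi> \<psi> by (auto simp: hopf_homs_def)
  note lin = algebra_hom_linear[OF ah(1)] algebra_hom_linear[OF ah(2)]
  note cl = linear_closed[OF lin(1)]
  have "comul L (\<psi> (\<phi> h)) = tensor_map K L L (\<lambda>h. \<psi> (\<phi> h)) (\<lambda>h. \<psi> (\<phi> h)) (comul H h)"
    if h: "h \<in> carrier H" for h
  proof -
    have ch: "comul H h \<in> carrier (tensor_module K H H)"
      using linear_closed[OF algebra_hom_linear[OF H.comul_hom] h] by simp
    have "comul L (\<psi> (\<phi> h)) = tensor_map K L L \<psi> \<psi> (comul J (\<phi> h))"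
      using \<psi> cl[OF h] by (simp add: hopf_homs_def tensor_map_def)
    also have "comul J (\<phi> h) = tensor_map K J J \<phi> \<phi> (comul H h)"
      using \<phi> h by (simp add: hopf_homs_def tensor_map_def)
    also have "tensor_map K L L \<psi> \<psi> (tensor_map K J J \<phi> \<phi> (comul H h))
        = tensor_map K L L (\<lambda>h. \<psi> (\<phi> h)) (\<lambda>h. \<psi> (\<phi> h)) (comul H h)"
      unfolding tensor_map_def[of K L L]
      by (rule H.K.tensor_lift_map[OF J.H.module_axioms J.H.module_axioms H.H.module_axioms H.H.module_axioms
            lin(1) lin(1) H.K.tensor_module_module[OF L.H.module_axioms L.H.module_axioms]
            H.K.tensor_map_bilinear[OF L.H.module_axioms L.H.module_axioms J.H.module_axioms J.H.module_axioms lin(2) lin(2)] ch])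
    finally show ?thesis .
  qed
  then show ?thesis
    using \<phi> \<psi> cl algebra_hom_compose[OF ah]
      linear_closed[OF H.antipode_linear] linear_closed[OF J.antipode_linear]
    by (simp add: hopf_homs_def tensor_map_def)
qed

lemma hopf_isos_compose:
  assumes "\<phi> \<in> hopf_isos K H J" "\<psi> \<in> hopf_isos K J L"
  shows "(\<lambda>h. \<psi> (\<phi> h)) \<in> hopf_isos K H L"
  using assms hopf_homs_compose[of \<phi> K H J \<psi> L] bij_betw_trans[of \<phi> "carrier H" "carrier J" \<psi> "carrier L"]
  by (simp add: hopf_isos_def comp_def)

text \<open>Transport of structure: all the axioms can be checked after applying an injective map, to the
  second and third tensor powers as well.\<close>

lemma hopf_algebra_transport:
  fixes \<Xi> :: "('k, 'c, 'z) hopf_scheme" and J :: "('k, 'j, 'y) hopf_scheme"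
  assumes J: "hopf_algebra K J" and \<Xi>: "module K \<Xi>"
    and \<phi>: "\<phi> \<in> linear_maps K \<Xi> J" and bij: "bij_betw \<phi> (carrier \<Xi>) (carrier J)"
    and mult: "\<And>a b. a \<in> carrier \<Xi> \<Longrightarrow> b \<in> carrier \<Xi> \<Longrightarrow>
      a \<otimes>\<^bsub>\<Xi>\<^esub> b \<in> carrier \<Xi> \<and> \<phi> (a \<otimes>\<^bsub>\<Xi>\<^esub> b) = \<phi> a \<otimes>\<^bsub>J\<^esub> \<phi> b"
    and one: "\<one>\<^bsub>\<Xi>\<^esub> \<in> carrier \<Xi>" "\<phi> \<one>\<^bsub>\<Xi>\<^esub> = \<one>\<^bsub>J\<^esub>"
    and comul: "\<And>h. h \<in> carrier \<Xi> \<Longrightarrow> comul \<Xi> h \<in> carrier (tensor_module K \<Xi> \<Xi>) \<and>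
      comul J (\<phi> h) = tensor_map K J J \<phi> \<phi> (comul \<Xi> h)"
    and counit: "\<And>h. h \<in> carrier \<Xi> \<Longrightarrow> counit J (\<phi> h) = counit \<Xi> h"
    and antipode: "\<And>h. h \<in> carrier \<Xi> \<Longrightarrow> antipode \<Xi> h \<in> carrier \<Xi> \<and> antipode J (\<phi> h) = \<phi> (antipode \<Xi> h)"
  shows "\<phi> \<in> hopf_isos K \<Xi> J"
proof -
  interpret J: hopf_algebra K J by fact
  interpret X: module K \<Xi> by fact
  define \<psi> where "\<psi> = inv_into (carrier \<Xi>) \<phi>"
  have \<psi>\<phi>: "\<psi> (\<phi> a) = a" if "a \<in> carrier \<Xi>" for a
    using bij that by (simp add: \<psi>_def bij_betw_def)
  have \<psi>_cl: "\<psi> b \<in> carrier \<Xi>" and \<phi>\<psi>: "\<phi> (\<psi> b) = b" if "b \<in> carrier J" for b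
    using bij that unfolding \<psi>_def by (auto simp: bij_betw_def f_inv_into_f intro: inv_into_into)
  note \<phi>_cl = linear_closed[OF \<phi>]
  have inj: "a = b" if "\<phi> a = \<phi> b" "a \<in> carrier \<Xi>" "b \<in> carrier \<Xi>" for a b
    using \<psi>\<phi> that by metis
  have \<psi>: "\<psi> \<in> linear_maps K J \<Xi>"
    by (rule linear_mapsI) (auto intro!: inj simp: \<psi>_cl \<phi>\<psi> linear_add[OF \<phi>] linear_smult[OF \<phi>])
  have A: "assoc_algebra K \<Xi>"
  proof (rule assoc_algebra_image[OF J.H.assoc_algebra_axioms, of \<psi>])
    show "carrier \<Xi> \<subseteq> \<psi> ` carrier J" using \<psi>\<phi> \<phi>_cl by (metis image_eqI subsetI)
    show "\<psi> \<zero>\<^bsub>J\<^esub> = \<zero>\<^bsub>\<Xi>\<^esub>" by (rule linear_zero[OF J.H.module_axioms \<Xi> \<psi>])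
  qed (use mult one in \<open>auto intro!: inj simp: \<psi>_cl \<phi>\<psi> linear_add[OF \<psi>] linear_smult[OF \<psi>]\<close>)
  interpret A: assoc_algebra K \<Xi> by (rule A)
  have \<phi>_hom: "\<phi> \<in> algebra_homs K \<Xi> J"
    using mult one by (intro algebra_homsI \<phi>) auto
  have \<psi>_hom: "\<psi> \<in> algebra_homs K J \<Xi>"
    using mult one by (intro algebra_homsI \<psi>) (auto intro!: inj simp: \<psi>_cl \<phi>\<psi>)
  note mJ = J.H.module_axioms
  note tm = J.K.tensor_module_module
  let ?TJ = "tensor_module K J J" and ?TX = "tensor_module K \<Xi> \<Xi>"
  have comul_X: "comul \<Xi> h = tensor_map K \<Xi> \<Xi> \<psi> \<psi> (comul J (\<phi> h))" if "h \<in> carrier \<Xi>" for h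
    using J.K.tensor_map_inverse[OF mJ mJ \<Xi> \<Xi> \<phi> \<phi> \<psi> \<psi> \<psi>\<phi> \<psi>\<phi>, of "comul \<Xi> h"] comul[OF that] by simp
  have comul_hom: "comul \<Xi> \<in> algebra_homs K \<Xi> (tensor_algebra K \<Xi> \<Xi>)"
    by (rule algebra_hom_cong[OF A algebra_hom_compose[OF \<phi>_hom algebra_hom_compose[OF J.comul_hom
            J.K.tensor_map_algebra_hom[OF A A J.H.assoc_algebra_axioms J.H.assoc_algebra_axioms \<psi>_hom \<psi>_hom]]]])
      (simp add: comul_X)
  have comul_lin: "comul \<Xi> \<in> linear_maps K \<Xi> ?TX"
    using algebra_hom_linear[OF comul_hom] by simp
  have counit_hom: "counit \<Xi> \<in> algebra_homs K \<Xi> (base_algebra K)"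
    by (rule algebra_hom_cong[OF A algebra_hom_compose[OF \<phi>_hom J.counit_hom]]) (simp add: counit)
  have antipode_lin: "antipode \<Xi> \<in> linear_maps K \<Xi> \<Xi>"
    by (rule linear_cong[OF _ linear_compose[OF \<phi> linear_compose[OF J.antipode_linear \<psi>]] \<Xi>])
      (simp add: antipode \<psi>\<phi>)
  note counit_lin = algebra_hom_linear[OF counit_hom] 
  note counit_s = linear_closed[OF counit_lin, simplified] linear_add[OF counit_lin, simplified]
    linear_smult[OF counit_lin, simplified]
  note J_counit_lin = algebra_hom_linear[OF J.counit_hom]
  note J_counit_s = linear_closed[OF J_counit_lin, simplified] linear_add[OF J_counit_lin, simplified]
    linear_smult[OF J_counit_lin, simplified]
  note anti_s = linear_closed[OF antipode_lin] linear_add[OF antipode_lin] linear_smult[OF antipode_lin]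
  note J_anti_s = linear_closed[OF J.antipode_linear] linear_add[OF J.antipode_linear] linear_smult[OF J.antipode_linear]
  \<comment> \<open>A Sweedler sum over \<open>\<Xi>\<close> whose summands are carried to those of a Sweedler sum over \<open>J\<close>.\<close>
  have sweedler: "\<phi> (tensor_lift K \<Xi> F (comul \<Xi> h)) = tensor_lift K J F' (comul J (\<phi> h))"
    if "F \<in> bilinear_maps K \<Xi> \<Xi> \<Xi>" "F' \<in> bilinear_maps K J J J"
      "\<And>a b. a \<in> carrier \<Xi> \<Longrightarrow> b \<in> carrier \<Xi> \<Longrightarrow> \<phi> (F a b) = F' (\<phi> a) (\<phi> b)" "h \<in> carrier \<Xi>" for F F' h
  proof -
    have "\<phi> (tensor_lift K \<Xi> F (comul \<Xi> h)) = tensor_lift K J (\<lambda>a b. \<phi> (F a b)) (comul \<Xi> h)"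
      using comul that by (intro J.K.tensor_lift_compose[OF \<Xi> \<Xi> \<Xi> mJ that(1) \<phi>]) auto
    also have "\<dots> = tensor_lift K J (\<lambda>a b. F' (\<phi> a) (\<phi> b)) (comul \<Xi> h)"
      using comul that by (intro J.K.tensor_lift_cong[OF \<Xi> \<Xi> mJ bilinear_compose[OF that(1) \<phi>]]) auto
    also have "\<dots> = tensor_lift K J F' (comul J (\<phi> h))"
      using comul[OF that(4)] J.K.tensor_lift_map[OF mJ mJ \<Xi> \<Xi> \<phi> \<phi> mJ that(2), of "comul \<Xi> h"] by simp
    finally show ?thesis .
  qed
  have cl_sw: "tensor_lift K \<Xi> F (comul \<Xi> h) \<in> carrier \<Xi>"
    if "F \<in> bilinear_maps K \<Xi> \<Xi> \<Xi>" "h \<in> carrier \<Xi>" for F h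
    using linear_closed[OF J.K.tensor_lift_linear[OF \<Xi> \<Xi> \<Xi> that(1)]] comul that by blast
  have hopf: "hopf_algebra K \<Xi>"
  proof (intro hopf_algebra.intro hopf_algebra_axioms.intro J.K.field_axioms A comul_hom counit_hom antipode_lin)
    fix h assume h: "h \<in> carrier \<Xi>"
    have b: "(\<lambda>a b. counit \<Xi> a \<odot>\<^bsub>\<Xi>\<^esub> b) \<in> bilinear_maps K \<Xi> \<Xi> \<Xi>"
        "(\<lambda>a b. counit J a \<odot>\<^bsub>J\<^esub> b) \<in> bilinear_maps K J J J"
      by (rule bilinear_mapsI; simp add: counit_s J_counit_s X.smult_l_distr X.smult_r_distr J.H.smult_l_distr
          J.H.smult_r_distr X.smult_assoc1[symmetric] J.H.smult_assoc1[symmetric] J.K.m_comm)+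
    show "tensor_lift K \<Xi> (\<lambda>a b. counit \<Xi> a \<odot>\<^bsub>\<Xi>\<^esub> b) (comul \<Xi> h) = h"
      by (rule inj[OF _ cl_sw[OF b(1) h] h], subst sweedler[OF b _ h])
        (simp_all add: linear_smult[OF \<phi>] counit counit_s h \<phi>_cl J.counit_left)
    have b: "(\<lambda>a b. counit \<Xi> b \<odot>\<^bsub>\<Xi>\<^esub> a) \<in> bilinear_maps K \<Xi> \<Xi> \<Xi>"
        "(\<lambda>a b. counit J b \<odot>\<^bsub>J\<^esub> a) \<in> bilinear_maps K J J J"
      by (rule bilinear_mapsI; simp add: counit_s J_counit_s X.smult_l_distr X.smult_r_distr J.H.smult_l_distr
          J.H.smult_r_distr X.smult_assoc1[symmetric] J.H.smult_assoc1[symmetric] J.K.m_comm)+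
    show "tensor_lift K \<Xi> (\<lambda>a b. counit \<Xi> b \<odot>\<^bsub>\<Xi>\<^esub> a) (comul \<Xi> h) = h"
      by (rule inj[OF _ cl_sw[OF b(1) h] h], subst sweedler[OF b _ h])
        (simp_all add: linear_smult[OF \<phi>] counit counit_s h \<phi>_cl J.counit_right)
    have unit: "counit \<Xi> h \<odot>\<^bsub>\<Xi>\<^esub> \<one>\<^bsub>\<Xi>\<^esub> \<in> carrier \<Xi>"
      "\<phi> (counit \<Xi> h \<odot>\<^bsub>\<Xi>\<^esub> \<one>\<^bsub>\<Xi>\<^esub>) = counit J (\<phi> h) \<odot>\<^bsub>J\<^esub> \<one>\<^bsub>J\<^esub>"
      using h by (simp_all add: counit_s linear_smult[OF \<phi>] counit one)
    have b: "(\<lambda>a b. antipode \<Xi> a \<otimes>\<^bsub>\<Xi>\<^esub> b) \<in> bilinear_maps K \<Xi> \<Xi> \<Xi>"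
        "(\<lambda>a b. antipode J a \<otimes>\<^bsub>J\<^esub> b) \<in> bilinear_maps K J J J"
      by (rule bilinear_mapsI; simp add: anti_s J_anti_s A.V.l_distr A.V.r_distr A.smult_mult_left A.smult_mult_right
          J.H.V.l_distr J.H.V.r_distr J.H.smult_mult_left J.H.smult_mult_right)+
    show "tensor_lift K \<Xi> (\<lambda>a b. antipode \<Xi> a \<otimes>\<^bsub>\<Xi>\<^esub> b) (comul \<Xi> h) = counit \<Xi> h \<odot>\<^bsub>\<Xi>\<^esub> \<one>\<^bsub>\<Xi>\<^esub>"
      by (rule inj[OF _ cl_sw[OF b(1) h] unit(1)], subst sweedler[OF b _ h])
        (simp_all add: mult antipode unit h \<phi>_cl J.antipode_left)
    have b: "(\<lambda>a b. a \<otimes>\<^bsub>\<Xi>\<^esub> antipode \<Xi> b) \<in> bilinear_maps K \<Xi> \<Xi> \<Xi>"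
        "(\<lambda>a b. a \<otimes>\<^bsub>J\<^esub> antipode J b) \<in> bilinear_maps K J J J"
      by (rule bilinear_mapsI; simp add: anti_s J_anti_s A.V.l_distr A.V.r_distr A.smult_mult_left A.smult_mult_right
          J.H.V.l_distr J.H.V.r_distr J.H.smult_mult_left J.H.smult_mult_right)+
    show "tensor_lift K \<Xi> (\<lambda>a b. a \<otimes>\<^bsub>\<Xi>\<^esub> antipode \<Xi> b) (comul \<Xi> h) = counit \<Xi> h \<odot>\<^bsub>\<Xi>\<^esub> \<one>\<^bsub>\<Xi>\<^esub>"
      by (rule inj[OF _ cl_sw[OF b(1) h] unit(1)], subst sweedler[OF b _ h])
        (simp_all add: mult antipode unit h \<phi>_cl J.antipode_right)
    let ?T3X = "tensor_module K \<Xi> ?TX" and ?T3J = "tensor_module K J ?TJ"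
    let ?p3X = "pure_tensor K \<Xi> ?TX" and ?p3J = "pure_tensor K J ?TJ"
    let ?pX = "pure_tensor K \<Xi> \<Xi>" and ?pJ = "pure_tensor K J J"
    let ?\<phi>2 = "tensor_map K J J \<phi> \<phi>" and ?\<psi>2 = "tensor_map K \<Xi> \<Xi> \<psi> \<psi>"
    let ?\<phi>3 = "tensor_map K J ?TJ \<phi> ?\<phi>2" and ?\<psi>3 = "tensor_map K \<Xi> ?TX \<psi> ?\<psi>2"
    note mTX = tm[OF \<Xi> \<Xi>] and mTJ = tm[OF mJ mJ]
    note mT3X = tm[OF \<Xi> mTX] and mT3J = tm[OF mJ mTJ]
    note l2 = J.K.tensor_map_linear[OF mJ mJ \<Xi> \<Xi> \<phi> \<phi>] and l2' = J.K.tensor_map_linear[OF \<Xi> \<Xi> mJ mJ \<psi> \<psi>]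
    note l3 = J.K.tensor_map_linear[OF mJ mTJ \<Xi> mTX \<phi> l2]
    note inv2 = J.K.tensor_map_inverse[OF mJ mJ \<Xi> \<Xi> \<phi> \<phi> \<psi> \<psi> \<psi>\<phi> \<psi>\<phi>]
    have inv3: "?\<psi>3 (?\<phi>3 C) = C" if "C \<in> carrier ?T3X" for C
      using J.K.tensor_map_inverse[OF mJ mTJ \<Xi> mTX \<phi> l2 \<psi> l2' \<psi>\<phi> inv2 that] .
    note sX = J.K.pure_closed[OF \<Xi> \<Xi>] J.K.pure_add_left[OF \<Xi> \<Xi>] J.K.pure_add_right[OF \<Xi> \<Xi>]
      J.K.pure_smult_left[OF \<Xi> \<Xi>] J.K.pure_smult_right[OF \<Xi> \<Xi>]
      J.K.pure_closed[OF \<Xi> mTX] J.K.pure_add_left[OF \<Xi> mTX] J.K.pure_add_right[OF \<Xi> mTX]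
      J.K.pure_smult_left[OF \<Xi> mTX] J.K.pure_smult_right[OF \<Xi> mTX]
    note sJ = J.K.pure_closed[OF mJ mJ] J.K.pure_add_left[OF mJ mJ] J.K.pure_add_right[OF mJ mJ]
      J.K.pure_smult_left[OF mJ mJ] J.K.pure_smult_right[OF mJ mJ]
      J.K.pure_closed[OF mJ mTJ] J.K.pure_add_left[OF mJ mTJ] J.K.pure_add_right[OF mJ mTJ]
      J.K.pure_smult_left[OF mJ mTJ] J.K.pure_smult_right[OF mJ mTJ]
    note mapp = J.K.tensor_map_pure[OF mJ mTJ \<Xi> mTX \<phi> l2] J.K.tensor_map_pure[OF mJ mJ \<Xi> \<Xi> \<phi> \<phi>]
    let ?lX = "\<lambda>b a\<^sub>1 a\<^sub>2. ?p3X a\<^sub>1 (?pX a\<^sub>2 b)" and ?rX = "\<lambda>a b\<^sub>1 b\<^sub>2. ?p3X a (?pX b\<^sub>1 b\<^sub>2)"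
    let ?lJ = "\<lambda>b a\<^sub>1 a\<^sub>2. ?p3J a\<^sub>1 (?pJ a\<^sub>2 b)" and ?rJ = "\<lambda>a b\<^sub>1 b\<^sub>2. ?p3J a (?pJ b\<^sub>1 b\<^sub>2)"
    have bX: "?lX b \<in> bilinear_maps K \<Xi> \<Xi> ?T3X" "?rX b \<in> bilinear_maps K \<Xi> \<Xi> ?T3X" if "b \<in> carrier \<Xi>" for b
      using that by (intro bilinear_mapsI; simp add: sX)+
    have bJ: "?lJ b \<in> bilinear_maps K J J ?T3J" "?rJ b \<in> bilinear_maps K J J ?T3J" if "b \<in> carrier J" for b
      using that by (intro bilinear_mapsI; simp add: sJ)+
    have cX: "a \<in> carrier \<Xi> \<Longrightarrow> comul \<Xi> a \<in> carrier ?TX" and cJ: "b \<in> carrier J \<Longrightarrow> comul J b \<in> carrier ?TJ" for a b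
      using comul linear_closed[OF algebra_hom_linear[OF J.comul_hom]] by simp_all
    have J_comul_lin: "comul J \<in> linear_maps K J ?TJ"
      using algebra_hom_linear[OF J.comul_hom] by simp
    \<comment> \<open>One iterated coproduct, in either bracketing, is carried to the other by the third tensor power.\<close>
    have step: "?\<phi>3 (tensor_lift K ?T3X (F c) (comul \<Xi> a)) = tensor_lift K ?T3J (F' (\<phi> c)) (comul J (\<phi> a))"
      if "F c \<in> bilinear_maps K \<Xi> \<Xi> ?T3X" "F' (\<phi> c) \<in> bilinear_maps K J J ?T3J"
        "\<And>a b. a \<in> carrier \<Xi> \<Longrightarrow> b \<in> carrier \<Xi> \<Longrightarrow> ?\<phi>3 (F c a b) = F' (\<phi> c) (\<phi> a) (\<phi> b)"
        "a \<in> carrier \<Xi>" for F :: "'c \<Rightarrow> _" and F' c a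
    proof -
      have "?\<phi>3 (tensor_lift K ?T3X (F c) (comul \<Xi> a)) = tensor_lift K ?T3J (\<lambda>a b. ?\<phi>3 (F c a b)) (comul \<Xi> a)"
        by (rule J.K.tensor_lift_compose[OF \<Xi> \<Xi> mT3X mT3J that(1) l3 cX[OF that(4)]])
      also have "\<dots> = tensor_lift K ?T3J (\<lambda>a b. F' (\<phi> c) (\<phi> a) (\<phi> b)) (comul \<Xi> a)"
        by (rule J.K.tensor_lift_cong[OF \<Xi> \<Xi> mT3J bilinear_compose[OF that(1) l3] that(3) cX[OF that(4)]])
      also have "\<dots> = tensor_lift K ?T3J (F' (\<phi> c)) (comul J (\<phi> a))"
        using comul[OF that(4)] J.K.tensor_lift_map[OF mJ mJ \<Xi> \<Xi> \<phi> \<phi> mT3J that(2) cX[OF that(4)]] by simp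
      finally show ?thesis .
    qed
    let ?LX = "\<lambda>a b. tensor_lift K ?T3X (?lX b) (comul \<Xi> a)" and ?RX = "\<lambda>a b. tensor_lift K ?T3X (?rX a) (comul \<Xi> b)"
    let ?LJ = "\<lambda>a b. tensor_lift K ?T3J (?lJ b) (comul J a)" and ?RJ = "\<lambda>a b. tensor_lift K ?T3J (?rJ a) (comul J b)"
    have X_lin: "(\<lambda>b. ?lX b u v) \<in> linear_maps K \<Xi> ?T3X" "(\<lambda>b. ?rX b u v) \<in> linear_maps K \<Xi> ?T3X"
      if "u \<in> carrier \<Xi>" "v \<in> carrier \<Xi>" for u v
      using that by (intro linear_mapsI; simp add: sX)+
    have J_lin: "(\<lambda>b. ?lJ b u v) \<in> linear_maps K J ?T3J" "(\<lambda>b. ?rJ b u v) \<in> linear_maps K J ?T3J"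
      if "u \<in> carrier J" "v \<in> carrier J" for u v
      using that by (intro linear_mapsI; simp add: sJ)+
    have LX: "?LX \<in> bilinear_maps K \<Xi> \<Xi> ?T3X" and RX: "?RX \<in> bilinear_maps K \<Xi> \<Xi> ?T3X"
      unfolding bilinear_maps_def
      by (auto intro!: linear_compose[OF comul_lin J.K.tensor_lift_linear[OF \<Xi> \<Xi> mT3X bX(1)]]
          J.K.tensor_lift_param[OF \<Xi> \<Xi> mT3X \<Xi> bX(1) X_lin(1) cX]
          linear_compose[OF comul_lin J.K.tensor_lift_linear[OF \<Xi> \<Xi> mT3X bX(2)]]
          J.K.tensor_lift_param[OF \<Xi> \<Xi> mT3X \<Xi> bX(2) X_lin(2) cX])
    have LJ: "?LJ \<in> bilinear_maps K J J ?T3J" and RJ: "?RJ \<in> bilinear_maps K J J ?T3J"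
      unfolding bilinear_maps_def
      by (auto intro!: linear_compose[OF J_comul_lin J.K.tensor_lift_linear[OF mJ mJ mT3J bJ(1)]]
          J.K.tensor_lift_param[OF mJ mJ mT3J mJ bJ(1) J_lin(1) cJ]
          linear_compose[OF J_comul_lin J.K.tensor_lift_linear[OF mJ mJ mT3J bJ(2)]]
          J.K.tensor_lift_param[OF mJ mJ mT3J mJ bJ(2) J_lin(2) cJ])
    have "?\<phi>3 (?LX a b) = ?LJ (\<phi> a) (\<phi> b)" "?\<phi>3 (?RX a b) = ?RJ (\<phi> a) (\<phi> b)"
      if ab: "a \<in> carrier \<Xi>" "b \<in> carrier \<Xi>" for a b
      using step[of ?lX b ?lJ a] step[of ?rX a ?rJ b] ab
      by (simp_all add: bX bJ \<phi>_cl mapp J.K.pure_closed[OF \<Xi> \<Xi>])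
    then have "?\<phi>3 (tensor_lift K ?T3X (\<lambda>a b. ?LX a b) (comul \<Xi> h)) = tensor_lift K ?T3J ?LJ (comul J (\<phi> h))"
      and "?\<phi>3 (tensor_lift K ?T3X (\<lambda>a b. ?RX a b) (comul \<Xi> h)) = tensor_lift K ?T3J ?RJ (comul J (\<phi> h))"
      using step[of "\<lambda>_. ?LX" h "\<lambda>_. ?LJ" h] step[of "\<lambda>_. ?RX" h "\<lambda>_. ?RJ" h] LX RX LJ RJ h by simp_all
    moreover have "tensor_lift K ?T3J ?LJ (comul J (\<phi> h)) = tensor_lift K ?T3J ?RJ (comul J (\<phi> h))"
      using J.coassoc[OF \<phi>_cl[OF h]] by (simp add: Let_def)
    ultimately have "tensor_lift K ?T3X ?LX (comul \<Xi> h) = tensor_lift K ?T3X ?RX (comul \<Xi> h)"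
      using inv3[OF linear_closed[OF J.K.tensor_lift_linear[OF \<Xi> \<Xi> mT3X LX] cX[OF h]]]
        inv3[OF linear_closed[OF J.K.tensor_lift_linear[OF \<Xi> \<Xi> mT3X RX] cX[OF h]]] by metis
    then show "let T = ?T3X; pure = (\<lambda>a b c. ?p3X a (?pX b c))
      in tensor_lift K T (\<lambda>a b. tensor_lift K T (\<lambda>a\<^sub>1 a\<^sub>2. pure a\<^sub>1 a\<^sub>2 b) (comul \<Xi> a)) (comul \<Xi> h)
        = tensor_lift K T (\<lambda>a b. tensor_lift K T (\<lambda>b\<^sub>1 b\<^sub>2. pure a b\<^sub>1 b\<^sub>2) (comul \<Xi> b)) (comul \<Xi> h)"
      by (simp add: Let_def)
  qed
  then show ?thesis
    using J \<phi>_hom comul counit antipode bij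
    by (simp add: hopf_isos_def hopf_homs_def tensor_map_def)
qed



section \<open>The Hopf algebra of a group\<close>

lemma group_hopf_sel:
  "carrier (group_hopf_algebra K P) = carrier (free_module K (carrier P))"
  "ring.zero (group_hopf_algebra K P) = ring.zero (free_module K (carrier P))"
  "add (group_hopf_algebra K P) = add (free_module K (carrier P))"
  "smult (group_hopf_algebra K P) = smult (free_module K (carrier P))"
  "monoid.mult (group_hopf_algebra K P) = monoid.mult (monoid_algebra K P)"
  "one (group_hopf_algebra K P) = single K \<one>\<^bsub>P\<^esub>"
  by (simp_all add: group_hopf_algebra_def Let_def module.defs)

lemmas group_hopf_maps =
  module_part_cong[of "group_hopf_algebra K P" "free_module K (carrier P)" for K P, OF group_hopf_sel(1-4)]

lemma group_hopf_tensor: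
  "tensor_module K (monoid_algebra K P) (monoid_algebra K P)
    = tensor_module K (group_hopf_algebra K P) (group_hopf_algebra K P)"
  "pure_tensor K (monoid_algebra K P) (monoid_algebra K P)
    = pure_tensor K (group_hopf_algebra K P) (group_hopf_algebra K P)"
  by (rule tensor_module_cong pure_tensor_cong; simp add: group_hopf_sel)+

lemma group_hopf_ops:
  "comul (group_hopf_algebra K P)
    = lin_ext K (tensor_module K (group_hopf_algebra K P) (group_hopf_algebra K P))
      (\<lambda>t. pure_tensor K (group_hopf_algebra K P) (group_hopf_algebra K P) (single K t) (single K t))"
  "counit (group_hopf_algebra K P) = lin_ext K (base_algebra K) (\<lambda>t. \<one>\<^bsub>K\<^esub>)"
  "antipode (group_hopf_algebra K P) = lin_ext K (group_hopf_algebra K P) (\<lambda>t. single K (inv\<^bsub>P\<^esub> t))"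
  by (simp_all add: group_hopf_tensor[symmetric] group_hopf_maps)
    (simp_all add: group_hopf_algebra_def Let_def module.defs hopf.defs)

locale group_hopf = field K + P: group P
  for K :: "('k, 'm) ring_scheme" and P :: "('h, 'n) monoid_scheme"
begin

abbreviation "A \<equiv> group_hopf_algebra K P"
abbreviation "AT \<equiv> tensor_module K A A"
abbreviation "ATA \<equiv> tensor_algebra K A A"
abbreviation "Apure \<equiv> pure_tensor K A A"

lemma A_assoc: "assoc_algebra K A"
  by (rule assoc_algebra_image[OF monoid_algebra_assoc[OF P.is_monoid], of "\<lambda>a. a"])
    (auto simp: group_hopf_sel)

interpretation A: assoc_algebra K A by (rule A_assoc)

lemmas A_module = A.module_axioms
lemmas AT_module = tensor_module_module[OF A_module A_module]
lemmas ATA_assoc = tensor_assoc_algebra[OF A_assoc A_assoc]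
lemmas Apure_simps = pure_closed[OF A_module A_module] pure_add_left[OF A_module A_module]
  pure_add_right[OF A_module A_module] pure_smult_left[OF A_module A_module] pure_smult_right[OF A_module A_module]

lemma A_single_in [simp]: "t \<in> carrier P \<Longrightarrow> single K t \<in> carrier A"
  by (simp add: group_hopf_sel)

lemma A_one: "\<one>\<^bsub>A\<^esub> = single K \<one>\<^bsub>P\<^esub>"
  by (simp add: group_hopf_sel)

text \<open>The grouplike elements span; all later statements about \<open>k[\<Gamma>]\<close> are reduced to them.\<close>

lemma A_eqI:
  assumes "module K Z" "\<phi> \<in> linear_maps K A Z" "\<psi> \<in> linear_maps K A Z"
    and "\<And>t. t \<in> carrier P \<Longrightarrow> \<phi> (single K t) = \<psi> (single K t)" and "a \<in> carrier A"
  shows "\<phi> a = \<psi> a"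
  using linear_free_eqI[of Z \<phi> "carrier P" \<psi> a] assms by (simp add: group_hopf_maps group_hopf_sel)

lemma A_single_mult [simp]:
  "s \<in> carrier P \<Longrightarrow> t \<in> carrier P \<Longrightarrow> single K s \<otimes>\<^bsub>A\<^esub> single K t = single K (s \<otimes>\<^bsub>P\<^esub> t)"
  using single_mult[OF P.is_monoid] by (simp add: group_hopf_sel)

lemma A_lift_linear: "module K Z \<Longrightarrow> (\<And>t. t \<in> carrier P \<Longrightarrow> \<phi> t \<in> carrier Z) \<Longrightarrow> lin_ext K Z \<phi> \<in> linear_maps K A Z"
  using lin_ext_linear[of Z "carrier P" \<phi>] by (simp add: group_hopf_maps)

lemma A_lift_hom:
  assumes "assoc_algebra K Z" "\<And>t. t \<in> carrier P \<Longrightarrow> \<phi> t \<in> carrier Z"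
    "\<And>s t. s \<in> carrier P \<Longrightarrow> t \<in> carrier P \<Longrightarrow> \<phi> (s \<otimes>\<^bsub>P\<^esub> t) = \<phi> s \<otimes>\<^bsub>Z\<^esub> \<phi> t" "\<phi> \<one>\<^bsub>P\<^esub> = \<one>\<^bsub>Z\<^esub>"
  shows "lin_ext K Z \<phi> \<in> algebra_homs K A Z"
  using lin_ext_algebra_hom[OF P.is_monoid assms]
  by (simp add: algebra_homs_def ring_hom_def group_hopf_maps group_hopf_sel)

lemma A_comul_hom: "comul A \<in> algebra_homs K A ATA"
  unfolding group_hopf_ops
  using A_lift_hom[OF ATA_assoc, of "\<lambda>t. Apure (single K t) (single K t)"]
  by (simp add: Apure_simps pure_mult[OF A_assoc A_assoc] A_one)

lemma A_comul_linear: "comul A \<in> linear_maps K A AT"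
  using algebra_hom_linear[OF A_comul_hom] by simp

lemma A_comul_single [simp]: "t \<in> carrier P \<Longrightarrow> comul A (single K t) = Apure (single K t) (single K t)"
  unfolding group_hopf_ops by (rule lin_ext_single[OF AT_module]) (simp add: Apure_simps)

lemma A_comul_closed [simp]: "a \<in> carrier A \<Longrightarrow> comul A a \<in> carrier AT"
  by (rule linear_closed[OF A_comul_linear])

lemma A_counit_hom: "counit A \<in> algebra_homs K A (base_algebra K)"
  unfolding group_hopf_ops by (rule A_lift_hom[OF base_algebra_assoc]) simp_all

lemma A_counit_single [simp]: "counit A (single K t) = \<one>\<^bsub>K\<^esub>"
proof -
  interpret B: assoc_algebra K "base_algebra K" by (rule base_algebra_assoc)
  show ?thesis unfolding group_hopf_ops by (rule lin_ext_single[OF B.module_axioms]) simp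
qed

lemma A_antipode_linear: "antipode A \<in> linear_maps K A A"
  unfolding group_hopf_ops by (rule A_lift_linear[OF A_module]) simp

lemma A_antipode_single [simp]: "t \<in> carrier P \<Longrightarrow> antipode A (single K t) = single K (inv\<^bsub>P\<^esub> t)"
  unfolding group_hopf_ops by (rule lin_ext_single[OF A_module]) simp

lemma A_hopf: "hopf_algebra K A"
proof (intro hopf_algebra.intro hopf_algebra_axioms.intro field_axioms A_assoc A_comul_hom A_counit_hom A_antipode_linear)
  fix a assume a: "a \<in> carrier A"
  note counit_lin = algebra_hom_linear[OF A_counit_hom]
  note c = linear_closed[OF counit_lin, simplified] linear_add[OF counit_lin, simplified]
    linear_smult[OF counit_lin, simplified]
  note ap = linear_closed[OF A_antipode_linear] linear_add[OF A_antipode_linear] linear_smult[OF A_antipode_linear]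
  note lift = linear_compose[OF A_comul_linear tensor_lift_linear[OF A_module A_module A_module]]
    tensor_lift_pure[OF A_module A_module A_module]
  note m = A.smult_l_distr A.smult_r_distr A.smult_assoc1[symmetric] m_comm A.V.l_distr A.V.r_distr
    A.smult_mult_left A.smult_mult_right
  have b: "(\<lambda>a b. counit A a \<odot>\<^bsub>A\<^esub> b) \<in> bilinear_maps K A A A" "(\<lambda>a b. counit A b \<odot>\<^bsub>A\<^esub> a) \<in> bilinear_maps K A A A"
    "(\<lambda>a b. antipode A a \<otimes>\<^bsub>A\<^esub> b) \<in> bilinear_maps K A A A" "(\<lambda>a b. a \<otimes>\<^bsub>A\<^esub> antipode A b) \<in> bilinear_maps K A A A"
    by (rule bilinear_mapsI; simp add: c ap m)+
  have u: "(\<lambda>a. counit A a \<odot>\<^bsub>A\<^esub> \<one>\<^bsub>A\<^esub>) \<in> linear_maps K A A"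
    by (rule linear_mapsI) (simp_all add: c m)
  show "tensor_lift K A (\<lambda>a b. counit A a \<odot>\<^bsub>A\<^esub> b) (comul A a) = a"
    by (rule A_eqI[OF A_module lift(1)[OF b(1)] A.id_linear _ a]) (simp add: lift(2)[OF b(1)])
  show "tensor_lift K A (\<lambda>a b. counit A b \<odot>\<^bsub>A\<^esub> a) (comul A a) = a"
    by (rule A_eqI[OF A_module lift(1)[OF b(2)] A.id_linear _ a]) (simp add: lift(2)[OF b(2)])
  show "tensor_lift K A (\<lambda>a b. antipode A a \<otimes>\<^bsub>A\<^esub> b) (comul A a) = counit A a \<odot>\<^bsub>A\<^esub> \<one>\<^bsub>A\<^esub>"
    by (rule A_eqI[OF A_module lift(1)[OF b(3)] u _ a]) (simp add: lift(2)[OF b(3)] A_one)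
  show "tensor_lift K A (\<lambda>a b. a \<otimes>\<^bsub>A\<^esub> antipode A b) (comul A a) = counit A a \<odot>\<^bsub>A\<^esub> \<one>\<^bsub>A\<^esub>"
    by (rule A_eqI[OF A_module lift(1)[OF b(4)] u _ a]) (simp add: lift(2)[OF b(4)] A_one)
  note T3 = tensor_module_module[OF A_module AT_module]
  note bil = iterated_comul_bilinear[OF A_module A_comul_linear]
  note lift3 = tensor_lift_pure[OF A_module A_module T3]
  show "let T = tensor_module K A AT; pure = (\<lambda>a b c. pure_tensor K A AT a (Apure b c))
    in tensor_lift K T (\<lambda>a b. tensor_lift K T (\<lambda>a\<^sub>1 a\<^sub>2. pure a\<^sub>1 a\<^sub>2 b) (comul A a)) (comul A a)
      = tensor_lift K T (\<lambda>a b. tensor_lift K T (\<lambda>b\<^sub>1 b\<^sub>2. pure a b\<^sub>1 b\<^sub>2) (comul A b)) (comul A a)"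
    unfolding Let_def
    by (rule A_eqI[OF T3 linear_compose[OF A_comul_linear tensor_lift_linear[OF A_module A_module T3 bil(1)]]
          linear_compose[OF A_comul_linear tensor_lift_linear[OF A_module A_module T3 bil(2)]] _ a])
      (simp add: lift3[OF bil(1)] lift3[OF bil(2)] lift3[OF bil(3)] lift3[OF bil(4)])
qed

end


section \<open>Functoriality in the datum\<close>

text \<open>Morphisms of data induce Hopf maps. The case of a subgroup gives the inclusion of \<open>B\<close>, the case of an
  isomorphism of groups gives the comparison with the bicrossed product of groups.\<close>

locale third_type_map = D: third_type K p G g f + C: third_type K p G' g' f'
  for K :: "('k, 'm) ring_scheme" and p and G :: "('g, 'n) monoid_scheme" and g f
    and G' :: "('h, 'l) monoid_scheme" and g' f' +
  fixes \<alpha> :: "'g \<Rightarrow> 'h"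
  assumes \<alpha>_hom: "\<alpha> \<in> hom G G'" and \<alpha>_g: "\<alpha> g = g'" and \<alpha>_f: "\<And>t. t \<in> carrier G \<Longrightarrow> f' (\<alpha> t) = f t"
begin

lemma \<alpha>_closed [simp]: "t \<in> carrier G \<Longrightarrow> \<alpha> t \<in> carrier G'"
  using \<alpha>_hom by (auto simp: hom_def)

lemma \<alpha>_mult: "s \<in> carrier G \<Longrightarrow> t \<in> carrier G \<Longrightarrow> \<alpha> (s \<otimes>\<^bsub>G\<^esub> t) = \<alpha> s \<otimes>\<^bsub>G'\<^esub> \<alpha> t"
  using \<alpha>_hom by (simp add: hom_mult)

lemma \<alpha>_group_hom: "group_hom G G' \<alpha>"
  by (simp add: group_hom_def group_hom_axioms_def \<alpha>_hom D.G.is_group C.G.is_group)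

lemmas \<alpha>_one = group_hom.hom_one[OF \<alpha>_group_hom]
lemmas \<alpha>_inv = group_hom.hom_inv[OF \<alpha>_group_hom]

definition third_map :: "('g letter list \<Rightarrow> 'k) set \<Rightarrow> ('h letter list \<Rightarrow> 'k) set" where
  "third_map = presented_hom K C.H (\<lambda>l. case l of Grp t \<Rightarrow> C.e (\<alpha> t) | Xgen \<Rightarrow> C.x)"

lemma third_map: "third_map \<in> algebra_homs K D.H C.H"
  and third_map_e: "t \<in> carrier G \<Longrightarrow> third_map (D.e t) = C.e (\<alpha> t)"
  and third_map_x: "third_map D.x = C.x"
proof -
  have comm: "C.e (\<alpha> t) \<otimes>\<^bsub>C.H\<^esub> C.x \<ominus>\<^bsub>C.H\<^esub> C.x \<otimes>\<^bsub>C.H\<^esub> C.e (\<alpha> t)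
      = f t \<odot>\<^bsub>C.H\<^esub> (C.e (\<alpha> t) \<otimes>\<^bsub>C.H\<^esub> (\<one>\<^bsub>C.H\<^esub> \<ominus>\<^bsub>C.H\<^esub> C.e (\<alpha> g)))" if "t \<in> carrier G" for t
    using C.e_x_commutator[of "\<alpha> t"] that by (simp add: \<alpha>_f \<alpha>_g)
  note hom = D.third_hom[OF C.H.assoc_algebra_axioms, where E = "\<lambda>t. C.e (\<alpha> t)" and \<xi> = C.x]
  show "third_map \<in> algebra_homs K D.H C.H"
    unfolding third_map_def by (rule hom(1)) (simp_all add: C.e_mult \<alpha>_mult \<alpha>_one C.e_one comm C.x_power)
  show "third_map (D.e t) = C.e (\<alpha> t)" if "t \<in> carrier G"
    unfolding third_map_def using that
    by (intro hom(2)) (simp_all add: C.e_mult \<alpha>_mult \<alpha>_one C.e_one comm C.x_power)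
  show "third_map D.x = C.x"
    unfolding third_map_def by (rule hom(3)) (simp_all add: C.e_mult \<alpha>_mult \<alpha>_one C.e_one comm C.x_power)
qed

lemma third_map_closed [simp]: "h \<in> carrier D.H \<Longrightarrow> third_map h \<in> carrier C.H"
  by (rule linear_closed[OF algebra_hom_linear[OF third_map]])

lemma third_map_hopf: "third_map \<in> hopf_homs K D.H C.H"
proof -
  note lin = algebra_hom_linear[OF third_map]
  note tmap = D.tensor_map_pure[OF C.H_module C.H_module D.H_module D.H_module lin lin]
  note tlin = D.tensor_map_linear[OF C.H_module C.H_module D.H_module D.H_module lin lin]
  note thom = D.tensor_map_algebra_hom[OF C.H.assoc_algebra_axioms C.H.assoc_algebra_axioms
      D.H.assoc_algebra_axioms D.H.assoc_algebra_axioms third_map third_map]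
  have one: "third_map \<one>\<^bsub>D.H\<^esub> = \<one>\<^bsub>C.H\<^esub>" by (rule algebra_hom_one[OF third_map])
  have comul: "comul C.H (third_map h) = tensor_map K C.H C.H third_map third_map (comul D.H h)"
    if "h \<in> carrier D.H" for h
    by (rule D.third_hom_eqI[OF algebra_hom_compose[OF third_map C.comul_hom]
          algebra_hom_compose[OF D.comul_hom thom] _ _ that])
      (simp_all add: third_map_e third_map_x D.comul_e D.comul_x C.comul_e C.comul_x tmap linear_add[OF tlin]
        D.pure_H_simps one \<alpha>_g)
  have counit: "counit C.H (third_map h) = counit D.H h" if "h \<in> carrier D.H" for h
    by (rule D.third_hom_eqI[OF algebra_hom_compose[OF third_map C.counit_hom] D.counit_hom _ _ that])
      (simp_all add: third_map_e third_map_x)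
  have opp: "third_map \<in> algebra_homs K (opposite_algebra D.H) (opposite_algebra C.H)"
    using third_map by (auto simp: algebra_homs_def ring_hom_def linear_maps_def)
  have antipode: "antipode C.H (third_map h) = third_map (antipode D.H h)" if "h \<in> carrier D.H" for h
    by (rule D.third_hom_eqI[OF algebra_hom_compose[OF third_map C.antipode_hom]
          algebra_hom_compose[OF D.antipode_hom opp] _ _ that])
      (simp_all add: third_map_e third_map_x D.antipode_e D.antipode_x C.antipode_e C.antipode_x \<alpha>_inv
        linear_neg[OF D.H_module C.H_module lin] algebra_hom_mult[OF third_map] \<alpha>_g)
  show ?thesis
    using comul counit antipode third_map D.H_hopf C.H_hopf by (simp add: hopf_homs_def tensor_map_def)
qed

text \<open>On the basis the map is \<open>tx\<^sup>i \<mapsto> \<alpha>(t)x\<^sup>i\<close>, so a left inverse of \<open>\<alpha>\<close> gives a linear left inverse.\<close>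

lemma third_map_basis:
  "t \<in> carrier G \<Longrightarrow> third_map (D.e t \<otimes>\<^bsub>D.H\<^esub> D.x [^]\<^bsub>D.H\<^esub> (i::nat)) = C.e (\<alpha> t) \<otimes>\<^bsub>C.H\<^esub> C.x [^]\<^bsub>C.H\<^esub> i"
  by (simp add: algebra_hom_mult[OF third_map] algebra_hom_pow[OF third_map D.H.V.is_monoid] third_map_e third_map_x)

lemma third_map_inverse:
  assumes inj: "inj_on \<alpha> (carrier G)"
  shows "\<exists>N \<in> linear_maps K C.H D.H. (\<forall>h\<in>carrier D.H. N (third_map h) = h) \<and>
    (\<forall>t\<in>carrier G. \<forall>i<p. N (C.e (\<alpha> t) \<otimes>\<^bsub>C.H\<^esub> C.x [^]\<^bsub>C.H\<^esub> i) = D.e t \<otimes>\<^bsub>D.H\<^esub> D.x [^]\<^bsub>D.H\<^esub> i)"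
proof -
  let ?v = "\<lambda>t i. if t \<in> \<alpha> ` carrier G then D.e (inv_into (carrier G) \<alpha> t) \<otimes>\<^bsub>D.H\<^esub> D.x [^]\<^bsub>D.H\<^esub> i else \<zero>\<^bsub>D.H\<^esub>"
  have "?v t i \<in> carrier D.H" for t and i :: nat
    using inv_into_into[of t \<alpha> "carrier G"] by simp
  then obtain N where N: "N \<in> linear_maps K C.H D.H"
    "\<And>t i. t \<in> carrier G' \<Longrightarrow> i < p \<Longrightarrow> N (C.e t \<otimes>\<^bsub>C.H\<^esub> C.x [^]\<^bsub>C.H\<^esub> i) = ?v t i"
    using C.third_basis[OF D.H_module, of ?v] by metis
  have v: "N (C.e (\<alpha> t) \<otimes>\<^bsub>C.H\<^esub> C.x [^]\<^bsub>C.H\<^esub> i) = D.e t \<otimes>\<^bsub>D.H\<^esub> D.x [^]\<^bsub>D.H\<^esub> i"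
    if "t \<in> carrier G" "i < p" for t i
    using N(2)[of "\<alpha> t" i] that inj by simp
  have "N (third_map h) = h" if "h \<in> carrier D.H" for h
    by (rule D.third_eqI[OF D.H_module linear_compose[OF algebra_hom_linear[OF third_map] N(1)] D.H.id_linear _ that])
      (simp add: third_map_basis v)
  with N(1) v show ?thesis by blast
qed

lemma third_map_inj:
  assumes "inj_on \<alpha> (carrier G)"
  shows "inj_on third_map (carrier D.H)"
  using third_map_inverse[OF assms]
proof (elim bexE conjE)
  fix N assume N: "\<forall>h\<in>carrier D.H. N (third_map h) = h"
  show ?thesis
    by (rule inj_on_inverseI[of _ N]) (rule bspec[OF N])
qed

lemma third_map_iso:
  assumes bij: "bij_betw \<alpha> (carrier G) (carrier G')"
  shows "third_map \<in> hopf_isos K D.H C.H"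
proof -
  have inj: "inj_on \<alpha> (carrier G)" and im: "\<alpha> ` carrier G = carrier G'"
    using bij by (auto simp: bij_betw_def)
  have "carrier C.H \<subseteq> third_map ` carrier D.H"
    using third_map_inverse[OF inj]
  proof (elim bexE conjE)
    fix N assume N: "N \<in> linear_maps K C.H D.H"
      "\<forall>t\<in>carrier G. \<forall>i<p. N (C.e (\<alpha> t) \<otimes>\<^bsub>C.H\<^esub> C.x [^]\<^bsub>C.H\<^esub> i) = D.e t \<otimes>\<^bsub>D.H\<^esub> D.x [^]\<^bsub>D.H\<^esub> i"
    have "third_map (N h) = h" if "h \<in> carrier C.H" for h
    proof (rule C.third_eqI[OF C.H_module linear_compose[OF N(1) algebra_hom_linear[OF third_map]] C.H.id_linear _ that])
      fix t and i :: nat assume "t \<in> carrier G'" "i < p"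
      moreover from this(1) obtain s where "s \<in> carrier G" "t = \<alpha> s" using im by auto
      ultimately show "third_map (N (C.e t \<otimes>\<^bsub>C.H\<^esub> C.x [^]\<^bsub>C.H\<^esub> i)) = C.e t \<otimes>\<^bsub>C.H\<^esub> C.x [^]\<^bsub>C.H\<^esub> i"
        using N(2) third_map_basis by simp
    qed
    note NK = this
    show ?thesis
    proof
      fix h assume h: "h \<in> carrier C.H"
      show "h \<in> third_map ` carrier D.H"
        using NK[OF h, symmetric] linear_closed[OF N(1) h] by (rule image_eqI)
    qed
  qed
  then show ?thesis
    using third_map_inj[OF inj] third_map_hopf unfolding hopf_isos_def bij_betw_def
    by (intro CollectI conjI subset_antisym) auto
qed

end


section \<open>The factorized group\<close>

text \<open>The converse of the dichotomy \<open>datum_cases\<close>. In this form the last condition on a datum visibly passes to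
  subgroups and along isomorphisms.\<close>

lemma (in field) third_type_datumI:
  fixes G :: "('g, 'n) monoid_scheme"
  assumes "group G" "finite (carrier G)" "g \<in> carrier G" "\<And>t. t \<in> carrier G \<Longrightarrow> g \<otimes>\<^bsub>G\<^esub> t = t \<otimes>\<^bsub>G\<^esub> g"
    and f: "\<And>t. t \<in> carrier G \<Longrightarrow> f t \<in> carrier R"
      "\<And>s t. s \<in> carrier G \<Longrightarrow> t \<in> carrier G \<Longrightarrow> f (s \<otimes>\<^bsub>G\<^esub> t) = f s \<oplus> f t" "f g = \<one>"
    and cases: "g [^]\<^bsub>G\<^esub> p = \<one>\<^bsub>G\<^esub> \<or> (\<forall>t\<in>carrier G. f t [^] p = f t)"
  shows "third_type_datum R p G g f"
proof -
  interpret G: group G by fact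
  let ?A = "monoid_algebra R G"
  interpret A: assoc_algebra R ?A by (rule monoid_algebra_assoc[OF G.is_monoid])
  have gp: "single R (g [^]\<^bsub>G\<^esub> p) \<in> carrier ?A"
    using assms(3) by simp
  have "(f t [^] p \<ominus> f t) \<odot>\<^bsub>?A\<^esub> (\<one>\<^bsub>?A\<^esub> \<ominus>\<^bsub>?A\<^esub> single R (g [^]\<^bsub>G\<^esub> p)) = \<zero>\<^bsub>?A\<^esub>" if t: "t \<in> carrier G" for t
    using cases
  proof
    assume "g [^]\<^bsub>G\<^esub> p = \<one>\<^bsub>G\<^esub>"
    then have "\<one>\<^bsub>?A\<^esub> \<ominus>\<^bsub>?A\<^esub> single R (g [^]\<^bsub>G\<^esub> p) = \<zero>\<^bsub>?A\<^esub>"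
      using A.M.r_neg[OF gp] by (simp add: a_minus_def)
    then show ?thesis using f(1)[OF t] A.smult_r_null by (simp del: monoid_algebra_sel)
  next
    assume "\<forall>t\<in>carrier G. f t [^] p = f t"
    then have "f t [^] p \<ominus> f t = \<zero>" using f(1)[OF t] t by (simp add: a_minus_def r_neg)
    then show ?thesis
      using A.smult_l_null[OF A.M.minus_closed[OF A.V.one_closed gp]] by simp
  qed
  then show ?thesis
    using assms by (auto simp: third_type_datum_def hom_def)
qed

locale factorized = third_type K p G g f
  for K :: "('k, 'm) ring_scheme" and p and G :: "'g monoid" and g f +
  fixes G\<^sub>B \<Gamma> :: "'g set"
  assumes GB: "subgroup G\<^sub>B G" and \<Gamma>: "subgroup \<Gamma> G" and product: "carrier G = G\<^sub>B <#>\<^bsub>G\<^esub> \<Gamma>"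
    and inter: "G\<^sub>B \<inter> \<Gamma> = {\<one>\<^bsub>G\<^esub>}" and g_GB: "g \<in> G\<^sub>B"
begin

abbreviation "P \<equiv> G\<lparr>carrier := \<Gamma>\<rparr>"
abbreviation "Q \<equiv> G\<lparr>carrier := G\<^sub>B\<rparr>"
abbreviation "l \<equiv> canonical_lact G \<Gamma> G\<^sub>B"
abbreviation "r \<equiv> canonical_ract G \<Gamma> G\<^sub>B"

lemma \<Gamma>_in [simp]: "h \<in> \<Gamma> \<Longrightarrow> h \<in> carrier G" and GB_in [simp]: "t \<in> G\<^sub>B \<Longrightarrow> t \<in> carrier G"
  using subgroup.mem_carrier[OF \<Gamma>] subgroup.mem_carrier[OF GB] by auto

lemmas \<Gamma>_closed [simp] = subgroup.m_closed[OF \<Gamma>] subgroup.one_closed[OF \<Gamma>] subgroup.m_inv_closed[OF \<Gamma>]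
lemmas GB_closed [simp] = subgroup.m_closed[OF GB] subgroup.one_closed[OF GB] subgroup.m_inv_closed[OF GB]

lemma factor_unique:
  assumes "h \<in> \<Gamma>" "h' \<in> \<Gamma>" "t \<in> G\<^sub>B" "t' \<in> G\<^sub>B" "h \<otimes>\<^bsub>G\<^esub> t = h' \<otimes>\<^bsub>G\<^esub> t'"
  shows "h = h'" "t = t'"
proof -
  have "inv\<^bsub>G\<^esub> h' \<otimes>\<^bsub>G\<^esub> (h \<otimes>\<^bsub>G\<^esub> t) \<otimes>\<^bsub>G\<^esub> inv\<^bsub>G\<^esub> t = inv\<^bsub>G\<^esub> h' \<otimes>\<^bsub>G\<^esub> (h' \<otimes>\<^bsub>G\<^esub> t') \<otimes>\<^bsub>G\<^esub> inv\<^bsub>G\<^esub> t"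
    using assms(5) by simp
  then have eq: "inv\<^bsub>G\<^esub> h' \<otimes>\<^bsub>G\<^esub> h = t' \<otimes>\<^bsub>G\<^esub> inv\<^bsub>G\<^esub> t"
    using assms(1-4) by (simp add: G.m_assoc) (simp add: G.m_assoc[symmetric])
  have "inv\<^bsub>G\<^esub> h' \<otimes>\<^bsub>G\<^esub> h \<in> \<Gamma>" using assms by (intro \<Gamma>_closed)
  moreover have "inv\<^bsub>G\<^esub> h' \<otimes>\<^bsub>G\<^esub> h \<in> G\<^sub>B" unfolding eq using assms by (intro GB_closed)
  ultimately have "inv\<^bsub>G\<^esub> h' \<otimes>\<^bsub>G\<^esub> h = \<one>\<^bsub>G\<^esub>" using inter by blast
  then show h: "h = h'"
    using assms by (metis G.inv_closed G.inv_equality G.inv_inv \<Gamma>_in)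
  then show "t = t'" using assms by simp
qed

lemma factor_exists:
  assumes "s \<in> carrier G"
  obtains h t where "h \<in> \<Gamma>" "t \<in> G\<^sub>B" "s = h \<otimes>\<^bsub>G\<^esub> t"
proof -
  have "inv\<^bsub>G\<^esub> s \<in> G\<^sub>B <#>\<^bsub>G\<^esub> \<Gamma>" using assms product by auto
  then obtain b c where bc: "b \<in> G\<^sub>B" "c \<in> \<Gamma>" "inv\<^bsub>G\<^esub> s = b \<otimes>\<^bsub>G\<^esub> c"
    by (auto simp: set_mult_def)
  then have "s = inv\<^bsub>G\<^esub> c \<otimes>\<^bsub>G\<^esub> inv\<^bsub>G\<^esub> b"
    using assms by (metis G.inv_inv G.inv_mult_group GB_in \<Gamma>_in)
  then show ?thesis
    by (rule that[OF \<Gamma>_closed(3)[OF bc(2)] GB_closed(3)[OF bc(1)]])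
qed

lemma act_eqI:
  assumes "t \<in> G\<^sub>B" "h \<in> \<Gamma>" "h' \<in> \<Gamma>" "t' \<in> G\<^sub>B" "t \<otimes>\<^bsub>G\<^esub> h = h' \<otimes>\<^bsub>G\<^esub> t'"
  shows "l t h = h'" "r t h = t'"
proof -
  show "l t h = h'"
    unfolding canonical_lact_def
  proof (rule the_equality)
    show "h' \<in> \<Gamma> \<and> (\<exists>t'\<in>G\<^sub>B. t \<otimes>\<^bsub>G\<^esub> h = h' \<otimes>\<^bsub>G\<^esub> t')" using assms by blast
    fix k assume "k \<in> \<Gamma> \<and> (\<exists>s\<in>G\<^sub>B. t \<otimes>\<^bsub>G\<^esub> h = k \<otimes>\<^bsub>G\<^esub> s)"
    then obtain s where "k \<in> \<Gamma>" "s \<in> G\<^sub>B" "t \<otimes>\<^bsub>G\<^esub> h = k \<otimes>\<^bsub>G\<^esub> s" by blast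
    then show "k = h'" using factor_unique(1)[of k h' s t'] assms by simp
  qed
  show "r t h = t'"
    unfolding canonical_ract_def
  proof (rule the_equality)
    show "t' \<in> G\<^sub>B \<and> (\<exists>h'\<in>\<Gamma>. t \<otimes>\<^bsub>G\<^esub> h = h' \<otimes>\<^bsub>G\<^esub> t')" using assms by blast
    fix s assume "s \<in> G\<^sub>B \<and> (\<exists>k\<in>\<Gamma>. t \<otimes>\<^bsub>G\<^esub> h = k \<otimes>\<^bsub>G\<^esub> s)"
    then obtain k where "k \<in> \<Gamma>" "s \<in> G\<^sub>B" "t \<otimes>\<^bsub>G\<^esub> h = k \<otimes>\<^bsub>G\<^esub> s" by blast
    then show "s = t'" using factor_unique(2)[of k h' s t'] assms by simp
  qed
qed

lemma
  assumes "t \<in> G\<^sub>B" "h \<in> \<Gamma>"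
  shows l_closed [simp]: "l t h \<in> \<Gamma>" and r_closed [simp]: "r t h \<in> G\<^sub>B" and act_product: "t \<otimes>\<^bsub>G\<^esub> h = l t h \<otimes>\<^bsub>G\<^esub> r t h"
proof -
  obtain h' t' where "h' \<in> \<Gamma>" "t' \<in> G\<^sub>B" "t \<otimes>\<^bsub>G\<^esub> h = h' \<otimes>\<^bsub>G\<^esub> t'"
    using factor_exists[of "t \<otimes>\<^bsub>G\<^esub> h"] assms by auto
  then show "l t h \<in> \<Gamma>" "r t h \<in> G\<^sub>B" "t \<otimes>\<^bsub>G\<^esub> h = l t h \<otimes>\<^bsub>G\<^esub> r t h"
    using act_eqI[OF assms] by simp_all
qed

lemma act_prod:
  assumes "t \<in> G\<^sub>B" "h \<in> \<Gamma>" "k \<in> \<Gamma>"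
  shows "l t (h \<otimes>\<^bsub>G\<^esub> k) = l t h \<otimes>\<^bsub>G\<^esub> l (r t h) k" "r t (h \<otimes>\<^bsub>G\<^esub> k) = r (r t h) k"
proof -
  have "t \<otimes>\<^bsub>G\<^esub> (h \<otimes>\<^bsub>G\<^esub> k) = l t h \<otimes>\<^bsub>G\<^esub> (r t h \<otimes>\<^bsub>G\<^esub> k)"
    using assms act_product[OF assms(1,2)] by (simp add: G.m_assoc[symmetric])
  also have "\<dots> = (l t h \<otimes>\<^bsub>G\<^esub> l (r t h) k) \<otimes>\<^bsub>G\<^esub> r (r t h) k"
    using assms act_product[of "r t h" k] by (simp add: G.m_assoc)
  finally show "l t (h \<otimes>\<^bsub>G\<^esub> k) = l t h \<otimes>\<^bsub>G\<^esub> l (r t h) k" "r t (h \<otimes>\<^bsub>G\<^esub> k) = r (r t h) k"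
    using act_eqI[of t "h \<otimes>\<^bsub>G\<^esub> k" "l t h \<otimes>\<^bsub>G\<^esub> l (r t h) k" "r (r t h) k"] assms by simp_all
qed

lemma prod_act:
  assumes "t \<in> G\<^sub>B" "s \<in> G\<^sub>B" "h \<in> \<Gamma>"
  shows "l (t \<otimes>\<^bsub>G\<^esub> s) h = l t (l s h)" "r (t \<otimes>\<^bsub>G\<^esub> s) h = r t (l s h) \<otimes>\<^bsub>G\<^esub> r s h"
proof -
  have "(t \<otimes>\<^bsub>G\<^esub> s) \<otimes>\<^bsub>G\<^esub> h = (t \<otimes>\<^bsub>G\<^esub> l s h) \<otimes>\<^bsub>G\<^esub> r s h"
    using assms act_product[OF assms(2,3)] by (simp add: G.m_assoc)
  also have "\<dots> = l t (l s h) \<otimes>\<^bsub>G\<^esub> (r t (l s h) \<otimes>\<^bsub>G\<^esub> r s h)"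
    using assms act_product[of t "l s h"] by (simp add: G.m_assoc)
  finally show "l (t \<otimes>\<^bsub>G\<^esub> s) h = l t (l s h)" "r (t \<otimes>\<^bsub>G\<^esub> s) h = r t (l s h) \<otimes>\<^bsub>G\<^esub> r s h"
    using act_eqI[of "t \<otimes>\<^bsub>G\<^esub> s" h "l t (l s h)" "r t (l s h) \<otimes>\<^bsub>G\<^esub> r s h"] assms by simp_all
qed

lemma one_act: "h \<in> \<Gamma> \<Longrightarrow> l \<one>\<^bsub>G\<^esub> h = h" "h \<in> \<Gamma> \<Longrightarrow> r \<one>\<^bsub>G\<^esub> h = \<one>\<^bsub>G\<^esub>"
  "t \<in> G\<^sub>B \<Longrightarrow> l t \<one>\<^bsub>G\<^esub> = \<one>\<^bsub>G\<^esub>" "t \<in> G\<^sub>B \<Longrightarrow> r t \<one>\<^bsub>G\<^esub> = t"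
  using act_eqI[of "\<one>\<^bsub>G\<^esub>" h h "\<one>\<^bsub>G\<^esub>"] act_eqI[of t "\<one>\<^bsub>G\<^esub>" "\<one>\<^bsub>G\<^esub>" t] by simp_all

lemma g_act: "h \<in> \<Gamma> \<Longrightarrow> l g h = h" "h \<in> \<Gamma> \<Longrightarrow> r g h = g"
  using act_eqI[of g h h g] g_GB g_central[of h] by simp_all

lemma P_group: "group P" and Q_group: "group Q"
  using subgroup.subgroup_is_group[OF \<Gamma> G.is_group] subgroup.subgroup_is_group[OF GB G.is_group] by auto

lemma group_matched_pair: "group_matched_pair P Q l r"
  by (intro group_matched_pair.intro group_matched_pair_axioms.intro P_group Q_group)
    (simp_all add: one_act act_prod prod_act)

lemma Q_datum: "third_type_datum K p Q g f"
proof (rule third_type_datumI[OF Q_group])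
  show "finite (carrier Q)"
    using datum finite_subset[OF subgroup.subset[OF GB]] by (auto simp: third_type_datum_def)
  show "g [^]\<^bsub>Q\<^esub> p = \<one>\<^bsub>Q\<^esub> \<or> (\<forall>t\<in>carrier Q. f t [^]\<^bsub>K\<^esub> p = f t)"
    using datum_cases by (auto simp: nat_pow_def)
qed (simp_all add: g_GB g_central)

end

sublocale factorized \<subseteq> B: third_type K p "G\<lparr>carrier := G\<^sub>B\<rparr>" g f
  by (intro third_type.intro third_type_axioms.intro field_axioms Q_group prime char Q_datum)

sublocale factorized \<subseteq> A: group_hopf K "G\<lparr>carrier := \<Gamma>\<rparr>"
  by (intro group_hopf.intro field_axioms P_group)

sublocale factorized \<subseteq> J: third_type_map K p "G\<lparr>carrier := G\<^sub>B\<rparr>" g f G g f "\<lambda>t. t"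
  by (intro third_type_map.intro third_type_map_axioms.intro third_type_axioms B.third_type_axioms)
    (auto simp: hom_def)

context factorized
begin

abbreviation "A \<equiv> group_hopf_algebra K P"
abbreviation "B \<equiv> third_hopf_algebra K p Q g f"
abbreviation "i \<equiv> group_incl K p G g f"
abbreviation "j \<equiv> third_incl K p G g f"
abbreviation "AB \<equiv> tensor_module K A B"
abbreviation "pureAB \<equiv> pure_tensor K A B"

interpretation AA: assoc_algebra K A by (rule A.A_assoc)

lemma j_eq: "j = J.third_map"
  by (simp add: third_incl_def J.third_map_def)

lemma j_hom: "j \<in> algebra_homs K B H" and j_e [simp]: "t \<in> G\<^sub>B \<Longrightarrow> j (B.e t) = e t" and j_x [simp]: "j B.x = x"
  and j_hopf: "j \<in> hopf_homs K B H" and j_inj: "inj_on j (carrier B)"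
  unfolding j_eq using J.third_map J.third_map_e J.third_map_x J.third_map_hopf J.third_map_inj
  by (simp_all add: inj_on_def)

lemma i_hom: "i \<in> algebra_homs K A H"
  unfolding group_incl_def by (rule A.A_lift_hom[OF H.assoc_algebra_axioms]) (simp_all add: e_mult e_one)

lemma i_single [simp]: "h \<in> \<Gamma> \<Longrightarrow> i (single K h) = e h"
  unfolding group_incl_def by (rule lin_ext_single[OF H_module]) simp

lemmas i_linear = algebra_hom_linear[OF i_hom] and j_linear = algebra_hom_linear[OF j_hom]

lemma ij_simps [simp]:
  "a \<in> carrier A \<Longrightarrow> i a \<in> carrier H" "u \<in> carrier B \<Longrightarrow> j u \<in> carrier H"
  "a \<in> carrier A \<Longrightarrow> b \<in> carrier A \<Longrightarrow> i (a \<oplus>\<^bsub>A\<^esub> b) = i a \<oplus>\<^bsub>H\<^esub> i b"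
  "u \<in> carrier B \<Longrightarrow> v \<in> carrier B \<Longrightarrow> j (u \<oplus>\<^bsub>B\<^esub> v) = j u \<oplus>\<^bsub>H\<^esub> j v"
  "c \<in> carrier K \<Longrightarrow> a \<in> carrier A \<Longrightarrow> i (c \<odot>\<^bsub>A\<^esub> a) = c \<odot>\<^bsub>H\<^esub> i a"
  "c \<in> carrier K \<Longrightarrow> u \<in> carrier B \<Longrightarrow> j (c \<odot>\<^bsub>B\<^esub> u) = c \<odot>\<^bsub>H\<^esub> j u"
  "a \<in> carrier A \<Longrightarrow> b \<in> carrier A \<Longrightarrow> i (a \<otimes>\<^bsub>A\<^esub> b) = i a \<otimes>\<^bsub>H\<^esub> i b"
  "u \<in> carrier B \<Longrightarrow> v \<in> carrier B \<Longrightarrow> j (u \<otimes>\<^bsub>B\<^esub> v) = j u \<otimes>\<^bsub>H\<^esub> j v"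
  "i \<one>\<^bsub>A\<^esub> = \<one>\<^bsub>H\<^esub>" "j \<one>\<^bsub>B\<^esub> = \<one>\<^bsub>H\<^esub>"
  using linear_closed[OF i_linear] linear_closed[OF j_linear] linear_add[OF i_linear] linear_add[OF j_linear]
    linear_smult[OF i_linear] linear_smult[OF j_linear] algebra_hom_mult[OF i_hom] algebra_hom_mult[OF j_hom]
    algebra_hom_one[OF i_hom] algebra_hom_one[OF j_hom] by simp_all

lemma i_comul: "a \<in> carrier A \<Longrightarrow> comul H (i a) = tensor_map K H H i i (comul A a)"
proof (rule A.A_eqI[OF T_module linear_compose[OF i_linear comul_linear]
      linear_compose[OF A.A_comul_linear tensor_map_linear[OF H_module H_module A.A_module A.A_module i_linear i_linear]]])
  fix h assume "h \<in> carrier P"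
  then show "comul H (i (single K h)) = tensor_map K H H i i (comul A (single K h))"
    using tensor_map_pure[OF H_module H_module A.A_module A.A_module i_linear i_linear] by (simp add: comul_e)
qed

lemma i_counit: "a \<in> carrier A \<Longrightarrow> counit H (i a) = counit A a"
proof -
  interpret Kb: assoc_algebra K "base_algebra K" by (rule base_algebra_assoc)
  show "a \<in> carrier A \<Longrightarrow> counit H (i a) = counit A a"
    by (rule A.A_eqI[OF Kb.module_axioms linear_compose[OF i_linear counit_linear] algebra_hom_linear[OF A.A_counit_hom]])
      simp_all
qed

lemma i_antipode: "a \<in> carrier A \<Longrightarrow> antipode H (i a) = i (antipode A a)"
proof (rule A.A_eqI[OF H_module linear_compose[OF i_linear antipode_linear] linear_compose[OF A.A_antipode_linear i_linear]])
  fix h assume h: "h \<in> carrier P"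
  then have "inv\<^bsub>P\<^esub> h = inv\<^bsub>G\<^esub> h" using G.m_inv_consistent[OF \<Gamma>] by simp
  then show "antipode H (i (single K h)) = i (antipode A (single K h))"
    using h by (simp add: antipode_e)
qed

lemma i_hopf: "i \<in> hopf_homs K A H"
  using i_comul i_counit i_antipode i_hom A.A_hopf H_hopf by (simp add: hopf_homs_def tensor_map_def)

lemma j_comul: "u \<in> carrier B \<Longrightarrow> comul H (j u) = tensor_map K H H j j (comul B u)"
  and j_counit: "u \<in> carrier B \<Longrightarrow> counit H (j u) = counit B u"
  and j_antipode: "u \<in> carrier B \<Longrightarrow> antipode H (j u) = j (antipode B u)"
  using j_hopf by (simp_all add: hopf_homs_def tensor_map_def)

lemmas AB_module = tensor_module_module[OF A.A_module B.H_module]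
lemmas pureAB_simps = pure_closed[OF A.A_module B.H_module] pure_add_left[OF A.A_module B.H_module]
  pure_add_right[OF A.A_module B.H_module] pure_smult_left[OF A.A_module B.H_module]
  pure_smult_right[OF A.A_module B.H_module]

abbreviation "fm \<equiv> factorization_map K H i j"

lemma fm_bilinear: "(\<lambda>a u. i a \<otimes>\<^bsub>H\<^esub> j u) \<in> bilinear_maps K A B H"
  by (rule bilinear_mapsI) (simp_all add: H.V.l_distr H.V.r_distr H.smult_mult_left H.smult_mult_right)

lemma fm_linear: "fm \<in> linear_maps K AB H"
  unfolding factorization_map_def by (rule tensor_lift_linear[OF A.A_module B.H_module H_module fm_bilinear])

lemma fm_pure [simp]: "a \<in> carrier A \<Longrightarrow> u \<in> carrier B \<Longrightarrow> fm (pureAB a u) = i a \<otimes>\<^bsub>H\<^esub> j u"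
  unfolding factorization_map_def by (rule tensor_lift_pure[OF A.A_module B.H_module H_module fm_bilinear])

lemma AB_eqI:
  assumes Z: "module K Z" and \<phi>: "\<phi> \<in> linear_maps K AB Z" and \<psi>: "\<psi> \<in> linear_maps K AB Z"
    and eq: "\<And>h u. h \<in> \<Gamma> \<Longrightarrow> u \<in> carrier B \<Longrightarrow> \<phi> (pureAB (single K h) u) = \<psi> (pureAB (single K h) u)"
    and C: "C \<in> carrier AB"
  shows "\<phi> C = \<psi> C"
proof (rule tensor_eqI[OF A.A_module B.H_module \<phi> \<psi> _ C])
  fix a u assume a: "a \<in> carrier A" and u: "u \<in> carrier B"
  note lin = bilinear_left[OF pure_bilinear[OF A.A_module B.H_module] u]
  show "\<phi> (pureAB a u) = \<psi> (pureAB a u)"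
    by (rule A.A_eqI[OF Z linear_compose[OF lin \<phi>] linear_compose[OF lin \<psi>] _ a]) (use eq u in simp)
qed

text \<open>The basis \<open>htx\<^sup>i\<close> of \<open>H\<close>, for \<open>h \<in> \<Gamma>\<close> and \<open>t \<in> G\<^sub>B\<close>, is the image of the basis \<open>h \<otimes> tx\<^sup>i\<close>.\<close>

lemma fm_inverse:
  obtains E where "E \<in> linear_maps K H AB" "\<And>w. w \<in> carrier H \<Longrightarrow> fm (E w) = w"
    "\<And>C. C \<in> carrier AB \<Longrightarrow> E (fm C) = C"
proof -
  interpret AB: module K AB by (rule AB_module)
  have "\<forall>s\<in>carrier G. \<exists>h t. h \<in> \<Gamma> \<and> t \<in> G\<^sub>B \<and> s = h \<otimes>\<^bsub>G\<^esub> t"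
    using factor_exists by metis
  then obtain c d where cd: "\<And>s. s \<in> carrier G \<Longrightarrow> c s \<in> \<Gamma> \<and> d s \<in> G\<^sub>B \<and> s = c s \<otimes>\<^bsub>G\<^esub> d s"
    by metis
  have cd_eq: "c (h \<otimes>\<^bsub>G\<^esub> t) = h" "d (h \<otimes>\<^bsub>G\<^esub> t) = t" if "h \<in> \<Gamma>" "t \<in> G\<^sub>B" for h t
    using cd[of "h \<otimes>\<^bsub>G\<^esub> t"] that factor_unique[of "c (h \<otimes>\<^bsub>G\<^esub> t)" h "d (h \<otimes>\<^bsub>G\<^esub> t)" t] by auto
  let ?v = "\<lambda>s n. pureAB (single K (c s)) (B.e (d s) \<otimes>\<^bsub>B\<^esub> B.x [^]\<^bsub>B\<^esub> (n::nat))"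
  have "?v s n \<in> carrier AB" if "s \<in> carrier G" for s n
    using cd[OF that] by (simp add: pureAB_simps)
  then obtain E where E: "E \<in> linear_maps K H AB"
    "\<And>s n. s \<in> carrier G \<Longrightarrow> n < p \<Longrightarrow> E (e s \<otimes>\<^bsub>H\<^esub> x [^]\<^bsub>H\<^esub> n) = ?v s n"
    using third_basis[OF AB_module, of ?v] by metis
  have jb: "j (B.e t \<otimes>\<^bsub>B\<^esub> B.x [^]\<^bsub>B\<^esub> n) = e t \<otimes>\<^bsub>H\<^esub> x [^]\<^bsub>H\<^esub> n" if "t \<in> G\<^sub>B" for t and n :: nat
    using that by (simp add: algebra_hom_pow[OF j_hom B.H.V.is_monoid])
  have fE: "fm (E w) = w" if "w \<in> carrier H" for w
  proof (rule third_eqI[OF H_module linear_compose[OF E(1) fm_linear] H.id_linear _ that])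
    fix s n assume s: "s \<in> carrier G" and n: "n < p"
    have "e (c s) \<otimes>\<^bsub>H\<^esub> (e (d s) \<otimes>\<^bsub>H\<^esub> x [^]\<^bsub>H\<^esub> n) = e s \<otimes>\<^bsub>H\<^esub> x [^]\<^bsub>H\<^esub> n"
      using cd[OF s] by (simp add: H.V.m_assoc[symmetric] e_mult)
    then show "fm (E (e s \<otimes>\<^bsub>H\<^esub> x [^]\<^bsub>H\<^esub> n)) = e s \<otimes>\<^bsub>H\<^esub> x [^]\<^bsub>H\<^esub> n"
      using cd[OF s] by (simp only: E(2)[OF s n]) (simp add: jb del: ij_simps(8))
  qed
  have Ef: "E (fm C) = C" if "C \<in> carrier AB" for C
  proof (rule AB_eqI[OF AB_module linear_compose[OF fm_linear E(1)] AB.id_linear _ that])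
    fix h u assume h: "h \<in> \<Gamma>" and u: "u \<in> carrier B"
    note lin = bilinear_right[OF pure_bilinear[OF A.A_module B.H_module] A.A_single_in]
    show "E (fm (pureAB (single K h) u)) = pureAB (single K h) u"
    proof (rule B.third_eqI[OF AB_module _ _ _ u])
      show "(\<lambda>u. E (fm (pureAB (single K h) u))) \<in> linear_maps K B AB"
        by (rule linear_compose[OF lin linear_compose[OF fm_linear E(1)]]) (use h in simp)
      show "(\<lambda>u. pureAB (single K h) u) \<in> linear_maps K B AB"
        by (rule lin) (use h in simp)
      fix t n assume t: "t \<in> carrier Q" and n: "n < p"
      have "fm (pureAB (single K h) (B.e t \<otimes>\<^bsub>B\<^esub> B.x [^]\<^bsub>B\<^esub> n)) = e (h \<otimes>\<^bsub>G\<^esub> t) \<otimes>\<^bsub>H\<^esub> x [^]\<^bsub>H\<^esub> n"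
        using h t by (simp add: jb H.V.m_assoc[symmetric] e_mult del: ij_simps(8))
      then show "E (fm (pureAB (single K h) (B.e t \<otimes>\<^bsub>B\<^esub> B.x [^]\<^bsub>B\<^esub> n))) = pureAB (single K h) (B.e t \<otimes>\<^bsub>B\<^esub> B.x [^]\<^bsub>B\<^esub> n)"
        using h t n by (simp add: E(2) cd_eq)
    qed
  qed
  show ?thesis by (rule that[OF E(1) fE Ef])
qed

lemma fm_bij: "bij_betw fm (carrier AB) (carrier H)"
proof -
  obtain E where E: "E \<in> linear_maps K H AB" "\<And>w. w \<in> carrier H \<Longrightarrow> fm (E w) = w"
    "\<And>C. C \<in> carrier AB \<Longrightarrow> E (fm C) = C" by (rule fm_inverse) blast
  show ?thesis
    by (rule bij_betw_byWitness[where f' = E])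
      (use E linear_closed[OF fm_linear] linear_closed[OF E(1)] in auto)
qed

lemma i_inj: "inj_on i (carrier A)"
proof (rule inj_onI)
  fix a b assume ab: "a \<in> carrier A" "b \<in> carrier A" "i a = i b"
  then have "fm (pureAB a \<one>\<^bsub>B\<^esub>) = fm (pureAB b \<one>\<^bsub>B\<^esub>)" by simp
  then have "pureAB a \<one>\<^bsub>B\<^esub> = pureAB b \<one>\<^bsub>B\<^esub>"
    by (rule inj_onD[OF bij_betw_imp_inj_on[OF fm_bij]]) (use ab in \<open>simp_all add: pureAB_simps\<close>)
  moreover have bil: "(\<lambda>a u. counit B u \<odot>\<^bsub>A\<^esub> a) \<in> bilinear_maps K A B A"
    by (rule bilinear_mapsI) (simp_all add: AA.smult_l_distr AA.smult_r_distr AA.smult_assoc1[symmetric] m_comm)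
  ultimately show "a = b"
    using tensor_lift_pure[OF A.A_module B.H_module A.A_module bil, of _ "\<one>\<^bsub>B\<^esub>"] ab
    by (metis AA.smult_one B.H.V.one_closed B.counit_simps(5))
qed

lemma exact: "exact_factorization K H A B i j"
  using i_hopf i_inj j_hopf j_inj fm_bij by (simp add: exact_factorization_def)

end


section \<open>Sweedler sums over two factors\<close>

text \<open>Summands are separately bilinear in the two tensor factors of \<open>\<Delta>(u)\<close> and in those of \<open>\<Delta>(a)\<close>.\<close>

definition quadrilinear_maps ::
  "('k, 'm) ring_scheme \<Rightarrow> ('k, 'b, 'y) module_scheme \<Rightarrow> ('k, 'a, 'x) module_scheme
    \<Rightarrow> ('k, 'z, 'u) module_scheme \<Rightarrow> ('b \<Rightarrow> 'b \<Rightarrow> 'a \<Rightarrow> 'a \<Rightarrow> 'z) set"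
where
  "quadrilinear_maps K B A Z = {\<phi>.
     (\<forall>u\<^sub>1\<in>carrier B. \<forall>u\<^sub>2\<in>carrier B. \<phi> u\<^sub>1 u\<^sub>2 \<in> bilinear_maps K A A Z) \<and>
     (\<forall>a\<^sub>1\<in>carrier A. \<forall>a\<^sub>2\<in>carrier A. (\<lambda>u\<^sub>1 u\<^sub>2. \<phi> u\<^sub>1 u\<^sub>2 a\<^sub>1 a\<^sub>2) \<in> bilinear_maps K B B Z)}"

text \<open>All sums that occur in the axioms combine one action on the first Sweedler components with another
  one on the second components.\<close>

lemma quadrilinear_split:
  assumes \<Phi>: "\<Phi> \<in> bilinear_maps K V W Z" and P: "P \<in> bilinear_maps K B A V" and Q: "Q \<in> bilinear_maps K B A W"
  shows "(\<lambda>u\<^sub>1 u\<^sub>2 a\<^sub>1 a\<^sub>2. \<Phi> (P u\<^sub>1 a\<^sub>1) (Q u\<^sub>2 a\<^sub>2)) \<in> quadrilinear_maps K B A Z"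
  unfolding quadrilinear_maps_def
proof (intro CollectI conjI ballI)
  fix u v assume "u \<in> carrier B" "v \<in> carrier B"
  then show "(\<lambda>a\<^sub>1 a\<^sub>2. \<Phi> (P u a\<^sub>1) (Q v a\<^sub>2)) \<in> bilinear_maps K A A Z"
    by (rule bilinear_compose_args[OF \<Phi> bilinear_right[OF P] bilinear_right[OF Q]])
next
  fix a b assume "a \<in> carrier A" "b \<in> carrier A"
  then show "(\<lambda>u\<^sub>1 u\<^sub>2. \<Phi> (P u\<^sub>1 a) (Q u\<^sub>2 b)) \<in> bilinear_maps K B B Z"
    by (rule bilinear_compose_args[OF \<Phi> bilinear_left[OF P] bilinear_left[OF Q]])
qed

lemma quadrilinear_split_swap:
  assumes \<Phi>: "\<Phi> \<in> bilinear_maps K V W Z" and P: "P \<in> bilinear_maps K B A V" and Q: "Q \<in> bilinear_maps K B A W"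
  shows "(\<lambda>u\<^sub>1 u\<^sub>2 a\<^sub>1 a\<^sub>2. \<Phi> (P u\<^sub>2 a\<^sub>2) (Q u\<^sub>1 a\<^sub>1)) \<in> quadrilinear_maps K B A Z"
  by (rule quadrilinear_split[OF bilinear_flip[OF \<Phi>] Q P])

context cring
begin

lemma
  fixes A :: "('a, 'v, 'x) hopf_scheme" and B :: "('a, 'w, 'y) hopf_scheme"
  assumes A: "module R A" and B: "module R B" and Z: "module R Z"
    and \<Delta>A: "comul A \<in> linear_maps R A (tensor_module R A A)"
    and \<Delta>B: "comul B \<in> linear_maps R B (tensor_module R B B)"
    and \<phi>: "\<phi> \<in> quadrilinear_maps R B A Z"
  shows sweedler2_inner: "\<And>a. a \<in> carrier A \<Longrightarrow>
      (\<lambda>u\<^sub>1 u\<^sub>2. tensor_lift R Z (\<phi> u\<^sub>1 u\<^sub>2) (comul A a)) \<in> bilinear_maps R B B Z"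
    and sweedler2_bilinear: "sweedler2 R A B Z \<phi> \<in> bilinear_maps R B A Z"
    and sweedler2_grouplike: "\<And>u a. u \<in> carrier B \<Longrightarrow> a \<in> carrier A \<Longrightarrow> comul A a = pure_tensor R A A a a \<Longrightarrow>
      sweedler2 R A B Z \<phi> u a = tensor_lift R Z (\<lambda>u\<^sub>1 u\<^sub>2. \<phi> u\<^sub>1 u\<^sub>2 a a) (comul B u)"
proof -
  have \<phi>1: "\<phi> u v \<in> bilinear_maps R A A Z" if "u \<in> carrier B" "v \<in> carrier B" for u v
    using \<phi> that by (simp add: quadrilinear_maps_def)
  have \<phi>2: "(\<lambda>u v. \<phi> u v a b) \<in> bilinear_maps R B B Z" if "a \<in> carrier A" "b \<in> carrier A" for a b
    using \<phi> that by (simp add: quadrilinear_maps_def)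
  note cl = linear_closed[OF \<Delta>A] linear_closed[OF \<Delta>B]
  show inner: "(\<lambda>u\<^sub>1 u\<^sub>2. tensor_lift R Z (\<phi> u\<^sub>1 u\<^sub>2) (comul A a)) \<in> bilinear_maps R B B Z"
    if a: "a \<in> carrier A" for a
    by (rule tensor_lift_param2[OF A A Z B B \<phi>1 \<phi>2 cl(1)[OF a]])
  show "sweedler2 R A B Z \<phi> \<in> bilinear_maps R B A Z"
    unfolding bilinear_maps_def sweedler2_def
  proof (intro CollectI conjI ballI)
    fix u assume u: "u \<in> carrier B"
    show "(\<lambda>a. tensor_lift R Z (\<lambda>u\<^sub>1 u\<^sub>2. tensor_lift R Z (\<phi> u\<^sub>1 u\<^sub>2) (comul A a)) (comul B u)) \<in> linear_maps R A Z"
      by (rule tensor_lift_param[OF B B Z A inner _ cl(2)[OF u]])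
        (auto intro: linear_compose[OF \<Delta>A tensor_lift_linear[OF A A Z \<phi>1]])
  next
    fix a assume a: "a \<in> carrier A"
    show "(\<lambda>u. tensor_lift R Z (\<lambda>u\<^sub>1 u\<^sub>2. tensor_lift R Z (\<phi> u\<^sub>1 u\<^sub>2) (comul A a)) (comul B u)) \<in> linear_maps R B Z"
      by (rule linear_compose[OF \<Delta>B tensor_lift_linear[OF B B Z inner[OF a]]])
  qed
  show "sweedler2 R A B Z \<phi> u a = tensor_lift R Z (\<lambda>u\<^sub>1 u\<^sub>2. \<phi> u\<^sub>1 u\<^sub>2 a a) (comul B u)"
    if u: "u \<in> carrier B" and a: "a \<in> carrier A" and \<Delta>: "comul A a = pure_tensor R A A a a" for u a
    unfolding sweedler2_def
    by (rule tensor_lift_cong[OF B B Z inner[OF a] _ cl(2)[OF u]])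
      (simp add: \<Delta> tensor_lift_pure[OF A A Z \<phi>1 a a])
qed

lemma sweedler2_param:
  fixes A :: "('a, 'v, 'x) hopf_scheme" and B :: "('a, 'w, 'y) hopf_scheme"
  assumes A: "module R A" and B: "module R B" and Z: "module R Z" and U: "module R U"
    and \<Delta>A: "comul A \<in> linear_maps R A (tensor_module R A A)"
    and \<Delta>B: "comul B \<in> linear_maps R B (tensor_module R B B)"
    and \<phi>: "\<And>c. c \<in> carrier U \<Longrightarrow> \<phi> c \<in> quadrilinear_maps R B A Z"
    and lin: "\<And>u\<^sub>1 u\<^sub>2 a\<^sub>1 a\<^sub>2. u\<^sub>1 \<in> carrier B \<Longrightarrow> u\<^sub>2 \<in> carrier B \<Longrightarrow> a\<^sub>1 \<in> carrier A \<Longrightarrow> a\<^sub>2 \<in> carrier A \<Longrightarrow>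
      (\<lambda>c. \<phi> c u\<^sub>1 u\<^sub>2 a\<^sub>1 a\<^sub>2) \<in> linear_maps R U Z"
    and u: "u \<in> carrier B" and a: "a \<in> carrier A"
  shows "(\<lambda>c. sweedler2 R A B Z (\<phi> c) u a) \<in> linear_maps R U Z"
  unfolding sweedler2_def
proof (rule tensor_lift_param[OF B B Z U])
  show "(\<lambda>u\<^sub>1 u\<^sub>2. tensor_lift R Z (\<phi> c u\<^sub>1 u\<^sub>2) (comul A a)) \<in> bilinear_maps R B B Z" if "c \<in> carrier U" for c
    by (rule sweedler2_inner[OF A B Z \<Delta>A \<Delta>B \<phi>[OF that] a])
  show "(\<lambda>c. tensor_lift R Z (\<phi> c u\<^sub>1 u\<^sub>2) (comul A a)) \<in> linear_maps R U Z"
    if v: "u\<^sub>1 \<in> carrier B" "u\<^sub>2 \<in> carrier B" for u\<^sub>1 u\<^sub>2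
    by (rule tensor_lift_param[OF A A Z U _ lin[OF v] linear_closed[OF \<Delta>A a]])
      (use \<phi> v in \<open>simp add: quadrilinear_maps_def\<close>)
qed (rule linear_closed[OF \<Delta>B u])

end


section \<open>Recursion along right multiplication by the generators\<close>

context third_type
begin

text \<open>The index \<open>i\<close> stands for the elements of \<open>\<Gamma>\<close> that are acted upon: passing a group element \<open>t\<close> replaces
  them by \<open>\<tau> t i\<close>, while \<open>m\<close> and \<open>n\<close> describe what is left behind on the right.\<close>

lemma right_recursion_unique:
  assumes L: "\<And>i. i \<in> I \<Longrightarrow> L i \<in> linear_maps K H Z" and L': "\<And>i. i \<in> I \<Longrightarrow> L' i \<in> linear_maps K H Z"
    and \<tau>: "\<And>t i. t \<in> carrier G \<Longrightarrow> i \<in> I \<Longrightarrow> \<tau> t i \<in> I"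
    and one: "\<And>i. i \<in> I \<Longrightarrow> L i \<one>\<^bsub>H\<^esub> = L' i \<one>\<^bsub>H\<^esub>"
    and grp: "\<And>t i a. t \<in> carrier G \<Longrightarrow> i \<in> I \<Longrightarrow> a \<in> carrier H \<Longrightarrow> L i (a \<otimes>\<^bsub>H\<^esub> e t) = m t i (L (\<tau> t i) a)"
      "\<And>t i a. t \<in> carrier G \<Longrightarrow> i \<in> I \<Longrightarrow> a \<in> carrier H \<Longrightarrow> L' i (a \<otimes>\<^bsub>H\<^esub> e t) = m t i (L' (\<tau> t i) a)"
    and x: "\<And>i a. i \<in> I \<Longrightarrow> a \<in> carrier H \<Longrightarrow> L i (a \<otimes>\<^bsub>H\<^esub> x) = n i (L i a)"
      "\<And>i a. i \<in> I \<Longrightarrow> a \<in> carrier H \<Longrightarrow> L' i (a \<otimes>\<^bsub>H\<^esub> x) = n i (L' i a)"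
    and i: "i \<in> I" and u: "u \<in> carrier H"
  shows "L i u = L' i u"
  using u i
proof (induction arbitrary: i rule: H_induct_right)
  case (add a b)
  then show ?case using linear_add[OF L] linear_add[OF L'] by simp
next
  case (smult c a)
  then show ?case using linear_smult[OF L] linear_smult[OF L'] by simp
qed (simp_all add: \<tau> one grp x)

text \<open>If the summand reacts to a grouplike factor by a linear map \<open>m\<close>, so does the sum; the next lemma is the
  same for the skew-primitive factor \<open>x\<close>.\<close>

lemma sweedler_grouplike:
  assumes Z: "module K Z" and Y: "module K Y" and F: "F \<in> bilinear_maps K H H Z" and F': "F' \<in> bilinear_maps K H H Y"
    and m: "m \<in> linear_maps K Y Z" and t: "t \<in> carrier G" and u: "u \<in> carrier H"
    and eq: "\<And>a b. a \<in> carrier H \<Longrightarrow> b \<in> carrier H \<Longrightarrow> F (a \<otimes>\<^bsub>H\<^esub> e t) (b \<otimes>\<^bsub>H\<^esub> e t) = m (F' a b)"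
  shows "tensor_lift K Z F (comul H (u \<otimes>\<^bsub>H\<^esub> e t)) = m (tensor_lift K Y F' (comul H u))"
proof -
  have "tensor_lift K Z F (comul H (u \<otimes>\<^bsub>H\<^esub> e t)) = tensor_lift K Z (\<lambda>a b. F (a \<otimes>\<^bsub>H\<^esub> e t) (b \<otimes>\<^bsub>H\<^esub> e t)) (comul H u)"
    by (rule sweedler_e_right[OF Z F u t])
  also have "\<dots> = tensor_lift K Z (\<lambda>a b. m (F' a b)) (comul H u)"
    by (rule sym, rule tensor_lift_cong[OF H_module H_module Z bilinear_compose[OF F' m] _ comul_closed[OF u]])
      (simp add: eq)
  also have "\<dots> = m (tensor_lift K Y F' (comul H u))"
    by (rule tensor_lift_compose[OF H_module H_module Y Z F' m comul_closed[OF u], symmetric])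
  finally show ?thesis .
qed

lemma sweedler_primitive:
  assumes Z: "module K Z" and Y: "module K Y" and F: "F \<in> bilinear_maps K H H Z" and F': "F' \<in> bilinear_maps K H H Y"
    and n: "n \<in> linear_maps K Y Z" and u: "u \<in> carrier H"
    and eq: "\<And>a b. a \<in> carrier H \<Longrightarrow> b \<in> carrier H \<Longrightarrow>
      F (a \<otimes>\<^bsub>H\<^esub> x) b \<oplus>\<^bsub>Z\<^esub> F (a \<otimes>\<^bsub>H\<^esub> e g) (b \<otimes>\<^bsub>H\<^esub> x) = n (F' a b)"
  shows "tensor_lift K Z F (comul H (u \<otimes>\<^bsub>H\<^esub> x)) = n (tensor_lift K Y F' (comul H u))"
proof -
  have "tensor_lift K Z F (comul H (u \<otimes>\<^bsub>H\<^esub> x))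
      = tensor_lift K Z (\<lambda>a b. F (a \<otimes>\<^bsub>H\<^esub> x) b \<oplus>\<^bsub>Z\<^esub> F (a \<otimes>\<^bsub>H\<^esub> e g) (b \<otimes>\<^bsub>H\<^esub> x)) (comul H u)"
    by (rule sweedler_x_right[OF Z F u])
  also have "\<dots> = tensor_lift K Z (\<lambda>a b. n (F' a b)) (comul H u)"
    by (rule sym, rule tensor_lift_cong[OF H_module H_module Z bilinear_compose[OF F' n] _ comul_closed[OF u]])
      (simp add: eq)
  also have "\<dots> = n (tensor_lift K Y F' (comul H u))"
    by (rule tensor_lift_compose[OF H_module H_module Y Z F' n comul_closed[OF u], symmetric])
  finally show ?thesis .
qed

text \<open>The form in which the axioms are proved: a Sweedler sum is identified with \<open>L\<close> because the summand
  satisfies, componentwise, the recursion of \<open>L\<close>.\<close>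

lemma sweedler_recursion:
  assumes Z: "module K Z" and F: "\<And>i. i \<in> I \<Longrightarrow> F i \<in> bilinear_maps K H H Z"
    and L: "\<And>i. i \<in> I \<Longrightarrow> L i \<in> linear_maps K H Z"
    and \<tau>: "\<And>t i. t \<in> carrier G \<Longrightarrow> i \<in> I \<Longrightarrow> \<tau> t i \<in> I"
    and m: "\<And>t i. t \<in> carrier G \<Longrightarrow> i \<in> I \<Longrightarrow> m t i \<in> linear_maps K Z Z"
    and n: "\<And>i. i \<in> I \<Longrightarrow> n i \<in> linear_maps K Z Z"
    and F_grp: "\<And>t i a b. t \<in> carrier G \<Longrightarrow> i \<in> I \<Longrightarrow> a \<in> carrier H \<Longrightarrow> b \<in> carrier H \<Longrightarrow>
      F i (a \<otimes>\<^bsub>H\<^esub> e t) (b \<otimes>\<^bsub>H\<^esub> e t) = m t i (F (\<tau> t i) a b)"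
    and F_x: "\<And>i a b. i \<in> I \<Longrightarrow> a \<in> carrier H \<Longrightarrow> b \<in> carrier H \<Longrightarrow>
      F i (a \<otimes>\<^bsub>H\<^esub> x) b \<oplus>\<^bsub>Z\<^esub> F i (a \<otimes>\<^bsub>H\<^esub> e g) (b \<otimes>\<^bsub>H\<^esub> x) = n i (F i a b)"
    and one: "\<And>i. i \<in> I \<Longrightarrow> L i \<one>\<^bsub>H\<^esub> = F i \<one>\<^bsub>H\<^esub> \<one>\<^bsub>H\<^esub>"
    and grp: "\<And>t i a. t \<in> carrier G \<Longrightarrow> i \<in> I \<Longrightarrow> a \<in> carrier H \<Longrightarrow> L i (a \<otimes>\<^bsub>H\<^esub> e t) = m t i (L (\<tau> t i) a)"
    and x: "\<And>i a. i \<in> I \<Longrightarrow> a \<in> carrier H \<Longrightarrow> L i (a \<otimes>\<^bsub>H\<^esub> x) = n i (L i a)"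
    and i: "i \<in> I" and u: "u \<in> carrier H"
  shows "L i u = tensor_lift K Z (F i) (comul H u)"
proof (rule right_recursion_unique[where L = L and L' = "\<lambda>i u. tensor_lift K Z (F i) (comul H u)"
      and \<tau> = \<tau> and m = m and n = n and I = I, OF L _ \<tau> _ grp _ x _ i u])
  show "(\<lambda>u. tensor_lift K Z (F i) (comul H u)) \<in> linear_maps K H Z" if "i \<in> I" for i
    by (rule linear_compose[OF comul_linear tensor_lift_linear[OF H_module H_module Z F[OF that]]])
  show "L i \<one>\<^bsub>H\<^esub> = tensor_lift K Z (F i) (comul H \<one>\<^bsub>H\<^esub>)" if "i \<in> I" for i
    using algebra_hom_one[OF comul_hom] tensor_lift_pure[OF H_module H_module Z F[OF that]] one[OF that] by simp
  show "tensor_lift K Z (F i) (comul H (a \<otimes>\<^bsub>H\<^esub> e t)) = m t i (tensor_lift K Z (F (\<tau> t i)) (comul H a))"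
    if "t \<in> carrier G" "i \<in> I" "a \<in> carrier H" for t i a
    using that by (intro sweedler_grouplike[OF Z Z F F m] \<tau> F_grp)
  show "tensor_lift K Z (F i) (comul H (a \<otimes>\<^bsub>H\<^esub> x)) = n i (tensor_lift K Z (F i) (comul H a))"
    if "i \<in> I" "a \<in> carrier H" for i a
    using that by (intro sweedler_primitive[OF Z Z F F n] F_x)
qed

lemma counit_twist:
  assumes "c \<in> carrier K"
  shows "counit H (twist c) = \<zero>\<^bsub>K\<^esub>"
proof -
  interpret Kb: assoc_algebra K "base_algebra K" by (rule base_algebra_assoc)
  have "b \<ominus>\<^bsub>base_algebra K\<^esub> b = \<zero>\<^bsub>K\<^esub>" if "b \<in> carrier K" for b
    using Kb.M.r_neg[of b] that by (simp add: a_minus_def)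
  then show ?thesis
    using assms linear_minus[OF H_module Kb.module_axioms counit_linear] linear_smult[OF counit_linear]
    by (simp add: twist_def)
qed

lemma twist_add:
  assumes "b \<in> carrier K" "c \<in> carrier K"
  shows "twist (b \<oplus>\<^bsub>K\<^esub> c) = twist c \<ominus>\<^bsub>H\<^esub> b \<odot>\<^bsub>H\<^esub> (\<one>\<^bsub>H\<^esub> \<ominus>\<^bsub>H\<^esub> e g)"
  using assms by (simp add: twist_def H.smult_l_distr a_minus_def H.M.minus_add H.M.a_ac)

lemma twist_zero: "twist \<zero>\<^bsub>K\<^esub> = x"
  by (simp add: twist_def H.smult_l_null a_minus_def)

text \<open>Subtracting a multiple of \<open>1 - g\<close>, which is itself skew-primitive, does not change the shape of \<open>\<Delta>(x)\<close>.\<close>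

lemma comul_twist:
  assumes c: "c \<in> carrier K"
  shows "comul H (twist c) = pure (twist c) \<one>\<^bsub>H\<^esub> \<oplus>\<^bsub>T\<^esub> pure (e g) (twist c)"
proof -
  interpret T: module K T by (rule T_module)
  have cancel: "(a \<ominus>\<^bsub>T\<^esub> (b \<ominus>\<^bsub>T\<^esub> c)) \<oplus>\<^bsub>T\<^esub> (a' \<ominus>\<^bsub>T\<^esub> (c \<ominus>\<^bsub>T\<^esub> b')) = (a \<oplus>\<^bsub>T\<^esub> a') \<ominus>\<^bsub>T\<^esub> (b \<ominus>\<^bsub>T\<^esub> b')"
    if "a \<in> carrier T" "b \<in> carrier T" "c \<in> carrier T" "a' \<in> carrier T" "b' \<in> carrier T" for a b c a' b'
    using that T.M.a_lcomm[of c "\<ominus>\<^bsub>T\<^esub> b" "\<ominus>\<^bsub>T\<^esub> c"] T.M.r_neg[of c]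
    by (simp add: a_minus_def T.M.minus_add T.M.a_ac)
  note lin = linear_add[OF comul_linear] linear_neg[OF H_module T_module comul_linear] linear_smult[OF comul_linear]
  have one: "comul H \<one>\<^bsub>H\<^esub> = pure \<one>\<^bsub>H\<^esub> \<one>\<^bsub>H\<^esub>"
    using algebra_hom_one[OF comul_hom] by simp
  have "comul H (twist c) = (pure x \<one>\<^bsub>H\<^esub> \<oplus>\<^bsub>T\<^esub> pure (e g) x) \<ominus>\<^bsub>T\<^esub>
      (c \<odot>\<^bsub>T\<^esub> pure \<one>\<^bsub>H\<^esub> \<one>\<^bsub>H\<^esub> \<ominus>\<^bsub>T\<^esub> c \<odot>\<^bsub>T\<^esub> pure (e g) (e g))"
    using c by (simp add: twist_def a_minus_def lin comul_x comul_e one pure_H_simps T.smult_r_distr T.smult_r_minus)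
  also have "\<dots> = pure (twist c) \<one>\<^bsub>H\<^esub> \<oplus>\<^bsub>T\<^esub> pure (e g) (twist c)"
    using c by (subst cancel[of _ _ "c \<odot>\<^bsub>T\<^esub> pure (e g) \<one>\<^bsub>H\<^esub>", symmetric])
      (simp_all add: twist_def a_minus_def pure_H_simps T.smult_r_distr T.smult_r_minus)
  finally show ?thesis .
qed

end


section \<open>Bicrossed products\<close>

text \<open>The bicrossed multiplication makes sense for any two bilinear actions; whether the factorization map
  respects it comes down to a single identity in \<open>H\<close>.\<close>

locale bilinear_actions = factorized +
  fixes lact ract
  assumes lact_bilinear: "lact \<in> bilinear_maps K B A A" and ract_bilinear: "ract \<in> bilinear_maps K B A B"
begin

interpretation AA: assoc_algebra K A by (rule A.A_assoc)
interpretation ABm: module K AB by (rule AB_module)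

lemma act_closed [simp]:
  "u \<in> carrier B \<Longrightarrow> a \<in> carrier A \<Longrightarrow> lact u a \<in> carrier A"
  "u \<in> carrier B \<Longrightarrow> a \<in> carrier A \<Longrightarrow> ract u a \<in> carrier B"
  using bilinear_closed[OF lact_bilinear] bilinear_closed[OF ract_bilinear] by auto

abbreviation "bmult \<equiv> bicrossed_mult K A B lact ract"
abbreviation "bprod \<equiv> bicrossed_product K A B lact ract"

lemmas sweedler_AB =
  sweedler2_bilinear[OF A.A_module B.H_module _ A.A_comul_linear B.comul_linear]
  sweedler2_grouplike[OF A.A_module B.H_module _ A.A_comul_linear B.comul_linear]
  sweedler2_param[OF A.A_module B.H_module _ _ A.A_comul_linear B.comul_linear]

abbreviation "cross_term a v \<equiv> (\<lambda>u\<^sub>1 u\<^sub>2 b\<^sub>1 b\<^sub>2. pureAB (a \<otimes>\<^bsub>A\<^esub> lact u\<^sub>1 b\<^sub>1) (ract u\<^sub>2 b\<^sub>2 \<otimes>\<^bsub>B\<^esub> v))"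
abbreviation "cross a u b v \<equiv> sweedler2 K A B AB (cross_term a v) u b"

lemma cross_term: "a \<in> carrier A \<Longrightarrow> v \<in> carrier B \<Longrightarrow> cross_term a v \<in> quadrilinear_maps K B A AB"
  by (rule quadrilinear_split[OF pure_bilinear[OF A.A_module B.H_module]
        bilinear_compose[OF lact_bilinear AA.mult_linear(1)] bilinear_compose[OF ract_bilinear B.H.mult_linear(2)]])

lemma
  shows cross_right: "a \<in> carrier A \<Longrightarrow> u \<in> carrier B \<Longrightarrow> (\<lambda>b v. cross a u b v) \<in> bilinear_maps K A B AB"
    and cross_left: "b \<in> carrier A \<Longrightarrow> v \<in> carrier B \<Longrightarrow> (\<lambda>a u. cross a u b v) \<in> bilinear_maps K A B AB"
proof -
  note lin = sweedler_AB(1)[OF AB_module cross_term]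
  have param: "(\<lambda>a. cross a u b v) \<in> linear_maps K A AB"
    if "v \<in> carrier B" "u \<in> carrier B" "b \<in> carrier A" for u b v
    by (rule sweedler_AB(3)[OF AB_module A.A_module cross_term[OF _ that(1)] _ that(2,3)], assumption, rule linear_mapsI)
      (use that in \<open>simp_all add: pureAB_simps AA.V.l_distr AA.smult_mult_left\<close>)
  have param': "(\<lambda>v. cross a u b v) \<in> linear_maps K B AB"
    if "a \<in> carrier A" "u \<in> carrier B" "b \<in> carrier A" for a u b
    by (rule sweedler_AB(3)[OF AB_module B.H_module cross_term[OF that(1)] _ that(2,3)], assumption, rule linear_mapsI)
      (use that in \<open>simp_all add: pureAB_simps B.H.V.r_distr B.H.smult_mult_right\<close>)
  show "(\<lambda>b v. cross a u b v) \<in> bilinear_maps K A B AB" if a: "a \<in> carrier A" and u: "u \<in> carrier B"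
    unfolding bilinear_maps_def
    using bilinear_left[OF lin[OF a]] bilinear_right[OF lin[OF a] u] param'[OF a u] by simp
  show "(\<lambda>a u. cross a u b v) \<in> bilinear_maps K A B AB" if b: "b \<in> carrier A" and v: "v \<in> carrier B"
    unfolding bilinear_maps_def
    using bilinear_left[OF lin[OF _ v] b] param[OF v _ b] by simp
qed

lemma bmult_eq: "bmult C D = tensor_lift K AB (\<lambda>a u. tensor_lift K AB (\<lambda>b v. cross a u b v) D) C"
  by (simp add: bicrossed_mult_def Let_def)

lemma bmult_bilinear: "bmult \<in> bilinear_maps K AB AB AB"
  and bmult_pure: "\<And>a u b v. a \<in> carrier A \<Longrightarrow> u \<in> carrier B \<Longrightarrow> b \<in> carrier A \<Longrightarrow> v \<in> carrier B \<Longrightarrow>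
    bmult (pureAB a u) (pureAB b v) = cross a u b v"
proof -
  have inner: "(\<lambda>a u. tensor_lift K AB (\<lambda>b v. cross a u b v) D) \<in> bilinear_maps K A B AB" if "D \<in> carrier AB" for D
    by (rule tensor_lift_param2[OF A.A_module B.H_module AB_module A.A_module B.H_module cross_right cross_left that])
  show "bmult \<in> bilinear_maps K AB AB AB"
    unfolding bilinear_maps_def bmult_eq
  proof (intro CollectI conjI ballI)
    fix D assume "D \<in> carrier AB"
    then show "(\<lambda>C. tensor_lift K AB (\<lambda>a u. tensor_lift K AB (\<lambda>b v. cross a u b v) D) C) \<in> linear_maps K AB AB"
      by (rule tensor_lift_linear[OF A.A_module B.H_module AB_module inner])
  next
    fix C assume C: "C \<in> carrier AB"
    show "(\<lambda>D. tensor_lift K AB (\<lambda>a u. tensor_lift K AB (\<lambda>b v. cross a u b v) D) C) \<in> linear_maps K AB AB"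
      by (rule tensor_lift_param[OF A.A_module B.H_module AB_module AB_module inner _ C])
        (auto intro: tensor_lift_linear[OF A.A_module B.H_module AB_module cross_right])
  qed
  show "bmult (pureAB a u) (pureAB b v) = cross a u b v"
    if "a \<in> carrier A" "u \<in> carrier B" "b \<in> carrier A" "v \<in> carrier B" for a u b v
    using that unfolding bmult_eq
    by (simp add: tensor_lift_pure[OF A.A_module B.H_module AB_module inner]
        tensor_lift_pure[OF A.A_module B.H_module AB_module cross_right] pureAB_simps)
qed

text \<open>The element \<open>\<Sum> (u\<^sub>1 \<rhd> a)(u\<^sub>2 \<lhd> a)\<close> of \<open>H\<close>, which for grouplike \<open>a\<close> should be \<open>ua\<close>.\<close>

definition "swap_sum u a = tensor_lift K H (\<lambda>u\<^sub>1 u\<^sub>2. i (lact u\<^sub>1 a) \<otimes>\<^bsub>H\<^esub> j (ract u\<^sub>2 a)) (comul B u)"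

lemma swap_term: "a \<in> carrier A \<Longrightarrow> (\<lambda>u\<^sub>1 u\<^sub>2. i (lact u\<^sub>1 a) \<otimes>\<^bsub>H\<^esub> j (ract u\<^sub>2 a)) \<in> bilinear_maps K B B H"
  by (rule bilinear_compose_args[OF fm_bilinear bilinear_left[OF lact_bilinear] bilinear_left[OF ract_bilinear]])

lemma fm_cross:
  assumes a: "a \<in> carrier A" and u: "u \<in> carrier B" and h: "h \<in> \<Gamma>" and v: "v \<in> carrier B"
  shows "fm (bmult (pureAB a u) (pureAB (single K h) v)) = i a \<otimes>\<^bsub>H\<^esub> (swap_sum u (single K h) \<otimes>\<^bsub>H\<^esub> j v)"
proof -
  let ?h = "single K h"
  have h': "?h \<in> carrier A" using h by simp
  have bil: "(\<lambda>u\<^sub>1 u\<^sub>2. pureAB (a \<otimes>\<^bsub>A\<^esub> lact u\<^sub>1 ?h) (ract u\<^sub>2 ?h \<otimes>\<^bsub>B\<^esub> v)) \<in> bilinear_maps K B B AB"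
    using cross_term[OF a v] h' by (simp add: quadrilinear_maps_def)
  let ?L = "\<lambda>w. i a \<otimes>\<^bsub>H\<^esub> (w \<otimes>\<^bsub>H\<^esub> j v)"
  have L: "?L \<in> linear_maps K H H"
    by (rule linear_compose[OF H.mult_linear(2) H.mult_linear(1)]) (use a v in simp_all)
  have "fm (bmult (pureAB a u) (pureAB ?h v)) = fm (tensor_lift K AB (\<lambda>u\<^sub>1 u\<^sub>2. cross_term a v u\<^sub>1 u\<^sub>2 ?h ?h) (comul B u))"
    using h by (simp only: bmult_pure[OF a u h' v])
      (simp add: sweedler_AB(2)[OF AB_module cross_term[OF a v] u h'])
  also have "\<dots> = tensor_lift K H (\<lambda>u\<^sub>1 u\<^sub>2. fm (cross_term a v u\<^sub>1 u\<^sub>2 ?h ?h)) (comul B u)"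
    by (rule tensor_lift_compose[OF B.H_module B.H_module AB_module H_module bil fm_linear B.comul_closed[OF u]])
  also have "\<dots> = tensor_lift K H (\<lambda>u\<^sub>1 u\<^sub>2. ?L (i (lact u\<^sub>1 ?h) \<otimes>\<^bsub>H\<^esub> j (ract u\<^sub>2 ?h))) (comul B u)"
    by (rule tensor_lift_cong[OF B.H_module B.H_module H_module bilinear_compose[OF bil fm_linear] _ B.comul_closed[OF u]])
      (use a v h' in \<open>simp add: H.V.m_assoc\<close>)
  also have "\<dots> = ?L (swap_sum u ?h)"
    unfolding swap_sum_def
    by (rule tensor_lift_compose[OF B.H_module B.H_module H_module H_module swap_term[OF h'] L B.comul_closed[OF u], symmetric])
  finally show ?thesis .
qed

lemma bprod_sel:
  "carrier bprod = carrier AB" "ring.zero bprod = ring.zero AB" "add bprod = add AB" "smult bprod = smult AB"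
  "monoid.mult bprod = bmult" "one bprod = pureAB \<one>\<^bsub>A\<^esub> \<one>\<^bsub>B\<^esub>"
  by (simp_all add: bicrossed_product_def Let_def)

lemmas bprod_maps = module_part_cong[OF bprod_sel(1-4)]

lemma bprod_tensor: "tensor_module K bprod bprod = tensor_module K AB AB" "pure_tensor K bprod bprod = pure_tensor K AB AB"
  by (rule tensor_module_cong pure_tensor_cong; simp add: bprod_sel)+

text \<open>The bicrossed product is a Hopf algebra because its operations are those of \<open>H\<close>, transported along the
  bijection \<open>fm\<close>.\<close>

lemma fm_hopf_iso:
  assumes swap: "\<And>u h. u \<in> carrier B \<Longrightarrow> h \<in> \<Gamma> \<Longrightarrow> j u \<otimes>\<^bsub>H\<^esub> e h = swap_sum u (single K h)"
  shows "fm \<in> hopf_isos K bprod H"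
proof (rule hopf_algebra_transport[OF H_hopf])
  note TT = tensor_module_module[OF AB_module AB_module]
  have fm_mult: "fm (bmult C D) = fm C \<otimes>\<^bsub>H\<^esub> fm D" if C: "C \<in> carrier AB" and D: "D \<in> carrier AB" for C D
  proof (rule AB_eqI[OF H_module linear_compose[OF bilinear_right[OF bmult_bilinear C] fm_linear]
        linear_compose[OF fm_linear H.mult_linear(1)[OF linear_closed[OF fm_linear C]]] _ D])
    fix h v assume h: "h \<in> \<Gamma>" and v: "v \<in> carrier B"
    have D': "pureAB (single K h) v \<in> carrier AB" using h v by (simp add: pureAB_simps)
    show "fm (bmult C (pureAB (single K h) v)) = fm C \<otimes>\<^bsub>H\<^esub> fm (pureAB (single K h) v)"
    proof (rule tensor_eqI[OF A.A_module B.H_module linear_compose[OF bilinear_left[OF bmult_bilinear D'] fm_linear]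
          linear_compose[OF fm_linear H.mult_linear(2)[OF linear_closed[OF fm_linear D']]] _ C])
      fix a u assume a: "a \<in> carrier A" and u: "u \<in> carrier B"
      then show "fm (bmult (pureAB a u) (pureAB (single K h) v)) = fm (pureAB a u) \<otimes>\<^bsub>H\<^esub> fm (pureAB (single K h) v)"
        using h v by (simp add: fm_cross swap[symmetric] H.V.m_assoc)
    qed
  qed
  show "C \<otimes>\<^bsub>bprod\<^esub> D \<in> carrier bprod \<and> fm (C \<otimes>\<^bsub>bprod\<^esub> D) = fm C \<otimes>\<^bsub>H\<^esub> fm D"
    if "C \<in> carrier bprod" "D \<in> carrier bprod" for C D
    using that fm_mult bilinear_closed[OF bmult_bilinear] by (simp add: bprod_sel)
  show "module K bprod"
    by (rule module_image[OF AB_module, of "\<lambda>C. C"]) (auto simp: bprod_sel)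
  show "fm \<in> linear_maps K bprod H" using fm_linear by (simp add: bprod_maps)
  show "bij_betw fm (carrier bprod) (carrier H)" using fm_bij by (simp add: bprod_sel)
  show "\<one>\<^bsub>bprod\<^esub> \<in> carrier bprod" "fm \<one>\<^bsub>bprod\<^esub> = \<one>\<^bsub>H\<^esub>" by (simp_all add: bprod_sel pureAB_simps)
  define \<psi> where "\<psi> = (\<lambda>a\<^sub>1 a\<^sub>2 u\<^sub>1 u\<^sub>2. pure_tensor K AB AB (pureAB a\<^sub>1 u\<^sub>1) (pureAB a\<^sub>2 u\<^sub>2))"
  note pure_lin = pure_bilinear[OF A.A_module B.H_module]
  have \<psi>: "\<psi> \<in> quadrilinear_maps K A B (tensor_module K AB AB)"
    unfolding \<psi>_def by (rule quadrilinear_split[OF pure_bilinear[OF AB_module AB_module] pure_lin pure_lin])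
  let ?\<Delta> = "sweedler2 K B A (tensor_module K AB AB) \<psi>"
  note sweedler_BA = B.H_module A.A_module TT B.comul_linear A.A_comul_linear \<psi>
  have comul_eq: "comul bprod = tensor_lift K (tensor_module K AB AB) ?\<Delta>"
    by (simp add: bicrossed_product_def Let_def sweedler2_def[abs_def] \<psi>_def)
  have \<Delta>_lin: "comul bprod \<in> linear_maps K AB (tensor_module K AB AB)"
    unfolding comul_eq by (rule tensor_lift_linear[OF A.A_module B.H_module TT sweedler2_bilinear[OF sweedler_BA]])
  note map_lin = tensor_map_linear[OF H_module H_module AB_module AB_module fm_linear fm_linear]
  show "comul bprod C \<in> carrier (tensor_module K bprod bprod) \<and> comul H (fm C) = tensor_map K H H fm fm (comul bprod C)"
    if "C \<in> carrier bprod" for C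
  proof
    have C: "C \<in> carrier AB" using that by (simp add: bprod_sel)
    show "comul bprod C \<in> carrier (tensor_module K bprod bprod)"
      using linear_closed[OF \<Delta>_lin C] by (simp add: bprod_tensor)
    show "comul H (fm C) = tensor_map K H H fm fm (comul bprod C)"
    proof (rule AB_eqI[OF T_module linear_compose[OF fm_linear comul_linear] linear_compose[OF \<Delta>_lin map_lin] _ C])
      fix h u assume h: "h \<in> \<Gamma>" and u: "u \<in> carrier B"
      have h': "single K h \<in> carrier A" using h by simp
      let ?\<psi> = "\<psi> (single K h) (single K h)"
      have \<psi>h: "?\<psi> \<in> bilinear_maps K B B (tensor_module K AB AB)"
        using \<psi> h' by (simp add: quadrilinear_maps_def)
      have "comul bprod (pureAB (single K h) u) = ?\<Delta> (single K h) u"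
        unfolding comul_eq by (rule tensor_lift_pure[OF A.A_module B.H_module TT sweedler2_bilinear[OF sweedler_BA] h' u])
      also have "\<dots> = tensor_lift K (tensor_module K AB AB) ?\<psi> (comul B u)"
        using h tensor_lift_pure[OF A.A_module A.A_module TT sweedler2_inner[OF sweedler_BA u] h' h']
        by (simp add: sweedler2_def)
      finally have "tensor_map K H H fm fm (comul bprod (pureAB (single K h) u))
          = tensor_lift K T (\<lambda>u\<^sub>1 u\<^sub>2. tensor_map K H H fm fm (?\<psi> u\<^sub>1 u\<^sub>2)) (comul B u)"
        by (simp add: tensor_lift_compose[OF B.H_module B.H_module TT T_module \<psi>h map_lin B.comul_closed[OF u]])
      also have "\<dots> = tensor_lift K T (\<lambda>u\<^sub>1 u\<^sub>2. pure (e h) (e h) \<otimes>\<^bsub>TA\<^esub> pure (j u\<^sub>1) (j u\<^sub>2)) (comul B u)"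
        by (rule tensor_lift_cong[OF B.H_module B.H_module T_module bilinear_compose[OF \<psi>h map_lin] _ B.comul_closed[OF u]])
          (use h in \<open>simp add: \<psi>_def tensor_map_pure[OF H_module H_module AB_module AB_module fm_linear fm_linear]
            pureAB_simps pure_H_mult\<close>)
      also have "\<dots> = pure (e h) (e h) \<otimes>\<^bsub>TA\<^esub> tensor_map K H H j j (comul B u)"
        unfolding tensor_map_def
        by (rule tensor_lift_compose[OF B.H_module B.H_module T_module T_module
              tensor_map_bilinear[OF H_module H_module B.H_module B.H_module j_linear j_linear] _ B.comul_closed[OF u], symmetric])
          (use assoc_algebra.mult_linear(1)[OF TA_assoc, of "pure (e h) (e h)"] h in \<open>simp add: pure_H_simps\<close>)
      also have "\<dots> = comul H (fm (pureAB (single K h) u))"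
        using h u by (simp add: algebra_hom_mult[OF comul_hom] comul_e j_comul)
      finally show "comul H (fm (pureAB (single K h) u)) = tensor_map K H H fm fm (comul bprod (pureAB (single K h) u))" ..
    qed
  qed
  interpret Kb: assoc_algebra K "base_algebra K" by (rule base_algebra_assoc)
  note A\<epsilon> = algebra_hom_linear[OF A.A_counit_hom]
  note \<epsilon>_simps = linear_closed[OF A\<epsilon>] linear_add[OF A\<epsilon>] linear_smult[OF A\<epsilon>]
    linear_closed[OF B.counit_linear] linear_add[OF B.counit_linear] linear_smult[OF B.counit_linear]
  have \<epsilon>: "(\<lambda>a u. counit A a \<otimes>\<^bsub>K\<^esub> counit B u) \<in> bilinear_maps K A B (base_algebra K)"
    by (rule bilinear_mapsI)
      (use \<epsilon>_simps in \<open>simp_all add: l_distr r_distr m_assoc m_lcomm\<close>)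
  show "counit H (fm C) = counit bprod C" if "C \<in> carrier bprod" for C
  proof -
    have eq: "counit bprod = tensor_lift K (base_algebra K) (\<lambda>a u. counit A a \<otimes>\<^bsub>K\<^esub> counit B u)"
      by (simp add: bicrossed_product_def Let_def)
    show ?thesis
      unfolding eq
    proof (rule tensor_eqI[OF A.A_module B.H_module linear_compose[OF fm_linear counit_linear]
          tensor_lift_linear[OF A.A_module B.H_module Kb.module_axioms \<epsilon>] _ that[unfolded bprod_sel]])
      fix a u assume "a \<in> carrier A" "u \<in> carrier B"
      then show "counit H (fm (pureAB a u))
          = tensor_lift K (base_algebra K) (\<lambda>a u. counit A a \<otimes>\<^bsub>K\<^esub> counit B u) (pureAB a u)"
        using algebra_hom_mult[OF counit_hom, of "i a" "j u"]
        by (simp add: tensor_lift_pure[OF A.A_module B.H_module Kb.module_axioms \<epsilon>] i_counit j_counit)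
    qed
  qed
  have S: "(\<lambda>a u. bmult (pureAB \<one>\<^bsub>A\<^esub> (antipode B u)) (pureAB (antipode A a) \<one>\<^bsub>B\<^esub>)) \<in> bilinear_maps K A B AB"
    by (rule bilinear_flip, rule bilinear_compose_args[OF bmult_bilinear linear_compose[OF B.antipode_linear bilinear_right[OF pure_lin]]
          linear_compose[OF A.A_antipode_linear bilinear_left[OF pure_lin]]]) simp_all
  have S_eq: "antipode bprod = tensor_lift K AB (\<lambda>a u. bmult (pureAB \<one>\<^bsub>A\<^esub> (antipode B u)) (pureAB (antipode A a) \<one>\<^bsub>B\<^esub>))"
    by (simp add: bicrossed_product_def Let_def)
  note S_lin = tensor_lift_linear[OF A.A_module B.H_module AB_module S, folded S_eq]
  show "antipode bprod C \<in> carrier bprod \<and> antipode H (fm C) = fm (antipode bprod C)" if "C \<in> carrier bprod" for C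
  proof
    have C: "C \<in> carrier AB" using that by (simp add: bprod_sel)
    show "antipode bprod C \<in> carrier bprod" using linear_closed[OF S_lin C] by (simp add: bprod_sel)
    show "antipode H (fm C) = fm (antipode bprod C)"
    proof (rule tensor_eqI[OF A.A_module B.H_module linear_compose[OF fm_linear antipode_linear]
          linear_compose[OF S_lin fm_linear] _ C])
      fix a u assume au: "a \<in> carrier A" "u \<in> carrier B"
      have cl: "antipode A a \<in> carrier A" "antipode B u \<in> carrier B"
        using linear_closed[OF A.A_antipode_linear au(1)] linear_closed[OF B.antipode_linear au(2)] .
      have "antipode H (i a \<otimes>\<^bsub>H\<^esub> j u) = antipode H (j u) \<otimes>\<^bsub>H\<^esub> antipode H (i a)"
        using algebra_hom_mult[OF antipode_hom, of "i a" "j u"] au by simp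
      then show "antipode H (fm (pureAB a u)) = fm (antipode bprod (pureAB a u))"
        using au cl unfolding S_eq
        by (simp add: tensor_lift_pure[OF A.A_module B.H_module AB_module S] fm_mult pureAB_simps i_antipode j_antipode)
    qed
  qed
qed

text \<open>Multiplicativity for the product of \<open>1 \<bowtie> u\<close> and \<open>h \<bowtie> 1\<close>.\<close>

lemma swap_of_fm_hopf_iso:
  assumes iso: "fm \<in> hopf_isos K bprod H" and u: "u \<in> carrier B" and h: "h \<in> \<Gamma>"
  shows "j u \<otimes>\<^bsub>H\<^esub> e h = swap_sum u (single K h)"
proof -
  have "fm (pureAB \<one>\<^bsub>A\<^esub> u \<otimes>\<^bsub>bprod\<^esub> pureAB (single K h) \<one>\<^bsub>B\<^esub>) = fm (pureAB \<one>\<^bsub>A\<^esub> u) \<otimes>\<^bsub>H\<^esub> fm (pureAB (single K h) \<one>\<^bsub>B\<^esub>)"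
    by (rule algebra_hom_mult[of _ K bprod]) (use iso u h in \<open>auto simp: hopf_isos_def hopf_homs_def bprod_sel pureAB_simps\<close>)
  moreover have "swap_sum u (single K h) \<in> carrier H"
    unfolding swap_sum_def
    by (rule linear_closed[OF tensor_lift_linear[OF B.H_module B.H_module H_module swap_term] B.comul_closed]) (use u h in simp_all)
  ultimately show ?thesis
    using u h by (simp add: bprod_sel fm_cross)
qed

end


section \<open>The actions on generators determine a matched pair\<close>

context factorized
begin

lemma j_twist: "c \<in> carrier K \<Longrightarrow> j (B.twist c) = twist c"
  using g_GB by (simp add: B.twist_def twist_def linear_minus[OF B.H_module H_module j_linear])

end

text \<open>The effect of moving a generator across \<open>h\<close>, in the presence of further factors \<open>u\<close> to its left.\<close>

locale factorized_actions = bilinear_actions +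
  assumes lact_start: "h \<in> \<Gamma> \<Longrightarrow> lact \<one>\<^bsub>B\<^esub> (single K h) = single K h"
    and lact_grp: "u \<in> carrier B \<Longrightarrow> s \<in> G\<^sub>B \<Longrightarrow> h \<in> \<Gamma> \<Longrightarrow>
      lact (u \<otimes>\<^bsub>B\<^esub> B.e s) (single K h) = lact u (single K (l s h))"
    and lact_x: "u \<in> carrier B \<Longrightarrow> h \<in> \<Gamma> \<Longrightarrow> lact (u \<otimes>\<^bsub>B\<^esub> B.x) (single K h) = \<zero>\<^bsub>A\<^esub>"
    and ract_start: "h \<in> \<Gamma> \<Longrightarrow> ract \<one>\<^bsub>B\<^esub> (single K h) = \<one>\<^bsub>B\<^esub>"
    and ract_grp: "u \<in> carrier B \<Longrightarrow> s \<in> G\<^sub>B \<Longrightarrow> h \<in> \<Gamma> \<Longrightarrow>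
      ract (u \<otimes>\<^bsub>B\<^esub> B.e s) (single K h) = ract u (single K (l s h)) \<otimes>\<^bsub>B\<^esub> B.e (r s h)"
    and ract_x: "u \<in> carrier B \<Longrightarrow> h \<in> \<Gamma> \<Longrightarrow>
      ract (u \<otimes>\<^bsub>B\<^esub> B.x) (single K h) = ract u (single K h) \<otimes>\<^bsub>B\<^esub> B.twist (f h)"
begin

interpretation AA: assoc_algebra K A by (rule A.A_assoc)
interpretation Kb: assoc_algebra K "base_algebra K" by (rule base_algebra_assoc)
interpretation AT: module K A.AT by (rule A.AT_module)
interpretation BT: module K B.T by (rule B.T_module)

lemmas act_linear = bilinear_left[OF lact_bilinear] bilinear_left[OF ract_bilinear]
lemmas A_counit_linear = algebra_hom_linear[OF A.A_counit_hom]
lemmas gen_simps = lact_start lact_grp lact_x ract_start ract_grp ract_x g_GB g_act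

lemma mult_twist:
  assumes "u \<in> carrier B" "c \<in> carrier K"
  shows "u \<otimes>\<^bsub>B\<^esub> B.twist c = u \<otimes>\<^bsub>B\<^esub> B.x \<ominus>\<^bsub>B\<^esub> c \<odot>\<^bsub>B\<^esub> (u \<ominus>\<^bsub>B\<^esub> u \<otimes>\<^bsub>B\<^esub> B.e g)"
  using assms g_GB by (simp add: B.twist_def a_minus_def B.H.V.r_distr B.H.V.r_minus B.H.smult_mult_right)

text \<open>Like \<open>x\<close>, the factor \<open>1 - g\<close> kills every \<open>h\<close>, because \<open>g\<close> is central in \<open>G\<close>.\<close>

lemma lact_twist:
  assumes u: "u \<in> carrier B" and c: "c \<in> carrier K" and h: "h \<in> \<Gamma>"
  shows "lact (u \<otimes>\<^bsub>B\<^esub> B.twist c) (single K h) = \<zero>\<^bsub>A\<^esub>"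
proof -
  have h': "single K h \<in> carrier A" using h by simp
  note lin = act_linear(1)[OF h']
  show ?thesis
    using u c h g_GB
    by (simp add: mult_twist linear_minus[OF B.H_module A.A_module lin] linear_smult[OF lin] gen_simps)
      (simp add: a_minus_def AA.M.r_neg AA.smult_r_null)
qed

text \<open>Since \<open>f\<close> is additive, this says for \<open>c = f(k)\<close> that moving \<open>y\<^sub>k\<close> across \<open>h\<close> leaves \<open>y\<^sub>k\<^sub>h\<close> behind; it is what
  makes \<open>\<lhd>\<close> an action.\<close>

lemma ract_twist:
  assumes u: "u \<in> carrier B" and c: "c \<in> carrier K" and h: "h \<in> \<Gamma>"
  shows "ract (u \<otimes>\<^bsub>B\<^esub> B.twist c) (single K h) = ract u (single K h) \<otimes>\<^bsub>B\<^esub> B.twist (c \<oplus>\<^bsub>K\<^esub> f h)"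
proof -
  have h': "single K h \<in> carrier A" using h by simp
  note lin = act_linear(2)[OF h']
  have "ract (u \<otimes>\<^bsub>B\<^esub> B.twist c) (single K h) = ract u (single K h) \<otimes>\<^bsub>B\<^esub> B.twist (f h)
      \<ominus>\<^bsub>B\<^esub> c \<odot>\<^bsub>B\<^esub> (ract u (single K h) \<ominus>\<^bsub>B\<^esub> ract u (single K h) \<otimes>\<^bsub>B\<^esub> B.e g)"
    using u c h g_GB
    by (simp add: mult_twist linear_minus[OF B.H_module B.H_module lin] linear_smult[OF lin] gen_simps del: B.H.smult_r_distr)
  also have "\<dots> = ract u (single K h) \<otimes>\<^bsub>B\<^esub> B.twist (c \<oplus>\<^bsub>K\<^esub> f h)"
    using u c h g_GB
    by (simp add: B.twist_add a_minus_def B.H.V.r_distr B.H.V.r_minus B.H.smult_mult_right del: B.H.smult_r_distr)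
  finally show ?thesis .
qed

lemma lact_mult_single:
  assumes h: "h \<in> \<Gamma>" and u: "u \<in> carrier B" and v: "v \<in> carrier B"
  shows "lact (u \<otimes>\<^bsub>B\<^esub> v) (single K h) = lact u (lact v (single K h))"
proof (rule B.right_recursion_unique[where I = \<Gamma> and \<tau> = l and m = "\<lambda>_ _ w. w" and n = "\<lambda>_ _. \<zero>\<^bsub>A\<^esub>"
      and L = "\<lambda>h v. lact (u \<otimes>\<^bsub>B\<^esub> v) (single K h)" and L' = "\<lambda>h v. lact u (lact v (single K h))",
      OF _ _ _ _ _ _ _ _ h v])
  fix h assume h: "h \<in> \<Gamma>"
  then have h': "single K h \<in> carrier A" by simp
  show "(\<lambda>v. lact (u \<otimes>\<^bsub>B\<^esub> v) (single K h)) \<in> linear_maps K B A"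
    by (rule linear_compose[OF B.H.mult_linear(1)[OF u] act_linear(1)[OF h']])
  show "(\<lambda>v. lact u (lact v (single K h))) \<in> linear_maps K B A"
    by (rule linear_compose[OF act_linear(1)[OF h'] bilinear_right[OF lact_bilinear u]])
qed (use u in \<open>simp_all add: gen_simps B.H.V.m_assoc[symmetric]
    linear_zero[OF A.A_module A.A_module bilinear_right[OF lact_bilinear]]\<close>)

lemma lact_comul_single:
  assumes h: "h \<in> \<Gamma>" and u: "u \<in> carrier B"
  shows "comul A (lact u (single K h))
    = tensor_lift K A.AT (\<lambda>u\<^sub>1 u\<^sub>2. A.Apure (lact u\<^sub>1 (single K h)) (lact u\<^sub>2 (single K h))) (comul B u)"
proof (rule B.sweedler_recursion[where I = \<Gamma> and \<tau> = l and m = "\<lambda>_ _ w. w" and n = "\<lambda>_ _. \<zero>\<^bsub>A.AT\<^esub>"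
      and L = "\<lambda>h u. comul A (lact u (single K h))", OF A.AT_module _ _ _ _ _ _ _ _ _ _ h u])
  fix h assume h: "h \<in> \<Gamma>"
  then have h': "single K h \<in> carrier A" by simp
  show "(\<lambda>u\<^sub>1 u\<^sub>2. A.Apure (lact u\<^sub>1 (single K h)) (lact u\<^sub>2 (single K h))) \<in> bilinear_maps K B B A.AT"
    by (rule bilinear_compose_args[OF pure_bilinear[OF A.A_module A.A_module] act_linear(1)[OF h'] act_linear(1)[OF h']])
  show "(\<lambda>u. comul A (lact u (single K h))) \<in> linear_maps K B A.AT"
    by (rule linear_compose[OF act_linear(1)[OF h'] A.A_comul_linear])
  show "(\<lambda>_. \<zero>\<^bsub>A.AT\<^esub>) \<in> linear_maps K A.AT A.AT" by (rule zero_linear[OF A.AT_module A.AT_module])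
  show "comul A (lact (a \<otimes>\<^bsub>B\<^esub> B.x) (single K h)) = \<zero>\<^bsub>A.AT\<^esub>" if "a \<in> carrier B" for a
    using that h linear_zero[OF A.A_module A.AT_module A.A_comul_linear] by (simp add: gen_simps)
qed (simp_all add: gen_simps AT.id_linear pure_zero_left[OF A.A_module A.A_module] pure_zero_right[OF A.A_module A.A_module])

lemma lact_counit_single:
  assumes h: "h \<in> \<Gamma>" and u: "u \<in> carrier B"
  shows "counit A (lact u (single K h)) = counit B u"
proof (rule B.right_recursion_unique[where I = \<Gamma> and \<tau> = l and m = "\<lambda>_ _ w. w" and n = "\<lambda>_ _. \<zero>\<^bsub>K\<^esub>"
      and L = "\<lambda>h v. counit A (lact v (single K h))" and L' = "\<lambda>h. counit B", OF _ B.counit_linear _ _ _ _ _ _ h u])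
  show "(\<lambda>u. counit A (lact u (single K h))) \<in> linear_maps K B (base_algebra K)" if "h \<in> \<Gamma>" for h
    using that by (intro linear_compose[OF act_linear(1) A_counit_linear]) simp
qed (use linear_zero[OF A.A_module Kb.module_axioms A_counit_linear] in \<open>simp_all add: gen_simps\<close>)

text \<open>The index is the pair \<open>(h, k)\<close>: a group element \<open>s\<close> acts on it by \<open>(s \<rhd> h, (s \<lhd> h) \<rhd> k)\<close>.\<close>

lemma ract_mult_single:
  assumes h: "h \<in> \<Gamma>" and k: "k \<in> \<Gamma>" and u: "u \<in> carrier B"
  shows "ract u (single K (h \<otimes>\<^bsub>G\<^esub> k)) = ract (ract u (single K h)) (single K k)"
proof -
  let ?I = "\<Gamma> \<times> \<Gamma>"
  have hk: "(h, k) \<in> ?I" using h k by simp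
  have "ract u (single K (fst (h, k) \<otimes>\<^bsub>G\<^esub> snd (h, k))) = ract (ract u (single K (fst (h, k)))) (single K (snd (h, k)))"
  proof (rule B.right_recursion_unique[where I = ?I and \<tau> = "\<lambda>s q. (l s (fst q), l (r s (fst q)) (snd q))"
        and m = "\<lambda>s q w. w \<otimes>\<^bsub>B\<^esub> B.e (r (r s (fst q)) (snd q))" and n = "\<lambda>q w. w \<otimes>\<^bsub>B\<^esub> B.twist (f (fst q) \<oplus>\<^bsub>K\<^esub> f (snd q))"
        and L = "\<lambda>q u. ract u (single K (fst q \<otimes>\<^bsub>G\<^esub> snd q))"
        and L' = "\<lambda>q u. ract (ract u (single K (fst q))) (single K (snd q))", OF _ _ _ _ _ _ _ _ hk u])
    fix q assume q: "q \<in> ?I"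
    then have q': "single K (fst q \<otimes>\<^bsub>G\<^esub> snd q) \<in> carrier A" "single K (fst q) \<in> carrier A" "single K (snd q) \<in> carrier A"
      by auto
    show "(\<lambda>u. ract u (single K (fst q \<otimes>\<^bsub>G\<^esub> snd q))) \<in> linear_maps K B B" by (rule act_linear(2)[OF q'(1)])
    show "(\<lambda>u. ract (ract u (single K (fst q))) (single K (snd q))) \<in> linear_maps K B B"
      by (rule linear_compose[OF act_linear(2)[OF q'(2)] act_linear(2)[OF q'(3)]])
  qed (auto simp: gen_simps act_prod ract_twist)
  then show ?thesis by simp
qed

lemma ract_comul_single:
  assumes h: "h \<in> \<Gamma>" and u: "u \<in> carrier B"
  shows "comul B (ract u (single K h))
    = tensor_lift K B.T (\<lambda>u\<^sub>1 u\<^sub>2. B.pure (ract u\<^sub>1 (single K h)) (ract u\<^sub>2 (single K h))) (comul B u)"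
proof (rule B.sweedler_recursion[where I = \<Gamma> and \<tau> = l and m = "\<lambda>s h w. w \<otimes>\<^bsub>B.TA\<^esub> comul B (B.e (r s h))"
      and n = "\<lambda>h w. w \<otimes>\<^bsub>B.TA\<^esub> comul B (B.twist (f h))"
      and L = "\<lambda>h u. comul B (ract u (single K h))", OF B.T_module _ _ _ _ _ _ _ _ _ _ h u])
  interpret TA: assoc_algebra K B.TA by (rule B.TA_assoc)
  note right = TA.mult_linear(2)[simplified]
  fix h assume h: "h \<in> \<Gamma>"
  then have h': "single K h \<in> carrier A" by simp
  show "(\<lambda>u\<^sub>1 u\<^sub>2. B.pure (ract u\<^sub>1 (single K h)) (ract u\<^sub>2 (single K h))) \<in> bilinear_maps K B B B.T"
    by (rule bilinear_compose_args[OF pure_bilinear[OF B.H_module B.H_module] act_linear(2)[OF h'] act_linear(2)[OF h']])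
  show "(\<lambda>u. comul B (ract u (single K h))) \<in> linear_maps K B B.T"
    by (rule linear_compose[OF act_linear(2)[OF h'] B.comul_linear])
  show "(\<lambda>w. w \<otimes>\<^bsub>B.TA\<^esub> comul B (B.twist (f h))) \<in> linear_maps K B.T B.T"
    using h by (intro right) simp
  show "(\<lambda>w. w \<otimes>\<^bsub>B.TA\<^esub> comul B (B.e (r s h))) \<in> linear_maps K B.T B.T" if "s \<in> carrier Q" for s
    using that h by (intro right) simp
  show "comul B (ract \<one>\<^bsub>B\<^esub> (single K h)) = B.pure (ract \<one>\<^bsub>B\<^esub> (single K h)) (ract \<one>\<^bsub>B\<^esub> (single K h))"
    using h algebra_hom_one[OF B.comul_hom] by (simp add: gen_simps)
  fix a b assume ab: "a \<in> carrier B" "b \<in> carrier B"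
  show "B.pure (ract (a \<otimes>\<^bsub>B\<^esub> B.x) (single K h)) (ract b (single K h))
      \<oplus>\<^bsub>B.T\<^esub> B.pure (ract (a \<otimes>\<^bsub>B\<^esub> B.e g) (single K h)) (ract (b \<otimes>\<^bsub>B\<^esub> B.x) (single K h))
    = B.pure (ract a (single K h)) (ract b (single K h)) \<otimes>\<^bsub>B.TA\<^esub> comul B (B.twist (f h))"
    using h ab TA.V.r_distr[of "B.pure (B.twist (f h)) \<one>\<^bsub>B\<^esub>" "B.pure (B.e g) (B.twist (f h))"]
    by (simp add: gen_simps B.comul_twist B.pure_H_simps B.pure_H_mult)
qed (simp_all add: gen_simps B.comul_e B.pure_H_mult algebra_hom_mult[OF B.comul_hom])

lemma ract_counit_single:
  assumes h: "h \<in> \<Gamma>" and u: "u \<in> carrier B"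
  shows "counit B (ract u (single K h)) = counit B u"
proof (rule B.right_recursion_unique[where I = \<Gamma> and \<tau> = l and m = "\<lambda>_ _ w. w" and n = "\<lambda>_ _. \<zero>\<^bsub>K\<^esub>"
      and L = "\<lambda>h v. counit B (ract v (single K h))" and L' = "\<lambda>h. counit B", OF _ B.counit_linear _ _ _ _ _ _ h u])
  show "(\<lambda>u. counit B (ract u (single K h))) \<in> linear_maps K B (base_algebra K)" if "h \<in> \<Gamma>" for h
    using that by (intro linear_compose[OF act_linear(2) B.counit_linear]) simp
qed (simp_all add: gen_simps B.counit_twist)

lemma lact_unit_single:
  assumes u: "u \<in> carrier B"
  shows "lact u (single K \<one>\<^bsub>G\<^esub>) = counit B u \<odot>\<^bsub>A\<^esub> single K \<one>\<^bsub>G\<^esub>"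
proof (rule B.right_recursion_unique[where I = "{\<one>\<^bsub>G\<^esub>}" and \<tau> = "\<lambda>_ i. i" and m = "\<lambda>_ _ w. w" and n = "\<lambda>_ _. \<zero>\<^bsub>A\<^esub>"
      and L = "\<lambda>h v. lact v (single K h)" and L' = "\<lambda>h v. counit B v \<odot>\<^bsub>A\<^esub> single K h", OF _ _ _ _ _ _ _ _ _ u])
  fix h assume "h \<in> {\<one>\<^bsub>G\<^esub>}"
  then have h': "single K h \<in> carrier A" by simp
  show "(\<lambda>v. lact v (single K h)) \<in> linear_maps K B A" by (rule act_linear(1)[OF h'])
  show "(\<lambda>v. counit B v \<odot>\<^bsub>A\<^esub> single K h) \<in> linear_maps K B A"
    using h' linear_closed[OF B.counit_linear]
    by (intro linear_mapsI)
      (simp_all add: linear_add[OF B.counit_linear] linear_smult[OF B.counit_linear] AA.smult_l_distr AA.smult_assoc1)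
qed (simp_all add: gen_simps one_act AA.smult_l_null)

lemma ract_one_single:
  assumes u: "u \<in> carrier B"
  shows "ract u (single K \<one>\<^bsub>G\<^esub>) = u"
proof (rule B.right_recursion_unique[where I = "{\<one>\<^bsub>G\<^esub>}" and \<tau> = "\<lambda>_ i. i" and m = "\<lambda>s _ w. w \<otimes>\<^bsub>B\<^esub> B.e s"
      and n = "\<lambda>_ w. w \<otimes>\<^bsub>B\<^esub> B.x" and L = "\<lambda>h v. ract v (single K h)" and L' = "\<lambda>h v. v", OF _ B.H.id_linear _ _ _ _ _ _ _ u])
  fix h assume "h \<in> {\<one>\<^bsub>G\<^esub>}"
  then have h': "single K h \<in> carrier A" by simp
  show "(\<lambda>v. ract v (single K h)) \<in> linear_maps K B B" by (rule act_linear(2)[OF h'])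
qed (simp_all add: gen_simps one_act B.twist_zero)

lemma lact_prod_single:
  assumes h: "h \<in> \<Gamma>" and k: "k \<in> \<Gamma>" and u: "u \<in> carrier B"
  shows "lact u (single K (h \<otimes>\<^bsub>G\<^esub> k))
    = tensor_lift K A (\<lambda>u\<^sub>1 u\<^sub>2. lact u\<^sub>1 (single K h) \<otimes>\<^bsub>A\<^esub> lact (ract u\<^sub>2 (single K h)) (single K k)) (comul B u)"
proof -
  let ?I = "\<Gamma> \<times> \<Gamma>"
  have hk: "(h, k) \<in> ?I" using h k by simp
  have "lact u (single K (fst (h, k) \<otimes>\<^bsub>G\<^esub> snd (h, k)))
    = tensor_lift K A (\<lambda>u\<^sub>1 u\<^sub>2. lact u\<^sub>1 (single K (fst (h, k))) \<otimes>\<^bsub>A\<^esub>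
        lact (ract u\<^sub>2 (single K (fst (h, k)))) (single K (snd (h, k)))) (comul B u)"
  proof (rule B.sweedler_recursion[where I = ?I and \<tau> = "\<lambda>s q. (l s (fst q), l (r s (fst q)) (snd q))"
        and m = "\<lambda>_ _ w. w" and n = "\<lambda>_ _. \<zero>\<^bsub>A\<^esub>" and L = "\<lambda>q u. lact u (single K (fst q \<otimes>\<^bsub>G\<^esub> snd q))",
        OF A.A_module _ _ _ _ _ _ _ _ _ _ hk u])
    fix q assume q: "q \<in> ?I"
    then have q': "single K (fst q \<otimes>\<^bsub>G\<^esub> snd q) \<in> carrier A" "single K (fst q) \<in> carrier A" "single K (snd q) \<in> carrier A"
      by auto
    show "(\<lambda>u\<^sub>1 u\<^sub>2. lact u\<^sub>1 (single K (fst q)) \<otimes>\<^bsub>A\<^esub> lact (ract u\<^sub>2 (single K (fst q))) (single K (snd q))) \<in> bilinear_maps K B B A"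
      by (rule bilinear_compose_args[OF AA.mult_bilinear act_linear(1)[OF q'(2)]
            linear_compose[OF act_linear(2)[OF q'(2)] act_linear(1)[OF q'(3)]]])
    show "(\<lambda>u. lact u (single K (fst q \<otimes>\<^bsub>G\<^esub> snd q))) \<in> linear_maps K B A" by (rule act_linear(1)[OF q'(1)])
    show "(\<lambda>_. \<zero>\<^bsub>A\<^esub>) \<in> linear_maps K A A" by (rule zero_linear[OF A.A_module A.A_module])
  qed (auto simp: gen_simps act_prod lact_twist AA.id_linear)
  then show ?thesis by simp
qed

lemma ract_prod_single:
  assumes h: "h \<in> \<Gamma>" and u: "u \<in> carrier B" and v: "v \<in> carrier B"
  shows "ract (u \<otimes>\<^bsub>B\<^esub> v) (single K h)
    = tensor_lift K B (\<lambda>v\<^sub>1 v\<^sub>2. ract u (lact v\<^sub>1 (single K h)) \<otimes>\<^bsub>B\<^esub> ract v\<^sub>2 (single K h)) (comul B v)"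
proof (rule B.sweedler_recursion[where I = \<Gamma> and \<tau> = l and m = "\<lambda>s h w. w \<otimes>\<^bsub>B\<^esub> B.e (r s h)"
      and n = "\<lambda>h w. w \<otimes>\<^bsub>B\<^esub> B.twist (f h)"
      and L = "\<lambda>h v. ract (u \<otimes>\<^bsub>B\<^esub> v) (single K h)", OF B.H_module _ _ _ _ _ _ _ _ _ _ h v])
  fix h assume h: "h \<in> \<Gamma>"
  then have h': "single K h \<in> carrier A" by simp
  show "(\<lambda>v\<^sub>1 v\<^sub>2. ract u (lact v\<^sub>1 (single K h)) \<otimes>\<^bsub>B\<^esub> ract v\<^sub>2 (single K h)) \<in> bilinear_maps K B B B"
    by (rule bilinear_compose_args[OF B.H.mult_bilinear linear_compose[OF act_linear(1)[OF h'] bilinear_right[OF ract_bilinear u]]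
          act_linear(2)[OF h']])
  show "(\<lambda>v. ract (u \<otimes>\<^bsub>B\<^esub> v) (single K h)) \<in> linear_maps K B B"
    by (rule linear_compose[OF B.H.mult_linear(1)[OF u] act_linear(2)[OF h']])
qed (use u in \<open>simp_all add: gen_simps B.H.V.m_assoc[symmetric] B.H.mult_linear
    linear_zero[OF A.A_module B.H_module bilinear_right[OF ract_bilinear]]\<close>)

text \<open>The two sides obey the same recursion. For \<open>x\<close> one of the two terms of \<open>\<Delta>(x)\<close>
  is killed on each side, and the surviving ones agree because \<open>g\<close> acts trivially on \<open>\<Gamma>\<close>.\<close>

lemma act_symmetric_single:
  assumes h: "h \<in> \<Gamma>" and u: "u \<in> carrier B"
  shows "tensor_lift K (tensor_module K B A) (\<lambda>u\<^sub>1 u\<^sub>2. pure_tensor K B A (ract u\<^sub>1 (single K h)) (lact u\<^sub>2 (single K h))) (comul B u)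
    = tensor_lift K (tensor_module K B A) (\<lambda>u\<^sub>1 u\<^sub>2. pure_tensor K B A (ract u\<^sub>2 (single K h)) (lact u\<^sub>1 (single K h))) (comul B u)"
proof -
  let ?BA = "tensor_module K B A" and ?p = "pure_tensor K B A"
  note BA = tensor_module_module[OF B.H_module A.A_module]
  interpret BA: module K ?BA by (rule BA)
  define F F' where "F h u v = ?p (ract u (single K h)) (lact v (single K h))"
    and "F' h u v = ?p (ract v (single K h)) (lact u (single K h))" for h u v
  define R where "R y = tensor_map K B A (\<lambda>w. w \<otimes>\<^bsub>B\<^esub> y) (\<lambda>a. a)" for y
  have R: "R y \<in> linear_maps K ?BA ?BA" and
    R_pure: "u \<in> carrier B \<Longrightarrow> a \<in> carrier A \<Longrightarrow> R y (?p u a) = ?p (u \<otimes>\<^bsub>B\<^esub> y) a" if "y \<in> carrier B" for y u a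
    unfolding R_def
    using tensor_map_linear[OF B.H_module A.A_module B.H_module A.A_module B.H.mult_linear(2)[OF that] AA.id_linear]
      tensor_map_pure[OF B.H_module A.A_module B.H_module A.A_module B.H.mult_linear(2)[OF that] AA.id_linear] by auto
  have F: "F h \<in> bilinear_maps K B B ?BA" "F' h \<in> bilinear_maps K B B ?BA" if "h \<in> \<Gamma>" for h
  proof -
    have h': "single K h \<in> carrier A" using that by simp
    note b = bilinear_compose_args[OF pure_bilinear[OF B.H_module A.A_module] act_linear(2)[OF h'] act_linear(1)[OF h']]
    show "F h \<in> bilinear_maps K B B ?BA" "F' h \<in> bilinear_maps K B B ?BA"
      using b bilinear_flip[OF b] by (simp_all add: F_def[abs_def] F'_def[abs_def])
  qed
  note zero = pure_zero_left[OF B.H_module A.A_module] pure_zero_right[OF B.H_module A.A_module]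
  have "tensor_lift K ?BA (F h) (comul B u) = tensor_lift K ?BA (F' h) (comul B u)"
  proof (rule B.right_recursion_unique[where I = \<Gamma> and \<tau> = l and m = "\<lambda>s h. R (B.e (r s h))" and n = "\<lambda>h. R (B.twist (f h))"
        and L = "\<lambda>h u. tensor_lift K ?BA (F h) (comul B u)" and L' = "\<lambda>h u. tensor_lift K ?BA (F' h) (comul B u)",
        OF _ _ _ _ _ _ _ _ h u])
    fix h assume h: "h \<in> \<Gamma>"
    note lin = tensor_lift_linear[OF B.H_module B.H_module BA]
    show "(\<lambda>u. tensor_lift K ?BA (F h) (comul B u)) \<in> linear_maps K B ?BA"
      "(\<lambda>u. tensor_lift K ?BA (F' h) (comul B u)) \<in> linear_maps K B ?BA"
      by (rule linear_compose[OF B.comul_linear lin[OF F(1)[OF h]]], rule linear_compose[OF B.comul_linear lin[OF F(2)[OF h]]])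
    show "tensor_lift K ?BA (F h) (comul B \<one>\<^bsub>B\<^esub>) = tensor_lift K ?BA (F' h) (comul B \<one>\<^bsub>B\<^esub>)"
      using algebra_hom_one[OF B.comul_hom] h
        tensor_lift_pure[OF B.H_module B.H_module BA F(1)[OF h]] tensor_lift_pure[OF B.H_module B.H_module BA F(2)[OF h]]
      by (simp add: F_def F'_def)
    fix a assume a: "a \<in> carrier B"
    have y: "B.twist (f h) \<in> carrier B" using h by simp
    show "tensor_lift K ?BA (F h) (comul B (a \<otimes>\<^bsub>B\<^esub> B.x)) = R (B.twist (f h)) (tensor_lift K ?BA (F h) (comul B a))"
      by (rule B.sweedler_primitive[OF BA BA F(1)[OF h] F(1)[OF h] R[OF y] a])
        (use h in \<open>simp add: F_def gen_simps R_pure zero pure_closed[OF B.H_module A.A_module]\<close>)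
    show "tensor_lift K ?BA (F' h) (comul B (a \<otimes>\<^bsub>B\<^esub> B.x)) = R (B.twist (f h)) (tensor_lift K ?BA (F' h) (comul B a))"
      by (rule B.sweedler_primitive[OF BA BA F(2)[OF h] F(2)[OF h] R[OF y] a])
        (use h in \<open>simp add: F'_def gen_simps R_pure zero pure_closed[OF B.H_module A.A_module]\<close>)
    fix s assume s: "s \<in> carrier Q"
    have lh: "l s h \<in> \<Gamma>" and y: "B.e (r s h) \<in> carrier B" using s h by simp_all
    show "tensor_lift K ?BA (F h) (comul B (a \<otimes>\<^bsub>B\<^esub> B.e s)) = R (B.e (r s h)) (tensor_lift K ?BA (F (l s h)) (comul B a))"
      by (rule B.sweedler_grouplike[OF BA BA F(1)[OF h] F(1)[OF lh] R[OF y] s a])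
        (use h s in \<open>simp add: F_def gen_simps R_pure\<close>)
    show "tensor_lift K ?BA (F' h) (comul B (a \<otimes>\<^bsub>B\<^esub> B.e s)) = R (B.e (r s h)) (tensor_lift K ?BA (F' (l s h)) (comul B a))"
      by (rule B.sweedler_grouplike[OF BA BA F(2)[OF h] F(2)[OF lh] R[OF y] s a])
        (use h s in \<open>simp add: F'_def gen_simps R_pure\<close>)
  qed simp
  then show ?thesis by (simp add: F_def[abs_def] F'_def[abs_def])
qed

text \<open>Both sides obey the commutation rules of \<open>H\<close> that motivated the locale.\<close>

lemma swap_single:
  assumes u: "u \<in> carrier B" and h: "h \<in> \<Gamma>"
  shows "j u \<otimes>\<^bsub>H\<^esub> e h = swap_sum u (single K h)"
  unfolding swap_sum_def
proof (rule B.sweedler_recursion[where I = \<Gamma> and \<tau> = l and m = "\<lambda>s h w. w \<otimes>\<^bsub>H\<^esub> e (r s h)"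
      and n = "\<lambda>h w. w \<otimes>\<^bsub>H\<^esub> twist (f h)"
      and L = "\<lambda>h v. j v \<otimes>\<^bsub>H\<^esub> e h", OF H_module _ _ _ _ _ _ _ _ _ _ h u])
  fix h assume h: "h \<in> \<Gamma>"
  then have h': "single K h \<in> carrier A" by simp
  show "(\<lambda>u\<^sub>1 u\<^sub>2. i (lact u\<^sub>1 (single K h)) \<otimes>\<^bsub>H\<^esub> j (ract u\<^sub>2 (single K h))) \<in> bilinear_maps K B B H"
    by (rule swap_term[OF h'])
  show "(\<lambda>v. j v \<otimes>\<^bsub>H\<^esub> e h) \<in> linear_maps K B H"
    by (rule linear_compose[OF j_linear H.mult_linear(2)]) (use h in simp)
  show "(\<lambda>w. w \<otimes>\<^bsub>H\<^esub> twist (f h)) \<in> linear_maps K H H" by (rule H.mult_linear(2)) (use h in simp)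
  show "j (a \<otimes>\<^bsub>B\<^esub> B.x) \<otimes>\<^bsub>H\<^esub> e h = (j a \<otimes>\<^bsub>H\<^esub> e h) \<otimes>\<^bsub>H\<^esub> twist (f h)" if "a \<in> carrier B" for a
    using that h by (simp add: H.V.m_assoc x_e)
  show "(\<lambda>w. w \<otimes>\<^bsub>H\<^esub> e (r s h)) \<in> linear_maps K H H" if "s \<in> carrier Q" for s
    by (rule H.mult_linear(2)) (use that h in simp)
  show "j (a \<otimes>\<^bsub>B\<^esub> B.e s) \<otimes>\<^bsub>H\<^esub> e h = (j a \<otimes>\<^bsub>H\<^esub> e (l s h)) \<otimes>\<^bsub>H\<^esub> e (r s h)" if "s \<in> carrier Q" "a \<in> carrier B" for s a
    using that h act_product[of s h] by (simp add: H.V.m_assoc e_mult)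
qed (simp_all add: gen_simps linear_zero[OF A.A_module H_module i_linear] j_twist H.V.m_assoc)

end


context factorized_actions
begin

interpretation AA: assoc_algebra K A by (rule A.A_assoc)
interpretation Kb: assoc_algebra K "base_algebra K" by (rule base_algebra_assoc)

text \<open>Every axiom is linear in the elements of \<open>A\<close>, so it is enough to know it for grouplike elements, where the
  inner Sweedler sum disappears.\<close>

lemma matched_pair: "hopf_matched_pair K A B lact ract"
proof (rule hopf_matched_pair.intro[OF A.A_hopf B.H_hopf hopf_matched_pair_axioms.intro])
  note BA = tensor_module_module[OF B.H_module A.A_module]
  note pure_AA = pure_bilinear[OF A.A_module A.A_module] and pure_BB = pure_bilinear[OF B.H_module B.H_module]
    and pure_BA = pure_bilinear[OF B.H_module A.A_module]
  note bil = sweedler_AB(1) and single_sum = sweedler_AB(2)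
  show "lact \<in> bilinear_maps K B A A" "ract \<in> bilinear_maps K B A B" by (rule lact_bilinear ract_bilinear)+
  show "lact \<one>\<^bsub>B\<^esub> a = a" if a: "a \<in> carrier A" for a
    by (rule A.A_eqI[OF A.A_module bilinear_right[OF lact_bilinear B.H.V.one_closed] AA.id_linear _ a]) (simp add: lact_start)
  show "ract \<one>\<^bsub>B\<^esub> a = counit A a \<odot>\<^bsub>B\<^esub> \<one>\<^bsub>B\<^esub>" if a: "a \<in> carrier A" for a
  proof (rule A.A_eqI[OF B.H_module bilinear_right[OF ract_bilinear B.H.V.one_closed] _ _ a])
    show "(\<lambda>a. counit A a \<odot>\<^bsub>B\<^esub> \<one>\<^bsub>B\<^esub>) \<in> linear_maps K A B"
      using linear_closed[OF A_counit_linear]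
      by (intro linear_mapsI)
        (simp_all add: linear_add[OF A_counit_linear] linear_smult[OF A_counit_linear] B.H.smult_l_distr B.H.smult_assoc1)
  qed (simp add: ract_start)
  fix u assume u: "u \<in> carrier B"
  show "lact u \<one>\<^bsub>A\<^esub> = counit B u \<odot>\<^bsub>A\<^esub> \<one>\<^bsub>A\<^esub>" "ract u \<one>\<^bsub>A\<^esub> = u"
    using lact_unit_single[OF u] ract_one_single[OF u] by (simp_all add: A.A_one)
  show "lact (u \<otimes>\<^bsub>B\<^esub> v) a = lact u (lact v a)" if v: "v \<in> carrier B" and a: "a \<in> carrier A" for v a
    by (rule A.A_eqI[OF A.A_module bilinear_right[OF lact_bilinear B.H.V.m_closed[OF u v]]
          linear_compose[OF bilinear_right[OF lact_bilinear v] bilinear_right[OF lact_bilinear u]] _ a])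
      (simp add: lact_mult_single[OF _ u v])
  fix a assume a: "a \<in> carrier A"
  have q: "(\<lambda>u\<^sub>1 u\<^sub>2 a\<^sub>1 a\<^sub>2. A.Apure (lact u\<^sub>1 a\<^sub>1) (lact u\<^sub>2 a\<^sub>2)) \<in> quadrilinear_maps K B A A.AT"
    by (rule quadrilinear_split[OF pure_AA lact_bilinear lact_bilinear])
  show "comul A (lact u a) = sweedler2 K A B A.AT (\<lambda>u\<^sub>1 u\<^sub>2 a\<^sub>1 a\<^sub>2. A.Apure (lact u\<^sub>1 a\<^sub>1) (lact u\<^sub>2 a\<^sub>2)) u a"
    by (rule A.A_eqI[OF A.AT_module linear_compose[OF bilinear_right[OF lact_bilinear u] A.A_comul_linear]
          bilinear_right[OF bil[OF A.AT_module q] u] _ a])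
      (simp add: single_sum[OF A.AT_module q u] lact_comul_single u)
  have q: "(\<lambda>u\<^sub>1 u\<^sub>2 a\<^sub>1 a\<^sub>2. B.pure (ract u\<^sub>1 a\<^sub>1) (ract u\<^sub>2 a\<^sub>2)) \<in> quadrilinear_maps K B A B.T"
    by (rule quadrilinear_split[OF pure_BB ract_bilinear ract_bilinear])
  show "comul B (ract u a) = sweedler2 K A B B.T (\<lambda>u\<^sub>1 u\<^sub>2 a\<^sub>1 a\<^sub>2. B.pure (ract u\<^sub>1 a\<^sub>1) (ract u\<^sub>2 a\<^sub>2)) u a"
    by (rule A.A_eqI[OF B.T_module linear_compose[OF bilinear_right[OF ract_bilinear u] B.comul_linear]
          bilinear_right[OF bil[OF B.T_module q] u] _ a])
      (simp add: single_sum[OF B.T_module q u] ract_comul_single u)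
  have \<epsilon>: "(\<lambda>a. counit B u \<otimes>\<^bsub>K\<^esub> counit A a) \<in> linear_maps K A (base_algebra K)"
    using linear_closed[OF A_counit_linear] u
    by (intro linear_mapsI)
      (simp_all add: linear_add[OF A_counit_linear] linear_smult[OF A_counit_linear] r_distr m_lcomm)
  show "counit A (lact u a) = counit B u \<otimes>\<^bsub>K\<^esub> counit A a"
    by (rule A.A_eqI[OF Kb.module_axioms linear_compose[OF bilinear_right[OF lact_bilinear u] A_counit_linear] \<epsilon> _ a])
      (use u in \<open>simp add: lact_counit_single\<close>)
  show "counit B (ract u a) = counit B u \<otimes>\<^bsub>K\<^esub> counit A a"
    by (rule A.A_eqI[OF Kb.module_axioms linear_compose[OF bilinear_right[OF ract_bilinear u] B.counit_linear] \<epsilon> _ a])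
      (use u in \<open>simp add: ract_counit_single\<close>)
  have q: "(\<lambda>u\<^sub>1 u\<^sub>2 a\<^sub>1 a\<^sub>2. pure_tensor K B A (ract u\<^sub>1 a\<^sub>1) (lact u\<^sub>2 a\<^sub>2)) \<in> quadrilinear_maps K B A (tensor_module K B A)"
    by (rule quadrilinear_split[OF pure_BA ract_bilinear lact_bilinear])
  have q': "(\<lambda>u\<^sub>1 u\<^sub>2 a\<^sub>1 a\<^sub>2. pure_tensor K B A (ract u\<^sub>2 a\<^sub>2) (lact u\<^sub>1 a\<^sub>1)) \<in> quadrilinear_maps K B A (tensor_module K B A)"
    by (rule quadrilinear_split_swap[OF pure_BA ract_bilinear lact_bilinear])
  show "sweedler2 K A B (tensor_module K B A) (\<lambda>u\<^sub>1 u\<^sub>2 a\<^sub>1 a\<^sub>2. pure_tensor K B A (ract u\<^sub>1 a\<^sub>1) (lact u\<^sub>2 a\<^sub>2)) u a =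
      sweedler2 K A B (tensor_module K B A) (\<lambda>u\<^sub>1 u\<^sub>2 a\<^sub>1 a\<^sub>2. pure_tensor K B A (ract u\<^sub>2 a\<^sub>2) (lact u\<^sub>1 a\<^sub>1)) u a"
    by (rule A.A_eqI[OF BA bilinear_right[OF bil[OF BA q] u] bilinear_right[OF bil[OF BA q'] u] _ a])
      (simp add: single_sum[OF BA q u] single_sum[OF BA q' u] act_symmetric_single u)
  show "ract (u \<otimes>\<^bsub>B\<^esub> v) a = sweedler2 K A B B (\<lambda>v\<^sub>1 v\<^sub>2 a\<^sub>1 a\<^sub>2. ract u (lact v\<^sub>1 a\<^sub>1) \<otimes>\<^bsub>B\<^esub> ract v\<^sub>2 a\<^sub>2) v a"
    if v: "v \<in> carrier B" for v
  proof -
    have q: "(\<lambda>v\<^sub>1 v\<^sub>2 a\<^sub>1 a\<^sub>2. ract u (lact v\<^sub>1 a\<^sub>1) \<otimes>\<^bsub>B\<^esub> ract v\<^sub>2 a\<^sub>2) \<in> quadrilinear_maps K B A B"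
      by (rule quadrilinear_split[OF B.H.mult_bilinear bilinear_compose[OF lact_bilinear bilinear_right[OF ract_bilinear u]] ract_bilinear])
    show ?thesis
      by (rule A.A_eqI[OF B.H_module bilinear_right[OF ract_bilinear B.H.V.m_closed[OF u v]]
            bilinear_right[OF bil[OF B.H_module q] v] _ a])
        (simp add: single_sum[OF B.H_module q v] ract_prod_single u v)
  qed
  fix b assume b: "b \<in> carrier A"
  show "ract u (a \<otimes>\<^bsub>A\<^esub> b) = ract (ract u a) b"
  proof (rule A.A_eqI[OF B.H_module linear_compose[OF AA.mult_linear(2)[OF b] bilinear_right[OF ract_bilinear u]]
        linear_compose[OF bilinear_right[OF ract_bilinear u] bilinear_left[OF ract_bilinear b]] _ a])
    fix h assume "h \<in> carrier P"
    then have h: "h \<in> \<Gamma>" and h': "single K h \<in> carrier A" by simp_all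
    show "ract u (single K h \<otimes>\<^bsub>A\<^esub> b) = ract (ract u (single K h)) b"
      by (rule A.A_eqI[OF B.H_module linear_compose[OF AA.mult_linear(1)[OF h'] bilinear_right[OF ract_bilinear u]]
            bilinear_right[OF ract_bilinear act_closed(2)[OF u h']] _ b])
        (use h u in \<open>simp add: ract_mult_single\<close>)
  qed
  let ?\<phi> = "\<lambda>b u\<^sub>1 u\<^sub>2 a\<^sub>1 a\<^sub>2. lact u\<^sub>1 a\<^sub>1 \<otimes>\<^bsub>A\<^esub> lact (ract u\<^sub>2 a\<^sub>2) b"
  have q: "?\<phi> b \<in> quadrilinear_maps K B A A" if "b \<in> carrier A" for b
    by (rule quadrilinear_split[OF bilinear_compose_args[OF AA.mult_bilinear AA.id_linear act_linear(1)[OF that]]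
          lact_bilinear ract_bilinear])
  have lin: "(\<lambda>b. ?\<phi> b u\<^sub>1 u\<^sub>2 a\<^sub>1 a\<^sub>2) \<in> linear_maps K A A"
    if "u\<^sub>1 \<in> carrier B" "u\<^sub>2 \<in> carrier B" "a\<^sub>1 \<in> carrier A" "a\<^sub>2 \<in> carrier A" for u\<^sub>1 u\<^sub>2 a\<^sub>1 a\<^sub>2
    using that by (intro linear_compose[OF bilinear_right[OF lact_bilinear] AA.mult_linear(1)]) simp_all
  show "lact u (a \<otimes>\<^bsub>A\<^esub> b) = sweedler2 K A B A (?\<phi> b) u a"
  proof (rule A.A_eqI[OF A.A_module linear_compose[OF AA.mult_linear(1)[OF a] bilinear_right[OF lact_bilinear u]]
        sweedler_AB(3)[OF A.A_module A.A_module q lin u a] _ b])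
    fix k assume "k \<in> carrier P"
    then have k: "k \<in> \<Gamma>" and k': "single K k \<in> carrier A" by simp_all
    show "lact u (a \<otimes>\<^bsub>A\<^esub> single K k) = sweedler2 K A B A (?\<phi> (single K k)) u a"
      by (rule A.A_eqI[OF A.A_module linear_compose[OF AA.mult_linear(2)[OF k'] bilinear_right[OF lact_bilinear u]]
            bilinear_right[OF bil[OF A.A_module q[OF k']] u] _ a])
        (use k in \<open>simp add: single_sum[OF A.A_module q[OF k'] u] lact_prod_single u\<close>)
  qed
qed

lemma associated: "associated_matched_pair K H A B i j lact ract"
  unfolding associated_matched_pair_def using matched_pair fm_hopf_iso[OF swap_single] by simp

lemma determined: "determined_by K p P Q g f l r (\<lambda>h. \<ominus>\<^bsub>K\<^esub> f h) lact ract"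
proof -
  have "lact (B.e t) (single K h) = single K (l t h) \<and> ract (B.e t) (single K h) = B.e (r t h)"
    if "t \<in> G\<^sub>B" "h \<in> \<Gamma>" for t h
    using that lact_grp[of "\<one>\<^bsub>B\<^esub>" t h] ract_grp[of "\<one>\<^bsub>B\<^esub>" t h] lact_start ract_start by simp
  moreover have "lact B.x (single K h) = \<zero>\<^bsub>A\<^esub> \<and>
      ract B.x (single K h) = B.x \<oplus>\<^bsub>B\<^esub> ((\<ominus>\<^bsub>K\<^esub> f h) \<odot>\<^bsub>B\<^esub> (\<one>\<^bsub>B\<^esub> \<ominus>\<^bsub>B\<^esub> B.e g))" if "h \<in> \<Gamma>" for h
    using that lact_x[of "\<one>\<^bsub>B\<^esub>" h] ract_x[of "\<one>\<^bsub>B\<^esub>" h] ract_start g_GB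
    by (simp add: B.twist_def a_minus_def[of B B.x] B.H.smult_l_minus)
  ultimately show ?thesis by (simp add: determined_by_def Let_def)
qed

end


section \<open>Existence and uniqueness of the associated matched pair\<close>

context factorized
begin

interpretation AA: assoc_algebra K A by (rule A.A_assoc)

text \<open>The maps \<open>id \<otimes> \<epsilon>\<close> and \<open>\<epsilon> \<otimes> id\<close> on \<open>A \<otimes> B\<close>, seen on \<open>H\<close> through the factorization.\<close>

lemma projections:
  "\<exists>\<pi>\<^sub>A \<in> linear_maps K H A. \<exists>\<pi>\<^sub>B \<in> linear_maps K H B. \<forall>a\<in>carrier A. \<forall>u\<in>carrier B.
    \<pi>\<^sub>A (i a \<otimes>\<^bsub>H\<^esub> j u) = counit B u \<odot>\<^bsub>A\<^esub> a \<and> \<pi>\<^sub>B (i a \<otimes>\<^bsub>H\<^esub> j u) = counit A a \<odot>\<^bsub>B\<^esub> u"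
proof -
  obtain E where E: "E \<in> linear_maps K H AB" "\<And>C. C \<in> carrier AB \<Longrightarrow> E (fm C) = C" by (rule fm_inverse) blast
  note A\<epsilon> = algebra_hom_linear[OF A.A_counit_hom]
  note \<epsilon>_simps = linear_closed[OF A\<epsilon>] linear_add[OF A\<epsilon>] linear_smult[OF A\<epsilon>]
    linear_closed[OF B.counit_linear] linear_add[OF B.counit_linear] linear_smult[OF B.counit_linear]
  have bA: "(\<lambda>a u. counit B u \<odot>\<^bsub>A\<^esub> a) \<in> bilinear_maps K A B A"
    by (rule bilinear_mapsI)
      (use \<epsilon>_simps in \<open>simp_all add: AA.smult_l_distr AA.smult_r_distr AA.smult_assoc1[symmetric] m_comm\<close>)
  have bB: "(\<lambda>a u. counit A a \<odot>\<^bsub>B\<^esub> u) \<in> bilinear_maps K A B B"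
    by (rule bilinear_mapsI)
      (use \<epsilon>_simps in \<open>simp_all add: B.H.smult_l_distr B.H.smult_r_distr B.H.smult_assoc1[symmetric] m_comm\<close>)
  have val: "E (i a \<otimes>\<^bsub>H\<^esub> j u) = pureAB a u" if "a \<in> carrier A" "u \<in> carrier B" for a u
    using E(2)[of "pureAB a u"] that by (simp add: pureAB_simps)
  show ?thesis
    using linear_compose[OF E(1) tensor_lift_linear[OF A.A_module B.H_module A.A_module bA]]
      linear_compose[OF E(1) tensor_lift_linear[OF A.A_module B.H_module B.H_module bB]]
      tensor_lift_pure[OF A.A_module B.H_module A.A_module bA] tensor_lift_pure[OF A.A_module B.H_module B.H_module bB]
    by (intro bexI[of _ "\<lambda>w. tensor_lift K A (\<lambda>a u. counit B u \<odot>\<^bsub>A\<^esub> a) (E w)"]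
        bexI[of _ "\<lambda>w. tensor_lift K B (\<lambda>a u. counit A a \<odot>\<^bsub>B\<^esub> u) (E w)"]) (simp_all add: val)
qed

text \<open>The projections are compatible with right multiplication by \<open>B\<close>, and this turns the commutation rules of
  \<open>H\<close> into the rules for the actions.\<close>

lemma canonical_actions:
  assumes \<pi>\<^sub>A: "\<pi>\<^sub>A \<in> linear_maps K H A" and \<pi>\<^sub>B: "\<pi>\<^sub>B \<in> linear_maps K H B"
    and val: "\<And>a u. a \<in> carrier A \<Longrightarrow> u \<in> carrier B \<Longrightarrow> \<pi>\<^sub>A (i a \<otimes>\<^bsub>H\<^esub> j u) = counit B u \<odot>\<^bsub>A\<^esub> a"
      "\<And>a u. a \<in> carrier A \<Longrightarrow> u \<in> carrier B \<Longrightarrow> \<pi>\<^sub>B (i a \<otimes>\<^bsub>H\<^esub> j u) = counit A a \<odot>\<^bsub>B\<^esub> u"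
  shows "factorized_actions K p G g f G\<^sub>B \<Gamma> (\<lambda>u a. \<pi>\<^sub>A (j u \<otimes>\<^bsub>H\<^esub> i a)) (\<lambda>u a. \<pi>\<^sub>B (j u \<otimes>\<^bsub>H\<^esub> i a))"
proof -
  have \<pi>\<^sub>A_right: "\<pi>\<^sub>A (w \<otimes>\<^bsub>H\<^esub> j v) = counit B v \<odot>\<^bsub>A\<^esub> \<pi>\<^sub>A w" and \<pi>\<^sub>B_right: "\<pi>\<^sub>B (w \<otimes>\<^bsub>H\<^esub> j v) = \<pi>\<^sub>B w \<otimes>\<^bsub>B\<^esub> v"
    if w: "w \<in> carrier H" and v: "v \<in> carrier B" for w v
  proof -
    from w fm_bij obtain C where C: "C \<in> carrier AB" "w = fm C" by (auto simp: bij_betw_def)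
    have jv: "j v \<in> carrier H" and \<epsilon>v: "counit B v \<in> carrier K" using v by simp_all
    have "(\<lambda>a. counit B v \<odot>\<^bsub>A\<^esub> a) \<in> linear_maps K A A"
      by (rule linear_mapsI) (use \<epsilon>v in \<open>simp_all add: AA.smult_r_distr AA.smult_assoc1[symmetric] m_comm\<close>)
    note lin = linear_compose[OF \<pi>\<^sub>A this]
    note fm_right = linear_compose[OF fm_linear H.mult_linear(2)[OF jv]]
    have "\<pi>\<^sub>A (fm C \<otimes>\<^bsub>H\<^esub> j v) = counit B v \<odot>\<^bsub>A\<^esub> \<pi>\<^sub>A (fm C)"
    proof (rule tensor_eqI[OF A.A_module B.H_module linear_compose[OF fm_right \<pi>\<^sub>A] linear_compose[OF fm_linear lin] _ C(1)])
      fix a u assume au: "a \<in> carrier A" "u \<in> carrier B"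
      then show "\<pi>\<^sub>A (fm (pureAB a u) \<otimes>\<^bsub>H\<^esub> j v) = counit B v \<odot>\<^bsub>A\<^esub> \<pi>\<^sub>A (fm (pureAB a u))"
        using v \<epsilon>v val(1)[of a "u \<otimes>\<^bsub>B\<^esub> v"] algebra_hom_mult[OF B.counit_hom au(2) v]
        by (simp add: H.V.m_assoc val AA.smult_assoc1[symmetric] m_comm)
    qed
    then show "\<pi>\<^sub>A (w \<otimes>\<^bsub>H\<^esub> j v) = counit B v \<odot>\<^bsub>A\<^esub> \<pi>\<^sub>A w" by (simp add: C)
    have "\<pi>\<^sub>B (fm C \<otimes>\<^bsub>H\<^esub> j v) = \<pi>\<^sub>B (fm C) \<otimes>\<^bsub>B\<^esub> v"
    proof (rule tensor_eqI[OF A.A_module B.H_module linear_compose[OF fm_right \<pi>\<^sub>B]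
          linear_compose[OF linear_compose[OF fm_linear \<pi>\<^sub>B] B.H.mult_linear(2)[OF v]] _ C(1)])
      fix a u assume au: "a \<in> carrier A" "u \<in> carrier B"
      then show "\<pi>\<^sub>B (fm (pureAB a u) \<otimes>\<^bsub>H\<^esub> j v) = \<pi>\<^sub>B (fm (pureAB a u)) \<otimes>\<^bsub>B\<^esub> v"
        using v val(2)[of a "u \<otimes>\<^bsub>B\<^esub> v"] linear_closed[OF algebra_hom_linear[OF A.A_counit_hom] au(1)]
        by (simp add: H.V.m_assoc val B.H.smult_mult_left)
    qed
    then show "\<pi>\<^sub>B (w \<otimes>\<^bsub>H\<^esub> j v) = \<pi>\<^sub>B w \<otimes>\<^bsub>B\<^esub> v" by (simp add: C)
  qed
  have bil: "(\<lambda>u a. j u \<otimes>\<^bsub>H\<^esub> i a) \<in> bilinear_maps K B A H"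
    by (rule bilinear_compose_args[OF H.mult_bilinear j_linear i_linear])
  have start: "\<pi>\<^sub>A (e h) = single K h" "\<pi>\<^sub>B (e h) = \<one>\<^bsub>B\<^esub>" if "h \<in> \<Gamma>" for h
    using val[of "single K h" "\<one>\<^bsub>B\<^esub>"] that by simp_all
  have closed: "\<pi>\<^sub>A w \<in> carrier A" "\<pi>\<^sub>B w \<in> carrier B" if "w \<in> carrier H" for w
    using linear_closed[OF \<pi>\<^sub>A that] linear_closed[OF \<pi>\<^sub>B that] .
  have grp: "j (u \<otimes>\<^bsub>B\<^esub> B.e s) \<otimes>\<^bsub>H\<^esub> e h = (j u \<otimes>\<^bsub>H\<^esub> e (l s h)) \<otimes>\<^bsub>H\<^esub> j (B.e (r s h))"
    if "u \<in> carrier B" "s \<in> G\<^sub>B" "h \<in> \<Gamma>" for u s h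
    using that act_product[of s h] by (simp add: H.V.m_assoc e_mult)
  have x: "j (u \<otimes>\<^bsub>B\<^esub> B.x) \<otimes>\<^bsub>H\<^esub> e h = (j u \<otimes>\<^bsub>H\<^esub> e h) \<otimes>\<^bsub>H\<^esub> j (B.twist (f h))"
    if "u \<in> carrier B" "h \<in> \<Gamma>" for u h
    using that by (simp add: H.V.m_assoc x_e j_twist)
  show ?thesis
  proof (intro factorized_actions.intro bilinear_actions.intro factorized_axioms bilinear_actions_axioms.intro
      factorized_actions_axioms.intro bilinear_compose[OF bil \<pi>\<^sub>A] bilinear_compose[OF bil \<pi>\<^sub>B])
    fix u h s assume u: "u \<in> carrier B" and h: "h \<in> \<Gamma>"
    have ue: "j u \<otimes>\<^bsub>H\<^esub> e h \<in> carrier H" using u h by simp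
    have tw: "B.twist (f h) \<in> carrier B" "counit B (B.twist (f h)) = \<zero>\<^bsub>K\<^esub>" using h by (simp_all add: B.counit_twist)
    show "\<pi>\<^sub>A (j (u \<otimes>\<^bsub>B\<^esub> B.x) \<otimes>\<^bsub>H\<^esub> i (single K h)) = \<zero>\<^bsub>A\<^esub>"
      using h by (simp only: i_single x[OF u h] \<pi>\<^sub>A_right[OF ue tw(1)]) (simp add: tw closed ue AA.smult_l_null)
    show "\<pi>\<^sub>B (j (u \<otimes>\<^bsub>B\<^esub> B.x) \<otimes>\<^bsub>H\<^esub> i (single K h)) = \<pi>\<^sub>B (j u \<otimes>\<^bsub>H\<^esub> i (single K h)) \<otimes>\<^bsub>B\<^esub> B.twist (f h)"
      using h by (simp only: i_single x[OF u h] \<pi>\<^sub>B_right[OF ue tw(1)])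
    assume s: "s \<in> G\<^sub>B"
    have ue: "j u \<otimes>\<^bsub>H\<^esub> e (l s h) \<in> carrier H" and er: "B.e (r s h) \<in> carrier B" using u h s by simp_all
    show "\<pi>\<^sub>A (j (u \<otimes>\<^bsub>B\<^esub> B.e s) \<otimes>\<^bsub>H\<^esub> i (single K h)) = \<pi>\<^sub>A (j u \<otimes>\<^bsub>H\<^esub> i (single K (l s h)))"
      using h s by (simp only: i_single l_closed grp[OF u s h] \<pi>\<^sub>A_right[OF ue er]) (simp add: closed ue)
    show "\<pi>\<^sub>B (j (u \<otimes>\<^bsub>B\<^esub> B.e s) \<otimes>\<^bsub>H\<^esub> i (single K h)) = \<pi>\<^sub>B (j u \<otimes>\<^bsub>H\<^esub> i (single K (l s h))) \<otimes>\<^bsub>B\<^esub> B.e (r s h)"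
      using h s by (simp only: i_single l_closed grp[OF u s h] \<pi>\<^sub>B_right[OF ue er])
  qed (simp_all add: start)
qed

text \<open>Project \<open>uh = \<Sum> (u\<^sub>1 \<rhd> h)(u\<^sub>2 \<lhd> h)\<close> onto the two factors: the counit of the other factor passes to \<open>u\<^sub>1\<close>
  or \<open>u\<^sub>2\<close>, and the sum collapses.\<close>

lemma unique_actions:
  assumes assoc: "associated_matched_pair K H A B i j lact ract"
    and \<pi>\<^sub>A: "\<pi>\<^sub>A \<in> linear_maps K H A" and \<pi>\<^sub>B: "\<pi>\<^sub>B \<in> linear_maps K H B"
    and val: "\<And>a u. a \<in> carrier A \<Longrightarrow> u \<in> carrier B \<Longrightarrow> \<pi>\<^sub>A (i a \<otimes>\<^bsub>H\<^esub> j u) = counit B u \<odot>\<^bsub>A\<^esub> a"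
      "\<And>a u. a \<in> carrier A \<Longrightarrow> u \<in> carrier B \<Longrightarrow> \<pi>\<^sub>B (i a \<otimes>\<^bsub>H\<^esub> j u) = counit A a \<odot>\<^bsub>B\<^esub> u"
    and u: "u \<in> carrier B" and h: "h \<in> \<Gamma>"
  shows "lact u (single K h) = \<pi>\<^sub>A (j u \<otimes>\<^bsub>H\<^esub> e h)" and "ract u (single K h) = \<pi>\<^sub>B (j u \<otimes>\<^bsub>H\<^esub> e h)"
proof -
  interpret mp: hopf_matched_pair K A B lact ract using assoc by (simp add: associated_matched_pair_def)
  interpret bilinear_actions K p G g f G\<^sub>B \<Gamma> lact ract
    by (intro bilinear_actions.intro factorized_axioms bilinear_actions_axioms.intro mp.lact_bilinear mp.ract_bilinear)
  have h': "single K h \<in> carrier A" using h by simp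
  note summand = swap_term[OF h'] and \<Delta>u = B.comul_closed[OF u]
  note lin = bilinear_left[OF lact_bilinear h'] bilinear_left[OF ract_bilinear h']
  have swap: "j u \<otimes>\<^bsub>H\<^esub> e h = swap_sum u (single K h)"
    using assoc by (intro swap_of_fm_hopf_iso u h) (simp add: associated_matched_pair_def)
  have \<epsilon>: "(\<lambda>a b. counit B b \<odot>\<^bsub>B\<^esub> a) \<in> bilinear_maps K B B B" "(\<lambda>a b. counit B a \<odot>\<^bsub>B\<^esub> b) \<in> bilinear_maps K B B B"
    by (rule bilinear_mapsI; simp add: B.H.smult_l_distr B.H.smult_r_distr B.H.smult_assoc1[symmetric] m_comm
        linear_add[OF B.counit_linear] linear_smult[OF B.counit_linear])+
  have "\<pi>\<^sub>A (j u \<otimes>\<^bsub>H\<^esub> e h) = tensor_lift K A (\<lambda>u\<^sub>1 u\<^sub>2. \<pi>\<^sub>A (i (lact u\<^sub>1 (single K h)) \<otimes>\<^bsub>H\<^esub> j (ract u\<^sub>2 (single K h)))) (comul B u)"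
    unfolding swap swap_sum_def by (rule tensor_lift_compose[OF B.H_module B.H_module H_module A.A_module summand \<pi>\<^sub>A \<Delta>u])
  also have "\<dots> = tensor_lift K A (\<lambda>u\<^sub>1 u\<^sub>2. lact (counit B u\<^sub>2 \<odot>\<^bsub>B\<^esub> u\<^sub>1) (single K h)) (comul B u)"
    by (rule tensor_lift_cong[OF B.H_module B.H_module A.A_module bilinear_compose[OF summand \<pi>\<^sub>A] _ \<Delta>u])
      (use h h' mp.ract_counit[OF _ h'] in \<open>simp add: val linear_smult[OF lin(1)]\<close>)
  also have "\<dots> = lact u (single K h)"
    using tensor_lift_compose[OF B.H_module B.H_module B.H_module A.A_module \<epsilon>(1) lin(1) \<Delta>u] B.H_counit_right[OF u] by simp
  finally show "lact u (single K h) = \<pi>\<^sub>A (j u \<otimes>\<^bsub>H\<^esub> e h)" ..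
  have "\<pi>\<^sub>B (j u \<otimes>\<^bsub>H\<^esub> e h) = tensor_lift K B (\<lambda>u\<^sub>1 u\<^sub>2. \<pi>\<^sub>B (i (lact u\<^sub>1 (single K h)) \<otimes>\<^bsub>H\<^esub> j (ract u\<^sub>2 (single K h)))) (comul B u)"
    unfolding swap swap_sum_def by (rule tensor_lift_compose[OF B.H_module B.H_module H_module B.H_module summand \<pi>\<^sub>B \<Delta>u])
  also have "\<dots> = tensor_lift K B (\<lambda>u\<^sub>1 u\<^sub>2. ract (counit B u\<^sub>1 \<odot>\<^bsub>B\<^esub> u\<^sub>2) (single K h)) (comul B u)"
    by (rule tensor_lift_cong[OF B.H_module B.H_module B.H_module bilinear_compose[OF summand \<pi>\<^sub>B] _ \<Delta>u])
      (use h h' mp.lact_counit[OF _ h'] in \<open>simp add: val linear_smult[OF lin(2)]\<close>)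
  also have "\<dots> = ract u (single K h)"
    using tensor_lift_compose[OF B.H_module B.H_module B.H_module B.H_module \<epsilon>(2) lin(2) \<Delta>u] B.H_counit_left[OF u] by simp
  finally show "ract u (single K h) = \<pi>\<^sub>B (j u \<otimes>\<^bsub>H\<^esub> e h)" ..
qed

end


context factorized
begin

interpretation AA: assoc_algebra K A by (rule A.A_assoc)

text \<open>The action of a product and the rule for \<open>(uv) \<lhd> a\<close>, applied with a generator \<open>v\<close>, whose
  comultiplication is known.\<close>

lemma determined_actions:
  assumes mp: "hopf_matched_pair K A B lact ract"
    and det: "determined_by K p P Q g f l r (\<lambda>h. \<ominus>\<^bsub>K\<^esub> f h) lact ract"
  shows "factorized_actions K p G g f G\<^sub>B \<Gamma> lact ract"
proof -
  interpret mp: hopf_matched_pair K A B lact ract by (rule mp)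
  interpret bilinear_actions K p G g f G\<^sub>B \<Gamma> lact ract
    by (intro bilinear_actions.intro factorized_axioms bilinear_actions_axioms.intro mp.lact_bilinear mp.ract_bilinear)
  have det_e: "lact (B.e s) (single K h) = single K (l s h)" "ract (B.e s) (single K h) = B.e (r s h)"
    if "s \<in> G\<^sub>B" "h \<in> \<Gamma>" for s h
    using det that by (simp_all add: determined_by_def Let_def)
  have det_x: "lact B.x (single K h) = \<zero>\<^bsub>A\<^esub>" "ract B.x (single K h) = B.twist (f h)" if "h \<in> \<Gamma>" for h
    using det that g_GB
    by (simp_all add: determined_by_def Let_def B.twist_def a_minus_def[of B B.x] B.H.smult_l_minus)
  have q: "(\<lambda>v\<^sub>1 v\<^sub>2 a\<^sub>1 a\<^sub>2. ract u (lact v\<^sub>1 a\<^sub>1) \<otimes>\<^bsub>B\<^esub> ract v\<^sub>2 a\<^sub>2) \<in> quadrilinear_maps K B A B" if u: "u \<in> carrier B" for u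
    by (rule quadrilinear_split[OF B.H.mult_bilinear bilinear_compose[OF lact_bilinear bilinear_right[OF ract_bilinear u]] ract_bilinear])
  show ?thesis
  proof (intro factorized_actions.intro bilinear_actions_axioms factorized_actions_axioms.intro)
    fix h assume h: "h \<in> \<Gamma>"
    then have h': "single K h \<in> carrier A" by simp
    show "lact \<one>\<^bsub>B\<^esub> (single K h) = single K h" "ract \<one>\<^bsub>B\<^esub> (single K h) = \<one>\<^bsub>B\<^esub>"
      using mp.lact_one[OF h'] mp.ract_unit[OF h'] by simp_all
    fix u assume u: "u \<in> carrier B"
    have bil: "(\<lambda>v\<^sub>1 v\<^sub>2. ract u (lact v\<^sub>1 (single K h)) \<otimes>\<^bsub>B\<^esub> ract v\<^sub>2 (single K h)) \<in> bilinear_maps K B B B"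
      using q[OF u] h' by (simp add: quadrilinear_maps_def)
    have prod: "ract (u \<otimes>\<^bsub>B\<^esub> v) (single K h)
        = tensor_lift K B (\<lambda>v\<^sub>1 v\<^sub>2. ract u (lact v\<^sub>1 (single K h)) \<otimes>\<^bsub>B\<^esub> ract v\<^sub>2 (single K h)) (comul B v)"
      if v: "v \<in> carrier B" for v
      using h by (simp add: mp.ract_prod[OF u v h'] sweedler_AB(2)[OF B.H_module q[OF u] v h'])
    note lift_pure = tensor_lift_pure[OF B.H_module B.H_module B.H_module bil]
    show "lact (u \<otimes>\<^bsub>B\<^esub> B.x) (single K h) = \<zero>\<^bsub>A\<^esub>"
      using u h' h linear_zero[OF A.A_module A.A_module bilinear_right[OF lact_bilinear u]]
      by (simp add: mp.lact_mult det_x)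
    show "ract (u \<otimes>\<^bsub>B\<^esub> B.x) (single K h) = ract u (single K h) \<otimes>\<^bsub>B\<^esub> B.twist (f h)"
      using u h g_GB linear_zero[OF A.A_module B.H_module bilinear_right[OF ract_bilinear u]]
        linear_add[OF tensor_lift_linear[OF B.H_module B.H_module B.H_module bil]]
      by (simp add: prod B.comul_x B.pure_H_simps lift_pure det_x det_e g_act)
    fix s assume s: "s \<in> G\<^sub>B"
    show "lact (u \<otimes>\<^bsub>B\<^esub> B.e s) (single K h) = lact u (single K (l s h))"
      using u h' h s by (simp add: mp.lact_mult det_e)
    show "ract (u \<otimes>\<^bsub>B\<^esub> B.e s) (single K h) = ract u (single K (l s h)) \<otimes>\<^bsub>B\<^esub> B.e (r s h)"
      using u h s by (simp add: prod B.comul_e lift_pure det_e)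
  qed
qed

lemma associated_exists: "\<exists>lact ract. associated_matched_pair K H A B i j lact ract"
proof -
  obtain \<pi>\<^sub>A \<pi>\<^sub>B where \<pi>: "\<pi>\<^sub>A \<in> linear_maps K H A" "\<pi>\<^sub>B \<in> linear_maps K H B"
    "\<And>a u. a \<in> carrier A \<Longrightarrow> u \<in> carrier B \<Longrightarrow> \<pi>\<^sub>A (i a \<otimes>\<^bsub>H\<^esub> j u) = counit B u \<odot>\<^bsub>A\<^esub> a"
    "\<And>a u. a \<in> carrier A \<Longrightarrow> u \<in> carrier B \<Longrightarrow> \<pi>\<^sub>B (i a \<otimes>\<^bsub>H\<^esub> j u) = counit A a \<odot>\<^bsub>B\<^esub> u"
    using projections by blast
  show ?thesis using factorized_actions.associated[OF canonical_actions[OF \<pi>]] by blast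
qed

lemma associated_iff_determined:
  "associated_matched_pair K H A B i j lact ract \<longleftrightarrow>
    hopf_matched_pair K A B lact ract \<and> determined_by K p P Q g f l r (\<lambda>h. \<ominus>\<^bsub>K\<^esub> f h) lact ract"
proof
  assume assoc: "associated_matched_pair K H A B i j lact ract"
  obtain \<pi>\<^sub>A \<pi>\<^sub>B where \<pi>: "\<pi>\<^sub>A \<in> linear_maps K H A" "\<pi>\<^sub>B \<in> linear_maps K H B"
    "\<And>a u. a \<in> carrier A \<Longrightarrow> u \<in> carrier B \<Longrightarrow> \<pi>\<^sub>A (i a \<otimes>\<^bsub>H\<^esub> j u) = counit B u \<odot>\<^bsub>A\<^esub> a"
    "\<And>a u. a \<in> carrier A \<Longrightarrow> u \<in> carrier B \<Longrightarrow> \<pi>\<^sub>B (i a \<otimes>\<^bsub>H\<^esub> j u) = counit A a \<odot>\<^bsub>B\<^esub> u"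
    using projections by blast
  show "hopf_matched_pair K A B lact ract \<and> determined_by K p P Q g f l r (\<lambda>h. \<ominus>\<^bsub>K\<^esub> f h) lact ract"
    using factorized_actions.determined[OF canonical_actions[OF \<pi>]] assoc
      unique_actions[OF assoc \<pi>, of "B.e t" for t] unique_actions[OF assoc \<pi> B.x_closed]
    by (simp add: determined_by_def associated_matched_pair_def Let_def)
next
  assume "hopf_matched_pair K A B lact ract \<and> determined_by K p P Q g f l r (\<lambda>h. \<ominus>\<^bsub>K\<^esub> f h) lact ract"
  then show "associated_matched_pair K H A B i j lact ract"
    using factorized_actions.associated[OF determined_actions] by blast
qed


section \<open>The group bicrossed product\<close>

abbreviation "L \<equiv> group_bicrossed_product P Q l r"
abbreviation "\<Theta> \<equiv> \<lambda>(h, t). h \<otimes>\<^bsub>G\<^esub> t"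
abbreviation "F \<equiv> \<lambda>(h, t). f t \<ominus>\<^bsub>K\<^esub> (\<ominus>\<^bsub>K\<^esub> f h)"

lemma L_sel: "carrier L = \<Gamma> \<times> G\<^sub>B" "\<one>\<^bsub>L\<^esub> = (\<one>\<^bsub>G\<^esub>, \<one>\<^bsub>G\<^esub>)"
  "(h, t) \<otimes>\<^bsub>L\<^esub> (k, s) = (h \<otimes>\<^bsub>G\<^esub> l t k, r t k \<otimes>\<^bsub>G\<^esub> s)"
  by (simp_all add: group_bicrossed_product_def)

lemma L_closed: "q \<in> carrier L \<Longrightarrow> q' \<in> carrier L \<Longrightarrow> q \<otimes>\<^bsub>L\<^esub> q' \<in> carrier L"
  by (auto simp: L_sel)

lemma \<Theta>_closed: "q \<in> carrier L \<Longrightarrow> \<Theta> q \<in> carrier G"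
  by (auto simp: L_sel)

lemma \<Theta>_mult: "q \<in> carrier L \<Longrightarrow> q' \<in> carrier L \<Longrightarrow> \<Theta> (q \<otimes>\<^bsub>L\<^esub> q') = \<Theta> q \<otimes>\<^bsub>G\<^esub> \<Theta> q'"
proof -
  assume "q \<in> carrier L" "q' \<in> carrier L"
  then obtain h t k s where q: "q = (h, t)" "q' = (k, s)" "h \<in> \<Gamma>" "t \<in> G\<^sub>B" "k \<in> \<Gamma>" "s \<in> G\<^sub>B"
    by (auto simp: L_sel)
  have "h \<otimes>\<^bsub>G\<^esub> (t \<otimes>\<^bsub>G\<^esub> k) \<otimes>\<^bsub>G\<^esub> s = h \<otimes>\<^bsub>G\<^esub> (l t k \<otimes>\<^bsub>G\<^esub> r t k) \<otimes>\<^bsub>G\<^esub> s"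
    using q act_product[of t k] by simp
  then show "\<Theta> (q \<otimes>\<^bsub>L\<^esub> q') = \<Theta> q \<otimes>\<^bsub>G\<^esub> \<Theta> q'"
    using q by (simp add: L_sel G.m_assoc)
qed

lemma \<Theta>_inj: "q \<in> carrier L \<Longrightarrow> q' \<in> carrier L \<Longrightarrow> \<Theta> q = \<Theta> q' \<Longrightarrow> q = q'"
  using factor_unique by (auto simp: L_sel)

lemma \<Theta>_bij: "bij_betw \<Theta> (carrier L) (carrier G)"
proof (rule bij_betwI')
  show "\<Theta> q = \<Theta> q' \<longleftrightarrow> q = q'" if "q \<in> carrier L" "q' \<in> carrier L" for q q'
    using \<Theta>_inj[OF that] by auto
  show "\<Theta> q \<in> carrier G" if "q \<in> carrier L" for q by (rule \<Theta>_closed[OF that])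
  show "\<exists>q\<in>carrier L. s = \<Theta> q" if "s \<in> carrier G" for s
  proof -
    obtain h t where "h \<in> \<Gamma>" "t \<in> G\<^sub>B" "s = h \<otimes>\<^bsub>G\<^esub> t" by (rule factor_exists[OF \<open>s \<in> carrier G\<close>]) blast
    then show ?thesis by (intro bexI[of _ "(h, t)"]) (simp_all add: L_sel)
  qed
qed

lemma L_group: "group L"
proof (rule groupI)
  show one: "\<one>\<^bsub>L\<^esub> \<in> carrier L" by (simp add: L_sel)
  show "q \<otimes>\<^bsub>L\<^esub> q' \<otimes>\<^bsub>L\<^esub> q'' = q \<otimes>\<^bsub>L\<^esub> (q' \<otimes>\<^bsub>L\<^esub> q'')"
    if "q \<in> carrier L" "q' \<in> carrier L" "q'' \<in> carrier L" for q q' q''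
    by (rule \<Theta>_inj) (use that in \<open>simp_all only: L_closed \<Theta>_mult G.m_assoc \<Theta>_closed\<close>)
  have \<Theta>_one: "\<Theta> \<one>\<^bsub>L\<^esub> = \<one>\<^bsub>G\<^esub>" by (simp add: L_sel)
  show "\<one>\<^bsub>L\<^esub> \<otimes>\<^bsub>L\<^esub> q = q" if "q \<in> carrier L" for q
    by (rule \<Theta>_inj) (use that one in \<open>simp_all only: L_closed \<Theta>_mult \<Theta>_one G.l_one \<Theta>_closed\<close>)
  show "\<exists>q'\<in>carrier L. q' \<otimes>\<^bsub>L\<^esub> q = \<one>\<^bsub>L\<^esub>" if q: "q \<in> carrier L" for q
  proof -
    have "inv\<^bsub>G\<^esub> \<Theta> q \<in> \<Theta> ` carrier L" using \<Theta>_bij \<Theta>_closed[OF q] by (simp only: bij_betw_def G.inv_closed)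
    then obtain q' where q': "q' \<in> carrier L" "inv\<^bsub>G\<^esub> \<Theta> q = \<Theta> q'" by blast
    have "\<Theta> (q' \<otimes>\<^bsub>L\<^esub> q) = \<Theta> \<one>\<^bsub>L\<^esub>"
      by (simp only: \<Theta>_mult q q'(1) q'(2)[symmetric] G.l_inv[OF \<Theta>_closed[OF q]] \<Theta>_one)
    then show ?thesis using \<Theta>_inj[OF L_closed[OF q'(1) q] one] q' by blast
  qed
qed (rule L_closed)

lemma \<Theta>_iso: "\<Theta> \<in> iso L G"
  using \<Theta>_bij \<Theta>_closed \<Theta>_mult by (simp add: iso_def hom_def Pi_iff del: split_paired_All)

lemma F_eq: "q \<in> carrier L \<Longrightarrow> F q = f (\<Theta> q)"
  by (auto simp: L_sel a_minus_def a_comm)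

lemma g_pow: "(\<one>\<^bsub>G\<^esub>, g) [^]\<^bsub>L\<^esub> n = (\<one>\<^bsub>G\<^esub>, g [^]\<^bsub>G\<^esub> n)" for n :: nat
proof -
  have cl: "g [^]\<^bsub>G\<^esub> n \<in> G\<^sub>B" for n :: nat by (induction n) (simp_all add: g_GB)
  show "(\<one>\<^bsub>G\<^esub>, g) [^]\<^bsub>L\<^esub> n = (\<one>\<^bsub>G\<^esub>, g [^]\<^bsub>G\<^esub> n)"
    by (induction n) (simp_all add: monoid.nat_pow_0 monoid.nat_pow_Suc group.is_monoid[OF L_group] L_sel cl one_act)
qed

lemma L_datum: "third_type_datum K p L (\<one>\<^bsub>G\<^esub>, g) F"
proof (rule third_type_datumI[OF L_group])
  have "finite (carrier G)" using datum by (simp add: third_type_datum_def)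
  then show "finite (carrier L)" using \<Theta>_bij bij_betw_finite by blast
  show gL: "(\<one>\<^bsub>G\<^esub>, g) \<in> carrier L" by (simp add: L_sel g_GB)
  show "(\<one>\<^bsub>G\<^esub>, g) \<otimes>\<^bsub>L\<^esub> q = q \<otimes>\<^bsub>L\<^esub> (\<one>\<^bsub>G\<^esub>, g)" if q: "q \<in> carrier L" for q
    by (rule \<Theta>_inj[OF L_closed[OF gL q] L_closed[OF q gL]])
      (use g_central[OF \<Theta>_closed[OF q]] in \<open>simp only: \<Theta>_mult gL q, simp\<close>)
  show "F q \<in> carrier K" if "q \<in> carrier L" for q
    using \<Theta>_closed[OF that] F_eq[OF that] by (simp only: f_closed)
  show "F (q \<otimes>\<^bsub>L\<^esub> q') = F q \<oplus>\<^bsub>K\<^esub> F q'" if "q \<in> carrier L" "q' \<in> carrier L" for q q'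
    using that by (simp only: F_eq L_closed \<Theta>_mult f_mult \<Theta>_closed)
  show "F (\<one>\<^bsub>G\<^esub>, g) = \<one>\<^bsub>K\<^esub>" using g_GB by (simp add: a_minus_def)
  show "(\<one>\<^bsub>G\<^esub>, g) [^]\<^bsub>L\<^esub> p = \<one>\<^bsub>L\<^esub> \<or> (\<forall>q\<in>carrier L. F q [^]\<^bsub>K\<^esub> p = F q)"
    using datum_cases
  proof
    assume "g [^]\<^bsub>G\<^esub> p = \<one>\<^bsub>G\<^esub>"
    then show ?thesis by (simp add: g_pow L_sel(2))
  next
    assume "\<forall>t\<in>carrier G. f t [^]\<^bsub>K\<^esub> p = f t"
    then show ?thesis using F_eq \<Theta>_closed by simp
  qed
qed

lemma third_L_iso: "\<exists>\<phi>. \<phi> \<in> hopf_isos K (third_hopf_algebra K p L (\<one>\<^bsub>G\<^esub>, g) F) H"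
  and third_L_iso': "\<exists>\<phi>. \<phi> \<in> hopf_isos K H (third_hopf_algebra K p L (\<one>\<^bsub>G\<^esub>, g) F)"
proof -
  interpret L: group L by (rule L_group)
  have L: "third_type K p L (\<one>\<^bsub>G\<^esub>, g) F"
    by (intro third_type.intro third_type_axioms.intro field_axioms L_group prime char L_datum)
  have gL: "(\<one>\<^bsub>G\<^esub>, g) \<in> carrier L" by (simp add: L_sel g_GB)
  interpret \<Theta>: third_type_map K p L "(\<one>\<^bsub>G\<^esub>, g)" F G g f \<Theta>
  proof (intro third_type_map.intro third_type_map_axioms.intro L third_type_axioms)
    show "\<Theta> \<in> hom L G" using \<Theta>_iso by (simp add: iso_def)
  qed (simp_all add: F_eq)
  show "\<exists>\<phi>. \<phi> \<in> hopf_isos K (third_hopf_algebra K p L (\<one>\<^bsub>G\<^esub>, g) F) H"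
    using \<Theta>.third_map_iso[OF \<Theta>_bij] by blast
  let ?\<Phi> = "inv_into (carrier L) \<Theta>"
  have \<Phi>_iso: "?\<Phi> \<in> iso G L" by (rule L.iso_set_sym[OF \<Theta>_iso])
  have \<Theta>\<Phi>: "\<Theta> (?\<Phi> s) = s" "?\<Phi> s \<in> carrier L" if "s \<in> carrier G" for s
    using that \<Theta>_bij by (simp_all add: bij_betw_def f_inv_into_f inv_into_into del: split_paired_All)
  interpret \<Phi>: third_type_map K p G g f L "(\<one>\<^bsub>G\<^esub>, g)" F ?\<Phi>
  proof (intro third_type_map.intro third_type_map_axioms.intro L third_type_axioms)
    show "?\<Phi> \<in> hom G L" using \<Phi>_iso by (simp add: iso_def)
    have "?\<Phi> (\<Theta> (\<one>\<^bsub>G\<^esub>, g)) = (\<one>\<^bsub>G\<^esub>, g)"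
      by (rule inv_into_f_f[OF bij_betw_imp_inj_on[OF \<Theta>_bij] gL])
    then show "?\<Phi> g = (\<one>\<^bsub>G\<^esub>, g)" using g_GB by simp
    show "F (?\<Phi> t) = f t" if "t \<in> carrier G" for t
      by (simp only: F_eq[OF \<Theta>\<Phi>(2)[OF that]] \<Theta>\<Phi>(1)[OF that])
  qed
  show "\<exists>\<phi>. \<phi> \<in> hopf_isos K H (third_hopf_algebra K p L (\<one>\<^bsub>G\<^esub>, g) F)"
    using \<Phi>.third_map_iso \<Phi>_iso by (auto simp: iso_def simp del: split_paired_All)
qed

lemma associated_bicrossed_iso:
  assumes "associated_matched_pair K H A B i j lact ract"
  shows "hopf_isomorphic K (bicrossed_product K A B lact ract) (third_hopf_algebra K p L (\<one>\<^bsub>G\<^esub>, g) F)"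
proof -
  obtain \<phi> where "\<phi> \<in> hopf_isos K H (third_hopf_algebra K p L (\<one>\<^bsub>G\<^esub>, g) F)" using third_L_iso' by blast
  then show ?thesis
    using hopf_isos_compose[of fm K "bicrossed_product K A B lact ract" H] assms
    by (auto simp: associated_matched_pair_def hopf_isomorphic_def)
qed

end

lemma (in domain) characteristic_prime:
  assumes "ring_characteristic R p" "p > 0"
  shows "Factorial_Ring.prime p"
proof -
  have char: "[n] \<cdot> \<one> = \<zero> \<longleftrightarrow> p dvd n" for n :: nat
    using assms(1) by (simp add: ring_characteristic_def)
  have "p dvd m \<or> p dvd n" if "p dvd m * n" for m n
  proof -
    have "([m] \<cdot> \<one>) \<otimes> ([n] \<cdot> \<one>) = \<zero>"
      using char[of "m * n"] that by (simp add: add_pow_ldistr add_pow_rdistr add.nat_pow_pow mult.commute)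
    then show ?thesis using integral[of "[m] \<cdot> \<one>" "[n] \<cdot> \<one>"] char by simp
  qed
  then have "prime_elem p"
    using char[of 1] assms(2) unfolding prime_elem_def by (intro conjI) auto
  then show ?thesis by simp
qed

theorem theorem4p4:
  fixes K :: "'k ring" and p :: nat
    and G :: "'g monoid" and g :: 'g and f :: "'g \<Rightarrow> 'k"
    and G\<^sub>B \<Gamma> :: "'g set"
  assumes "algebraically_closed K" and "ring_characteristic K p" and "p > 0"
    and "third_type_datum K p G g f"
    and "subgroup G\<^sub>B G" and "subgroup \<Gamma> G"
    and "carrier G = G\<^sub>B <#>\<^bsub>G\<^esub> \<Gamma>" and "G\<^sub>B \<inter> \<Gamma> = {\<one>\<^bsub>G\<^esub>}"
    and "g \<in> G\<^sub>B" and "\<Gamma> \<noteq> {\<one>\<^bsub>G\<^esub>}"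
  shows "let
      P = G\<lparr>carrier := \<Gamma>\<rparr>; Q = G\<lparr>carrier := G\<^sub>B\<rparr>;
      H = third_hopf_algebra K p G g f;
      A = group_hopf_algebra K P;
      B = third_hopf_algebra K p Q g f;
      i = group_incl K p G g f;
      j = third_incl K p G g f;
      l = canonical_lact G \<Gamma> G\<^sub>B;
      r = canonical_ract G \<Gamma> G\<^sub>B;
      \<gamma> = (\<lambda>h. \<ominus>\<^bsub>K\<^esub> f h);
      x = third_x K p Q g f;
      L = group_bicrossed_product P Q l r;
      g\<^sub>L = (\<one>\<^bsub>G\<^esub>, g);
      \<Theta> = (\<lambda>(h, t). h \<otimes>\<^bsub>G\<^esub> t);
      F = (\<lambda>(h, t). f t \<ominus>\<^bsub>K\<^esub> \<gamma> h)
    in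
      group_matched_pair P Q l r \<and>
      exact_factorization K H A B i j \<and>
      (\<exists>lact ract. associated_matched_pair K H A B i j lact ract) \<and>
      (\<forall>lact ract. associated_matched_pair K H A B i j lact ract \<longleftrightarrow>
         hopf_matched_pair K A B lact ract \<and> determined_by K p P Q g f l r \<gamma> lact ract) \<and>
      (\<forall>lact ract. associated_matched_pair K H A B i j lact ract \<longrightarrow>
         (\<forall>h\<in>\<Gamma>. lact x (single K h) = \<zero>\<^bsub>A\<^esub> \<and>
           ract x (single K h) = x \<ominus>\<^bsub>B\<^esub> (f h \<odot>\<^bsub>B\<^esub> (\<one>\<^bsub>B\<^esub> \<ominus>\<^bsub>B\<^esub> third_grp K p Q g f g)))) \<and>
      \<Theta> \<in> iso L G \<and>
      (\<forall>h\<in>\<Gamma>. \<forall>t\<in>G\<^sub>B. F (h, t) = f (h \<otimes>\<^bsub>G\<^esub> t) \<and> f (h \<otimes>\<^bsub>G\<^esub> t) = f (\<Theta> (h, t))) \<and>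
      third_type_datum K p L g\<^sub>L F \<and>
      (\<forall>lact ract. associated_matched_pair K H A B i j lact ract \<longrightarrow>
         hopf_isomorphic K (bicrossed_product K A B lact ract) (third_hopf_algebra K p L g\<^sub>L F)) \<and>
      hopf_isomorphic K (third_hopf_algebra K p L g\<^sub>L F) H"
proof -
  interpret field K by (rule algebraically_closed.axioms(1)[OF assms(1)])
  have "group G" using assms(4) by (simp add: third_type_datum_def)
  moreover have "Factorial_Ring.prime p" by (rule characteristic_prime[OF assms(2,3)])
  moreover have "[p] \<cdot>\<^bsub>K\<^esub> \<one>\<^bsub>K\<^esub> = \<zero>\<^bsub>K\<^esub>" using assms(2) by (simp add: ring_characteristic_def)
  ultimately interpret factorized K p G g f G\<^sub>B \<Gamma>
    by (intro factorized.intro third_type.intro third_type_axioms.intro factorized_axioms.intro field_axioms assms(4-9))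
  have x_act: "lact B.x (single K h) = \<zero>\<^bsub>A\<^esub> \<and>
      ract B.x (single K h) = B.x \<ominus>\<^bsub>B\<^esub> (f h \<odot>\<^bsub>B\<^esub> (\<one>\<^bsub>B\<^esub> \<ominus>\<^bsub>B\<^esub> B.e g))"
    if "associated_matched_pair K H A B i j lact ract" "h \<in> \<Gamma>" for lact ract h
    using that g_GB
    by (simp add: associated_iff_determined determined_by_def Let_def a_minus_def[of B B.x] B.H.smult_l_minus)
  have \<Theta>F: "F (h, t) = f (h \<otimes>\<^bsub>G\<^esub> t) \<and> f (h \<otimes>\<^bsub>G\<^esub> t) = f (\<Theta> (h, t))" if "h \<in> \<Gamma>" "t \<in> G\<^sub>B" for h t
    using F_eq[of "(h, t)"] that by (simp add: L_sel)
  have iso: "hopf_isomorphic K (third_hopf_algebra K p L (\<one>\<^bsub>G\<^esub>, g) F) H"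
    using third_L_iso by (auto simp: hopf_isomorphic_def)
  show ?thesis
    unfolding Let_def
    using group_matched_pair exact associated_exists associated_iff_determined x_act \<Theta>_iso \<Theta>F L_datum
      associated_bicrossed_iso iso
    by (intro conjI ballI allI impI) blast+
qed

end
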